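(* Let $\pi_f$ be a centered Gaussian process prior in $H$ with reproducing kernel Hilbert space $\mathbb H$. Let $\theta_0$ be an interior point of the compact set $\Theta$ and $f_0\in H$ with $\dot K_{\theta_0}f_0\neq0$ and $K_\theta f_0\ne K_{\theta_0}f_0$ for all $\theta\ne\theta_0$. Assume: (a) There is a normed space $(S,\|\cdot\|_S)$ with $S\subset H$, whose norm is stronger than that of $H$, such that $K_\theta H\subset S$ for all $\theta\in\Theta$ and $$\int_0^1\sqrt{\log N\bigl(\epsilon,\{h:\|h\|_S\le 1\},\|\cdot\|_H\bigr)}\,d\epsilon<\infty .$$ (b) There are operators $\dot K_\theta:H\to H$ with $(K_{\theta+s}f-K_\theta f)/s\to\dot K_\theta f$ in $H$ as $s\to0$, for every $f\in H$, $\theta\in\Theta$, and constants $D_0,\dots,D_3$ such that for all $\theta,\theta_1,\theta_2\in\Theta$ and $f_1,f_2\in H$: $\|K_\theta\|\le D_0$, $\|\dot K_\theta\|\le D_0$; $\|K_\theta-K_{\theta_0}\|_{H\to S}\le D_1|\theta-\theta_0|$; $\|K_\theta-K_{\theta_0}-(\theta-\theta_0)\dot K_{\theta_0}\|_{H\to S}\le D_2(\theta-\theta_0)^2$; $\|K_{\theta_1}f_1-K_{\theta_2}f_2\|\le D_3|\theta_1-\theta_2|(\|f_1\|\wedge\|f_2\|)+D_3\|f_1-f_2\|$. Let $\epsilon_n\downarrow0$ with $n\epsilon_n^2\to\infty$ be such that $\phi_{f_0}(\epsilon_n)\le n\epsilon_n^2$, and let $\rho_n\downarrow0$ be such that $\psi_{\gamma_{\theta_0,f_0}}(\rho_n)\le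 n\rho_n^2$. Suppose that one of the following holds: (i) $n\epsilon_n^4+n\epsilon_n^2\rho_n^2\to0$; (ii) $n\epsilon_n^4\to0$ and $\gamma_{\theta_0,f_0}\in\mathbb H$; (iii) $\theta\mapsto\|K_\theta f\|$ is constant on $\Theta$ for every $f\in H$, and $n\epsilon_n^2\rho_n^2\to0$; (iv) $\theta\mapsto\|K_\theta f\|$ is constant on $\Theta$ for every $f\in H$, and $\gamma_{\theta_0,f_0}\in\mathbb H$. Then the Bernstein-von Mises theorem holds at $(\theta_0,f_0)$, i.e. in $P^n_{\theta_0,f_0}$-probability as $n\to\infty$, $$\Big\|\Pi(\theta\in\cdot\mid X^n)-N\Big(\theta_0+\tfrac1{\sqrt n}\Delta^n_{\theta_0,f_0},\ \tfrac1n\tilde I_{\theta_0,f_0}^{-1}\Big)\Big\|_{\rm TV}\to0 .$$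
   Context: Gaussian prior functions. For $\gamma,f_0\in H$ and $\epsilon>0$, $\psi_\gamma(\epsilon)=\inf_{h\in\mathbb H:\|h-\gamma\|\le\epsilon}\|h\|_{\mathbb H}^2$ (decentering function) and $\phi_{f_0}(\epsilon)=\psi_{f_0}(\epsilon)-\log\pi_f(f:\|f\|\le\epsilon)$ (concentration function). Model. $\Theta\subset\mathbb R$ is compact, $(H,\langle\cdot,\cdot\rangle,\|\cdot\|)$ is a separable Hilbert space, and $K_\theta:H\to H$, $\theta\in\Theta$, are bounded linear operators with adjoints $K_\theta^*$. $\|A\|_{H\to S}=\sup_{\|h\|\le1}\|Ah\|_S$ is the operator norm, written $\|A\|$ if $S=H$. $N(\epsilon,A,d)$ is the minimal number of $d$-balls of radius $\epsilon$ needed to cover $A$; $a\wedge b$ is the minimum. Fix an orthonormal basis $(e_k)_{k\in\mathbb N}$ of $H$. $P^n_{\theta,f}$ is the law of $X^n=(X^{(1)},X^{(2)})$, two sequences with $$X^{(1)}_k=\langle f,e_k\rangle+n^{-1/2}Z_{1,k},\qquad X^{(2)}_k=\langle K_\theta f,e_k\rangle+n^{-1/2}Z_{2,k},$$ where the $Z_{i,k}$ are i.i.d. standard normal. For $h\in H$, $\langle X^{(i)},h\rangle:=\sum_kX^{(i)}_k\langle h,e_k\rangle$ (convergent in $L_2$ and almost surely), and, under $P^n_{\theta,f}$, $\langle h,\dot W^{(1)}\rangle:=\sqrt n(\langle X^{(1)},h\rangle-\langle f,h\rangle)$ and $\langle h,\dot W^{(2)}\rangle:=\sqrt n(\langle X^{(2)},h\rangle-\langle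 K_\theta f,h\rangle)$. With $P_0^n$ the law for $f=0$, $$\log\frac{dP^n_{\theta,f}}{dP^n_0}(X^n)=n\langle X^{(1)},f\rangle-\tfrac n2\|f\|^2+n\langle X^{(2)},K_\theta f\rangle-\tfrac n2\|K_\theta f\|^2 .$$ Prior and posterior. The prior is $\Pi=\pi_\theta\times\pi_f$, where $\pi_\theta$ has a continuous Lebesgue density on $\Theta$ bounded away from $0$ and $\infty$. $\Pi(\cdot\mid X^n)$ is the posterior of $(\theta,f)$ obtained from the likelihood $\frac{dP^n_{\theta,f}}{dP^n_0}(X^n)=\exp\bigl(n\langle X^{(1)},f\rangle-\tfrac n2\|f\|^2+n\langle X^{(2)},K_\theta f\rangle-\tfrac n2\|K_\theta f\|^2\bigr)$ by Bayes' formula. Semiparametric quantities. The least favorable direction is $\gamma_{\theta,f}=(I+K_\theta^*K_\theta)^{-1}K_\theta^*\dot K_\theta f$, and the efficient Fisher information is $\tilde I_{\theta,f}=\|\gamma_{\theta,f}\|^2+\|\dot K_\theta f-K_\theta\gamma_{\theta,f}\|^2$. Further $$\Delta^n_{\theta,f}=\frac1{\tilde I_{\theta,f}}\bigl(\langle\dot K_\theta f,\dot W^{(2)}\rangle-\langle\gamma_{\theta,f},\dot W^{(1)}\rangle-\langle K_\theta\gamma_{\theta,f},\dot W^{(2)}\rangle\bigr),$$ a measurable transformation of $X^n$ distributed as $N(0,\tilde I_{\theta,f}^{-1})$ under $P^n_{\theta,f}$. The total variation distance is $\|P-Q\|_{\rm TV}=2\sup_F|P(F)-Q(F)|$. *)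

theory Defs
  imports "HOL-Probability.Probability"
begin

section \<open>Gaussian measures and their reproducing kernel Hilbert spaces\<close>

(* Parametrised by the variance v, with v = 0 allowed. *)
definition normal_measure :: "real \<Rightarrow> real \<Rightarrow> real measure" where
  "normal_measure \<mu> v =
     (if v = 0 then return borel \<mu> else density lborel (\<lambda>x. ennreal (normal_density \<mu> (sqrt v) x)))"

definition centered_gaussian :: "'h::real_inner measure \<Rightarrow> bool" where
  "centered_gaussian \<pi> \<longleftrightarrow> prob_space \<pi> \<and> sets \<pi> = sets borel \<and>
     (\<forall>h. \<exists>v\<ge>0. distr \<pi> borel (\<lambda>f. f \<bullet> h) = normal_measure 0 v)"

(* The closure in L2(\<pi>) of the continuous linear functionals of H; by Riesz' theorem these are
   the maps f \<mapsto> <f, l> with l in H. *)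
definition functional_closure :: "'h::real_inner measure \<Rightarrow> ('h \<Rightarrow> real) set" where
  "functional_closure \<pi> =
     {g \<in> borel_measurable \<pi>. integrable \<pi> (\<lambda>f. (g f)\<^sup>2) \<and>
        (\<exists>l :: nat \<Rightarrow> 'h. (\<lambda>k. LINT f|\<pi>. (g f - f \<bullet> l k)\<^sup>2) \<longlonglongrightarrow> 0)}"

(* The RKHS consists of the elements E[g(f) f] of H with g in functional_closure \<pi>, and carries the
   L2(\<pi>)-norm of g.  For Gaussian \<pi> the map sending g to E[g(f) f] is injective up to
   \<pi>-almost sure equality, so the norm is well defined. *)
definition rkhs :: "'h::{real_inner,banach,second_countable_topology} measure \<Rightarrow> 'h set" where
  "rkhs \<pi> = (\<lambda>g. LINT f|\<pi>. g f *\<^sub>R f) ` functional_closure \<pi>"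

definition rkhs_norm ::
    "'h::{real_inner,banach,second_countable_topology} measure \<Rightarrow> 'h \<Rightarrow> real" where
  "rkhs_norm \<pi> h =
     (THE r. \<exists>g\<in>functional_closure \<pi>. h = (LINT f|\<pi>. g f *\<^sub>R f) \<and> r = sqrt (LINT f|\<pi>. (g f)\<^sup>2))"

(* Extended real valued: the infimum over the empty set is \<infinity>. *)
definition decentering ::
    "'h::{real_inner,banach,second_countable_topology} measure \<Rightarrow> 'h \<Rightarrow> real \<Rightarrow> ereal" where
  "decentering \<pi> \<gamma> \<epsilon> = (INF h\<in>{h \<in> rkhs \<pi>. norm (h - \<gamma>) \<le> \<epsilon>}. ereal ((rkhs_norm \<pi> h)\<^sup>2))"

(* For \<epsilon> > 0 the small ball probability of a centered Gaussian measure is positive, so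
   the convention ln 0 = 0 plays no role. *)
definition concentration ::
    "'h::{real_inner,banach,second_countable_topology} measure \<Rightarrow> 'h \<Rightarrow> real \<Rightarrow> ereal" where
  "concentration \<pi> f0 \<epsilon> = decentering \<pi> f0 \<epsilon> - ereal (ln (measure \<pi> {f. norm f \<le> \<epsilon>}))"


section \<open>Normed subspaces, operator norms and entropy\<close>

definition normed_subspace :: "'h::real_vector set \<Rightarrow> ('h \<Rightarrow> real) \<Rightarrow> bool" where
  "normed_subspace S nS \<longleftrightarrow> subspace S \<and>
     (\<forall>x\<in>S. 0 \<le> nS x \<and> (nS x = 0 \<longrightarrow> x = 0)) \<and>
     (\<forall>x\<in>S. \<forall>c. nS (c *\<^sub>R x) = \<bar>c\<bar> * nS x) \<and>
     (\<forall>x\<in>S. \<forall>y\<in>S. nS (x + y) \<le> nS x + nS y)"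

definition stronger_norm :: "'h::real_normed_vector set \<Rightarrow> ('h \<Rightarrow> real) \<Rightarrow> bool" where
  "stronger_norm S nS \<longleftrightarrow> (\<exists>C. \<forall>x\<in>S. norm x \<le> C * nS x)"

(* Infinite if A does not map into S, or is unbounded as a map into S. *)
definition opnorm_into ::
    "'h::real_normed_vector set \<Rightarrow> ('h \<Rightarrow> real) \<Rightarrow> ('h \<Rightarrow>\<^sub>L 'h) \<Rightarrow> ereal" where
  "opnorm_into S nS A = (SUP h\<in>{h. norm h \<le> 1}. if A h \<in> S then ereal (nS (A h)) else \<infinity>)"

definition covering_number :: "real \<Rightarrow> 'a::metric_space set \<Rightarrow> enat" where
  "covering_number \<epsilon> A = (INF C\<in>{C. finite C \<and> A \<subseteq> (\<Union>c\<in>C. ball c \<epsilon>)}. enat (card C))"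

(* The square root of the logarithm of a covering number. *)
definition sqrt_log :: "enat \<Rightarrow> ennreal" where
  "sqrt_log N = (case N of enat m \<Rightarrow> ennreal (sqrt (ln (real m))) | \<infinity> \<Rightarrow> \<infinity>)"


section \<open>The statistical model\<close>

definition orthonormal_basis :: "(nat \<Rightarrow> 'h::real_inner) \<Rightarrow> bool" where
  "orthonormal_basis e \<longleftrightarrow>
     (\<forall>i j. e i \<bullet> e j = (if i = j then 1 else 0)) \<and> closure (span (range e)) = UNIV"

type_synonym observation = "(nat \<Rightarrow> real) \<times> (nat \<Rightarrow> real)"

definition sample_algebra :: "observation measure" where
  "sample_algebra = (\<Pi>\<^sub>M k\<in>UNIV. borel) \<Otimes>\<^sub>M (\<Pi>\<^sub>M k\<in>UNIV. borel)"

(* The law of the noise (Z1, Z2). *)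
definition noise :: "observation measure" where
  "noise = (\<Pi>\<^sub>M k\<in>UNIV. normal_measure 0 1) \<Otimes>\<^sub>M (\<Pi>\<^sub>M k\<in>UNIV. normal_measure 0 1)"

definition data_law ::
    "(nat \<Rightarrow> 'h::real_inner) \<Rightarrow> (real \<Rightarrow> 'h \<Rightarrow>\<^sub>L 'h) \<Rightarrow> nat \<Rightarrow> real \<Rightarrow> 'h \<Rightarrow> observation measure" where
  "data_law e K n \<theta> f = distr noise sample_algebra
     (\<lambda>(z1, z2). ((\<lambda>k. f \<bullet> e k + z1 k / sqrt (real n)), (\<lambda>k. K \<theta> f \<bullet> e k + z2 k / sqrt (real n))))"

(* The series converges almost surely under every data_law e K n \<theta> f, for each fixed h. *)
definition pairing :: "(nat \<Rightarrow> 'h::real_inner) \<Rightarrow> (nat \<Rightarrow> real) \<Rightarrow> 'h \<Rightarrow> real" where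
  "pairing e x h = (\<Sum>k. x k * (h \<bullet> e k))"

(* The density of P^n_(\<theta>,f) with respect to P^n_0. *)
definition likelihood ::
    "(nat \<Rightarrow> 'h::real_inner) \<Rightarrow> (real \<Rightarrow> 'h \<Rightarrow>\<^sub>L 'h) \<Rightarrow> nat \<Rightarrow> observation \<Rightarrow> real \<Rightarrow> 'h \<Rightarrow> real" where
  "likelihood e K n x \<theta> f =
     exp (real n * pairing e (fst x) f - real n / 2 * (norm f)\<^sup>2
        + real n * pairing e (snd x) (K \<theta> f) - real n / 2 * (norm (K \<theta> f))\<^sup>2)"


section \<open>Prior and posterior\<close>

(* A measure with space \<Theta>, so that the operators K \<theta> with \<theta> outside \<Theta> play no role. *)
definition theta_prior :: "real set \<Rightarrow> (real \<Rightarrow> real) \<Rightarrow> real measure" where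
  "theta_prior \<Theta> p = density (restrict_space lborel \<Theta>) (\<lambda>\<theta>. ennreal (p \<theta>))"

definition posterior ::
    "(nat \<Rightarrow> 'h::real_inner) \<Rightarrow> (real \<Rightarrow> 'h \<Rightarrow>\<^sub>L 'h) \<Rightarrow> (real \<times> 'h) measure \<Rightarrow> nat \<Rightarrow> observation
       \<Rightarrow> (real \<times> 'h) measure" where
  "posterior e K prior n x = density prior
     (\<lambda>(\<theta>, f). ennreal (likelihood e K n x \<theta> f)
        / (\<integral>\<^sup>+q. ennreal (likelihood e K n x (fst q) (snd q)) \<partial>prior))"

definition theta_posterior ::
    "(nat \<Rightarrow> 'h::real_inner) \<Rightarrow> (real \<Rightarrow> 'h \<Rightarrow>\<^sub>L 'h) \<Rightarrow> (real \<times> 'h) measure \<Rightarrow> nat \<Rightarrow> observation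
       \<Rightarrow> real measure" where
  "theta_posterior e K prior n x = distr (posterior e K prior n x) borel fst"


section \<open>Semiparametric quantities\<close>

(* Kd is the derivative of K with respect to \<theta>. *)
definition least_favorable ::
    "(real \<Rightarrow> 'h::real_inner \<Rightarrow>\<^sub>L 'h) \<Rightarrow> (real \<Rightarrow> 'h \<Rightarrow>\<^sub>L 'h) \<Rightarrow> real \<Rightarrow> 'h \<Rightarrow> 'h" where
  "least_favorable K Kd \<theta> f =
     inv (\<lambda>h. h + adjoint (K \<theta>) (K \<theta> h)) (adjoint (K \<theta>) (Kd \<theta> f))"

definition efficient_information ::
    "(real \<Rightarrow> 'h::real_inner \<Rightarrow>\<^sub>L 'h) \<Rightarrow> (real \<Rightarrow> 'h \<Rightarrow>\<^sub>L 'h) \<Rightarrow> real \<Rightarrow> 'h \<Rightarrow> real" where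
  "efficient_information K Kd \<theta> f =
     (norm (least_favorable K Kd \<theta> f))\<^sup>2
       + (norm (Kd \<theta> f - K \<theta> (least_favorable K Kd \<theta> f)))\<^sup>2"

definition white_noise1 ::
    "(nat \<Rightarrow> 'h::real_inner) \<Rightarrow> nat \<Rightarrow> 'h \<Rightarrow> observation \<Rightarrow> 'h \<Rightarrow> real" where
  "white_noise1 e n f x h = sqrt (real n) * (pairing e (fst x) h - f \<bullet> h)"

definition white_noise2 ::
    "(nat \<Rightarrow> 'h::real_inner) \<Rightarrow> (real \<Rightarrow> 'h \<Rightarrow>\<^sub>L 'h) \<Rightarrow> nat \<Rightarrow> real \<Rightarrow> 'h \<Rightarrow> observation \<Rightarrow> 'h \<Rightarrow> real"
  where
  "white_noise2 e K n \<theta> f x h = sqrt (real n) * (pairing e (snd x) h - K \<theta> f \<bullet> h)"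

definition efficient_center ::
    "(nat \<Rightarrow> 'h::real_inner) \<Rightarrow> (real \<Rightarrow> 'h \<Rightarrow>\<^sub>L 'h) \<Rightarrow> (real \<Rightarrow> 'h \<Rightarrow>\<^sub>L 'h) \<Rightarrow> nat \<Rightarrow> real \<Rightarrow> 'h
       \<Rightarrow> observation \<Rightarrow> real" where
  "efficient_center e K Kd n \<theta> f x =
     (let \<gamma> = least_favorable K Kd \<theta> f
      in 1 / efficient_information K Kd \<theta> f *
           (white_noise2 e K n \<theta> f x (Kd \<theta> f) - white_noise1 e n f x \<gamma>
              - white_noise2 e K n \<theta> f x (K \<theta> \<gamma>)))"


section \<open>Modes of convergence\<close>

definition tv_dist :: "'a measure \<Rightarrow> 'a measure \<Rightarrow> real" where
  "tv_dist P Q = 2 * (SUP F\<in>sets P. \<bar>measure P F - measure Q F\<bar>)"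

(* The underlying probability spaces vary with n.  Measurability is part of the notion, since
   measure (M n) vanishes on nonmeasurable sets. *)
definition tendsto_in_prob :: "(nat \<Rightarrow> 'a measure) \<Rightarrow> (nat \<Rightarrow> 'a \<Rightarrow> real) \<Rightarrow> real \<Rightarrow> bool" where
  "tendsto_in_prob M Y c \<longleftrightarrow>
     (\<forall>\<^sub>F n in sequentially. Y n \<in> borel_measurable (M n)) \<and>
     (\<forall>\<delta>>0. (\<lambda>n. measure (M n) {x \<in> space (M n). \<bar>Y n x - c\<bar> > \<delta>}) \<longlonglongrightarrow> 0)"

end

theory Submission
  imports Defs
begin

text \<open>The likelihood is a factor free of the parameters times \<open>exp (ell n z \<theta> f)\<close>, where z is the noise
  and the expectation of \<open>exp (ell n z \<theta> f)\<close> over z is one. Hence expected unnormalised posterior masses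
  are prior masses (Tonelli), and a lower bound for the total mass gives posterior contraction of f at the
  rate \<open>\<epsilon> n\<close> and consistency for \<open>\<theta>\<close>. Since only the prior, and not the entropy, of sets of f
  is controlled, large values of \<open>norm (f - f0)\<close> are excluded by rotation invariance of the Gaussian prior, and
  the dependence on \<open>\<theta>\<close> by Dudley's chaining bound for the white noise indexed by the unit ball of S.

  Put \<open>t = \<theta> - \<theta>0\<close> and let g be close to the least favorable direction and of the form \<open>covop l\<close>, with
  \<open>covop\<close> the covariance operator of the prior. On the set where the posterior concentrates,
  \<open>ell n z \<theta> f - ell n z \<theta>0 (f + t g)\<close> equals \<open>sqrt n t V - n t\<^sup>2 I / 2\<close> up to a small multiple of \<open>1 + n t\<^sup>2\<close>,
  uniformly in f. By the Cameron-Martin theorem the shift of f by \<open>t g\<close> changes the prior by a factor close to one,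
  so integrating f out leaves a marginal density of \<open>\<theta>\<close> that is, up to a constant, almost the normal density with
  mean \<open>\<theta>0 + V / (sqrt n I)\<close> and variance \<open>1 / (n I)\<close>. As posterior and normal law are both probability
  measures, a lower bound of the posterior by nearly the normal law on every Borel set suffices for convergence
  in total variation.\<close>

section \<open>Characteristic functionals determine finite measures\<close>

text \<open>Two independent draws from the prior have a scaled sum and difference that are again
  independent with the prior law. Hence the square of an evidence at sample size n / 2 splits into
  an evidence with half the quadratic penalty and a Laplace transform of the squared norm, which the
  small ball probability bounds below; the unspent half of the penalty suppresses f far from f0.

  The prior variance of \<open>f \<bullet> l n\<close> bounds it by a multiple of
  \<open>n * \<epsilon> n * s n\<close> under the posterior, so for t of order 1 / sqrt n the
  Cameron-Martin density is close to one once \<open>sqrt n * \<epsilon> n * s n\<close> vanishes.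
  The condition on \<open>n * \<epsilon> n ^ 4\<close> comes from the inner product of the increment
  of K at f - f0 with \<open>K \<theta>0 (f - f0)\<close>, of order
  \<open>t * (\<epsilon> n)\<^sup>2\<close>; if the norms of \<open>K \<theta> h\<close> are
  constant in \<open>\<theta>\<close>, it is minus half a squared norm, of order
  \<open>t\<^sup>2\<close>.

  The upper and lower bounds for the marginal of \<open>\<theta>\<close> share the integral over f
  at \<open>\<theta>0\<close> as a factor. It is localised by the same contraction result, with the
  point mass at \<open>\<theta>0\<close> as prior.\<close>

lemma norm_le_iff_inner_dense:
  fixes x :: "'a::real_inner"
  assumes "\<And>X. open X \<Longrightarrow> X \<noteq> {} \<Longrightarrow> \<exists>d\<in>D. d \<in> X" "0 \<le> r"
  shows "norm x \<le> r \<longleftrightarrow> (\<forall>d\<in>D. x \<bullet> d \<le> r * norm d)"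
proof
  assume "norm x \<le> r"
  then show "\<forall>d\<in>D. x \<bullet> d \<le> r * norm d"
    by (meson mult_right_mono norm_cauchy_schwarz norm_ge_zero order_trans)
next
  assume *: "\<forall>d\<in>D. x \<bullet> d \<le> r * norm d"
  show "norm x \<le> r"
  proof (rule ccontr)
    assume "\<not> norm x \<le> r"
    then have "r * norm x < norm x * norm x"
      using assms(2) by (intro mult_strict_right_mono) auto
    then have "x \<in> {d. r * norm d < x \<bullet> d}"
      by (simp add: dot_square_norm power2_eq_square)
    moreover have "open {d. r * norm d < x \<bullet> d}"
      by (intro open_Collect_less continuous_intros)
    ultimately obtain d where "d \<in> D" "r * norm d < x \<bullet> d"
      using assms(1) by blast
    with * show False by force
  qed
qed

text \<open>A closed ball is an intersection of half spaces with normals in a countable dense set,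
  and an open set is a countable union of closed balls with dense centres. Measures on the space are
  thereby controlled by one-dimensional projections.\<close>

lemma sets_borel_eq_inner:
  "sets (borel :: 'a::{real_inner,second_countable_topology} measure)
     = sigma_sets UNIV {{x. x \<bullet> l \<in> A} |l A. A \<in> sets (borel :: real measure)}" (is "_ = sigma_sets UNIV ?G")
proof
  obtain D :: "'a set" where D: "countable D" "\<And>X. open X \<Longrightarrow> X \<noteq> {} \<Longrightarrow> \<exists>d\<in>D. d \<in> X"
    using countable_dense_exists by blast
  interpret sigma_algebra UNIV "sigma_sets UNIV ?G"
    by (rule sigma_algebra_sigma_sets) auto
  have cb: "cball c r \<in> sigma_sets UNIV ?G" if "0 \<le> r" for c :: 'a and r
  proof -
    \<comment> \<open>The normal 0 imposes no constraint; it keeps the index set of the countable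
      intersection nonempty.\<close>
    have "cball c r = (\<Inter>d\<in>insert 0 D. {x. x \<bullet> d \<in> {.. c \<bullet> d + r * norm d}})"
    proof -
      have "x \<in> cball c r \<longleftrightarrow> norm (x - c) \<le> r" for x
        by (simp add: dist_norm norm_minus_commute)
      then show ?thesis
        by (auto simp: norm_le_iff_inner_dense[OF D(2) that] algebra_simps)
    qed
    also have "\<dots> \<in> sigma_sets UNIV ?G"
      proof (rule countable_INT')
      show "(\<lambda>d. {x. x \<bullet> d \<in> {.. c \<bullet> d + r * norm d}}) ` insert 0 D \<subseteq> sigma_sets UNIV ?G"
        proof (rule image_subsetI)
          fix d :: 'a
          have "{x. x \<bullet> d \<in> {.. c \<bullet> d + r * norm d}} \<in> ?G"
            by (intro CollectI exI[of _ d]) auto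
          then show "{x. x \<bullet> d \<in> {.. c \<bullet> d + r * norm d}} \<in> sigma_sets UNIV ?G" by simp
        qed
    qed (use D(1) in auto)
    finally show ?thesis .
  qed
  have op: "U \<in> sigma_sets UNIV ?G" if U: "open U" for U :: "'a set"
  proof -
    let ?C = "{(d, m). d \<in> D \<and> cball d (1 / real (Suc m)) \<subseteq> U}"
    have "U = (\<Union>(d, m)\<in>?C. cball d (1 / real (Suc m)))"
    proof (intro equalityI subsetI)
      fix x assume "x \<in> U"
      then obtain e where e: "0 < e" "ball x e \<subseteq> U" using U openE by blast
      obtain m :: nat where m: "1 / real (Suc m) < e / 2"
        using e(1) by (meson half_gt_zero nat_approx_posE)
      obtain d where d: "d \<in> D" "d \<in> ball x (1 / real (Suc m))"
        using D(2)[of "ball x (1 / real (Suc m))"] by fastforce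
      have "cball d (1 / real (Suc m)) \<subseteq> U"
      proof
        fix y assume "y \<in> cball d (1 / real (Suc m))"
        then have "dist x y < e" using d(2) m dist_triangle[of x y d] by simp
        then show "y \<in> U" using e(2) by auto
      qed
      then show "x \<in> (\<Union>(d, m)\<in>?C. cball d (1 / real (Suc m)))"
        using d by (intro UN_I[of "(d, m)"]) (auto simp: dist_commute)
    qed auto
    moreover have "countable ?C"
      by (rule countable_subset[of _ "D \<times> UNIV"]) (use D(1) in auto)
    moreover have "(\<Union>(d, m)\<in>?C. cball d (1 / real (Suc m))) \<in> sigma_sets UNIV ?G"
      using \<open>countable ?C\<close> by (auto intro!: cb)
    ultimately show ?thesis by metis
  qed
  show "sets borel \<subseteq> sigma_sets UNIV ?G"
  proof -
    have "sets (borel :: 'a measure) = sigma_sets UNIV {U. open U}" by (simp add: borel_def)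
    also have "\<dots> \<subseteq> sigma_sets UNIV ?G"
      using op by (intro sigma_sets_mono) blast
    finally show ?thesis .
  qed
  show "sigma_sets UNIV ?G \<subseteq> sets borel"
  proof (rule sets.sigma_sets_subset[of ?G borel, simplified])
    show "?G \<subseteq> sets borel"
    by auto
  qed
qed

text \<open>The value of \<open>char\<close> at 0 is the total mass, so both measures are divided by
  the same constant and Levy's uniqueness theorem for distributions applies; a common mass of 0 is
  treated apart.\<close>

lemma finite_measure_char_eq_imp_eq:
  fixes M N :: "real measure"
  assumes "finite_measure M" "finite_measure N" and [measurable_cong]: "sets M = sets borel" "sets N = sets borel"
    and char: "\<And>t. char M t = char N t"
  shows "M = N"
proof -
  interpret M: finite_measure M by fact
  interpret N: finite_measure N by fact
  have sp: "space M = UNIV" "space N = UNIV"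
    using assms(3,4)[THEN sets_eq_imp_space_eq] by auto
  have m: "measure M (space M) = measure N (space N)"
    using char[of 0] by (simp add: char_def)
  show ?thesis
  proof (cases "measure M (space M) = 0")
    case True
    have "emeasure M A = emeasure N A" if "A \<in> sets M" for A
      using True m M.bounded_measure[of A] N.bounded_measure[of A]
      by (simp add: M.emeasure_eq_measure N.emeasure_eq_measure measure_le_0_iff)
    then show ?thesis by (intro measure_eqI) (simp_all add: assms)
  next
    case False
    define c where "c = measure M (space M)"
    have c: "c > 0" using False c_def zero_less_measure_iff by metis
    define S :: "real measure \<Rightarrow> real measure" where "S = (\<lambda>M. density M (\<lambda>_. ennreal (1 / c)))"
    have rd: "real_distribution (S K)"
      if [measurable_cong]: "sets K = sets borel" and "emeasure K UNIV = ennreal c" for K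
    proof -
      have sK: "space K = UNIV" using sets_eq_imp_space_eq[OF that(1)] by simp
      have "emeasure (S K) UNIV = ennreal (1 / c) * emeasure K UNIV"
        unfolding S_def by (subst emeasure_density) (auto simp: sK)
      also have "\<dots> = 1"
        using c unfolding that(2) by (subst ennreal_mult[symmetric]) auto
      finally have "emeasure (S K) UNIV = 1" .
      then show ?thesis
        unfolding real_distribution_def real_distribution_axioms_def
        by (intro conjI prob_spaceI) (simp_all add: S_def that sK)
    qed
    have pM: "real_distribution (S M)"
      using M.emeasure_eq_measure[of UNIV] by (intro rd) (simp_all add: assms c_def sp)
    have pN: "real_distribution (S N)"
      using N.emeasure_eq_measure[of UNIV] m by (intro rd) (simp_all add: assms c_def sp)
    have "char (S M) = char (S N)"
    proof
      fix t
      have "char (S K) t = (1 / c) *\<^sub>R char K t" if [measurable_cong]: "sets K = sets borel" for K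
        using c unfolding char_def S_def
        by (subst integral_density) auto
      then show "char (S M) t = char (S N) t" using assms by simp
    qed
    then have eq: "S M = S N" using Levy_uniqueness pM pN by blast
    have "emeasure M A = emeasure N A" if "A \<in> sets M" for A
    proof -
      have "emeasure (S M) A = emeasure (S N) A" using eq by simp
      then have "ennreal (1 / c) * emeasure M A = ennreal (1 / c) * emeasure N A"
        using that assms S_def by (simp add: emeasure_density nn_integral_cmult_indicator)
      then show ?thesis using c by (simp add: ennreal_mult_cancel_left)
    qed
    then show ?thesis by (intro measure_eqI) (simp_all add: assms)
  qed
qed

text \<open>Weighting by w and projecting along l gives finite measures on the line whose
  characteristic functions are the two sides of the assumption.\<close>

lemma integral_indicator_eq_of_char_eq:
  fixes \<mu> \<nu> :: "'a::{real_inner,second_countable_topology} measure" and w :: "'a \<Rightarrow> real"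
  assumes fin: "finite_measure \<mu>" "finite_measure \<nu>"
    and sets: "sets \<mu> = sets borel" "sets \<nu> = sets borel"
    and w: "w \<in> borel_measurable borel" "\<And>x. 0 \<le> w x" "\<And>x. w x \<le> B"
    and eq: "\<And>t. (CLINT x|\<mu>. w x *\<^sub>R iexp (t * (x \<bullet> l))) = (CLINT x|\<nu>. w x *\<^sub>R iexp (t * (x \<bullet> l)))"
    and A: "A \<in> sets borel"
  shows "(LINT x|\<mu>. w x * indicator A (x \<bullet> l)) = (LINT x|\<nu>. w x * indicator A (x \<bullet> l))"
proof -
  define P where "P = (\<lambda>\<mu>. distr (density \<mu> (\<lambda>x. ennreal (w x))) borel (\<lambda>x. x \<bullet> l))"
  note w(1)[measurable]
  have fP: "finite_measure (P K)" and cP: "char (P K) t = (CLINT x|K. w x *\<^sub>R iexp (t * (x \<bullet> l)))"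
    and mP: "measure (P K) A = (LINT x|K. w x * indicator A (x \<bullet> l))"
    if K: "finite_measure K" and [measurable_cong]: "sets K = sets borel" for K t
  proof -
    interpret K: finite_measure K by fact
    have "emeasure (density K (\<lambda>x. ennreal (w x))) (space K) = (\<integral>\<^sup>+x. ennreal (w x) \<partial>K)"
      by (subst emeasure_density) (auto)
    also have "\<dots> \<le> (\<integral>\<^sup>+x. ennreal B \<partial>K)"
      using w by (intro nn_integral_mono) (simp add: ennreal_leI)
    also have "\<dots> < \<infinity>" by (simp add: ennreal_mult_less_top K.emeasure_eq_measure)
    finally have fd: "finite_measure (density K (\<lambda>x. ennreal (w x)))"
      by (intro finite_measureI) auto
    then show "finite_measure (P K)"
      unfolding P_def by (intro finite_measure.finite_measure_distr) auto
    show "char (P K) t = (CLINT x|K. w x *\<^sub>R iexp (t * (x \<bullet> l)))"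
      unfolding P_def char_def using w
      by (subst integral_distr) (auto simp: integral_density)
    have "measure (P K) A = (LINT x|density K (\<lambda>x. ennreal (w x)). indicator A (x \<bullet> l))"
    proof -
      have "measure (P K) A = measure (density K (\<lambda>x. ennreal (w x))) ((\<lambda>x. x \<bullet> l) -` A \<inter> space K)"
        unfolding P_def using A by (subst measure_distr) auto
      also have "\<dots> = (LINT x|density K (\<lambda>x. ennreal (w x)). indicator ((\<lambda>x. x \<bullet> l) -` A \<inter> space K) x)"
        by simp
      also have "\<dots> = (LINT x|density K (\<lambda>x. ennreal (w x)). indicator A (x \<bullet> l))"
        by (intro Bochner_Integration.integral_cong) (auto simp: indicator_def)
      finally show ?thesis .
    qed
    also have "\<dots> = (LINT x|K. w x * indicator A (x \<bullet> l))"
      using w A by (subst integral_density) auto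
    finally show "measure (P K) A = (LINT x|K. w x * indicator A (x \<bullet> l))" .
  qed
  have "P \<mu> = P \<nu>"
    by (rule finite_measure_char_eq_imp_eq) (use fP cP fin sets eq in \<open>auto simp: P_def\<close>)
  then show ?thesis using mP fin sets by metis
qed

text \<open>Levy's uniqueness theorem on the line, applied to the measures with weights G, \<open>G (1 + cos)\<close> and
  \<open>G (1 + sin)\<close>, keeps the matching when G is multiplied by the indicator of \<open>{x. x \<bullet> l \<in> A}\<close>; this reduces
  uniqueness on the Hilbert space to an intersection-stable generator.\<close>

definition char_matched :: "'a::real_inner measure \<Rightarrow> 'a measure \<Rightarrow> ('a \<Rightarrow> real) \<Rightarrow> bool" where
  "char_matched \<mu> \<nu> G \<longleftrightarrow> G \<in> borel_measurable borel \<and> (\<forall>x. 0 \<le> G x \<and> G x \<le> 1) \<and>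
     (\<forall>h. (CLINT x|\<mu>. G x *\<^sub>R iexp (x \<bullet> h)) = (CLINT x|\<nu>. G x *\<^sub>R iexp (x \<bullet> h)))"

lemma char_matched_times_indicator:
  fixes \<mu> \<nu> :: "'a::{real_inner,second_countable_topology} measure"
  assumes fin: "finite_measure \<mu>" "finite_measure \<nu>"
    and sets: "sets \<mu> = sets borel" "sets \<nu> = sets borel"
    and G: "char_matched \<mu> \<nu> G" and A: "A \<in> sets borel"
  shows "char_matched \<mu> \<nu> (\<lambda>x. G x * indicator A (x \<bullet> l))"
proof -
  have [measurable]: "G \<in> borel_measurable borel" and G01: "\<And>x. 0 \<le> G x" "\<And>x. G x \<le> 1"
    and eq: "\<And>h. (CLINT x|\<mu>. G x *\<^sub>R iexp (x \<bullet> h)) = (CLINT x|\<nu>. G x *\<^sub>R iexp (x \<bullet> h))"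
    using G unfolding char_matched_def by auto
  have iG: "integrable K (\<lambda>x. G x *\<^sub>R iexp (x \<bullet> h))"
    if "finite_measure K" "sets K = sets borel" for K h
  proof -
    interpret K: finite_measure K by fact
    note that(2)[measurable_cong]
    show ?thesis by (rule K.integrable_const_bound[of _ 1]) (use G01 in \<open>auto simp: abs_le_iff\<close>, (meson)?)
  qed
  have iR: "integrable K (\<lambda>x. G x * (q x * indicator A (x \<bullet> l)))"
    if "finite_measure K" "sets K = sets borel" and [measurable]: "q \<in> borel_measurable borel"
      and q: "\<And>x. \<bar>q x\<bar> \<le> 1" for K q
  proof -
    interpret K: finite_measure K by fact
    note that(2)[measurable_cong]
    have "\<bar>G x * (q x * indicator A (x \<bullet> l))\<bar> \<le> 1" for x
      using G01[of x] q[of x] by (auto simp: abs_mult mult_le_one)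
    then show ?thesis using A by (intro K.integrable_const_bound[of _ 1]) auto
  qed
  let ?I = "\<lambda>x. indicator A (x \<bullet> l) :: real"
  have key: "(LINT x|\<mu>. G x * (q x * ?I x)) = (LINT x|\<nu>. G x * (q x * ?I x))"
    if q: "q = (\<lambda>x. cos (x \<bullet> h)) \<or> q = (\<lambda>x. sin (x \<bullet> h))" for q h
  proof -
    have [measurable]: "q \<in> borel_measurable borel" using q by auto
    have q1: "\<bar>q x\<bar> \<le> 1" for x using q by auto
    \<comment> \<open>Euler's formulas: a weight times 1 + q becomes a combination of three
      characters, at \<open>t *\<^sub>R l\<close> and at \<open>t *\<^sub>R l\<close> plus or minus
      h, whose integrals against G agree by matching.\<close>
    obtain c d where cd: "\<And>x. complex_of_real (q x) = c * iexp (x \<bullet> h) + d * iexp (- (x \<bullet> h))"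
    proof (rule disjE[OF q])
      assume "q = (\<lambda>x. cos (x \<bullet> h))"
      then have "complex_of_real (q x) = (1/2) * iexp (x \<bullet> h) + (1/2) * iexp (- (x \<bullet> h))" for x
        by (simp add: cos_of_real[symmetric] cos_exp_eq)
      then show ?thesis by (rule)
    next
      assume "q = (\<lambda>x. sin (x \<bullet> h))"
      then have "complex_of_real (q x) = (1/(2*\<i>)) * iexp (x \<bullet> h) + (-1/(2*\<i>)) * iexp (- (x \<bullet> h))" for x
        by (simp add: sin_of_real[symmetric] sin_exp_eq field_simps)
      then show ?thesis by (rule)
    qed
    have w: "(CLINT x|K. (G x * (1 + q x)) *\<^sub>R iexp (t * (x \<bullet> l))) =
        (CLINT x|K. G x *\<^sub>R iexp (x \<bullet> (t *\<^sub>R l))) + c * (CLINT x|K. G x *\<^sub>R iexp (x \<bullet> (t *\<^sub>R l + h)))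
         + d * (CLINT x|K. G x *\<^sub>R iexp (x \<bullet> (t *\<^sub>R l - h)))"
      if K: "finite_measure K" "sets K = sets borel" for K t
    proof -
      have "(G x * (1 + q x)) *\<^sub>R iexp (t * (x \<bullet> l)) = G x *\<^sub>R iexp (x \<bullet> (t *\<^sub>R l))
          + c * (G x *\<^sub>R iexp (x \<bullet> (t *\<^sub>R l + h))) + d * (G x *\<^sub>R iexp (x \<bullet> (t *\<^sub>R l - h)))" for x
        by (simp add: cd scaleR_conv_of_real algebra_simps exp_add exp_diff exp_minus field_simps)
      then have "(CLINT x|K. (G x * (1 + q x)) *\<^sub>R iexp (t * (x \<bullet> l))) = (CLINT x|K. G x *\<^sub>R iexp (x \<bullet> (t *\<^sub>R l))
          + c * (G x *\<^sub>R iexp (x \<bullet> (t *\<^sub>R l + h))) + d * (G x *\<^sub>R iexp (x \<bullet> (t *\<^sub>R l - h))))"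
        by simp
      also have "\<dots> = (CLINT x|K. G x *\<^sub>R iexp (x \<bullet> (t *\<^sub>R l))) + c * (CLINT x|K. G x *\<^sub>R iexp (x \<bullet> (t *\<^sub>R l + h)))
         + d * (CLINT x|K. G x *\<^sub>R iexp (x \<bullet> (t *\<^sub>R l - h)))"
        by (simp only: Bochner_Integration.integral_add Bochner_Integration.integrable_add
            integrable_mult_right integral_mult_right_zero iG[OF K])
      finally show ?thesis .
    qed
    \<comment> \<open>The weight G q changes sign and defines no measure; 1 + q lies between 0 and
      2, and the part without q is subtracted afterwards.\<close>
    have "(LINT x|\<mu>. (G x * (1 + q x)) * ?I x) = (LINT x|\<nu>. (G x * (1 + q x)) * ?I x)"
    proof (rule integral_indicator_eq_of_char_eq[OF fin sets, where B=2])
      show "0 \<le> G x * (1 + q x)" for x using G01[of x] q1[of x] by (simp)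
      show "G x * (1 + q x) \<le> 2" for x
        using mult_mono[of "G x" 1 "1 + q x" 2] G01[of x] q1[of x] by (simp)
      show "(CLINT x|\<mu>. (G x * (1 + q x)) *\<^sub>R iexp (t * (x \<bullet> l))) = (CLINT x|\<nu>. (G x * (1 + q x)) *\<^sub>R iexp (t * (x \<bullet> l)))" for t
        by (simp only: w[OF fin(1) sets(1)] w[OF fin(2) sets(2)] eq)
    qed (use A in auto)
    moreover have "(LINT x|\<mu>. G x * ?I x) = (LINT x|\<nu>. G x * ?I x)"
      by (rule integral_indicator_eq_of_char_eq[OF fin sets, where B=1])
        (use A G01 eq[of "_ *\<^sub>R l"] in auto)
    moreover have "(LINT x|K. (G x * (1 + q x)) * ?I x) = (LINT x|K. G x * ?I x) + (LINT x|K. G x * (q x * ?I x))"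
      if K: "finite_measure K" "sets K = sets borel" for K
      using iR[OF K, of "\<lambda>_. 1"] iR[OF K _ q1]
      by (auto simp: algebra_simps)
    ultimately show ?thesis using fin sets by simp
  qed
  have "(CLINT x|\<mu>. (G x * ?I x) *\<^sub>R iexp (x \<bullet> h)) = (CLINT x|\<nu>. (G x * ?I x) *\<^sub>R iexp (x \<bullet> h))" for h
  proof -
    have "(CLINT x|K. (G x * ?I x) *\<^sub>R iexp (x \<bullet> h)) =
        complex_of_real (LINT x|K. G x * (cos (x \<bullet> h) * ?I x)) + \<i> * complex_of_real (LINT x|K. G x * (sin (x \<bullet> h) * ?I x))"
      if K: "finite_measure K" "sets K = sets borel" for K
    proof -
      have "(G x * ?I x) *\<^sub>R iexp (x \<bullet> h) = complex_of_real (G x * (cos (x \<bullet> h) * ?I x))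
          + \<i> * complex_of_real (G x * (sin (x \<bullet> h) * ?I x))" for x
        by (simp add: scaleR_conv_of_real exp_Euler cos_of_real sin_of_real algebra_simps)
      then show ?thesis
        using iR[OF K, of "\<lambda>x. cos (x \<bullet> h)"] iR[OF K, of "\<lambda>x. sin (x \<bullet> h)"]
        by (simp del: of_real_mult)
    qed
    then show ?thesis using key[of _ h] fin sets by simp
  qed
  moreover have "0 \<le> G x * ?I x \<and> G x * ?I x \<le> 1" for x
    using G01[of x] by (auto simp: indicator_def)
  ultimately show ?thesis using A unfolding char_matched_def by auto
qed

text \<open>Starting from the constant 1, finitely many indicator factors keep the matching. At h =
  0 it says that finite intersections of sets \<open>{x. x \<bullet> l \<in> A}\<close> have equal
  measures, and these form an intersection-stable generator of the Borel sets.\<close>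

theorem char_functional_unique:
  fixes \<mu> \<nu> :: "'a::{real_inner,second_countable_topology} measure"
  assumes fin: "finite_measure \<mu>" "finite_measure \<nu>"
    and sets: "sets \<mu> = sets borel" "sets \<nu> = sets borel"
    and eq: "\<And>h. (CLINT x|\<mu>. iexp (x \<bullet> h)) = (CLINT x|\<nu>. iexp (x \<bullet> h))"
  shows "\<mu> = \<nu>"
proof -
  interpret M: finite_measure \<mu> by fact
  interpret N: finite_measure \<nu> by fact
  have sp: "space \<mu> = UNIV" "space \<nu> = UNIV" using sets[THEN sets_eq_imp_space_eq] by auto
  let ?G = "{{x. x \<bullet> l \<in> A} |(l::'a) A. A \<in> sets (borel :: real measure)}"
  let ?E = "{\<Inter>\<F> |\<F>. finite \<F> \<and> \<F> \<subseteq> ?G}"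
  have matched: "char_matched \<mu> \<nu> (indicator (\<Inter>\<F>))" if "finite \<F>" "\<F> \<subseteq> ?G" for \<F>
    using that
  proof (induction \<F> rule: finite_induct)
    case empty
    then show ?case by (simp add: char_matched_def eq)
  next
    case (insert X \<F>)
    then obtain l A where X: "X = {x. x \<bullet> l \<in> A}" "A \<in> sets borel" by auto
    have "indicator (\<Inter>(insert X \<F>)) = (\<lambda>x. indicator (\<Inter>\<F>) x * indicator A (x \<bullet> l) :: real)"
      by (auto simp: indicator_def X)
    then show ?case
      using char_matched_times_indicator[OF fin sets _ X(2)] insert by simp
  qed
  have E_sets: "X \<in> sets borel" if "X \<in> ?E" for X
    using that matched unfolding char_matched_def
    by (auto simp: borel_measurable_indicator_iff)
  have s: "sets borel = sigma_sets UNIV ?E"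
  proof
    show "sigma_sets UNIV ?E \<subseteq> sets borel"
      using E_sets sets.sigma_sets_subset[of ?E borel] by auto
    have "?G \<subseteq> ?E"
    proof
      fix X assume "X \<in> ?G"
      then show "X \<in> ?E" by (intro CollectI exI[of _ "{X}"]) auto
    qed
    then show "sets borel \<subseteq> sigma_sets UNIV ?E"
      unfolding sets_borel_eq_inner[where 'a='a] by (rule sigma_sets_mono')
  qed
  show ?thesis
  proof (rule measure_eqI_generator_eq[where E="?E" and \<Omega>=UNIV and A="\<lambda>_. UNIV"])
    show "Int_stable ?E"
    proof (rule Int_stableI, safe)
      fix F1 F2 assume "finite F1" "F1 \<subseteq> ?G" "finite F2" "F2 \<subseteq> ?G"
      then show "\<exists>\<F>. \<Inter>F1 \<inter> \<Inter>F2 = \<Inter>\<F> \<and> finite \<F> \<and> \<F> \<subseteq> ?G"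
        by (intro exI[of _ "F1 \<union> F2"]) auto
    qed
    fix X assume X: "X \<in> ?E"
    then obtain \<F> where \<F>: "X = \<Inter>\<F>" "finite \<F>" "\<F> \<subseteq> ?G" by blast
    have "complex_of_real (measure \<mu> X) = complex_of_real (measure \<nu> X)"
    proof -
      have "(CLINT x|K. indicator X x *\<^sub>R iexp (x \<bullet> 0)) = complex_of_real (measure K X)"
        if "space K = UNIV" for K :: "'a measure"
      proof -
        have "(CLINT x|K. indicator X x *\<^sub>R iexp (x \<bullet> 0)) = (CLINT x|K. complex_of_real (indicator X x))"
          by (intro Bochner_Integration.integral_cong refl) (simp only: scaleR_conv_of_real inner_zero_right of_real_0 mult_zero_right exp_zero mult_1_right)
        also have "\<dots> = complex_of_real (measure K X)"
          by (simp add: that)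
        finally show ?thesis .
      qed
      moreover have "(CLINT x|\<mu>. indicator X x *\<^sub>R iexp (x \<bullet> 0)) = (CLINT x|\<nu>. indicator X x *\<^sub>R iexp (x \<bullet> 0))"
        using matched[OF \<F>(2,3)] char_matched_def \<F>(1) by blast
      ultimately show ?thesis using sp by simp
    qed
    then show "emeasure \<mu> X = emeasure \<nu> X"
      by (simp add: M.emeasure_eq_measure N.emeasure_eq_measure)
  next
    show "range (\<lambda>_::nat. UNIV) \<subseteq> ?E" by auto
  qed (use sets s in \<open>auto simp: M.emeasure_eq_measure\<close>)
qed

section \<open>Normal laws\<close>

abbreviation std_normal :: "real measure" where "std_normal \<equiv> density lborel std_normal_density"

lemma prob_space_std_normal: "prob_space std_normal"
  by (rule prob_space_normal_density) simp

text \<open>The affine image of a standard normal variable covers v = 0 and v > 0 at once, so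
  moments, characteristic functions and measurability in the mean are all derived from
  \<open>std_normal\<close>.\<close>

lemma normal_measure_eq_distr:
  assumes "0 \<le> v"
  shows "normal_measure \<mu> v = distr std_normal borel (\<lambda>x. \<mu> + sqrt v * x)"
proof (cases "v = 0")
  case True
  interpret prob_space std_normal by (rule prob_space_std_normal)
  show ?thesis using True by (auto simp: normal_measure_def)
next
  case False
  interpret prob_space std_normal by (rule prob_space_std_normal)
  have "distributed std_normal lborel (\<lambda>x. x) (\<lambda>x. ennreal (std_normal_density x))"
    by (auto simp: distributed_def distr_id2)
  from normal_density_affine[OF this, of "sqrt v" \<mu>]
  have "distributed std_normal lborel (\<lambda>x. \<mu> + sqrt v * x) (\<lambda>x. ennreal (normal_density \<mu> (sqrt v) x))"
    using False assms by simp
  then have "distr std_normal lborel (\<lambda>x. \<mu> + sqrt v * x) = density lborel (\<lambda>x. ennreal (normal_density \<mu> (sqrt v) x))"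
    by (simp add: distributed_def)
  moreover have "distr std_normal lborel (\<lambda>x. \<mu> + sqrt v * x) = distr std_normal borel (\<lambda>x. \<mu> + sqrt v * x)"
    by (rule distr_cong) auto
  ultimately show ?thesis using False by (simp add: normal_measure_def)
qed

lemma sets_normal_measure [simp, measurable_cong]: "sets (normal_measure \<mu> v) = sets borel"
  by (simp add: normal_measure_def)

lemma space_normal_measure [simp]: "space (normal_measure \<mu> v) = UNIV"
  by (simp add: normal_measure_def)

lemma prob_space_normal_measure: "0 \<le> v \<Longrightarrow> prob_space (normal_measure \<mu> v)"
  unfolding normal_measure_eq_distr by (intro prob_space.prob_space_distr prob_space_std_normal) simp

lemma char_normal_measure:
  assumes "0 \<le> v"
  shows "char (normal_measure 0 v) t = complex_of_real (exp (- (v * t\<^sup>2) / 2))"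
proof -
  have "char (normal_measure 0 v) t = char std_normal (t * sqrt v)"
    unfolding char_def normal_measure_eq_distr[OF assms]
    by (subst integral_distr) (auto simp: mult_ac)
  then show ?thesis using assms
    by (simp add: char_std_normal_distribution power_mult_distrib)
qed

text \<open>Completing the square; this is the Cameron-Martin formula on the line.\<close>

lemma std_normal_tilt:
  "density std_normal (\<lambda>x. ennreal (exp (s * x - s\<^sup>2 / 2))) = distr std_normal borel (\<lambda>x. s + x)"
proof -
  have "distr std_normal borel (\<lambda>x. s + x) = normal_measure s 1"
    by (simp add: normal_measure_eq_distr)
  also have "\<dots> = density lborel (\<lambda>x. ennreal (normal_density s 1 x))"
    by (simp add: normal_measure_def)
  also have "\<dots> = density lborel (\<lambda>x. ennreal (std_normal_density x) * ennreal (exp (s * x - s\<^sup>2 / 2)))"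
    by (intro density_cong)
      (auto simp: ennreal_mult[symmetric] normal_density_def exp_add[symmetric] power2_eq_square field_simps)
  also have "\<dots> = density std_normal (\<lambda>x. ennreal (exp (s * x - s\<^sup>2 / 2)))"
    by (subst density_density_eq) auto
  finally show ?thesis by simp
qed

lemma nn_integral_exp_normal_measure:
  assumes "0 \<le> v"
  shows "(\<integral>\<^sup>+x. ennreal (exp (s * x)) \<partial>normal_measure 0 v) = ennreal (exp (s\<^sup>2 * v / 2))"
proof -
  interpret prob_space std_normal by (rule prob_space_std_normal)
  let ?s = "s * sqrt v"
  have "(\<integral>\<^sup>+x. ennreal (exp (s * x)) \<partial>normal_measure 0 v) = (\<integral>\<^sup>+x. ennreal (exp (?s * x)) \<partial>std_normal)"
    unfolding normal_measure_eq_distr[OF assms]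
    by (subst nn_integral_distr) (auto simp: mult_ac)
  also have "\<dots> = (\<integral>\<^sup>+x. ennreal (exp (?s\<^sup>2 / 2)) * ennreal (exp (?s * x - ?s\<^sup>2 / 2)) \<partial>std_normal)"
    by (auto simp: ennreal_mult[symmetric] exp_add[symmetric])
  also have "\<dots> = ennreal (exp (?s\<^sup>2 / 2)) * (\<integral>\<^sup>+x. ennreal (exp (?s * x - ?s\<^sup>2 / 2)) \<partial>std_normal)"
    by (rule nn_integral_cmult) simp
  also have "(\<integral>\<^sup>+x. ennreal (exp (?s * x - ?s\<^sup>2 / 2)) \<partial>std_normal) = emeasure (density std_normal (\<lambda>x. ennreal (exp (?s * x - ?s\<^sup>2 / 2)))) UNIV"
    by (subst emeasure_density) auto
  also have "\<dots> = 1"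
    unfolding std_normal_tilt by (subst emeasure_distr) (use emeasure_space_1 in auto)
  finally show ?thesis using assms by (simp add: power_mult_distrib)
qed

text \<open>The tilt by \<open>exp (x - v / 2)\<close> moves the mean from 0 to v, hence the factor
  \<open>iexp (t * v)\<close>.\<close>

lemma char_normal_measure_tilt:
  assumes "0 \<le> v"
  shows "(CLINT x|normal_measure 0 v. exp (x - v / 2) *\<^sub>R iexp (t * x))
    = iexp (t * v) * complex_of_real (exp (- (v * t\<^sup>2) / 2))"
proof -
  let ?s = "sqrt v"
  have v: "v = ?s\<^sup>2" using assms by simp
  have "(CLINT x|normal_measure 0 v. exp (x - v / 2) *\<^sub>R iexp (t * x))
     = (CLINT x|std_normal. exp (?s * x - ?s\<^sup>2 / 2) *\<^sub>R iexp (t * (?s * x)))"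
    unfolding normal_measure_eq_distr[OF assms] using assms
    by (subst integral_distr) auto
  also have "\<dots> = (CLINT x|density std_normal (\<lambda>x. ennreal (exp (?s * x - ?s\<^sup>2 / 2))). iexp (t * (?s * x)))"
    by (subst integral_density) auto
  also have "\<dots> = (CLINT x|std_normal. iexp (t * (?s * (?s + x))))"
    unfolding std_normal_tilt by (subst integral_distr) auto
  also have "\<dots> = (CLINT x|std_normal. iexp (t * v) * iexp (t * ?s * x))"
  by (smt (verit) Bochner_Integration.integral_cong v algebra_simps power2_eq_square of_real_add exp_add)
  also have "\<dots> = iexp (t * v) * char std_normal (t * ?s)"
    unfolding char_def by simp
  also have "\<dots> = iexp (t * v) * complex_of_real (exp (- (v * t\<^sup>2) / 2))"
    using assms by (simp add: char_std_normal_distribution power_mult_distrib)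
  finally show ?thesis .
qed

lemma normal_measure_moments:
  assumes "0 \<le> v"
  shows "integrable (normal_measure 0 v) (\<lambda>x. x ^ k)"
    and "(LINT x|normal_measure 0 v. x) = 0"
    and "(LINT x|normal_measure 0 v. x\<^sup>2) = v"
    and "(LINT x|normal_measure 0 v. x ^ 4) = 3 * v\<^sup>2"
proof -
  show "integrable (normal_measure 0 v) (\<lambda>x. x ^ k)"
    unfolding normal_measure_eq_distr[OF assms]
    using integrable_std_normal_distribution_moment[of k]
    by (subst integrable_distr_eq) (auto simp: power_mult_distrib)
  show "(LINT x|normal_measure 0 v. x) = 0"
    unfolding normal_measure_eq_distr[OF assms]
    using integral_std_normal_distribution_moment_odd[of 1]
    by (subst integral_distr) auto
  show "(LINT x|normal_measure 0 v. x\<^sup>2) = v"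
    unfolding normal_measure_eq_distr[OF assms]
    using std_normal_distribution_even_moments[of 1] assms
    by (subst integral_distr) (auto simp: power_mult_distrib)
  have "sqrt v ^ 4 = v\<^sup>2" using assms by (simp add: power4_eq_xxxx power2_eq_square)
  then show "(LINT x|normal_measure 0 v. x ^ 4) = 3 * v\<^sup>2"
    unfolding normal_measure_eq_distr[OF assms]
    using std_normal_distribution_even_moments[of 2] by (subst integral_distr) (auto simp: power_mult_distrib fact_numeral)
qed

lemma (in prob_space) mgf_tail_bound:
  assumes X [measurable]: "X \<in> borel_measurable M"
    and mgf: "\<And>s. (\<integral>\<^sup>+\<omega>. ennreal (exp (s * X \<omega>)) \<partial>M) \<le> ennreal (exp (s\<^sup>2 * B\<^sup>2 / 2))"
    and "0 < B" "0 \<le> x"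
  shows "measure M {\<omega> \<in> space M. \<bar>X \<omega>\<bar> > x} \<le> 2 * exp (- x\<^sup>2 / (2 * B\<^sup>2))"
proof -
  have one: "measure M {\<omega> \<in> space M. c * X \<omega> > x} \<le> exp (- x\<^sup>2 / (2 * B\<^sup>2))" if c: "c\<^sup>2 = 1" for c
  proof -
    \<comment> \<open>The minimiser of \<open>s\<^sup>2 * B\<^sup>2 / 2 - s * x\<close> in the
      Chernoff bound; c = 1 and c = -1 give the two tails.\<close>
    define s where "s = x / B\<^sup>2"
    have s: "0 \<le> s" using assms by (simp add: s_def)
    have "ennreal (exp (s * x)) * emeasure M {\<omega> \<in> space M. c * X \<omega> > x}
       = (\<integral>\<^sup>+\<omega>. ennreal (exp (s * x)) * indicator {\<omega> \<in> space M. c * X \<omega> > x} \<omega> \<partial>M)"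
      by (subst nn_integral_cmult_indicator) auto
    also have "\<dots> \<le> (\<integral>\<^sup>+\<omega>. ennreal (exp ((s * c) * X \<omega>)) \<partial>M)"
      using s by (intro nn_integral_mono) (auto simp: indicator_def mult.assoc mult_left_mono)
    also have "\<dots> \<le> ennreal (exp (s\<^sup>2 * B\<^sup>2 / 2))"
      using mgf[of "s * c"] c by (simp add: power_mult_distrib)
    finally have "ennreal (exp (s * x) * measure M {\<omega> \<in> space M. c * X \<omega> > x}) \<le> ennreal (exp (s\<^sup>2 * B\<^sup>2 / 2))"
      by (simp add: emeasure_eq_measure ennreal_mult)
    then have "exp (s * x) * measure M {\<omega> \<in> space M. c * X \<omega> > x} \<le> exp (s\<^sup>2 * B\<^sup>2 / 2)"
      by simp
    then have "measure M {\<omega> \<in> space M. c * X \<omega> > x} \<le> exp (s\<^sup>2 * B\<^sup>2 / 2) / exp (s * x)"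
      by (simp add: field_simps)
    also have "\<dots> = exp (- x\<^sup>2 / (2 * B\<^sup>2))"
      using assms(3) by (simp add: exp_diff[symmetric] s_def power2_eq_square)
    finally show ?thesis .
  qed
  have "measure M {\<omega> \<in> space M. \<bar>X \<omega>\<bar> > x}
      \<le> measure M ({\<omega> \<in> space M. 1 * X \<omega> > x} \<union> {\<omega> \<in> space M. - 1 * X \<omega> > x})"
    by (intro finite_measure_mono) auto
  also have "\<dots> \<le> measure M {\<omega> \<in> space M. 1 * X \<omega> > x} + measure M {\<omega> \<in> space M. - 1 * X \<omega> > x}"
    by (intro measure_Un_le) auto
  also have "\<dots> \<le> 2 * exp (- x\<^sup>2 / (2 * B\<^sup>2))"
    using one[of 1] one[of "-1"] by simp
  finally show ?thesis .
qed

section \<open>Gaussian measures on a Hilbert space\<close>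

locale onb =
  fixes e :: "nat \<Rightarrow> 'h::real_inner"
  assumes basis: "orthonormal_basis e"
begin

lemma inner_basis: "e i \<bullet> e j = (if i = j then 1 else 0)"
  using basis by (auto simp: orthonormal_basis_def)

lemma norm_basis_sum: "(norm (\<Sum>k<N. c k *\<^sub>R e k))\<^sup>2 = (\<Sum>k<N. (c k)\<^sup>2)"
  unfolding power2_norm_eq_inner
  by (simp add: inner_sum_left inner_sum_right inner_basis power2_eq_square if_distrib cong: if_cong)

lemma inner_basis_sum: "j < N \<Longrightarrow> (\<Sum>k<N. c k *\<^sub>R e k) \<bullet> e j = c j"
  by (simp add: inner_sum_left inner_basis if_distrib cong: if_cong)

definition partial_expansion :: "nat \<Rightarrow> 'h \<Rightarrow> 'h" where
  "partial_expansion N h = (\<Sum>k<N. (h \<bullet> e k) *\<^sub>R e k)"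

lemma norm_residual: "(norm (h - partial_expansion N h))\<^sup>2 = (norm h)\<^sup>2 - (\<Sum>k<N. (h \<bullet> e k)\<^sup>2)"
proof -
  have "h \<bullet> partial_expansion N h = (\<Sum>k<N. (h \<bullet> e k)\<^sup>2)"
    by (simp add: partial_expansion_def inner_sum_right power2_eq_square)
  then show ?thesis
    using norm_basis_sum[of "\<lambda>k. h \<bullet> e k" N]
    by (simp add: power2_norm_eq_inner inner_diff_right inner_commute partial_expansion_def)
qed

lemma partial_expansion_sum: "partial_expansion N (\<Sum>k<N. c k *\<^sub>R e k) = (\<Sum>k<N. c k *\<^sub>R e k)"
  unfolding partial_expansion_def by (intro sum.cong refl) (simp add: inner_basis_sum)

lemma partial_expansion_diff: "partial_expansion N (g - h) = partial_expansion N g - partial_expansion N h"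
  by (simp add: partial_expansion_def inner_diff_left scaleR_diff_left sum_subtractf)

lemma span_basis: "s \<in> span (range e) \<Longrightarrow> \<exists>N c. s = (\<Sum>k<N. c k *\<^sub>R e k)"
proof (induction rule: span_induct_alt)
  case base
  show ?case by (intro exI[of _ 0]) simp
next
  case (step c x y)
  then obtain N d where y: "y = (\<Sum>k<N. d k *\<^sub>R e k)" by auto
  obtain j where x: "x = e j" using step by auto
  define M where "M = max N (Suc j)"
  have "y = (\<Sum>k<M. (if k < N then d k else 0) *\<^sub>R e k)"
    unfolding y M_def by (rule sum.mono_neutral_cong_left) auto
  moreover have "c *\<^sub>R x = (\<Sum>k<M. (if k = j then c else 0) *\<^sub>R e k)"
  proof -
    have "(\<Sum>k<M. (if k = j then c else 0) *\<^sub>R e k) = (\<Sum>k<M. if k = j then c *\<^sub>R e k else 0)"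
      by (intro sum.cong) auto
    then show ?thesis by (simp add: x M_def less_max_iff_disj)
  qed
  ultimately have "c *\<^sub>R x + y = (\<Sum>k<M. ((if k = j then c else 0) + (if k < N then d k else 0)) *\<^sub>R e k)"
    by (simp add: scaleR_add_left sum.distrib)
  then show ?case
    by auto
qed

text \<open>The map from h to its residual is linear, does not increase norms and annihilates each
  finite combination of the basis once N is large, so a residual is bounded by the distance to the
  dense span.\<close>

lemma partial_expansion_tendsto: "(\<lambda>N. partial_expansion N h) \<longlonglongrightarrow> h"
proof (rule LIMSEQ_I)
  fix r :: real assume r: "0 < r"
  have "h \<in> closure (span (range e))" using basis by (auto simp: orthonormal_basis_def)
  then obtain s where s: "s \<in> span (range e)" "dist s h < r"
    using r by (meson closure_approachable)
  then obtain N c where sN: "s = (\<Sum>k<N. c k *\<^sub>R e k)" using span_basis by blast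
  have "norm (partial_expansion n h - h) < r" if "N \<le> n" for n
  proof -
    have "s = (\<Sum>k<n. (if k < N then c k else 0) *\<^sub>R e k)"
      unfolding sN using that by (intro sum.mono_neutral_cong_left) auto
    then have sn: "partial_expansion n s = s" by (metis partial_expansion_sum)
    have "(norm (h - partial_expansion n h))\<^sup>2 = (norm ((h - s) - partial_expansion n (h - s)))\<^sup>2"
      by (simp add: partial_expansion_diff sn)
    also have "\<dots> \<le> (norm (h - s))\<^sup>2"
      unfolding norm_residual by (simp add: sum_nonneg)
    finally have "norm (h - partial_expansion n h) \<le> norm (h - s)" by simp
    then show ?thesis using s(2) by (simp add: dist_norm norm_minus_commute)
  qed
  then show "\<exists>N. \<forall>n\<ge>N. norm (partial_expansion n h - h) < r" by blast
qed

lemma parseval: "(\<lambda>k. (h \<bullet> e k)\<^sup>2) sums (norm h)\<^sup>2"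
proof -
  have "(\<lambda>N. (norm h)\<^sup>2 - (norm (h - partial_expansion N h))\<^sup>2) \<longlonglongrightarrow> (norm h)\<^sup>2 - (norm (h - h))\<^sup>2"
    by (intro tendsto_intros partial_expansion_tendsto)
  then show ?thesis unfolding sums_def norm_residual by simp
qed

lemma parseval_inner: "(\<lambda>k. (g \<bullet> e k) * (h \<bullet> e k)) sums (g \<bullet> h)"
proof -
  have "(\<lambda>N. partial_expansion N g \<bullet> h) \<longlonglongrightarrow> g \<bullet> h"
    by (intro tendsto_intros partial_expansion_tendsto)
  then show ?thesis
    unfolding sums_def partial_expansion_def by (simp add: inner_sum_left inner_commute[of "e _"])
qed

end

lemma integral_pair_mult:
  fixes f :: "'a \<Rightarrow> complex" and g :: "'b \<Rightarrow> complex"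
  assumes "prob_space M" "prob_space N" and f: "integrable M f" and g: "integrable N g"
  shows "(CLINT p|M \<Otimes>\<^sub>M N. f (fst p) * g (snd p)) = (CLINT x|M. f x) * (CLINT y|N. g y)"
proof -
  interpret M: prob_space M by fact
  interpret N: prob_space N by fact
  interpret MN: pair_prob_space M N ..
  have "integrable (M \<Otimes>\<^sub>M N) (\<lambda>p. f (fst p) * g (snd p))"
    by (rule MN.Fubini_integrable) (use f g in \<open>auto simp: norm_mult\<close>)
  then have "(CLINT p|M \<Otimes>\<^sub>M N. f (fst p) * g (snd p)) = (CLINT x|M. CLINT y|N. f x * g y)"
    by (subst MN.integral_fst'[symmetric]) auto
  then show ?thesis by simp
qed

lemma integral_pair_iexp:
  assumes "prob_space M" "prob_space N" and f [measurable]: "f \<in> borel_measurable M" and g [measurable]: "g \<in> borel_measurable N"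
  shows "(CLINT p|M \<Otimes>\<^sub>M N. iexp (f (fst p) + g (snd p))) = (CLINT x|M. iexp (f x)) * (CLINT y|N. iexp (g y))"
proof -
  interpret M: prob_space M by fact
  interpret N: prob_space N by fact
  have "integrable M (\<lambda>x. iexp (f x))" "integrable N (\<lambda>x. iexp (g x))"
    by (intro M.integrable_const_bound[of _ 1] N.integrable_const_bound[of _ 1]; simp)+
  from integral_pair_mult[OF assms(1,2) this] show ?thesis
    by (simp add: distrib_left exp_add)
qed

section \<open>Covariances, rotation invariance and tilting\<close>

locale gaussian_measure =
  fixes \<pi> :: "'h::{real_inner,banach,second_countable_topology} measure"
  assumes gaussian: "centered_gaussian \<pi>"
begin

sublocale prob_space \<pi>
  using gaussian by (simp add: centered_gaussian_def)

lemma sets_pi [simp, measurable_cong]: "sets \<pi> = sets borel"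
  using gaussian by (simp add: centered_gaussian_def)

lemma space_pi [simp]: "space \<pi> = UNIV"
  using sets_eq_imp_space_eq[OF sets_pi] by simp

definition cov :: "'h \<Rightarrow> 'h \<Rightarrow> real" where
  "cov h k = (LINT f|\<pi>. (f \<bullet> h) * (f \<bullet> k))"

lemma distr_inner: "distr \<pi> borel (\<lambda>f. f \<bullet> h) = normal_measure 0 (cov h h)" and cov_nonneg: "0 \<le> cov h h"
  and integrable_inner_power: "integrable \<pi> (\<lambda>f. (f \<bullet> h) ^ k)"
  and fourth_moment: "(LINT f|\<pi>. (f \<bullet> h) ^ 4) = 3 * (cov h h)\<^sup>2"
proof -
  obtain v where v: "0 \<le> v" "distr \<pi> borel (\<lambda>f. f \<bullet> h) = normal_measure 0 v"
    using gaussian centered_gaussian_def by blast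
  have "cov h h = (LINT x|distr \<pi> borel (\<lambda>f. f \<bullet> h). x\<^sup>2)"
    unfolding cov_def by (subst integral_distr) (auto simp: power2_eq_square)
  then have c: "cov h h = v"
    unfolding v normal_measure_moments[OF v(1)] by simp
  then show "distr \<pi> borel (\<lambda>f. f \<bullet> h) = normal_measure 0 (cov h h)" "0 \<le> cov h h" using v by auto
  have "integrable (distr \<pi> borel (\<lambda>f. f \<bullet> h)) (\<lambda>x. x ^ k)"
    unfolding v using normal_measure_moments[OF v(1)] by simp
  then show "integrable \<pi> (\<lambda>f. (f \<bullet> h) ^ k)"
    by (subst (asm) integrable_distr_eq) auto
  have "(LINT f|\<pi>. (f \<bullet> h) ^ 4) = (LINT x|distr \<pi> borel (\<lambda>f. f \<bullet> h). x ^ 4)"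
    by (subst integral_distr) auto
  then show "(LINT f|\<pi>. (f \<bullet> h) ^ 4) = 3 * (cov h h)\<^sup>2"
    unfolding v c normal_measure_moments[OF v(1)] by simp
qed

lemma integrable_inner_mult: "integrable \<pi> (\<lambda>f. (f \<bullet> h) * (f \<bullet> k))"
proof (rule Bochner_Integration.integrable_bound)
  show "integrable \<pi> (\<lambda>f. (f \<bullet> h)\<^sup>2 + (f \<bullet> k)\<^sup>2)"
    by (intro Bochner_Integration.integrable_add integrable_inner_power)
  have "\<bar>a * b\<bar> \<le> a\<^sup>2 + b\<^sup>2" for a b :: real
  proof -
    have "0 \<le> (\<bar>a\<bar> - \<bar>b\<bar>)\<^sup>2 + \<bar>a * b\<bar>" by simp
    then show ?thesis by (simp add: power2_diff abs_mult)
  qed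
  then show "AE f in \<pi>. norm ((f \<bullet> h) * (f \<bullet> k)) \<le> norm ((f \<bullet> h)\<^sup>2 + (f \<bullet> k)\<^sup>2)" by simp
qed simp

lemma cov_add_left: "cov (h + h') k = cov h k + cov h' k"
  unfolding cov_def using integrable_inner_mult by (simp add: inner_add_right distrib_right)

lemma cov_commute: "cov h k = cov k h"
  unfolding cov_def by (simp add: mult.commute)

lemma cov_add_right: "cov k (h + h') = cov k h + cov k h'"
  using cov_add_left[of h h' k] by (simp add: cov_commute)

lemma cov_scaleR_left: "cov (c *\<^sub>R h) k = c * cov h k"
  unfolding cov_def by (simp add: mult.assoc)

lemma cov_scaleR_right: "cov k (c *\<^sub>R h) = c * cov k h"
  using cov_scaleR_left[of c h k] by (simp add: cov_commute)

lemma cov_minus_left: "cov (- h) k = - cov h k"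
  using cov_scaleR_left[of "-1"] by simp

lemma cov_minus_right: "cov k (- h) = - cov k h"
  using cov_scaleR_right[of k "-1"] by simp

lemma cov_diff_left: "cov (h - h') k = cov h k - cov h' k"
  using cov_add_left[of h "- h'" k] by (simp add: cov_minus_left)

lemma cov_diff_right: "cov k (h - h') = cov k h - cov k h'"
  using cov_diff_left[of h h' k] by (simp add: cov_commute)

lemmas cov_simps = cov_diff_left cov_diff_right cov_add_left cov_add_right cov_scaleR_left cov_scaleR_right cov_minus_left cov_minus_right

lemma char_inner: "(CLINT f|\<pi>. iexp (f \<bullet> h)) = complex_of_real (exp (- cov h h / 2))"
proof -
  have "(CLINT f|\<pi>. iexp (f \<bullet> h)) = char (distr \<pi> borel (\<lambda>f. f \<bullet> h)) 1"
    unfolding char_def by (subst integral_distr) auto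
  then show ?thesis by (simp add: distr_inner char_normal_measure cov_nonneg)
qed

lemma mgf_inner: "(\<integral>\<^sup>+f. ennreal (exp (s * (f \<bullet> h))) \<partial>\<pi>) = ennreal (exp (s\<^sup>2 * cov h h / 2))"
proof -
  have "(\<integral>\<^sup>+f. ennreal (exp (s * (f \<bullet> h))) \<partial>\<pi>) = (\<integral>\<^sup>+x. ennreal (exp (s * x)) \<partial>distr \<pi> borel (\<lambda>f. f \<bullet> h))"
    by (subst nn_integral_distr) auto
  then show ?thesis by (simp add: distr_inner nn_integral_exp_normal_measure cov_nonneg)
qed

definition rotate :: "'h \<times> 'h \<Rightarrow> 'h \<times> 'h" where
  "rotate = (\<lambda>(x, y). ((x + y) /\<^sub>R sqrt 2, (x - y) /\<^sub>R sqrt 2))"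

lemma sets_pair_pi: "sets (\<pi> \<Otimes>\<^sub>M \<pi>) = sets (borel :: ('h \<times> 'h) measure)"
  by (subst borel_prod[symmetric]) simp_all

text \<open>The map \<open>rotate\<close> is orthogonal and its own adjoint, so it acts on the
  argument (h, k) of the characteristic functional, which depends only on
  \<open>cov h h + cov k k\<close>; the parallelogram law for \<open>cov\<close> leaves this sum
  unchanged.\<close>

lemma rotation_invariant: "distr (\<pi> \<Otimes>\<^sub>M \<pi>) (\<pi> \<Otimes>\<^sub>M \<pi>) rotate = \<pi> \<Otimes>\<^sub>M \<pi>"
proof -
  interpret pp: pair_prob_space \<pi> \<pi> ..
  have m: "rotate \<in> measurable (\<pi> \<Otimes>\<^sub>M \<pi>) (\<pi> \<Otimes>\<^sub>M \<pi>)"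
    unfolding rotate_def by measurable
  have c: "(CLINT p|\<pi> \<Otimes>\<^sub>M \<pi>. iexp (p \<bullet> (h, k))) = complex_of_real (exp (- (cov h h + cov k k) / 2))" for h k
  proof -
    have "(CLINT p|\<pi> \<Otimes>\<^sub>M \<pi>. iexp (p \<bullet> (h, k))) = (CLINT p|\<pi> \<Otimes>\<^sub>M \<pi>. iexp ((fst p \<bullet> h) + (snd p \<bullet> k)))"
      by (intro Bochner_Integration.integral_cong refl) (simp add: inner_prod_def)
    also have "\<dots> = complex_of_real (exp (- cov h h / 2)) * complex_of_real (exp (- cov k k / 2))"
      by (subst integral_pair_iexp[of \<pi> \<pi> "\<lambda>x. x \<bullet> h" "\<lambda>y. y \<bullet> k"]) (auto simp: prob_space_axioms char_inner)
    finally show ?thesis by (simp add: exp_add[symmetric] flip: of_real_mult)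
  qed
  show ?thesis
  proof (rule char_functional_unique)
    show "finite_measure (distr (\<pi> \<Otimes>\<^sub>M \<pi>) (\<pi> \<Otimes>\<^sub>M \<pi>) rotate)" by (intro pp.finite_measure_distr m)
    show "finite_measure (\<pi> \<Otimes>\<^sub>M \<pi>)" by simp
    fix hk :: "'h \<times> 'h"
    obtain h k where hk: "hk = (h, k)" by fastforce
    have "(CLINT p|distr (\<pi> \<Otimes>\<^sub>M \<pi>) (\<pi> \<Otimes>\<^sub>M \<pi>) rotate. iexp (p \<bullet> hk)) = (CLINT p|\<pi> \<Otimes>\<^sub>M \<pi>. iexp (rotate p \<bullet> hk))"
      by (subst integral_distr[OF m]) (auto simp: measurable_cong_sets[OF sets_pair_pi refl])
    also have "\<dots> = (CLINT p|\<pi> \<Otimes>\<^sub>M \<pi>. iexp (p \<bullet> ((h + k) /\<^sub>R sqrt 2, (h - k) /\<^sub>R sqrt 2)))"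
      unfolding rotate_def hk
      by (intro Bochner_Integration.integral_cong)
        (auto simp: algebra_simps)
    also have "\<dots> = complex_of_real (exp (- (cov h h + cov k k) / 2))"
    by (simp add: cov_simps field_simps c)
    finally show "(CLINT p|distr (\<pi> \<Otimes>\<^sub>M \<pi>) (\<pi> \<Otimes>\<^sub>M \<pi>) rotate. iexp (p \<bullet> hk)) = (CLINT p|\<pi> \<Otimes>\<^sub>M \<pi>. iexp (p \<bullet> hk))"
      unfolding hk c .
    show "sets (distr (\<pi> \<Otimes>\<^sub>M \<pi>) (\<pi> \<Otimes>\<^sub>M \<pi>) rotate) = sets borel" by (simp only: sets_distr sets_pair_pi)
  qed (rule sets_pair_pi)
qed

lemma nn_integral_rotate:
  assumes [measurable]: "F \<in> borel_measurable (\<pi> \<Otimes>\<^sub>M \<pi>)"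
  shows "(\<integral>\<^sup>+p. F (rotate p) \<partial>(\<pi> \<Otimes>\<^sub>M \<pi>)) = (\<integral>\<^sup>+p. F p \<partial>(\<pi> \<Otimes>\<^sub>M \<pi>))"
proof -
  have m: "rotate \<in> measurable (\<pi> \<Otimes>\<^sub>M \<pi>) (\<pi> \<Otimes>\<^sub>M \<pi>)"
    unfolding rotate_def by measurable
  show ?thesis
    by (subst rotation_invariant[symmetric]) (simp add: nn_integral_distr[OF m])
qed

lemma nn_integral_inner: "F \<in> borel_measurable borel \<Longrightarrow> (\<integral>\<^sup>+f. F (f \<bullet> h) \<partial>\<pi>) = (\<integral>\<^sup>+x. F x \<partial>normal_measure 0 (cov h h))"
  unfolding distr_inner[symmetric] by (subst nn_integral_distr) auto

lemma cov_eq_zero_AE: "cov h h = 0 \<Longrightarrow> AE f in \<pi>. f \<bullet> h = 0"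
  using integrable_inner_mult[of h h] unfolding cov_def
  by (subst (asm) integral_nonneg_eq_0_iff_AE) auto

text \<open>Linear functionals of a Gaussian law are jointly Gaussian, so uncorrelated ones are
  independent: the cross term in the exponent of the characteristic functional vanishes and the
  functional factorises.\<close>

lemma joint_law:
  assumes "cov h k = 0"
  shows "distr \<pi> (borel \<Otimes>\<^sub>M borel) (\<lambda>f. (f \<bullet> h, f \<bullet> k)) = normal_measure 0 (cov h h) \<Otimes>\<^sub>M normal_measure 0 (cov k k)"
proof (rule char_functional_unique)
  let ?N = "\<lambda>h. normal_measure 0 (cov h h)"
  have p: "prob_space (?N h)" for h by (simp add: prob_space_normal_measure cov_nonneg)
  show "finite_measure (distr \<pi> (borel \<Otimes>\<^sub>M borel) (\<lambda>f. (f \<bullet> h, f \<bullet> k)))"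
    by (intro finite_measure_distr) measurable
  interpret N: pair_prob_space "?N h" "?N k"
    using p by (simp add: pair_prob_space_def pair_sigma_finite_def prob_space_imp_sigma_finite)
  show "finite_measure (?N h \<Otimes>\<^sub>M ?N k)" by simp
  show "sets (distr \<pi> (borel \<Otimes>\<^sub>M borel) (\<lambda>f. (f \<bullet> h, f \<bullet> k))) = sets borel"
    by (simp only: sets_distr borel_prod)
  show s: "sets (?N h \<Otimes>\<^sub>M ?N k) = sets borel"
    by (subst borel_prod[symmetric]) simp_all
  fix st :: "real \<times> real"
  obtain s t where st: "st = (s, t)" by fastforce
  have "(CLINT p|distr \<pi> (borel \<Otimes>\<^sub>M borel) (\<lambda>f. (f \<bullet> h, f \<bullet> k)). iexp (p \<bullet> st)) = (CLINT f|\<pi>. iexp (f \<bullet> (s *\<^sub>R h + t *\<^sub>R k)))"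
    unfolding st
    by (subst integral_distr) (auto simp: inner_prod_def inner_add_right mult.commute)
  also have "\<dots> = complex_of_real (exp (- (cov h h * s\<^sup>2) / 2)) * complex_of_real (exp (- (cov k k * t\<^sup>2) / 2))"
    unfolding char_inner of_real_mult[symmetric] exp_add[symmetric]
    by (simp add: cov_simps assms cov_commute[of k h] power2_eq_square)
  also have "\<dots> = (CLINT p|?N h \<Otimes>\<^sub>M ?N k. iexp (s * fst p + t * snd p))"
    using integral_pair_iexp[OF p[of h] p[of k], of "\<lambda>x. s * x" "\<lambda>y. t * y"]
      char_normal_measure[OF cov_nonneg, of h s] char_normal_measure[OF cov_nonneg, of k t]
    by (simp add: char_def)
  also have "\<dots> = (CLINT p|?N h \<Otimes>\<^sub>M ?N k. iexp (p \<bullet> st))"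
    unfolding st by (intro Bochner_Integration.integral_cong refl) (simp add: inner_prod_def mult.commute)
  finally show "(CLINT p|distr \<pi> (borel \<Otimes>\<^sub>M borel) (\<lambda>f. (f \<bullet> h, f \<bullet> k)). iexp (p \<bullet> st)) = (CLINT p|?N h \<Otimes>\<^sub>M ?N k. iexp (p \<bullet> st))" .
qed

text \<open>Subtracting from h its regression on l leaves a k uncorrelated with l. By independence
  only the factor along l feels the tilt, and that factor is one-dimensional.\<close>

lemma char_tilted:
  "(CLINT f|\<pi>. exp (f \<bullet> l - cov l l / 2) *\<^sub>R iexp (f \<bullet> h)) = iexp (cov l h) * complex_of_real (exp (- cov h h / 2))"
proof (cases "cov l l = 0")
  case True
  then have z: "AE f in \<pi>. f \<bullet> l = 0" by (rule cov_eq_zero_AE)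
  then have "cov l h = (LINT f|\<pi>. 0)"
    unfolding cov_def by (intro integral_cong_AE) auto
  moreover have "(CLINT f|\<pi>. exp (f \<bullet> l - cov l l / 2) *\<^sub>R iexp (f \<bullet> h)) = (CLINT f|\<pi>. iexp (f \<bullet> h))"
    using z by (intro integral_cong_AE) (auto simp: True)
  ultimately show ?thesis by (simp add: char_inner)
next
  case False
  define a where "a = cov l h / cov l l"
  define k where "k = h - a *\<^sub>R l"
  have lk: "cov l k = 0" using False by (simp add: k_def a_def cov_simps)
  have hk: "h = a *\<^sub>R l + k" by (simp add: k_def)
  let ?N = "\<lambda>h. normal_measure 0 (cov h h)"
  have Nl: "prob_space (?N h)" for h by (simp add: prob_space_normal_measure cov_nonneg)
  interpret Nk: prob_space "?N k" by (rule Nl)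
  define F where "F = (\<lambda>x. exp (x - cov l l / 2) *\<^sub>R iexp (a * x))"
  have F [measurable]: "F \<in> borel_measurable borel" unfolding F_def by measurable
  have i: "integrable (?N l) F"
  proof (rule integrableI_bounded)
    have "(\<integral>\<^sup>+x. ennreal (norm (F x)) \<partial>?N l) = (\<integral>\<^sup>+x. ennreal (exp (- cov l l / 2)) * ennreal (exp (1 * x)) \<partial>?N l)"
      by (simp add: F_def ennreal_mult[symmetric] exp_add[symmetric])
    also have "\<dots> < \<infinity>"
      by (subst nn_integral_cmult, simp) (simp only: nn_integral_exp_normal_measure[OF cov_nonneg], simp add: ennreal_mult_less_top)
    finally show "(\<integral>\<^sup>+x. ennreal (norm (F x)) \<partial>?N l) < \<infinity>" .
  qed simp
  have "(CLINT f|\<pi>. exp (f \<bullet> l - cov l l / 2) *\<^sub>R iexp (f \<bullet> h))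
      = (CLINT f|\<pi>. F (f \<bullet> l) * iexp (f \<bullet> k))"
    by (intro Bochner_Integration.integral_cong refl)
      (simp add: F_def hk inner_add_right distrib_left exp_add)
  also have "\<dots> = (CLINT p|distr \<pi> (borel \<Otimes>\<^sub>M borel) (\<lambda>f. (f \<bullet> l, f \<bullet> k)). F (fst p) * iexp (snd p))"
    by (subst integral_distr) auto
  also have "\<dots> = (CLINT x|?N l. F x) * (CLINT y|?N k. iexp y)"
    unfolding joint_law[OF lk]
    by (rule integral_pair_mult[OF Nl Nl i]) (intro Nk.integrable_const_bound[of _ 1]; simp)
  also have "(CLINT x|?N l. F x) = iexp (a * cov l l) * complex_of_real (exp (- (cov l l * a\<^sup>2) / 2))"
    unfolding F_def by (rule char_normal_measure_tilt[OF cov_nonneg])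
  also have "(CLINT y|?N k. iexp y) = complex_of_real (exp (- cov k k / 2))"
    using char_normal_measure[OF cov_nonneg, of k 1] by (simp add: char_def)
  also have "iexp (a * cov l l) * complex_of_real (exp (- (cov l l * a\<^sup>2) / 2)) * complex_of_real (exp (- cov k k / 2))
      = iexp (a * cov l l) * complex_of_real (exp (- (cov l l * a\<^sup>2 + cov k k) / 2))"
    by (simp add: exp_add[symmetric] flip: of_real_mult)
  also have "a * cov l l = cov l h" using False by (simp add: a_def)
  also have "cov l l * a\<^sup>2 + cov k k = cov h h"
    unfolding hk using lk by (simp add: cov_simps cov_commute[of k l] power2_eq_square)
  finally show ?thesis .
qed

lemma integrable_norm_mult_of_square:
  assumes "integrable \<pi> (\<lambda>f. (g f)\<^sup>2)" "g \<in> borel_measurable \<pi>" "integrable \<pi> (\<lambda>f. (norm f)\<^sup>2)"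
  shows "integrable \<pi> (\<lambda>f. g f *\<^sub>R f)"
proof (rule Bochner_Integration.integrable_bound)
  show "integrable \<pi> (\<lambda>f. (g f)\<^sup>2 + (norm f)\<^sup>2)"
    by (intro Bochner_Integration.integrable_add assms)
  have "\<bar>a\<bar> * b \<le> a\<^sup>2 + b\<^sup>2" if "0 \<le> b" for a b :: real
  proof -
    have "0 \<le> (\<bar>a\<bar> - b)\<^sup>2 + \<bar>a\<bar> * b" using that by simp
    then show ?thesis by (simp add: power2_diff mult.commute)
  qed
  then show "AE f in \<pi>. norm (g f *\<^sub>R f) \<le> norm ((g f)\<^sup>2 + (norm f)\<^sup>2)" by simp
qed (use assms in simp)

end

section \<open>Square integrability of the norm\<close>

locale gaussian_basis = gaussian_measure \<pi> + onb e
  for \<pi> :: "'h::{real_inner,banach,second_countable_topology} measure" and e :: "nat \<Rightarrow> 'h"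
begin

text \<open>Gaussian fourth moments are three times squared variances, so the second moment of a
  partial sum S of the squared norm is at most three times the square of its mean. Since the norm is
  finite everywhere, S is at most R off a small event. These two facts bound the mean of S
  independently of N, and summation over the basis gives the claim.\<close>

lemma integrable_norm_square: "integrable \<pi> (\<lambda>f. (norm f)\<^sup>2)"
proof -
  define S where "S = (\<lambda>N f. \<Sum>k<N. (f \<bullet> e k)\<^sup>2)"
  define m where "m = (\<lambda>N. \<Sum>k<N. cov (e k) (e k))"
  have SN: "S N f \<le> (norm f)\<^sup>2" for N f
    using sum_le_suminf[of "\<lambda>k. (f \<bullet> e k)\<^sup>2" "{..<N}"] parseval[of f]
    by (auto simp: S_def sums_iff)
  have iS: "integrable \<pi> (S N)" for N unfolding S_def by (intro Bochner_Integration.integrable_sum integrable_inner_power)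
  have ES: "(LINT f|\<pi>. S N f) = m N" for N
    unfolding S_def m_def using integrable_inner_power[of _ 2]
    by (simp add: cov_def power2_eq_square)
  have m0: "0 \<le> m N" for N by (simp add: m_def sum_nonneg cov_nonneg)
  have jk: "integrable \<pi> (\<lambda>f. (f \<bullet> h)\<^sup>2 * (f \<bullet> k)\<^sup>2) \<and> (LINT f|\<pi>. (f \<bullet> h)\<^sup>2 * (f \<bullet> k)\<^sup>2) \<le> 3 * (cov h h * cov k k)" for h k
  proof (cases "cov h h = 0 \<or> cov k k = 0")
    case True
    then have z: "AE f in \<pi>. (f \<bullet> h)\<^sup>2 * (f \<bullet> k)\<^sup>2 = 0"
      using cov_eq_zero_AE[of h] cov_eq_zero_AE[of k] by (auto)
    have "integrable \<pi> (\<lambda>f. (f \<bullet> h)\<^sup>2 * (f \<bullet> k)\<^sup>2) \<longleftrightarrow> integrable \<pi> (\<lambda>f. 0::real)"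
      using z by (intro integrable_cong_AE) auto
    moreover have "(LINT f|\<pi>. (f \<bullet> h)\<^sup>2 * (f \<bullet> k)\<^sup>2) = (LINT f|\<pi>. 0)"
      using z by (intro integral_cong_AE) auto
    ultimately show ?thesis by (simp add: cov_nonneg)
  next
    case False
    define a b where "a = cov h h" and "b = cov k k"
    have ab: "0 < a" "0 < b" using False cov_nonneg[of h] cov_nonneg[of k] by (auto simp: a_def b_def)
    \<comment> \<open>The weights balance the two fourth moments: after integration each summand
      contributes \<open>3 * a * b / 2\<close>.\<close>
    have le: "(f \<bullet> h)\<^sup>2 * (f \<bullet> k)\<^sup>2 \<le> (b / (2 * a)) * (f \<bullet> h) ^ 4 + (a / (2 * b)) * (f \<bullet> k) ^ 4" for f
    proof -
      let ?x = "(f \<bullet> h)\<^sup>2" and ?y = "(f \<bullet> k)\<^sup>2"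
      have "0 \<le> (b * ?x - a * ?y)\<^sup>2 / (2 * a * b)" using ab by simp
      also have "\<dots> = (b / (2 * a)) * ?x\<^sup>2 + (a / (2 * b)) * ?y\<^sup>2 - ?x * ?y"
        using ab by (simp add: field_simps power2_eq_square)
      finally show ?thesis by simp
    qed
    have i: "integrable \<pi> (\<lambda>f. (b / (2 * a)) * (f \<bullet> h) ^ 4 + (a / (2 * b)) * (f \<bullet> k) ^ 4)"
      by (intro Bochner_Integration.integrable_add integrable_mult_right integrable_inner_power)
    have i2: "integrable \<pi> (\<lambda>f. (f \<bullet> h)\<^sup>2 * (f \<bullet> k)\<^sup>2)"
    proof (rule Bochner_Integration.integrable_bound[OF i])
      show "AE f in \<pi>. norm ((f \<bullet> h)\<^sup>2 * (f \<bullet> k)\<^sup>2) \<le> norm ((b / (2 * a)) * (f \<bullet> h) ^ 4 + (a / (2 * b)) * (f \<bullet> k) ^ 4)"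
        using order_trans[OF le abs_ge_self] by (intro AE_I2) (simp only: real_norm_def abs_mult abs_power2)
    qed simp
    have "(LINT f|\<pi>. (f \<bullet> h)\<^sup>2 * (f \<bullet> k)\<^sup>2) \<le> (LINT f|\<pi>. (b / (2 * a)) * (f \<bullet> h) ^ 4 + (a / (2 * b)) * (f \<bullet> k) ^ 4)"
      by (intro integral_mono i i2 le)
    also have "\<dots> = (b / (2 * a)) * (3 * a\<^sup>2) + (a / (2 * b)) * (3 * b\<^sup>2)"
      using integrable_inner_power[of _ 4] by (simp add: fourth_moment a_def b_def)
    also have "\<dots> = 3 * (a * b)" by (simp add: power2_eq_square)
    finally show ?thesis using i2 by (simp add: a_def b_def)
  qed
  have S2: "(S N f)\<^sup>2 = (\<Sum>j<N. \<Sum>k<N. (f \<bullet> e j)\<^sup>2 * (f \<bullet> e k)\<^sup>2)" for N f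
    by (simp add: S_def power2_eq_square[of "sum _ _"] sum_product)
  have iS2: "integrable \<pi> (\<lambda>f. (S N f)\<^sup>2)" for N
    unfolding S2 using jk by auto
  have ES2: "(LINT f|\<pi>. (S N f)\<^sup>2) \<le> 3 * (m N)\<^sup>2" for N
  proof -
    have "(LINT f|\<pi>. (S N f)\<^sup>2) = (\<Sum>j<N. \<Sum>k<N. (LINT f|\<pi>. (f \<bullet> e j)\<^sup>2 * (f \<bullet> e k)\<^sup>2))"
      unfolding S2 using jk by simp
    also have "\<dots> \<le> (\<Sum>j<N. \<Sum>k<N. 3 * (cov (e j) (e j) * cov (e k) (e k)))"
      by (intro sum_mono) (use jk in auto)
    also have "\<dots> = 3 * (m N)\<^sup>2"
    proof -
      have "3 * (m N)\<^sup>2 = 3 * (\<Sum>j<N. \<Sum>k<N. cov (e j) (e j) * cov (e k) (e k))"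
        by (simp only: m_def power2_eq_square sum_product)
      also have "\<dots> = (\<Sum>j<N. \<Sum>k<N. 3 * (cov (e j) (e j) * cov (e k) (e k)))"
        by (simp only: sum_distrib_left)
      finally show ?thesis by simp
    qed
    finally show ?thesis .
  qed
  obtain R where R: "0 \<le> R" "measure \<pi> {f. (norm f)\<^sup>2 > R} \<le> 1 / 12"
  proof -
    have "(\<lambda>n. measure \<pi> {f. (norm f)\<^sup>2 > real n}) \<longlonglongrightarrow> measure \<pi> (\<Inter>n. {f. (norm f)\<^sup>2 > real n})"
      by (rule finite_Lim_measure_decseq) (auto simp: decseq_def)
    also have "(\<Inter>n. {f::'h. (norm f)\<^sup>2 > real n}) = {}"
      by (auto) (meson less_asym reals_Archimedean2)
    finally have "eventually (\<lambda>n. measure \<pi> {f. (norm f)\<^sup>2 > real n} < 1 / 12) sequentially"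
      by (intro order_tendstoD) auto
    then obtain n where "measure \<pi> {f. (norm f)\<^sup>2 > real n} < 1 / 12" by (auto simp: eventually_sequentially)
    then show ?thesis by (intro that[of "real n"]) auto
  qed
  let ?A = "{f. (norm f)\<^sup>2 > R}"
  have mb: "m N \<le> 2 * R" for N
  proof (cases "m N = 0")
    case False
    then have m: "0 < m N" using m0[of N] by simp
    \<comment> \<open>With this c and the probability bound 1 / 12 the two error terms are
      \<open>m N / 4\<close> each, so half of \<open>m N\<close> is absorbed on the left.\<close>
    define c where "c = 1 / (6 * m N)"
    have c: "0 < c" using m by (simp add: c_def)
    \<comment> \<open>Off \<open>?A\<close> the sum is at most R; on \<open>?A\<close> Young's
      inequality trades S for its square and a constant.\<close>
    have pw: "S N f \<le> R + (c / 2) * (S N f)\<^sup>2 + (1 / (2 * c)) * indicator ?A f" for f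
    proof (cases "f \<in> ?A")
      case True
      have "0 \<le> (c * S N f - 1)\<^sup>2 / (2 * c)" using c by simp
      also have "\<dots> = (c / 2) * (S N f)\<^sup>2 + 1 / (2 * c) - S N f"
        using c by (simp add: field_simps power2_eq_square)
      finally show ?thesis using True R by simp
    next
      case f: False
      have "S N f \<le> R" using SN[of N f] f by simp
      then show ?thesis using c by (simp add: add_increasing2)
    qed
    have iA: "integrable \<pi> (indicator ?A :: 'h \<Rightarrow> real)"
      by (simp_all add: emeasure_eq_measure)
    have "m N \<le> (LINT f|\<pi>. R + (c / 2) * (S N f)\<^sup>2 + (1 / (2 * c)) * indicator ?A f)"
      unfolding ES[symmetric]
      by (intro integral_mono pw iS Bochner_Integration.integrable_add integrable_mult_right iS2 iA) simp
    also have "\<dots> = R + (c / 2) * (LINT f|\<pi>. (S N f)\<^sup>2) + (1 / (2 * c)) * measure \<pi> ?A"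
      using iS2[of N] iA prob_space by (simp)
    also have "\<dots> \<le> R + (c / 2) * (3 * (m N)\<^sup>2) + (1 / (2 * c)) * (1 / 12)"
      using c R ES2 by (intro add_mono mult_left_mono) auto
    also have "\<dots> = R + m N / 2" by (simp add: c_def power2_eq_square)
    finally show ?thesis by simp
  qed (use R in simp)
  show ?thesis
  proof (rule integrableI_nonneg)
    have "(\<integral>\<^sup>+f. ennreal ((norm f)\<^sup>2) \<partial>\<pi>) = (\<integral>\<^sup>+f. (\<Sum>k. ennreal ((f \<bullet> e k)\<^sup>2)) \<partial>\<pi>)"
      using parseval by (simp add: suminf_ennreal2 sums_iff)
    also have "\<dots> = (\<Sum>k. \<integral>\<^sup>+f. ennreal ((f \<bullet> e k)\<^sup>2) \<partial>\<pi>)"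
      by (rule nn_integral_suminf) simp
    also have "\<dots> = (\<Sum>k. ennreal (cov (e k) (e k)))"
      using integrable_inner_power[of _ 2]
      by (intro suminf_cong) (simp add: nn_integral_eq_integral cov_def power2_eq_square)
    also have "\<dots> \<le> ennreal (2 * R)"
    proof (rule suminf_le_const)
      show "(\<Sum>k<N. ennreal (cov (e k) (e k))) \<le> ennreal (2 * R)" for N
        using mb[of N] by (simp add: cov_nonneg m_def ennreal_leI)
    qed simp
    also have "\<dots> < \<infinity>" by simp
    finally show "(\<integral>\<^sup>+f. ennreal ((norm f)\<^sup>2) \<partial>\<pi>) < \<infinity>" .
  qed auto
qed

end

section \<open>Shifts of Gaussian measures and small balls\<close>

context gaussian_basis
begin

definition covop :: "'h \<Rightarrow> 'h" where
  "covop l = (LINT f|\<pi>. (f \<bullet> l) *\<^sub>R f)"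

lemma integral_scaleR_inner:
  assumes "integrable \<pi> (\<lambda>f. (g f)\<^sup>2)" "g \<in> borel_measurable \<pi>"
  shows "(LINT f|\<pi>. g f *\<^sub>R f) \<bullet> h = (LINT f|\<pi>. g f * (f \<bullet> h))"
  using integral_inner_left[OF integrable_norm_mult_of_square[OF assms integrable_norm_square], of h] by simp

lemma covop_inner: "covop l \<bullet> h = cov l h"
  unfolding covop_def cov_def by (intro integral_scaleR_inner integrable_inner_power) simp

lemma covop_scaleR: "covop (c *\<^sub>R l) = c *\<^sub>R covop l"
  by (rule vector_eq_rdot[THEN iffD1]) (simp add: covop_inner cov_simps)

text \<open>Shifting by \<open>covop l\<close> multiplies the characteristic functional at h by
  \<open>iexp (cov l h)\<close>, exactly as tilting by the exponential of
  \<open>f \<bullet> l\<close> does.\<close>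

lemma law_shift: "distr \<pi> borel (\<lambda>f. f + covop l) = density \<pi> (\<lambda>f. ennreal (exp (f \<bullet> l - cov l l / 2)))"
proof (rule char_functional_unique)
  show "finite_measure (distr \<pi> borel (\<lambda>f. f + covop l))"
    by (intro finite_measure_distr) simp
  have "(\<integral>\<^sup>+f. ennreal (exp (f \<bullet> l - cov l l / 2)) \<partial>\<pi>) = (\<integral>\<^sup>+f. ennreal (exp (- cov l l / 2)) * ennreal (exp (1 * (f \<bullet> l))) \<partial>\<pi>)"
    by (simp add: ennreal_mult[symmetric] exp_add[symmetric])
  also have "\<dots> < \<infinity>"
    by (subst nn_integral_cmult, simp) (simp only: mgf_inner, simp add: ennreal_mult_less_top)
  finally show "finite_measure (density \<pi> (\<lambda>f. ennreal (exp (f \<bullet> l - cov l l / 2))))"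
    by (intro finite_measureI) (simp add: emeasure_density)
  fix h
  have "(CLINT f|distr \<pi> borel (\<lambda>f. f + covop l). iexp (f \<bullet> h)) = (CLINT f|\<pi>. iexp (f \<bullet> h) * iexp (cov l h))"
    by (subst integral_distr) (auto simp: inner_add_left covop_inner distrib_left exp_add)
  also have "\<dots> = iexp (cov l h) * complex_of_real (exp (- cov h h / 2))"
    by (simp add: char_inner)
  also have "\<dots> = (CLINT f|density \<pi> (\<lambda>f. ennreal (exp (f \<bullet> l - cov l l / 2))). iexp (f \<bullet> h))"
    by (subst integral_density) (auto simp: char_tilted)
  finally show "(CLINT f|distr \<pi> borel (\<lambda>f. f + covop l). iexp (f \<bullet> h)) =
    (CLINT f|density \<pi> (\<lambda>f. ennreal (exp (f \<bullet> l - cov l l / 2))). iexp (f \<bullet> h))" .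
qed simp_all

theorem cameron_martin:
  assumes [measurable]: "F \<in> borel_measurable borel"
  shows "(\<integral>\<^sup>+f. F (f + covop l) \<partial>\<pi>) = (\<integral>\<^sup>+f. F f * ennreal (exp (f \<bullet> l - cov l l / 2)) \<partial>\<pi>)"
proof -
  have "(\<integral>\<^sup>+f. F (f + covop l) \<partial>\<pi>) = (\<integral>\<^sup>+f. F f \<partial>distr \<pi> borel (\<lambda>f. f + covop l))"
    by (subst nn_integral_distr) auto
  also have "\<dots> = (\<integral>\<^sup>+f. F f * ennreal (exp (f \<bullet> l - cov l l / 2)) \<partial>\<pi>)"
    unfolding law_shift by (subst nn_integral_density) (auto simp: mult.commute)
  finally show ?thesis .
qed

lemma law_uminus: "distr \<pi> borel uminus = \<pi>"
proof (rule char_functional_unique)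
  show "finite_measure (distr \<pi> borel uminus)"
    by (intro finite_measure_distr) simp
  show "(CLINT f|distr \<pi> borel uminus. iexp (f \<bullet> h)) = (CLINT f|\<pi>. iexp (f \<bullet> h))" for h
    using char_inner[of "- h"] char_inner[of h]
    by (subst integral_distr) (auto simp: cov_minus_left cov_minus_right)
qed (simp_all)

lemma norm_ball_sets [measurable]: "{f::'h. norm (f - a) \<le> r} \<in> sets borel"
  by simp

text \<open>By separability some ball of radius \<open>\<epsilon> / 2\<close> has positive mass. Two
  independent draws from it differ by at most \<open>\<epsilon>\<close>, and their difference over
  sqrt 2 is again a draw from the prior.\<close>

lemma small_ball_pos:
  assumes "0 < \<epsilon>"
  shows "0 < measure \<pi> {f. norm f \<le> \<epsilon>}"
proof -
  obtain D :: "'h set" where D: "countable D" "\<And>X. open X \<Longrightarrow> X \<noteq> {} \<Longrightarrow> \<exists>d\<in>D. d \<in> X"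
    using countable_dense_exists by blast
  define r where "r = \<epsilon> / 2"
  have r: "0 < r" using assms by (simp add: r_def)
  have "\<exists>d\<in>D. 0 < emeasure \<pi> {f. norm (f - d) \<le> r}"
  proof (rule ccontr)
    assume "\<not> (\<exists>d\<in>D. 0 < emeasure \<pi> {f. norm (f - d) \<le> r})"
    then have z: "\<And>d. d \<in> D \<Longrightarrow> {f. norm (f - d) \<le> r} \<in> null_sets \<pi>"
      by auto
    have "(\<Union>d\<in>D. {f. norm (f - d) \<le> r}) \<in> null_sets \<pi>"
      using D(1) z by (intro null_sets_UN')
    moreover have "(\<Union>d\<in>D. {f. norm (f - d) \<le> r}) = UNIV"
    proof (intro equalityI subsetI UNIV_I)
      fix x :: 'h
      obtain d where "d \<in> D" "d \<in> ball x r"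
        using D(2)[of "ball x r"] r by fastforce
      then show "x \<in> (\<Union>d\<in>D. {f. norm (f - d) \<le> r})"
        by (auto simp: dist_norm bexI[of _ d])
    qed
    ultimately show False using emeasure_space_1 by (auto)
  qed
  then obtain d where d: "0 < emeasure \<pi> {f. norm (f - d) \<le> r}" by blast
  let ?B = "{f. norm (f - d) \<le> r}"
  have "0 < emeasure \<pi> ?B * emeasure \<pi> ?B" using d by (simp add: ennreal_zero_less_mult_iff)
  also have "\<dots> = emeasure (\<pi> \<Otimes>\<^sub>M \<pi>) (?B \<times> ?B)"
    by (intro emeasure_pair_measure_Times[symmetric]) auto
  also have "\<dots> = (\<integral>\<^sup>+p. indicator (?B \<times> ?B) p \<partial>(\<pi> \<Otimes>\<^sub>M \<pi>))"
    by simp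
  also have "\<dots> \<le> (\<integral>\<^sup>+p. indicator {f. norm f \<le> \<epsilon>} (snd (rotate p)) \<partial>(\<pi> \<Otimes>\<^sub>M \<pi>))"
  proof (intro nn_integral_mono)
    fix p :: "'h \<times> 'h"
    have "norm (snd (rotate (x, y))) \<le> \<epsilon>" if "norm (x - d) \<le> r" "norm (y - d) \<le> r" for x y
    proof -
      have "norm (x - y) \<le> 2 * r"
        using norm_triangle_ineq4[of "x - d" "y - d"] that by simp
      also have "\<dots> \<le> \<epsilon> * sqrt 2"
        using assms by (simp add: r_def)
      finally have "norm (x - y) / sqrt 2 \<le> \<epsilon>" by (simp add: field_simps)
      moreover have "norm (snd (rotate (x, y))) = norm (x - y) / sqrt 2"
        by (simp only: rotate_def prod.case snd_conv norm_scaleR) (simp add: field_simps)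
      ultimately show ?thesis by simp
    qed
    then show "indicator (?B \<times> ?B) p \<le> (indicator {f. norm f \<le> \<epsilon>} (snd (rotate p)) :: ennreal)"
      by (auto simp: indicator_def)
  qed
  also have "\<dots> = (\<integral>\<^sup>+p. indicator {f. norm f \<le> \<epsilon>} (snd p) \<partial>(\<pi> \<Otimes>\<^sub>M \<pi>))"
    by (rule nn_integral_rotate[of "\<lambda>p. indicator {f. norm f \<le> \<epsilon>} (snd p)"]) measurable
  also have "\<dots> = (\<integral>\<^sup>+x. \<integral>\<^sup>+y. indicator {f. norm f \<le> \<epsilon>} y \<partial>\<pi> \<partial>\<pi>)"
    by (subst nn_integral_fst[symmetric]) (measurable)
  also have "\<dots> = emeasure \<pi> {f. norm f \<le> \<epsilon>}"
    using emeasure_space_1 by simp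
  finally show ?thesis by (simp add: emeasure_eq_measure)
qed

text \<open>By Cameron-Martin the shifted ball has mass \<open>exp (- cov l l / 2)\<close> times the
  integral of \<open>exp (f \<bullet> (- l))\<close> over the centred ball. As exp x is at least 1 +
  x and the linear term integrates to zero by symmetry, this integral is at least the mass of the
  ball.\<close>

lemma shift_ball:
  "exp (- cov l l / 2) * measure \<pi> {f. norm f \<le> \<epsilon>} \<le> measure \<pi> {f. norm (f - covop l) \<le> \<epsilon>}"
proof -
  let ?B = "{f::'h. norm f \<le> \<epsilon>}"
  have i1: "integrable \<pi> (\<lambda>f. indicator ?B f * (f \<bullet> l))"
    by (rule Bochner_Integration.integrable_bound[OF integrable_inner_power[of l 1]]) (auto simp: indicator_def)
  have "(LINT f|\<pi>. indicator ?B f * (f \<bullet> l)) = (LINT f|distr \<pi> borel uminus. indicator ?B f * (f \<bullet> l))"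
    by (simp add: law_uminus)
  also have "\<dots> = (LINT f|\<pi>. - (indicator ?B f * (f \<bullet> l)))"
    by (subst integral_distr) (auto simp: indicator_def)
  finally have z: "(LINT f|\<pi>. indicator ?B f * (f \<bullet> l)) = 0" by simp
  have iB: "integrable \<pi> (indicator ?B :: 'h \<Rightarrow> real)"
    by (simp_all add: emeasure_eq_measure)
  have bd: "\<bar>indicator ?B f * exp (f \<bullet> (- l))\<bar> \<le> exp (\<epsilon> * norm l)" for f
  proof (cases "norm f \<le> \<epsilon>")
    case True
    then have "f \<bullet> (- l) \<le> \<epsilon> * norm l"
      using norm_cauchy_schwarz[of f "- l"] mult_right_mono[OF True norm_ge_zero[of l]] by simp
    then show ?thesis using True by simp
  qed simp
  have i2: "integrable \<pi> (\<lambda>f. indicator ?B f * exp (f \<bullet> (- l)))"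
    by (rule integrable_const_bound[of _ "exp (\<epsilon> * norm l)"]) (use bd in auto)
  have "measure \<pi> ?B = (LINT f|\<pi>. indicator ?B f - indicator ?B f * (f \<bullet> l))"
    using i1 iB z by (simp)
  also have "\<dots> \<le> (LINT f|\<pi>. indicator ?B f * exp (f \<bullet> (- l)))"
  proof (intro integral_mono Bochner_Integration.integrable_diff i1 i2 iB)
    fix f
    show "indicator ?B f - indicator ?B f * (f \<bullet> l) \<le> indicator ?B f * exp (f \<bullet> (- l))"
      using exp_ge_add_one_self[of "- (f \<bullet> l)"] by (auto simp: indicator_def)
  qed
  finally have "ennreal (measure \<pi> ?B) \<le> ennreal (LINT f|\<pi>. indicator ?B f * exp (f \<bullet> (- l)))"
    by simp
  also have "\<dots> = (\<integral>\<^sup>+f. ennreal (indicator ?B f * exp (f \<bullet> (- l))) \<partial>\<pi>)"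
    by (rule nn_integral_eq_integral[symmetric, OF i2]) simp
  also have "\<dots> = (\<integral>\<^sup>+f. indicator ?B f * ennreal (exp (f \<bullet> (- l))) \<partial>\<pi>)"
    by (intro nn_integral_cong) (simp add: indicator_def)
  finally have "ennreal (exp (- cov l l / 2)) * ennreal (measure \<pi> ?B)
      \<le> ennreal (exp (- cov l l / 2)) * (\<integral>\<^sup>+f. indicator ?B f * ennreal (exp (f \<bullet> (- l))) \<partial>\<pi>)"
    by (rule mult_left_mono) simp
  also have "\<dots> = (\<integral>\<^sup>+f. indicator ?B f * ennreal (exp (f \<bullet> (- l) - cov (- l) (- l) / 2)) \<partial>\<pi>)"
    by (subst nn_integral_cmult[symmetric])
      (auto intro: nn_integral_cong simp: indicator_def ennreal_mult[symmetric] exp_add[symmetric] cov_simps)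
  also have "\<dots> = (\<integral>\<^sup>+f. indicator ?B (f + covop (- l)) \<partial>\<pi>)"
    by (rule cameron_martin[symmetric]) simp
  also have "\<dots> = (\<integral>\<^sup>+f. indicator {f. norm (f - covop l) \<le> \<epsilon>} f \<partial>\<pi>)"
    using covop_scaleR[of "-1" l] by (simp add: indicator_def)
  finally show ?thesis by (simp add: emeasure_eq_measure ennreal_mult[symmetric])
qed

text \<open>The ball lies in a slab orthogonal to l, whose mass is at most its width times the
  maximal normal density. The linear dependence on \<open>\<epsilon>\<close> later yields a lower
  bound for \<open>\<epsilon> n\<close>.\<close>

lemma small_ball_upper:
  assumes "0 < cov l l" and True: "0 \<le> \<epsilon>"
  shows "measure \<pi> {f. norm f \<le> \<epsilon>} \<le> 2 * (norm l * \<epsilon>) / sqrt (2 * pi * cov l l)"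
proof -
  let ?v = "cov l l" and ?s = "norm l * \<epsilon>"
  have "emeasure \<pi> {f. norm f \<le> \<epsilon>} \<le> (\<integral>\<^sup>+f. indicator {-?s..?s} (f \<bullet> l) \<partial>\<pi>)"
  proof (subst nn_integral_indicator[symmetric], simp, intro nn_integral_mono)
    fix f :: 'h
    have "\<bar>f \<bullet> l\<bar> \<le> ?s" if "norm f \<le> \<epsilon>"
      using Cauchy_Schwarz_ineq2[of f l] mult_right_mono[OF that norm_ge_zero[of l]] by (simp add: mult.commute)
    then show "indicator {f. norm f \<le> \<epsilon>} f \<le> (indicator {-?s..?s} (f \<bullet> l) :: ennreal)"
      by (auto simp: indicator_def)
  qed
  also have "\<dots> = (\<integral>\<^sup>+x. indicator {-?s..?s} x \<partial>normal_measure 0 ?v)"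
    by (rule nn_integral_inner) simp
  also have "\<dots> = (\<integral>\<^sup>+x. ennreal (normal_density 0 (sqrt ?v) x) * indicator {-?s..?s} x \<partial>lborel)"
    using assms by (simp add: normal_measure_def emeasure_density)
  also have "\<dots> \<le> (\<integral>\<^sup>+x. ennreal (1 / sqrt (2 * pi * ?v)) * indicator {-?s..?s} x \<partial>lborel)"
    using assms by (intro nn_integral_mono mult_right_mono) (auto simp: normal_density_def divide_right_mono)
  also have "\<dots> = ennreal (1 / sqrt (2 * pi * ?v)) * ennreal (2 * ?s)"
    using True by (subst nn_integral_cmult_indicator) (auto simp: mult.commute)
  finally show ?thesis
    using assms by (simp add: emeasure_eq_measure ennreal_mult[symmetric])
qed

text \<open>The difference of g and g' is orthogonal in L2 to every continuous linear functional,
  yet it is an L2 limit of such functionals; hence it vanishes. This makes the definite description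
  in \<open>rkhs_norm\<close> meaningful.\<close>

lemma functional_closure_eq_AE:
  assumes g: "g \<in> functional_closure \<pi>" and g': "g' \<in> functional_closure \<pi>"
    and eq: "(LINT f|\<pi>. g f *\<^sub>R f) = (LINT f|\<pi>. g' f *\<^sub>R f)"
  shows "AE f in \<pi>. g f = g' f"
proof -
  obtain l where gm [measurable]: "g \<in> borel_measurable \<pi>" and gi: "integrable \<pi> (\<lambda>f. (g f)\<^sup>2)"
    and l: "(\<lambda>k. LINT f|\<pi>. (g f - f \<bullet> l k)\<^sup>2) \<longlonglongrightarrow> 0"
    using g functional_closure_def by blast
  obtain l' where gm' [measurable]: "g' \<in> borel_measurable \<pi>" and gi': "integrable \<pi> (\<lambda>f. (g' f)\<^sup>2)"
    and l': "(\<lambda>k. LINT f|\<pi>. (g' f - f \<bullet> l' k)\<^sup>2) \<longlonglongrightarrow> 0"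
    using g' functional_closure_def by blast
  have sq: "integrable \<pi> (\<lambda>f. (a f - b f)\<^sup>2)"
    if [measurable]: "a \<in> borel_measurable \<pi>" "b \<in> borel_measurable \<pi>"
      and "integrable \<pi> (\<lambda>f. (a f)\<^sup>2)" "integrable \<pi> (\<lambda>f. (b f)\<^sup>2)" for a b :: "'h \<Rightarrow> real"
  proof (rule Bochner_Integration.integrable_bound)
    show "integrable \<pi> (\<lambda>f. 2 * (a f)\<^sup>2 + 2 * (b f)\<^sup>2)" using that by auto
    have "(x - y)\<^sup>2 \<le> 2 * x\<^sup>2 + 2 * y\<^sup>2" for x y :: real
      using zero_le_power2[of "x + y"] by (simp add: power2_sum power2_diff)
    then show "AE f in \<pi>. norm ((a f - b f)\<^sup>2) \<le> norm (2 * (a f)\<^sup>2 + 2 * (b f)\<^sup>2)" by simp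
  qed simp
  have ml: "integrable \<pi> (\<lambda>f. a f * (f \<bullet> h))"
    if [measurable]: "a \<in> borel_measurable \<pi>" and "integrable \<pi> (\<lambda>f. (a f)\<^sup>2)" for a :: "'h \<Rightarrow> real" and h
  proof (rule Bochner_Integration.integrable_bound)
    show "integrable \<pi> (\<lambda>f. (a f)\<^sup>2 + (f \<bullet> h)\<^sup>2)" using that integrable_inner_power by auto
    have "\<bar>x * y\<bar> \<le> x\<^sup>2 + y\<^sup>2" for x y :: real
    proof -
      have "0 \<le> (\<bar>x\<bar> - \<bar>y\<bar>)\<^sup>2 + \<bar>x * y\<bar>" by simp
      then show ?thesis by (simp add: power2_diff abs_mult)
    qed
    then show "AE f in \<pi>. norm (a f * (f \<bullet> h)) \<le> norm ((a f)\<^sup>2 + (f \<bullet> h)\<^sup>2)" by simp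
  qed simp
  let ?u = "\<lambda>f. g f - g' f"
  let ?w = "\<lambda>k f. f \<bullet> (l k - l' k)"
  have iu: "integrable \<pi> (\<lambda>f. (?u f)\<^sup>2)" by (rule sq[OF gm gm' gi gi'])
  have orth: "(LINT f|\<pi>. ?u f * (f \<bullet> h)) = 0" for h
  proof -
    have "(LINT f|\<pi>. g f * (f \<bullet> h)) = (LINT f|\<pi>. g' f * (f \<bullet> h))"
      using eq integral_scaleR_inner[OF gi gm, of h] integral_scaleR_inner[OF gi' gm', of h] by simp
    then show ?thesis
      using ml[OF gm gi, of h] ml[OF gm' gi', of h] by (simp add: left_diff_distrib)
  qed
  have bound: "(LINT f|\<pi>. (?u f)\<^sup>2) \<le> 2 * (LINT f|\<pi>. (g f - f \<bullet> l k)\<^sup>2) + 2 * (LINT f|\<pi>. (g' f - f \<bullet> l' k)\<^sup>2)" for k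
  proof -
    have i1: "integrable \<pi> (\<lambda>f. (g f - f \<bullet> l k)\<^sup>2)" "integrable \<pi> (\<lambda>f. (g' f - f \<bullet> l' k)\<^sup>2)"
      by (intro sq gi gi' integrable_inner_power ; simp)+
    have i2: "integrable \<pi> (\<lambda>f. (?u f - ?w k f)\<^sup>2)"
      by (intro sq[of ?u] iu integrable_inner_power) simp_all
    \<comment> \<open>Subtracting twice the product with \<open>?w k\<close> costs nothing by
      orthogonality and completes the square up to a nonnegative term.\<close>
    have "(LINT f|\<pi>. (?u f)\<^sup>2) = (LINT f|\<pi>. (?u f)\<^sup>2 - 2 * (?u f * ?w k f))"
      using iu ml[OF _ iu, of "l k - l' k"] orth by simp
    also have "\<dots> \<le> (LINT f|\<pi>. (?u f - ?w k f)\<^sup>2)"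
    proof (intro integral_mono i2 Bochner_Integration.integrable_diff iu integrable_mult_right)
      show "integrable \<pi> (\<lambda>f. ?u f * ?w k f)" using ml[OF _ iu, of "l k - l' k"] by simp
      show "(?u f)\<^sup>2 - 2 * (?u f * ?w k f) \<le> (?u f - ?w k f)\<^sup>2" for f
        using zero_le_power2[of "?w k f"] by (simp only: power2_diff[of "?u f" "?w k f"])
    qed
    also have "\<dots> \<le> (LINT f|\<pi>. 2 * (g f - f \<bullet> l k)\<^sup>2 + 2 * (g' f - f \<bullet> l' k)\<^sup>2)"
    proof (intro integral_mono i2)
      fix f
      have "(x - y)\<^sup>2 \<le> 2 * x\<^sup>2 + 2 * y\<^sup>2" for x y :: real
        using zero_le_power2[of "x + y"] by (simp add: power2_sum power2_diff)
      from this[of "g f - f \<bullet> l k" "g' f - f \<bullet> l' k"]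
      show "(?u f - ?w k f)\<^sup>2 \<le> 2 * (g f - f \<bullet> l k)\<^sup>2 + 2 * (g' f - f \<bullet> l' k)\<^sup>2"
        by (simp add: algebra_simps)
    qed (use i1 in auto)
    also have "\<dots> = 2 * (LINT f|\<pi>. (g f - f \<bullet> l k)\<^sup>2) + 2 * (LINT f|\<pi>. (g' f - f \<bullet> l' k)\<^sup>2)"
      using i1 by simp
    finally show ?thesis .
  qed
  have "(\<lambda>k. 2 * (LINT f|\<pi>. (g f - f \<bullet> l k)\<^sup>2) + 2 * (LINT f|\<pi>. (g' f - f \<bullet> l' k)\<^sup>2)) \<longlonglongrightarrow> 2 * 0 + 2 * 0"
    by (intro tendsto_intros l l')
  then have "(LINT f|\<pi>. (?u f)\<^sup>2) \<le> 0"
    using bound by (intro LIMSEQ_le_const[where X="\<lambda>k. 2 * (LINT f|\<pi>. (g f - f \<bullet> l k)\<^sup>2) + 2 * (LINT f|\<pi>. (g' f - f \<bullet> l' k)\<^sup>2)"]) auto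
  then have "(LINT f|\<pi>. (?u f)\<^sup>2) = 0"
    by (intro antisym) simp_all
  then have "AE f in \<pi>. (?u f)\<^sup>2 = 0"
    by (subst (asm) integral_nonneg_eq_0_iff_AE[OF iu]) auto
  then show ?thesis by simp
qed

lemma rkhs_norm_eq:
  assumes g: "g \<in> functional_closure \<pi>"
  shows "rkhs_norm \<pi> (LINT f|\<pi>. g f *\<^sub>R f) = sqrt (LINT f|\<pi>. (g f)\<^sup>2)"
  unfolding rkhs_norm_def
proof (rule the_equality)
  show "\<exists>g'\<in>functional_closure \<pi>. (LINT f|\<pi>. g f *\<^sub>R f) = (LINT f|\<pi>. g' f *\<^sub>R f)
      \<and> sqrt (LINT f|\<pi>. (g f)\<^sup>2) = sqrt (LINT f|\<pi>. (g' f)\<^sup>2)"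
    using g by blast
  fix r
  assume "\<exists>g'\<in>functional_closure \<pi>. (LINT f|\<pi>. g f *\<^sub>R f) = (LINT f|\<pi>. g' f *\<^sub>R f) \<and> r = sqrt (LINT f|\<pi>. (g' f)\<^sup>2)"
  then obtain g' where g': "g' \<in> functional_closure \<pi>" "(LINT f|\<pi>. g f *\<^sub>R f) = (LINT f|\<pi>. g' f *\<^sub>R f)"
    and r: "r = sqrt (LINT f|\<pi>. (g' f)\<^sup>2)" by blast
  have "AE f in \<pi>. g f = g' f" by (rule functional_closure_eq_AE[OF g g'])
  moreover have "g \<in> borel_measurable \<pi>" "g' \<in> borel_measurable \<pi>"
    using g g' by (auto simp: functional_closure_def)
  ultimately show "r = sqrt (LINT f|\<pi>. (g f)\<^sup>2)"
    unfolding r by (intro arg_cong[where f=sqrt] integral_cong_AE) auto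
qed

text \<open>Shifts are taken along \<open>covop l\<close> only: there the Cameron-Martin density is the exponential of a
  continuous linear functional, and no measurable linear functional has to be handled.\<close>

lemma rkhs_approx:
  assumes h: "h \<in> rkhs \<pi>" and \<delta>: "0 < \<delta>"
  obtains l where "norm (covop l - h) \<le> \<delta>" "cov l l \<le> (rkhs_norm \<pi> h)\<^sup>2 + \<delta>"
proof -
  obtain g where g: "g \<in> functional_closure \<pi>" and hg: "h = (LINT f|\<pi>. g f *\<^sub>R f)"
    using h rkhs_def by blast
  obtain l where gm [measurable]: "g \<in> borel_measurable \<pi>" and gi: "integrable \<pi> (\<lambda>f. (g f)\<^sup>2)"
    and l: "(\<lambda>k. LINT f|\<pi>. (g f - f \<bullet> l k)\<^sup>2) \<longlonglongrightarrow> 0"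
    using g functional_closure_def by blast
  define d where "d = (\<lambda>k. LINT f|\<pi>. (g f - f \<bullet> l k)\<^sup>2)"
  define r where "r = (LINT f|\<pi>. (g f)\<^sup>2)"
  define T where "T = (LINT f|\<pi>. (norm f)\<^sup>2)"
  have r0: "0 \<le> r" and T0: "0 \<le> T" by (simp_all add: r_def T_def)
  have rn: "(rkhs_norm \<pi> h)\<^sup>2 = r" unfolding hg rkhs_norm_eq[OF g] by (simp add: r_def)
  have id: "integrable \<pi> (\<lambda>f. (g f - f \<bullet> l k)\<^sup>2)" for k
  proof (rule Bochner_Integration.integrable_bound)
    show "integrable \<pi> (\<lambda>f. 2 * (g f)\<^sup>2 + 2 * (f \<bullet> l k)\<^sup>2)" using gi integrable_inner_power by auto
    have "(x - y)\<^sup>2 \<le> 2 * x\<^sup>2 + 2 * y\<^sup>2" for x y :: real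
      using zero_le_power2[of "x + y"] by (simp add: power2_sum power2_diff)
    then show "AE f in \<pi>. norm ((g f - f \<bullet> l k)\<^sup>2) \<le> norm (2 * (g f)\<^sup>2 + 2 * (f \<bullet> l k)\<^sup>2)" by simp
  qed simp
  \<comment> \<open>Young's inequality with a free weight c replaces Cauchy-Schwarz: for large c the
    second term is small, and then the first vanishes as k grows.\<close>
  have n: "norm (covop (l k) - h) \<le> c * d k / 2 + T / (2 * c)" if c: "0 < c" for c k
  proof -
    have i1: "integrable \<pi> (\<lambda>f. (f \<bullet> l k) *\<^sub>R f)" "integrable \<pi> (\<lambda>f. g f *\<^sub>R f)"
      by (intro integrable_norm_mult_of_square integrable_norm_square gi integrable_inner_power; simp)+
    have "covop (l k) - h = (LINT f|\<pi>. (f \<bullet> l k - g f) *\<^sub>R f)"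
      using i1 by (simp add: covop_def hg scaleR_diff_left)
    also have "norm \<dots> \<le> (LINT f|\<pi>. norm ((f \<bullet> l k - g f) *\<^sub>R f))"
      by (rule integral_norm_bound)
    also have "\<dots> \<le> (LINT f|\<pi>. (c / 2) * (g f - f \<bullet> l k)\<^sup>2 + (1 / (2 * c)) * (norm f)\<^sup>2)"
    proof (intro integral_mono)
      show "integrable \<pi> (\<lambda>f. norm ((f \<bullet> l k - g f) *\<^sub>R f))"
        using integrable_norm[OF Bochner_Integration.integrable_diff[OF i1]] by (simp only: scaleR_diff_left)
      show "integrable \<pi> (\<lambda>f. (c / 2) * (g f - f \<bullet> l k)\<^sup>2 + (1 / (2 * c)) * (norm f)\<^sup>2)"
        by (intro Bochner_Integration.integrable_add integrable_mult_right id integrable_norm_square)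
      fix f
      let ?x = "\<bar>f \<bullet> l k - g f\<bar>" and ?y = "norm f"
      have "0 \<le> (c * ?x - ?y)\<^sup>2 / (2 * c)" using c by simp
      also have "\<dots> = (c / 2) * ?x\<^sup>2 + (1 / (2 * c)) * ?y\<^sup>2 - ?x * ?y"
        using c by (simp add: field_simps power2_eq_square)
      finally show "norm ((f \<bullet> l k - g f) *\<^sub>R f) \<le> (c / 2) * (g f - f \<bullet> l k)\<^sup>2 + (1 / (2 * c)) * (norm f)\<^sup>2"
        by (simp add: power2_commute[of "g f"])
    qed
    also have "\<dots> = c * d k / 2 + T / (2 * c)"
      using id integrable_norm_square by (simp add: d_def T_def)
    finally show ?thesis .
  qed
  have q: "cov (l k) (l k) \<le> (1 + c) * r + (1 + 1 / c) * d k" if c: "0 < c" for c k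
  proof -
    have "cov (l k) (l k) \<le> (LINT f|\<pi>. (1 + c) * (g f)\<^sup>2 + (1 + 1 / c) * (g f - f \<bullet> l k)\<^sup>2)"
      unfolding cov_def
    proof (intro integral_mono integrable_inner_mult)
      show "integrable \<pi> (\<lambda>f. (1 + c) * (g f)\<^sup>2 + (1 + 1 / c) * (g f - f \<bullet> l k)\<^sup>2)"
        by (intro Bochner_Integration.integrable_add integrable_mult_right id gi)
      fix f
      let ?x = "g f" and ?y = "g f - f \<bullet> l k"
      have "0 \<le> (c * ?x + ?y)\<^sup>2 / c" using c by simp
      also have "\<dots> = (1 + c) * ?x\<^sup>2 + (1 + 1 / c) * ?y\<^sup>2 - (?x - ?y)\<^sup>2"
        using c by (simp add: field_simps power2_eq_square)
      finally show "(f \<bullet> l k) * (f \<bullet> l k) \<le> (1 + c) * (g f)\<^sup>2 + (1 + 1 / c) * (g f - f \<bullet> l k)\<^sup>2"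
        by (simp add: power2_eq_square)
    qed
    also have "\<dots> = (1 + c) * r + (1 + 1 / c) * d k"
      using id gi by (simp add: d_def r_def)
    finally show ?thesis .
  qed
  \<comment> \<open>These values make \<open>T / (2 * c)\<close> and \<open>b * r\<close> at most
    \<open>\<delta> / 2\<close>; the terms with \<open>d k\<close> use up the other halves.\<close>
  define c where "c = (T + 1) / \<delta>"
  define b where "b = \<delta> / (2 * (r + 1))"
  have c: "0 < c" and b: "0 < b" using \<delta> r0 T0 by (auto simp: c_def b_def)
  have "(\<lambda>k. c * d k + (1 + 1 / b) * d k) \<longlonglongrightarrow> c * 0 + (1 + 1 / b) * 0"
    unfolding d_def by (intro tendsto_intros l)
  then have "eventually (\<lambda>k. c * d k + (1 + 1 / b) * d k < \<delta> / 2) sequentially"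
    using \<delta> by (intro order_tendstoD) auto
  then obtain k where k: "c * d k + (1 + 1 / b) * d k < \<delta> / 2" by (auto simp: eventually_sequentially)
  have d0: "0 \<le> d k" by (simp add: d_def)
  have k1: "c * d k < \<delta> / 2" "(1 + 1 / b) * d k < \<delta> / 2"
  proof -
    have "0 \<le> c * d k" "0 \<le> (1 + 1 / b) * d k" using c b d0 by simp_all
    then show "c * d k < \<delta> / 2" "(1 + 1 / b) * d k < \<delta> / 2" using k by linarith+
  qed
  have "T / (2 * c) \<le> \<delta> / 2" using \<delta> T0 by (simp add: c_def field_simps)
  with n[OF c, of k] k1(1) \<delta> have "norm (covop (l k) - h) \<le> \<delta>" by simp
  moreover have "b * r \<le> \<delta> / 2"
  proof -
    have "\<delta> * r \<le> \<delta> * (r + 1)" using \<delta> by simp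
    then show ?thesis using r0 by (simp add: b_def field_simps)
  qed
  with q[OF b, of k] k1(2) have "cov (l k) (l k) \<le> (rkhs_norm \<pi> h)\<^sup>2 + \<delta>"
    unfolding rn distrib_right[of 1 b] by linarith
  ultimately show ?thesis by (rule)
qed

text \<open>The slack \<open>\<delta>\<close> pays for an infimum that may not be attained and for
  replacing an element of the RKHS by one of the form \<open>covop l\<close>.\<close>

lemma decentering_approx:
  assumes "decentering \<pi> \<gamma> \<epsilon> \<le> ereal c" "0 < \<delta>"
  obtains l where "norm (covop l - \<gamma>) \<le> \<epsilon> + \<delta>" "cov l l \<le> c + \<delta>"
proof -
  have "decentering \<pi> \<gamma> \<epsilon> < ereal (c + \<delta> / 2)"
    using assms by (simp add: order_le_less_trans)
  then obtain h where h: "h \<in> rkhs \<pi>" "norm (h - \<gamma>) \<le> \<epsilon>" "(rkhs_norm \<pi> h)\<^sup>2 < c + \<delta> / 2"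
    unfolding decentering_def by (auto simp: INF_less_iff)
  obtain l where l: "norm (covop l - h) \<le> \<delta> / 2" "cov l l \<le> (rkhs_norm \<pi> h)\<^sup>2 + \<delta> / 2"
    using rkhs_approx[OF h(1), of "\<delta> / 2"] assms(2) by auto
  have "norm (covop l - \<gamma>) \<le> \<epsilon> + \<delta>"
    using norm_triangle_ineq[of "covop l - h" "h - \<gamma>"] l h assms(2) by simp
  moreover have "cov l l \<le> c + \<delta>" using l h by simp
  ultimately show ?thesis by (rule)
qed

lemma concentration_approx:
  assumes "concentration \<pi> f0 \<epsilon> \<le> ereal c" "0 < \<epsilon>" "0 < \<delta>"
  obtains l where "norm (covop l - f0) \<le> \<epsilon> + \<delta>" "cov l l \<le> c + ln (measure \<pi> {f. norm f \<le> \<epsilon>}) + \<delta>"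
proof -
  have "decentering \<pi> f0 \<epsilon> \<le> ereal (c + ln (measure \<pi> {f. norm f \<le> \<epsilon>}))"
    using assms(1) unfolding concentration_def by (cases "decentering \<pi> f0 \<epsilon>") auto
  from decentering_approx[OF this assms(3)] show ?thesis using that by metis
qed

text \<open>Both parts come from one element \<open>covop l\<close>, which is within
  \<open>2 * \<epsilon>\<close> of f0. Nonnegativity of \<open>cov l l\<close> leaves the bound for
  the centred ball; \<open>shift_ball\<close> around \<open>covop l\<close> gives the other, with
  radius \<open>3 * \<epsilon>\<close>. The 1 in the exponent absorbs the slack.\<close>

lemma concentration_ball:
  assumes "concentration \<pi> f0 \<epsilon> \<le> ereal c" "0 < \<epsilon>"
  shows "exp (- c - 1) \<le> measure \<pi> {f. norm f \<le> \<epsilon>}"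
    and "exp (- c - 1) \<le> measure \<pi> {f. norm (f - f0) \<le> 3 * \<epsilon>}"
proof -
  define p where "p = measure \<pi> {f. norm f \<le> \<epsilon>}"
  have p: "0 < p" using small_ball_pos[OF assms(2)] by (simp add: p_def)
  obtain l where l: "norm (covop l - f0) \<le> \<epsilon> + min 1 \<epsilon>" "cov l l \<le> c + ln p + min 1 \<epsilon>"
    using concentration_approx[OF assms, of "min 1 \<epsilon>"] assms(2) by (auto simp: p_def)
  have "- c - 1 \<le> ln p" using l(2) cov_nonneg[of l] by (simp)
  then show 1: "exp (- c - 1) \<le> measure \<pi> {f. norm f \<le> \<epsilon>}"
    unfolding p_def[symmetric] using p by (metis exp_le_cancel_iff exp_ln)
  have "exp (- c - 1) \<le> exp (- cov l l / 2 + ln p)"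
    using l(2) cov_nonneg[of l] by (simp)
  also have "\<dots> = exp (- cov l l / 2) * measure \<pi> {f. norm f \<le> \<epsilon>}"
    unfolding exp_add p_def[symmetric] using p by simp
  also have "\<dots> \<le> measure \<pi> {f. norm (f - covop l) \<le> \<epsilon>}" by (rule shift_ball)
  also have "\<dots> \<le> measure \<pi> {f. norm (f - f0) \<le> 3 * \<epsilon>}"
  proof (intro finite_measure_mono subsetI)
    fix f assume "f \<in> {f. norm (f - covop l) \<le> \<epsilon>}"
    then show "f \<in> {f. norm (f - f0) \<le> 3 * \<epsilon>}"
      using norm_triangle_ineq[of "f - covop l" "covop l - f0"] l(1) by (simp)
  qed simp
  finally show "exp (- c - 1) \<le> measure \<pi> {f. norm (f - f0) \<le> 3 * \<epsilon>}" .
qed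

end

section \<open>White noise\<close>

definition white_seq :: "(nat \<Rightarrow> real) measure" where
  "white_seq = (\<Pi>\<^sub>M k\<in>UNIV. normal_measure 0 1)"

lemma noise_eq: "noise = white_seq \<Otimes>\<^sub>M white_seq"
  by (simp add: noise_def white_seq_def)

interpretation white: prob_space white_seq
  unfolding white_seq_def by (intro prob_space_PiM prob_space_normal_measure) simp

lemma space_white_seq [simp]: "space white_seq = UNIV"
  by (auto simp: white_seq_def space_PiM)

lemma sets_white_seq [measurable_cong]: "sets white_seq = sets (\<Pi>\<^sub>M k\<in>UNIV. borel)"
  unfolding white_seq_def by (intro sets_PiM_cong) auto

lemma white_component: "z \<in> measurable M white_seq \<Longrightarrow> (\<lambda>x. z x k) \<in> borel_measurable M"
proof (rule measurable_compose[of z M "\<Pi>\<^sub>M k\<in>UNIV. borel"])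
  assume "z \<in> measurable M white_seq"
  then show "z \<in> measurable M (\<Pi>\<^sub>M k\<in>UNIV. borel)"
    by (simp only: measurable_cong_sets[OF refl sets_white_seq])
  show "(\<lambda>a. a k) \<in> borel_measurable (\<Pi>\<^sub>M k\<in>UNIV. borel)"
    by simp
qed

text \<open>Splitting off the first coordinate allows induction over the number of
  coordinates.\<close>

lemma nn_integral_white_seq_iter:
  assumes [measurable]: "F \<in> borel_measurable white_seq"
  shows "(\<integral>\<^sup>+z. F z \<partial>white_seq) = (\<integral>\<^sup>+s. \<integral>\<^sup>+\<omega>. F (case_nat s \<omega>) \<partial>white_seq \<partial>normal_measure 0 1)"
proof -
  interpret N: prob_space "normal_measure 0 1" by (simp add: prob_space_normal_measure)
  interpret sequence_space "normal_measure 0 1" by unfold_locales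
  have m: "(\<lambda>(s, \<omega>). case_nat s \<omega>) \<in> measurable (normal_measure 0 1 \<Otimes>\<^sub>M white_seq) white_seq"
    by simp
  have "(\<integral>\<^sup>+z. F z \<partial>white_seq) = (\<integral>\<^sup>+z. F z \<partial>distr (normal_measure 0 1 \<Otimes>\<^sub>M white_seq) white_seq (\<lambda>(s, \<omega>). case_nat s \<omega>))"
    using PiM_iter by (simp add: white_seq_def)
  also have "\<dots> = (\<integral>\<^sup>+p. F (case_nat (fst p) (snd p)) \<partial>(normal_measure 0 1 \<Otimes>\<^sub>M white_seq))"
    by (subst nn_integral_distr[OF m]) (auto simp: split_beta')
  also have "\<dots> = (\<integral>\<^sup>+s. \<integral>\<^sup>+\<omega>. F (case_nat s \<omega>) \<partial>white_seq \<partial>normal_measure 0 1)"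
    by (subst white.nn_integral_fst[symmetric]) (auto)
  finally show ?thesis .
qed

lemma char_white_seq_iter:
  "(CLINT z|white_seq. iexp (\<Sum>k<Suc N. z k * c k))
     = char (normal_measure 0 1) (c 0) * (CLINT z|white_seq. iexp (\<Sum>k<N. z k * c (Suc k)))"
proof -
  interpret N: prob_space "normal_measure 0 1" by (simp add: prob_space_normal_measure)
  interpret sequence_space "normal_measure 0 1" by unfold_locales
  have m: "(\<lambda>(s, \<omega>). case_nat s \<omega>) \<in> measurable (normal_measure 0 1 \<Otimes>\<^sub>M white_seq) white_seq"
    by simp
  have "(CLINT z|white_seq. iexp (\<Sum>k<Suc N. z k * c k))
      = (CLINT z|distr (normal_measure 0 1 \<Otimes>\<^sub>M white_seq) white_seq (\<lambda>(s, \<omega>). case_nat s \<omega>). iexp (\<Sum>k<Suc N. z k * c k))"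
    using PiM_iter by (simp add: white_seq_def)
  also have "\<dots> = (CLINT p|normal_measure 0 1 \<Otimes>\<^sub>M white_seq. iexp (c 0 * fst p + (\<Sum>k<N. snd p k * c (Suc k))))"
    by (subst integral_distr[OF m]) (auto simp: split_beta' sum.lessThan_Suc_shift mult.commute simp del: sum.lessThan_Suc)
  also have "\<dots> = (CLINT s|normal_measure 0 1. iexp (c 0 * s)) * (CLINT z|white_seq. iexp (\<Sum>k<N. z k * c (Suc k)))"
  proof (rule integral_pair_iexp)
    show "(*) (c 0) \<in> borel_measurable (normal_measure 0 1)" by measurable
  qed (simp_all add: N.prob_space_axioms white.prob_space_axioms)
  finally show ?thesis by (simp add: char_def)
qed

lemma char_white_sum:
  "(CLINT z|white_seq. iexp (\<Sum>k<N. z k * c k)) = complex_of_real (exp (- (\<Sum>k<N. (c k)\<^sup>2) / 2))"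
proof (induction N arbitrary: c)
  case 0
  then show ?case using white.prob_space by simp
next
  case (Suc N)
  show ?case
    unfolding char_white_seq_iter Suc
    by (simp add: char_normal_measure sum.lessThan_Suc_shift exp_add[symmetric] del: sum.lessThan_Suc flip: of_real_mult)
qed

text \<open>Kolmogorov's maximal inequality. The free starting value s makes the induction work:
  given the first coordinate a, the claim for N applies with start \<open>s + a * c 0\<close> and
  shifted coefficients, and the mean of the square of that start is
  \<open>s\<^sup>2 + (c 0)\<^sup>2\<close>.\<close>

lemma maximal_inequality_white:
  assumes "0 < x"
  shows "emeasure white_seq {z. \<exists>n\<le>N. x \<le> \<bar>s + (\<Sum>k<n. z k * c k)\<bar>} \<le> ennreal ((s\<^sup>2 + (\<Sum>k<N. (c k)\<^sup>2)) / x\<^sup>2)"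
proof (induction N arbitrary: s c)
  case 0
  have "1 \<le> s\<^sup>2 / x\<^sup>2" if "x \<le> \<bar>s\<bar>"
    using assms power_mono[OF that, of 2] by simp
  then show ?case
    using white.emeasure_space_1 by (auto)
next
  case (Suc N)
  let ?R = "ennreal ((s\<^sup>2 + (\<Sum>k<Suc N. (c k)\<^sup>2)) / x\<^sup>2)"
  show ?case
  \<comment> \<open>A start at or beyond x makes the right side at least 1; otherwise the level x
    can be reached only from the first step on.\<close>
  proof (cases "x \<le> \<bar>s\<bar>")
    case True
    have "1 \<le> s\<^sup>2 / x\<^sup>2" using assms power_mono[OF True, of 2] by simp
    also have "\<dots> \<le> (s\<^sup>2 + (\<Sum>k<Suc N. (c k)\<^sup>2)) / x\<^sup>2"
      by (intro divide_right_mono) (simp_all add: sum_nonneg)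
    finally have "1 \<le> ?R" by simp
    then show ?thesis using white.emeasure_le_1 order_trans by blast
  next
    case False
    let ?A = "\<lambda>s c N. {z. \<exists>n\<le>N. x \<le> \<bar>s + (\<Sum>k<n. z k * c k)\<bar>}"
    have A: "?A s c N \<in> sets white_seq" for s c N
    proof -
      have "{z\<in>space white_seq. \<exists>n\<in>{..N}. x \<le> \<bar>s + (\<Sum>k<n. z k * c k)\<bar>} \<in> sets white_seq"
        by measurable
      then show ?thesis by (simp add: Bex_def)
    qed
    have eq: "case_nat a \<omega> \<in> ?A s c (Suc N) \<longleftrightarrow> \<omega> \<in> ?A (s + a * c 0) (\<lambda>k. c (Suc k)) N" for a \<omega>
    proof
      assume "case_nat a \<omega> \<in> ?A s c (Suc N)"
      then obtain n where n: "n \<le> Suc N" "x \<le> \<bar>s + (\<Sum>k<n. case_nat a \<omega> k * c k)\<bar>" by blast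
      with False obtain m where "n = Suc m" by (cases n) auto
      with n show "\<omega> \<in> ?A (s + a * c 0) (\<lambda>k. c (Suc k)) N"
        by (auto simp: sum.lessThan_Suc_shift simp del: sum.lessThan_Suc)
    next
      assume "\<omega> \<in> ?A (s + a * c 0) (\<lambda>k. c (Suc k)) N"
      then show "case_nat a \<omega> \<in> ?A s c (Suc N)"
        by (auto simp: sum.lessThan_Suc_shift add.assoc simp del: sum.lessThan_Suc exI[of _ "Suc m"])
    qed
    interpret N: prob_space "normal_measure 0 1" by (simp add: prob_space_normal_measure)
    let ?S = "\<Sum>k<N. (c (Suc k))\<^sup>2"
    have ex: "((s + a * c 0)\<^sup>2 + ?S) / x\<^sup>2 = (s\<^sup>2 + ?S) / x\<^sup>2 + (2 * s * c 0 / x\<^sup>2) * a + ((c 0)\<^sup>2 / x\<^sup>2) * a\<^sup>2" for a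
      using assms by (simp add: power2_eq_square field_simps)
    have i: "integrable (normal_measure 0 1) (\<lambda>a. (s\<^sup>2 + ?S) / x\<^sup>2 + (2 * s * c 0 / x\<^sup>2) * a + ((c 0)\<^sup>2 / x\<^sup>2) * a\<^sup>2)"
      using normal_measure_moments(1)[of 1 1] normal_measure_moments(1) by simp
    have "emeasure white_seq (?A s c (Suc N)) = (\<integral>\<^sup>+z. indicator (?A s c (Suc N)) z \<partial>white_seq)"
      using A by simp
    also have "\<dots> = (\<integral>\<^sup>+a. \<integral>\<^sup>+\<omega>. indicator (?A s c (Suc N)) (case_nat a \<omega>) \<partial>white_seq \<partial>normal_measure 0 1)"
      by (intro nn_integral_white_seq_iter) simp
    also have "\<dots> = (\<integral>\<^sup>+a. emeasure white_seq (?A (s + a * c 0) (\<lambda>k. c (Suc k)) N) \<partial>normal_measure 0 1)"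
    proof (intro nn_integral_cong)
      fix a
      have "indicator (?A s c (Suc N)) (case_nat a \<omega>) = (indicator (?A (s + a * c 0) (\<lambda>k. c (Suc k)) N) \<omega> :: ennreal)" for \<omega>
        by (simp only: indicator_def eq)
      then show "(\<integral>\<^sup>+\<omega>. indicator (?A s c (Suc N)) (case_nat a \<omega>) \<partial>white_seq)
          = emeasure white_seq (?A (s + a * c 0) (\<lambda>k. c (Suc k)) N)"
        by (simp only: nn_integral_indicator[OF A])
    qed
    also have "\<dots> \<le> (\<integral>\<^sup>+a. ennreal (((s + a * c 0)\<^sup>2 + (\<Sum>k<N. (c (Suc k))\<^sup>2)) / x\<^sup>2) \<partial>normal_measure 0 1)"
      by (intro nn_integral_mono Suc)
    also have "\<dots> = ennreal (LINT a|normal_measure 0 1. ((s + a * c 0)\<^sup>2 + (\<Sum>k<N. (c (Suc k))\<^sup>2)) / x\<^sup>2)"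
      unfolding ex using i
      by (rule nn_integral_eq_integral) (simp only: ex[symmetric], simp add: sum_nonneg)
    also have "(LINT a|normal_measure 0 1. ((s + a * c 0)\<^sup>2 + (\<Sum>k<N. (c (Suc k))\<^sup>2)) / x\<^sup>2)
        = (s\<^sup>2 + ?S) / x\<^sup>2 + (c 0)\<^sup>2 / x\<^sup>2"
      unfolding ex using normal_measure_moments[of 1] normal_measure_moments(1)[of 1 1] N.prob_space by simp
    also have "\<dots> = (s\<^sup>2 + (\<Sum>k<Suc N. (c k)\<^sup>2)) / x\<^sup>2"
      by (simp add: sum.lessThan_Suc_shift add_divide_distrib del: sum.lessThan_Suc)
    finally show ?thesis .
  qed
qed

text \<open>The maximal inequality bounds all increments after m at once by the tail of the square
  sum, so almost surely the partial sums are Cauchy.\<close>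

lemma AE_summable_white:
  assumes c: "summable (\<lambda>k. (c k)\<^sup>2)"
  shows "AE z in white_seq. summable (\<lambda>k. z k * c k)"
proof -
  define S where "S = (\<lambda>z n. \<Sum>k<n. z k * c k :: real)"
  define tail where "tail = (\<lambda>m. \<Sum>k. (c (k + m))\<^sup>2)"
  let ?A = "\<lambda>x m. {z. \<exists>n\<ge>m. x \<le> \<bar>S z n - S z m\<bar>}"
  have bound: "emeasure white_seq (?A x m) \<le> ennreal (tail m / x\<^sup>2)" if x: "0 < x" for x m
  proof -
    let ?B = "\<lambda>N. {z. \<exists>n\<le>N. m \<le> n \<and> x \<le> \<bar>S z n - S z m\<bar>}"
    \<comment> \<open>Zero coefficients below m turn increments after m into partial sums starting
      at 0.\<close>
    let ?c = "\<lambda>k. if m \<le> k then c k else 0"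
    have B: "?B N \<in> sets white_seq" for N
    proof -
      have "{z\<in>space white_seq. \<exists>n\<in>{m..N}. x \<le> \<bar>S z n - S z m\<bar>} \<in> sets white_seq"
        unfolding S_def by measurable
      then show ?thesis by (auto simp: Bex_def conj_ac)
    qed
    have SS: "S z n - S z m = (\<Sum>k<n. z k * ?c k)" if "m \<le> n" for z n
    proof -
      have "S z n = S z m + (\<Sum>k\<in>{m..<n}. z k * c k)"
        unfolding S_def using that by (simp add: lessThan_atLeast0 sum.atLeastLessThan_concat)
      moreover have "(\<Sum>k<n. z k * ?c k) = (\<Sum>k\<in>{m..<n}. z k * c k)"
        by (intro sum.mono_neutral_cong_right) auto
      ultimately show ?thesis by simp
    qed
    have "emeasure white_seq (?B N) \<le> ennreal (tail m / x\<^sup>2)" for N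
    proof -
      have "emeasure white_seq (?B N) \<le> emeasure white_seq {z. \<exists>n\<le>N. x \<le> \<bar>0 + (\<Sum>k<n. z k * ?c k)\<bar>}"
      proof (rule emeasure_mono)
        show "?B N \<subseteq> {z. \<exists>n\<le>N. x \<le> \<bar>0 + (\<Sum>k<n. z k * ?c k)\<bar>}" using SS by auto
        have "{z\<in>space white_seq. \<exists>n\<in>{..N}. x \<le> \<bar>0 + (\<Sum>k<n. z k * ?c k)\<bar>} \<in> sets white_seq"
          by measurable
        then show "{z. \<exists>n\<le>N. x \<le> \<bar>0 + (\<Sum>k<n. z k * ?c k)\<bar>} \<in> sets white_seq" by (simp add: Bex_def)
      qed
      also have "\<dots> \<le> ennreal ((0\<^sup>2 + (\<Sum>k<N. (?c k)\<^sup>2)) / x\<^sup>2)"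
        by (rule maximal_inequality_white[OF x])
      also have "\<dots> \<le> ennreal (tail m / x\<^sup>2)"
      proof (intro ennreal_leI divide_right_mono)
        have "(\<Sum>k<N. (?c k)\<^sup>2) = (\<Sum>k\<in>{m..<N}. (c k)\<^sup>2)"
          by (intro sum.mono_neutral_cong_right) auto
        also have "\<dots> = (\<Sum>k<N - m. (c (k + m))\<^sup>2)"
          by (rule sum.reindex_bij_witness[of _ "\<lambda>k. k + m" "\<lambda>k. k - m"]) auto
        also have "\<dots> \<le> tail m"
          unfolding tail_def using c by (intro sum_le_suminf) (auto simp: summable_iff_shift[of "\<lambda>k. (c k)\<^sup>2"])
        finally show "0\<^sup>2 + (\<Sum>k<N. (?c k)\<^sup>2) \<le> tail m" by simp
      qed simp
      finally show ?thesis .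
    qed
    moreover have "?A x m = (\<Union>N. ?B N)" by auto
    moreover have "emeasure white_seq (\<Union>N. ?B N) = (SUP N. emeasure white_seq (?B N))"
      using B by (intro SUP_emeasure_incseq[symmetric]) (auto simp: incseq_def intro: order_trans)
    ultimately show ?thesis by (simp add: SUP_least)
  qed
  have Am: "?A x m \<in> sets white_seq" for x m
  proof -
    have "{z\<in>space white_seq. \<exists>n\<in>{m..}. x \<le> \<bar>S z n - S z m\<bar>} \<in> sets white_seq"
      unfolding S_def by measurable
    then show ?thesis by (auto simp: Bex_def)
  qed
  have tail0: "tail \<longlonglongrightarrow> 0"
    unfolding tail_def by (rule suminf_exist_split2[OF c])
  have nul: "(\<Inter>m. ?A x m) \<in> null_sets white_seq" if x: "0 < x" for x
  proof -
    have "emeasure white_seq (\<Inter>m. ?A x m) \<le> ennreal (tail m / x\<^sup>2)" for m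
      by (rule order_trans[OF emeasure_mono bound[OF x]]) (use Am in auto)
    moreover have "(\<lambda>m. ennreal (tail m / x\<^sup>2)) \<longlonglongrightarrow> ennreal (0 / x\<^sup>2)"
      using x by (intro tendsto_intros tail0) auto
    ultimately have "emeasure white_seq (\<Inter>m. ?A x m) \<le> 0"
      by (intro LIMSEQ_le_const[where X="\<lambda>m. ennreal (tail m / x\<^sup>2)"]) auto
    then show ?thesis using Am by auto
  qed
  have "AE z in white_seq. \<forall>j. z \<notin> (\<Inter>m. ?A (1 / real (Suc j)) m)"
    unfolding AE_all_countable using nul by (intro allI AE_not_in) simp
  then show ?thesis
  proof eventually_elim
    fix z assume z: "\<forall>j. z \<notin> (\<Inter>m. ?A (1 / real (Suc j)) m)"
    have "Cauchy (S z)"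
      unfolding Cauchy_altdef2
    proof (intro allI impI)
      fix r :: real assume "0 < r"
      then obtain j :: nat where j: "1 / real (Suc j) < r" by (meson nat_approx_posE)
      obtain m where m: "z \<notin> ?A (1 / real (Suc j)) m" using z by blast
      have "\<bar>S z n - S z m\<bar> < 1 / real (Suc j)" if "m \<le> n" for n
        using m that by (metis (mono_tags, lifting) mem_Collect_eq not_le)
      then have "\<forall>n\<ge>m. dist (S z n) (S z m) < r"
        using j less_trans unfolding dist_real_def by blast
      then show "\<exists>N. \<forall>n\<ge>N. dist (S z n) (S z N) < r" by blast
    qed
    then show "summable (\<lambda>k. z k * c k)"
      by (simp add: summable_iff_convergent Cauchy_convergent_iff S_def)
  qed
qed

section \<open>White noise as a process indexed by H\<close>

context onb
begin

lemma pairing_measurable [measurable (raw)]: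
  fixes f :: "_ \<Rightarrow> 'h"
  assumes [measurable]: "z \<in> measurable M white_seq" "\<And>v. (\<lambda>x. f x \<bullet> v) \<in> borel_measurable M"
  shows "(\<lambda>x. pairing e (z x) (f x)) \<in> borel_measurable M"
  unfolding pairing_def
  by (intro borel_measurable_suminf borel_measurable_times white_component assms)

text \<open>Where the series in \<open>pairing\<close> diverges its value means nothing. On this
  set, a linear subspace of H, \<open>pairing e z\<close> is linear; each fixed h belongs to it for
  almost all z.\<close>

definition paired :: "(nat \<Rightarrow> real) \<Rightarrow> 'h set" where
  "paired z = {h. summable (\<lambda>k. z k * (h \<bullet> e k))}"

lemma paired_measurable:
  fixes f :: "_ \<Rightarrow> 'h"
  assumes [measurable]: "z \<in> measurable M white_seq" "\<And>v. (\<lambda>x. f x \<bullet> v) \<in> borel_measurable M"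
  shows "Measurable.pred M (\<lambda>x. f x \<in> paired (z x))"
  unfolding paired_def mem_Collect_eq summable_iff_convergent Cauchy_convergent_iff[symmetric] pred_def
  by (intro sets_Collect_Cauchy borel_measurable_sum borel_measurable_times white_component assms)

lemma paired_add: "g \<in> paired z \<Longrightarrow> h \<in> paired z \<Longrightarrow> g + h \<in> paired z"
  and pairing_add: "g \<in> paired z \<Longrightarrow> h \<in> paired z \<Longrightarrow> pairing e z (g + h) = pairing e z g + pairing e z h"
  using summable_add suminf_add[symmetric]
  by (auto simp: paired_def pairing_def inner_add_left distrib_left)

lemma paired_scaleR: "h \<in> paired z \<Longrightarrow> c *\<^sub>R h \<in> paired z"
  and pairing_scaleR: "h \<in> paired z \<Longrightarrow> pairing e z (c *\<^sub>R h) = c * pairing e z h"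
  using suminf_mult[of "\<lambda>k. z k * (h \<bullet> e k)" c]
  by (auto simp: paired_def pairing_def mult.left_commute)

lemma paired_diff: "g \<in> paired z \<Longrightarrow> h \<in> paired z \<Longrightarrow> g - h \<in> paired z"
  and pairing_diff: "g \<in> paired z \<Longrightarrow> h \<in> paired z \<Longrightarrow> pairing e z (g - h) = pairing e z g - pairing e z h"
  using summable_diff suminf_diff[symmetric]
  by (auto simp: paired_def pairing_def inner_diff_left right_diff_distrib)

lemma paired_zero: "0 \<in> paired z" and pairing_zero: "pairing e z 0 = 0"
  by (auto simp: paired_def pairing_def)

lemma AE_paired: "AE z in white_seq. h \<in> paired z"
  unfolding paired_def mem_Collect_eq using parseval[of h]
  by (intro AE_summable_white) (simp add: sums_iff)

text \<open>Finite sums are normal with variance a partial sum of Parseval's series; dominated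
  convergence carries the characteristic functions to the limit.\<close>

lemma distr_pairing: "distr white_seq borel (\<lambda>z. pairing e z h) = normal_measure 0 ((norm h)\<^sup>2)"
proof -
  have "char (distr white_seq borel (\<lambda>z. pairing e z h)) t = char (normal_measure 0 ((norm h)\<^sup>2)) t" for t
  proof (rule LIMSEQ_unique)
    let ?X = "\<lambda>N. CLINT z|white_seq. iexp (\<Sum>k<N. z k * (t * (h \<bullet> e k)))"
    have "char (distr white_seq borel (\<lambda>z. pairing e z h)) t = (CLINT z|white_seq. iexp (t * pairing e z h))"
      unfolding char_def by (subst integral_distr) auto
    moreover have "?X \<longlonglongrightarrow> (CLINT z|white_seq. iexp (t * pairing e z h))"
    proof (rule integral_dominated_convergence[where w="\<lambda>_. 1"])
      show "AE z in white_seq. (\<lambda>N. iexp (\<Sum>k<N. z k * (t * (h \<bullet> e k)))) \<longlonglongrightarrow> iexp (t * pairing e z h)"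
        using AE_paired[of h]
      proof eventually_elim
        fix z assume "h \<in> paired z"
        then have "(\<lambda>N. \<Sum>k<N. z k * (h \<bullet> e k)) \<longlonglongrightarrow> pairing e z h"
          unfolding paired_def pairing_def by (auto simp: summable_LIMSEQ)
        then have "(\<lambda>N. t * (\<Sum>k<N. z k * (h \<bullet> e k))) \<longlonglongrightarrow> t * pairing e z h"
          by (intro tendsto_intros)
        then have "(\<lambda>N. \<Sum>k<N. z k * (t * (h \<bullet> e k))) \<longlonglongrightarrow> t * pairing e z h"
          by (simp add: sum_distrib_left mult.left_commute)
        then show "(\<lambda>N. iexp (\<Sum>k<N. z k * (t * (h \<bullet> e k)))) \<longlonglongrightarrow> iexp (t * pairing e z h)"
          by (intro tendsto_intros)
      qed
    qed auto
    ultimately show "?X \<longlonglongrightarrow> char (distr white_seq borel (\<lambda>z. pairing e z h)) t" by simp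
    have "(\<lambda>N. \<Sum>k<N. (t * (h \<bullet> e k))\<^sup>2) \<longlonglongrightarrow> t\<^sup>2 * (norm h)\<^sup>2"
      using sums_mult[OF parseval[of h], of "t\<^sup>2"] by (simp add: sums_def power_mult_distrib)
    then have "?X \<longlonglongrightarrow> complex_of_real (exp (- (t\<^sup>2 * (norm h)\<^sup>2) / 2))"
      unfolding char_white_sum by (intro tendsto_intros) auto
    then show "?X \<longlonglongrightarrow> char (normal_measure 0 ((norm h)\<^sup>2)) t"
      by (simp add: char_normal_measure mult.commute)
  qed
  then show ?thesis
    by (intro finite_measure_char_eq_imp_eq white.finite_measure_distr prob_space.finite_measure[OF prob_space_normal_measure]) simp_all
qed

lemma mgf_pairing: "(\<integral>\<^sup>+z. ennreal (exp (s * pairing e z h)) \<partial>white_seq) = ennreal (exp (s\<^sup>2 * (norm h)\<^sup>2 / 2))"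
proof -
  have "(\<integral>\<^sup>+z. ennreal (exp (s * pairing e z h)) \<partial>white_seq)
     = (\<integral>\<^sup>+x. ennreal (exp (s * x)) \<partial>distr white_seq borel (\<lambda>z. pairing e z h))"
    by (subst nn_integral_distr) auto
  then show ?thesis by (simp add: distr_pairing nn_integral_exp_normal_measure)
qed

lemma pairing_tail:
  assumes "norm h \<le> B" "0 < B" "0 \<le> x"
  shows "measure white_seq {z. \<bar>pairing e z h\<bar> > x} \<le> 2 * exp (- x\<^sup>2 / (2 * B\<^sup>2))"
proof -
  have "(\<integral>\<^sup>+z. ennreal (exp (s * pairing e z h)) \<partial>white_seq) \<le> ennreal (exp (s\<^sup>2 * B\<^sup>2 / 2))" for s
    unfolding mgf_pairing using assms
    by (auto intro: mult_left_mono)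
  then have "measure white_seq {z \<in> space white_seq. \<bar>pairing e z h\<bar> > x} \<le> 2 * exp (- x\<^sup>2 / (2 * B\<^sup>2))"
    by (intro white.mgf_tail_bound) (use assms in auto)
  then show ?thesis by simp
qed

end

section \<open>Chaining\<close>

lemma covering_number_antimono: "\<eta> \<le> \<eta>' \<Longrightarrow> covering_number \<eta>' A \<le> covering_number \<eta> A"
  unfolding covering_number_def
proof (rule INF_superset_mono)
  assume le: "\<eta> \<le> \<eta>'"
  show "{C. finite C \<and> A \<subseteq> (\<Union>c\<in>C. ball c \<eta>)} \<subseteq> {C. finite C \<and> A \<subseteq> (\<Union>c\<in>C. ball c \<eta>')}"
  proof
    fix C assume C: "C \<in> {C. finite C \<and> A \<subseteq> (\<Union>c\<in>C. ball c \<eta>)}"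
    have "(\<Union>c\<in>C. ball c \<eta>) \<subseteq> (\<Union>c\<in>C. ball c \<eta>')" using le by (intro UN_mono) auto
    with C show "C \<in> {C. finite C \<and> A \<subseteq> (\<Union>c\<in>C. ball c \<eta>')}" by auto
  qed
qed simp

lemma sqrt_log_mono: "m \<le> n \<Longrightarrow> sqrt_log m \<le> sqrt_log n"
proof (cases m; cases n)
  fix a b assume "m \<le> n" "m = enat a" "n = enat b"
  \<comment> \<open>The value \<open>ln 0 = 0\<close> keeps the empty cover in line with
    monotonicity.\<close>
  then show ?thesis by (cases "a = 0") (auto simp: sqrt_log_def)
qed (auto simp: sqrt_log_def)

lemma covering_number_finite:
  assumes "covering_number \<eta> A = enat m"
  obtains C where "finite C" "A \<subseteq> (\<Union>c\<in>C. ball c \<eta>)" "card C = m"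
proof -
  have "\<exists>C\<in>{C. finite C \<and> A \<subseteq> (\<Union>c\<in>C. ball c \<eta>)}. enat (card C) = enat m"
  proof (rule ccontr)
    assume n: "\<not> ?thesis"
    let ?X = "(\<lambda>C. enat (card C)) ` {C. finite C \<and> A \<subseteq> (\<Union>c\<in>C. ball c \<eta>)}"
    have "?X \<noteq> {}" using assms unfolding covering_number_def by (metis Inf_enat_def enat.distinct)
    then have "Inf ?X \<in> ?X" unfolding Inf_enat_def by (auto intro: LeastI)
    then show False using n assms unfolding covering_number_def by auto
  qed
  then show ?thesis using that by auto
qed

text \<open>A lower Riemann sum over dyadic intervals: on each of them the covering number is
  smallest at the right end point.\<close>

lemma entropy_sum:
  fixes A :: "'a::metric_space set"
  defines "a \<equiv> \<lambda>j. sqrt_log (covering_number (1 / 2 ^ j) A)"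
  shows "(\<Sum>j<J. ennreal (1 / 2 ^ Suc j) * a j) \<le> (\<integral>\<^sup>+\<eta>\<in>{0..1}. sqrt_log (covering_number \<eta> A) \<partial>lborel)"
proof -
  let ?I = "\<lambda>j::nat. {1 / 2 ^ Suc j<..1 / 2 ^ j :: real}"
  have pw: "(\<Sum>j<J. a j * indicator (?I j) \<eta>) \<le> sqrt_log (covering_number \<eta> A) * indicator {0..1} \<eta>" for \<eta>
  proof (cases "\<exists>j<J. \<eta> \<in> ?I j")
    case True
    then obtain i where i: "i < J" "\<eta> \<in> ?I i" by blast
    have disj: "\<eta> \<notin> ?I j" if "j \<noteq> i" for j
    proof
      assume j: "\<eta> \<in> ?I j"
      have lt: False if "k < l" "\<eta> \<in> ?I k" "\<eta> \<in> ?I l" for k l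
      proof -
        have "(1::real) / 2 ^ l \<le> 1 / 2 ^ Suc k"
          using that by (intro divide_left_mono power_increasing) auto
        then show False using that by auto
      qed
      show False using lt[of i j] lt[of j i] i j that by linarith
    qed
    have "(\<Sum>j<J. a j * indicator (?I j) \<eta>) = (\<Sum>j\<in>{i}. a j * indicator (?I j) \<eta>)"
      using i disj by (intro sum.mono_neutral_right) auto
    also have "\<dots> = a i" using i by simp
    also have "\<dots> \<le> sqrt_log (covering_number \<eta> A)"
      unfolding a_def using i by (intro sqrt_log_mono covering_number_antimono) auto
    also have "\<dots> = sqrt_log (covering_number \<eta> A) * indicator {0..1} \<eta>"
    proof -
      have "(1::real) / 2 ^ i \<le> 1" "(0::real) \<le> 1 / 2 ^ Suc i" by auto
      moreover have "1 / 2 ^ Suc i < \<eta>" "\<eta> \<le> 1 / 2 ^ i" using i(2) by auto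
      ultimately have "0 \<le> \<eta>" "\<eta> \<le> 1" by linarith+
      then show ?thesis by simp
    qed
    finally show ?thesis .
  next
    case False
    then show ?thesis by simp
  qed
  have "(\<Sum>j<J. ennreal (1 / 2 ^ Suc j) * a j) = (\<Sum>j<J. \<integral>\<^sup>+\<eta>. a j * indicator (?I j) \<eta> \<partial>lborel)"
  proof (intro sum.cong refl)
    fix j
    have "(1::real) / 2 ^ Suc j \<le> 1 / 2 ^ j" by (simp add: divide_simps)
    then have "emeasure lborel (?I j) = ennreal (1 / 2 ^ j - 1 / 2 ^ Suc j)" by simp
    also have "1 / 2 ^ j - 1 / 2 ^ Suc j = (1 / 2 ^ Suc j :: real)" by simp
    finally show "ennreal (1 / 2 ^ Suc j) * a j = (\<integral>\<^sup>+\<eta>. a j * indicator (?I j) \<eta> \<partial>lborel)"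
      by (subst nn_integral_cmult_indicator) (auto simp: mult.commute)
  qed
  also have "\<dots> = (\<integral>\<^sup>+\<eta>. (\<Sum>j<J. a j * indicator (?I j) \<eta>) \<partial>lborel)"
    by (rule nn_integral_sum[symmetric]) simp
  also have "\<dots> \<le> (\<integral>\<^sup>+\<eta>\<in>{0..1}. sqrt_log (covering_number \<eta> A) \<partial>lborel)"
    by (intro nn_integral_mono pw)
  finally show ?thesis .
qed

lemma sqrt_add_le: "0 \<le> x \<Longrightarrow> 0 \<le> y \<Longrightarrow> sqrt (x + y) \<le> sqrt x + sqrt y"
  by (intro real_le_lsqrt) (auto simp: power2_sum)

context onb
begin

lemma sets_pairing_greater [measurable]: "{z. x < \<bar>pairing e z h\<bar>} \<in> sets white_seq"
proof -
  have "{z\<in>space white_seq. x < \<bar>pairing e z h\<bar>} \<in> sets white_seq" by measurable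
  then show ?thesis by simp
qed

text \<open>Chaining through nets of radius \<open>1 / 2 ^ j\<close>. The random constant is common
  to all s, while the exceptional null set depends on s. This is enough: by Fubini the bound holds,
  for almost every z, at almost every parameter drawn from the prior.\<close>

theorem dudley_bound:
  assumes S: "normed_subspace S nS"
    and ent: "(\<integral>\<^sup>+\<eta>\<in>{0..1}. sqrt_log (covering_number \<eta> {h \<in> S. nS h \<le> 1}) \<partial>lborel) < \<infinity>"
  obtains C where "C \<in> borel_measurable white_seq" "\<And>z. 0 \<le> C z"
    "\<And>s. s \<in> S \<Longrightarrow> AE z in white_seq. \<bar>pairing e z s\<bar> \<le> C z * nS s"
proof -
  let ?B = "{h \<in> S. nS h \<le> 1}"
  define r where "r = (\<lambda>j::nat. 1 / 2 ^ j :: real)"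
  have r0: "0 < r j" for j by (simp add: r_def)
  have fin: "covering_number (r j) ?B \<noteq> \<infinity>" for j
  proof
    assume "covering_number (r j) ?B = \<infinity>"
    \<comment> \<open>An infinite covering number at one radius makes a term of the dyadic sum
      infinite.\<close>
    then have "(\<Sum>i<Suc j. ennreal (1 / 2 ^ Suc i) * sqrt_log (covering_number (1 / 2 ^ i) ?B)) = \<infinity>"
      by (simp add: r_def sqrt_log_def)
    with entropy_sum[where J="Suc j" and A="?B"] have "\<infinity> \<le> (\<integral>\<^sup>+\<eta>\<in>{0..1}. sqrt_log (covering_number \<eta> ?B) \<partial>lborel)"
      by (simp only:)
    with ent show False by simp
  qed
  then have "\<forall>j. \<exists>m. covering_number (r j) ?B = enat m" by auto
  then obtain m where m: "\<And>j. covering_number (r j) ?B = enat (m j)" by metis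
  have "\<forall>j. \<exists>N. finite N \<and> ?B \<subseteq> (\<Union>c\<in>N. ball c (r j)) \<and> card N = m j"
  proof
    fix j
    obtain D where "finite D" "?B \<subseteq> (\<Union>c\<in>D. ball c (r j))" "card D = m j"
      by (rule covering_number_finite[OF m[of j]])
    then show "\<exists>N. finite N \<and> ?B \<subseteq> (\<Union>c\<in>N. ball c (r j)) \<and> card N = m j" by blast
  qed
  from choice[OF this] obtain N where N: "\<And>j. finite (N j)" "\<And>j. ?B \<subseteq> (\<Union>c\<in>N j. ball c (r j))" "\<And>j. card (N j) = m j"
    by blast
  have "0 \<in> ?B"
  proof -
    have z: "0 \<in> S" using S by (simp add: normed_subspace_def subspace_0)
    have "nS (0 *\<^sub>R 0) = \<bar>0\<bar> * nS 0" using S z normed_subspace_def by blast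
    then show ?thesis using z by simp
  qed
  then have m1: "1 \<le> m j" for j
  proof -
    have "N j \<noteq> {}" using N\<open>0 \<in> ?B\<close> by blast
    then have "0 < card (N j)" using N(1) by (simp add: card_gt_0_iff)
    then show ?thesis using N(3) by simp
  qed
  define u where "u = (\<lambda>j. sqrt (ln (real (m j))))"
  have u0: "0 \<le> u j" for j using m1[of j] by (simp add: u_def)
  have su: "summable (\<lambda>j. r j * u j)"
  proof (rule summableI_nonneg_bounded)
    let ?E = "enn2real (\<integral>\<^sup>+\<eta>\<in>{0..1}. sqrt_log (covering_number \<eta> ?B) \<partial>lborel)"
    show "(\<Sum>j<J. r j * u j) \<le> 2 * ?E" for J
    proof -
      have "ennreal (\<Sum>j<J. (1 / 2 ^ Suc j) * u j) = (\<Sum>j<J. ennreal (1 / 2 ^ Suc j) * sqrt_log (covering_number (1 / 2 ^ j) ?B))"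
      proof (subst sum_ennreal[symmetric], simp add: u0, intro sum.cong refl)
        fix j
        have sl: "sqrt_log (covering_number (1 / 2 ^ j) ?B) = ennreal (u j)"
          using m[of j] by (simp add: r_def sqrt_log_def u_def)
        show "ennreal (1 / 2 ^ Suc j * u j) = ennreal (1 / 2 ^ Suc j) * sqrt_log (covering_number (1 / 2 ^ j) ?B)"
          unfolding sl by (rule ennreal_mult) (simp, rule u0)
      qed
      also have "\<dots> \<le> ennreal ?E"
        using entropy_sum[where J=J and A="?B"] ent by simp
      finally have "(\<Sum>j<J. (1 / 2 ^ Suc j) * u j) \<le> ?E" by simp
      moreover have "(\<Sum>j<J. r j * u j) = 2 * (\<Sum>j<J. (1 / 2 ^ Suc j) * u j)"
        by (simp add: r_def sum_distrib_left)
      ultimately show ?thesis by simp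
    qed
  qed (simp add: r_def u0)
  \<comment> \<open>Pairs that can be consecutive links: two approximations of the same point at
    levels j and j + 1 are at most \<open>r j + r (Suc j)\<close> apart.\<close>
  define P where "P = (\<lambda>j. {(a, b). a \<in> N j \<and> b \<in> N (Suc j) \<and> norm (b - a) \<le> 2 * r j})"
  have Psub: "P j \<subseteq> N j \<times> N (Suc j)" for j by (auto simp: P_def)
  have fP: "finite (P j)" for j by (rule finite_subset[OF Psub]) (simp add: N)
  have cP: "card (P j) \<le> m j * m (Suc j)" for j
    using card_mono[OF _ Psub[of j]] N by simp
  define M where "M = (\<lambda>j z. Max (insert 0 ((\<lambda>(a, b). \<bar>pairing e z (b - a)\<bar>) ` P j)))"
  define M0 where "M0 = (\<lambda>z. Max (insert 0 ((\<lambda>a. \<bar>pairing e z a\<bar>) ` N 0)))"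
  have Mge: "\<bar>pairing e z (b - a)\<bar> \<le> M j z" if "(a, b) \<in> P j" for a b j z
    unfolding M_def using that fP by (intro Max_ge) (auto)
  have M0ge: "\<bar>pairing e z a\<bar> \<le> M0 z" if "a \<in> N 0" for a z
    unfolding M0_def using that N(1) by auto
  have Mnn: "0 \<le> M j z" and M0nn: "0 \<le> M0 z" for j z
    unfolding M_def M0_def using fP N(1) by (simp)+
  have Mm [measurable]: "M j \<in> borel_measurable white_seq" for j
  proof -
    have "(\<lambda>z. Max ((\<lambda>i. (case i of None \<Rightarrow> 0 | Some (a, b) \<Rightarrow> \<bar>pairing e z (b - a)\<bar>)) ` insert None (Some ` P j))) \<in> borel_measurable white_seq"
      using fP by (intro borel_measurable_Max) (auto)
    also have "(\<lambda>z. Max ((\<lambda>i. (case i of None \<Rightarrow> 0 | Some (a, b) \<Rightarrow> \<bar>pairing e z (b - a)\<bar>)) ` insert None (Some ` P j))) = M j"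
      unfolding M_def by (simp add: image_image)
    finally show ?thesis .
  qed
  have M0m [measurable]: "M0 \<in> borel_measurable white_seq"
  proof -
    have "(\<lambda>z. Max ((\<lambda>i. (case i of None \<Rightarrow> 0 | Some a \<Rightarrow> \<bar>pairing e z a\<bar>)) ` insert None (Some ` N 0))) \<in> borel_measurable white_seq"
      using N by (intro borel_measurable_Max) (auto)
    also have "(\<lambda>z. Max ((\<lambda>i. (case i of None \<Rightarrow> 0 | Some a \<Rightarrow> \<bar>pairing e z a\<bar>)) ` insert None (Some ` N 0))) = M0"
      unfolding M0_def by (simp add: image_image)
    finally show ?thesis .
  qed
  \<comment> \<open>For a pairing of standard deviation at most \<open>2 * r j\<close> this level
    has tail \<open>2 * exp (- ln (m j) - ln (m (Suc j)) - j)\<close>. The logarithms pay for the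
    number of pairs in the union bound and leave \<open>2 * exp (- j)\<close>.\<close>
  define x where "x = (\<lambda>j. 2 * r j * (sqrt 2 * sqrt (ln (real (m j)) + ln (real (m (Suc j))) + real j)))"
  have x0: "0 \<le> x j" for j using r0[of j] m1[of j] m1[of "Suc j"] by (simp add: x_def)
  have Mxs [measurable]: "{z. x j < M j z} \<in> sets white_seq" for j
  proof -
    have "{z\<in>space white_seq. x j < M j z} \<in> sets white_seq" by measurable
    then show ?thesis by simp
  qed
  have Mx: "measure white_seq {z. M j z > x j} \<le> 2 * exp (- real j)" for j
  proof -
    have "measure white_seq {z. M j z > x j} \<le> measure white_seq (\<Union>(a, b)\<in>P j. {z. \<bar>pairing e z (b - a)\<bar> > x j})"
    proof (rule white.finite_measure_mono)
      show "{z. M j z > x j} \<subseteq> (\<Union>(a, b)\<in>P j. {z. \<bar>pairing e z (b - a)\<bar> > x j})"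
        unfolding M_def using x0[of j] fP by (subst Max_gr_iff) auto
    qed (use fP in \<open>auto intro!: sets.finite_UN\<close>)
    also have "\<dots> \<le> (\<Sum>p\<in>P j. measure white_seq (case p of (a, b) \<Rightarrow> {z. \<bar>pairing e z (b - a)\<bar> > x j}))"
      using fP by (intro measure_UNION_le) auto
    also have "\<dots> \<le> (\<Sum>p\<in>P j. 2 * exp (- (x j)\<^sup>2 / (2 * (2 * r j)\<^sup>2)))"
    proof (intro sum_mono)
      fix p assume p: "p \<in> P j"
      obtain a b where ab: "p = (a, b)" by fastforce
      have "norm (b - a) \<le> 2 * r j" using p by (simp add: ab P_def)
      from pairing_tail[OF this _ x0[of j]] r0[of j]
      show "measure white_seq (case p of (a, b) \<Rightarrow> {z. \<bar>pairing e z (b - a)\<bar> > x j}) \<le> 2 * exp (- (x j)\<^sup>2 / (2 * (2 * r j)\<^sup>2))"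
        by (simp add: ab)
    qed
    also have "\<dots> = real (card (P j)) * (2 * exp (- (x j)\<^sup>2 / (2 * (2 * r j)\<^sup>2)))" by simp
    also have "(x j)\<^sup>2 / (2 * (2 * r j)\<^sup>2) = ln (real (m j)) + ln (real (m (Suc j))) + real j"
      using r0[of j] m1[of j] m1[of "Suc j"] by (simp add: x_def power_mult_distrib)
    then have "- (x j)\<^sup>2 / (2 * (2 * r j)\<^sup>2) = - ln (real (m j)) - ln (real (m (Suc j))) - real j" by simp
    also have "exp (- ln (real (m j)) - ln (real (m (Suc j))) - real j) = exp (- real j) / (real (m j) * real (m (Suc j)))"
    proof -
      have "exp (- ln (real (m j)) - ln (real (m (Suc j))) - real j)
          = exp (- real j) * (exp (- ln (real (m j))) * exp (- ln (real (m (Suc j)))))"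
        by (simp add: exp_add[symmetric])
      moreover have "exp (- ln (real (m k))) = 1 / real (m k)" for k
        using m1[of k] by (simp add: exp_minus inverse_eq_divide)
      ultimately show ?thesis by simp
    qed
    also have "real (card (P j)) * (2 * (exp (- real j) / (real (m j) * real (m (Suc j)))))
        \<le> (real (m j) * real (m (Suc j))) * (2 * (exp (- real j) / (real (m j) * real (m (Suc j)))))"
      using cP[of j] by (intro mult_right_mono) (auto simp flip: of_nat_mult)
    also have "\<dots> = 2 * exp (- real j)" using m1[of j] m1[of "Suc j"] by simp
    finally show ?thesis .
  qed
  have sexp: "summable (\<lambda>j. exp (- real j))"
  proof -
    have "summable (\<lambda>j. exp (-1 :: real) ^ j)" by simp
    then show ?thesis by (simp add: exp_of_nat_mult[symmetric])
  qed
  have sx: "summable x"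
  proof (rule summable_comparison_test)
    \<comment> \<open>Subadditivity of the square root separates the entropies, summable by the
      integral condition, from the terms \<open>j / 2 ^ j\<close>.\<close>
    let ?y = "\<lambda>j. 2 * sqrt 2 * (r j * u j + 2 * (r (Suc j) * u (Suc j)) + real j * (1/2) ^ j)"
    have "summable (\<lambda>j. real j * (1/2::real) ^ j)"
    proof (rule summable_comparison_test)
      show "summable (\<lambda>j. real (Suc j) * (1/2::real) ^ j)"
        using geometric_deriv_sums[of "1/2::real"] by (simp add: sums_iff)
      show "\<exists>N. \<forall>n\<ge>N. norm (real n * (1/2::real) ^ n) \<le> real (Suc n) * (1/2) ^ n"
        by simp
    qed
    then show "summable ?y"
      using su summable_Suc_iff[THEN iffD2, OF su] by (intro summable_mult summable_add)
    have "norm (x j) \<le> ?y j" for j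
    proof -
      have "sqrt (ln (real (m j)) + ln (real (m (Suc j))) + real j) \<le> u j + u (Suc j) + sqrt (real j)"
        unfolding u_def using m1[of j] m1[of "Suc j"]
        by (intro order_trans[OF sqrt_add_le] add_mono) auto
      also have "sqrt (real j) \<le> real j" using real_sqrt_le_mono[of "real j" "(real j)\<^sup>2"]
        by (cases "j = 0") (auto simp: power2_eq_square)
      finally have "x j \<le> 2 * r j * (sqrt 2 * (u j + u (Suc j) + real j))"
        unfolding x_def using r0[of j] by auto
      also have "\<dots> = ?y j" by (simp add: r_def field_simps)
      finally show ?thesis using x0[of j] by simp
    qed
    then show "\<exists>N. \<forall>n\<ge>N. norm (x n) \<le> ?y n" by blast
  qed
  have AEM: "AE z in white_seq. summable (\<lambda>j. M j z)"
  proof -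
    \<comment> \<open>Borel-Cantelli: almost surely \<open>M j\<close> exceeds \<open>x j\<close>
      only finitely often, so summability of x passes to the random maxima.\<close>
    have "AE z in white_seq. eventually (\<lambda>j. z \<in> space white_seq - {z. M j z > x j}) sequentially"
    proof (rule borel_cantelli_AE1)
      show "summable (\<lambda>j. measure white_seq {z. M j z > x j})"
        by (rule summable_comparison_test[OF _ summable_mult[OF sexp, of 2]]) (use Mx in auto)
    qed (auto simp: white.emeasure_eq_measure)
    then show ?thesis
    proof eventually_elim
      fix z assume "eventually (\<lambda>j. z \<in> space white_seq - {z. M j z > x j}) sequentially"
      then have "eventually (\<lambda>j. norm (M j z) \<le> x j) sequentially"
        by eventually_elim (use Mnn in \<open>auto simp: not_less\<close>)
      then show "summable (\<lambda>j. M j z)" by (rule summable_comparison_test_ev[OF _ sx])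
    qed
  qed
  \<comment> \<open>The absolute value keeps C nonnegative even where the series diverges.\<close>
  define C where "C = (\<lambda>z. \<bar>M0 z + (\<Sum>j. M j z)\<bar>)"
  have ball1: "AE z in white_seq. \<bar>pairing e z h\<bar> \<le> C z" if h: "h \<in> ?B" for h
  proof -
    have "\<forall>j. \<exists>a\<in>N j. norm (h - a) < r j"
      using N(2) h by (force simp: dist_norm norm_minus_commute)
    then obtain a where a: "\<And>j. a j \<in> N j" "\<And>j. norm (h - a j) < r j" by metis
    have aP: "(a j, a (Suc j)) \<in> P j" for j
    proof -
      have "norm (a (Suc j) - a j) \<le> norm (h - a j) + norm (h - a (Suc j))"
        using norm_triangle_ineq4[of "h - a j" "h - a (Suc j)"] by simp
      also have "\<dots> \<le> r j + r (Suc j)" using a[of j] a[of "Suc j"] by simp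
      also have "\<dots> \<le> 2 * r j" by (simp add: r_def field_simps)
      finally show ?thesis using a(1) by (simp add: P_def)
    qed
    \<comment> \<open>For one h the end of the chain is negligible: errors above
      \<open>r j * j\<close> occur only finitely often by Borel-Cantelli, and \<open>r j * j\<close>
      tends to 0.\<close>
    have "AE z in white_seq. eventually (\<lambda>j. z \<in> space white_seq - {z. \<bar>pairing e z (h - a j)\<bar> > r j * real j}) sequentially"
    proof (rule borel_cantelli_AE1)
      have le: "measure white_seq {z. \<bar>pairing e z (h - a j)\<bar> > r j * real j} \<le> 2 * exp (- real j / 2)" for j
      proof -
        have "measure white_seq {z. \<bar>pairing e z (h - a j)\<bar> > r j * real j} \<le> 2 * exp (- (r j * real j)\<^sup>2 / (2 * (r j)\<^sup>2))"
          using r0[of j] a[of j] by (intro pairing_tail) auto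
        also have "(r j * real j)\<^sup>2 / (2 * (r j)\<^sup>2) = (real j)\<^sup>2 / 2"
          using r0[of j] by (simp add: power_mult_distrib)
        then have "- (r j * real j)\<^sup>2 / (2 * (r j)\<^sup>2) = - (real j)\<^sup>2 / 2" by simp
        also have "2 * exp (- (real j)\<^sup>2 / 2) \<le> 2 * exp (- real j / 2)"
          by (cases "j = 0") (auto simp: power2_eq_square)
        finally show ?thesis .
      qed
      have "summable (\<lambda>j. exp (-1/2 :: real) ^ j)" by simp
      then have "summable (\<lambda>j. 2 * exp (- real j / 2))"
        by (simp add: exp_of_nat_mult[symmetric])
      then show "summable (\<lambda>j. measure white_seq {z. \<bar>pairing e z (h - a j)\<bar> > r j * real j})"
        by (rule summable_comparison_test[rotated]) (use le in auto)
    qed (auto simp: white.emeasure_eq_measure)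
    moreover have "AE z in white_seq. \<forall>j. a j \<in> paired z"
      unfolding AE_all_countable using AE_paired by blast
    ultimately show ?thesis using AEM AE_paired[of h]
    proof eventually_elim
      fix z
      assume ev: "eventually (\<lambda>j. z \<in> space white_seq - {z. \<bar>pairing e z (h - a j)\<bar> > r j * real j}) sequentially"
        and pa: "\<forall>j. a j \<in> paired z" and sM: "summable (\<lambda>j. M j z)" and ph: "h \<in> paired z"
      have tel: "\<bar>pairing e z (a J)\<bar> \<le> M0 z + (\<Sum>j<J. M j z)" for J
      proof (induction J)
        case 0
        then show ?case using M0ge a(1) by simp
      next
        case (Suc J)
        have "pairing e z (a (Suc J)) = pairing e z (a J) + pairing e z (a (Suc J) - a J)"
          using pa by (simp add: pairing_diff)
        then show ?case using Suc Mge[OF aP, of z J] by simp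
      qed
      have Ceq: "C z = M0 z + (\<Sum>j. M j z)"
        unfolding C_def using M0nn suminf_nonneg[OF sM Mnn] by simp
      have aC: "\<bar>pairing e z (a J)\<bar> \<le> C z" for J
        unfolding Ceq by (rule order_trans[OF tel], intro add_left_mono sum_le_suminf[OF sM]) (simp_all add: Mnn)
      have "eventually (\<lambda>j. \<bar>pairing e z h\<bar> \<le> C z + r j * real j) sequentially"
        using ev
      proof eventually_elim
        fix j assume "z \<in> space white_seq - {z. \<bar>pairing e z (h - a j)\<bar> > r j * real j}"
        then show "\<bar>pairing e z h\<bar> \<le> C z + r j * real j"
          using aC[of j] pa ph by (auto simp: pairing_diff)
      qed
      moreover have "(\<lambda>j. C z + r j * real j) \<longlonglongrightarrow> C z + 0"
      proof (intro tendsto_intros)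
        have "(\<lambda>j. real j * (1/2) ^ j) \<longlonglongrightarrow> (0::real)"
          by (rule powser_times_n_limit_0) simp
        then show "(\<lambda>j. r j * real j) \<longlonglongrightarrow> 0" by (simp add: r_def power_divide)
      qed
      ultimately show "\<bar>pairing e z h\<bar> \<le> C z"
        by (intro tendsto_lowerbound[where f="\<lambda>j. C z + r j * real j" and F=sequentially]) auto
    qed
  qed
  show ?thesis
  proof (rule that[of C])
    show "C \<in> borel_measurable white_seq" unfolding C_def by measurable
    show "0 \<le> C z" for z by (simp add: C_def)
    fix s assume s: "s \<in> S"
    show "AE z in white_seq. \<bar>pairing e z s\<bar> \<le> C z * nS s"
    proof (cases "nS s = 0")
      case True
      then have "s = 0" using S s unfolding normed_subspace_def by blast
      then show ?thesis using True by (simp add: pairing_zero)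
    next
      case False
      have n0: "0 \<le> nS s" using S s unfolding normed_subspace_def by blast
      let ?h = "(1 / nS s) *\<^sub>R s"
      have "?h \<in> S" using S s unfolding normed_subspace_def by (simp add: subspace_scale)
      moreover have "nS ?h = \<bar>1 / nS s\<bar> * nS s" using S s normed_subspace_def by blast
      ultimately have "?h \<in> ?B" using False by simp
      from ball1[OF this] AE_paired[of s] show ?thesis
      proof eventually_elim
        fix z assume "\<bar>pairing e z ?h\<bar> \<le> C z" "s \<in> paired z"
        then show "\<bar>pairing e z s\<bar> \<le> C z * nS s"
          using n0 False by (simp add: pairing_scaleR field_simps)
      qed
    qed
  qed
qed

end

section \<open>The product of the two noise sequences\<close>

lemma prob_space_noise: "prob_space noise"
  unfolding noise_eq by (intro prob_space_pair white.prob_space_axioms)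

interpretation noise: prob_space noise by (rule prob_space_noise)

lemma space_noise [simp]: "space noise = UNIV"
  by (simp add: noise_eq space_pair_measure)

lemma sets_noise [measurable_cong]: "sets noise = sets (white_seq \<Otimes>\<^sub>M white_seq)"
  by (simp add: noise_eq)

lemma nn_integral_noise_mult:
  assumes [measurable]: "F \<in> borel_measurable white_seq" "G \<in> borel_measurable white_seq"
  shows "(\<integral>\<^sup>+z. F (fst z) * G (snd z) \<partial>noise) = (\<integral>\<^sup>+z. F z \<partial>white_seq) * (\<integral>\<^sup>+z. G z \<partial>white_seq)"
  unfolding noise_eq
  by (subst white.nn_integral_fst[symmetric]) (auto simp: nn_integral_cmult nn_integral_multc)

lemma distr_noise_fst: "distr noise white_seq fst = white_seq"
  and distr_noise_snd: "distr noise white_seq snd = white_seq"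
proof -
  have "emeasure (distr noise white_seq fst) A = emeasure white_seq A" "emeasure (distr noise white_seq snd) A = emeasure white_seq A"
    if A: "A \<in> sets white_seq" for A
  proof -
    have "fst -` A = A \<times> (UNIV :: (nat \<Rightarrow> real) set)" "snd -` A = (UNIV :: (nat \<Rightarrow> real) set) \<times> A" by auto
    then show "emeasure (distr noise white_seq fst) A = emeasure white_seq A" "emeasure (distr noise white_seq snd) A = emeasure white_seq A"
      using A white.emeasure_pair_measure_Times[OF A sets.top[of white_seq]] white.emeasure_pair_measure_Times[OF sets.top[of white_seq] A]
        white.emeasure_space_1 by (simp_all add: noise_eq emeasure_distr space_pair_measure)
  qed
  then show "distr noise white_seq fst = white_seq" "distr noise white_seq snd = white_seq"
    by (auto intro!: measure_eqI)
qed

lemma emeasure_noise_fst: "A \<in> sets white_seq \<Longrightarrow> emeasure noise {z. fst z \<in> A} = emeasure white_seq A"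
  and emeasure_noise_snd: "A \<in> sets white_seq \<Longrightarrow> emeasure noise {z. snd z \<in> A} = emeasure white_seq A"
  using emeasure_distr[of fst noise white_seq A] emeasure_distr[of snd noise white_seq A]
  by (simp_all add: distr_noise_fst distr_noise_snd vimage_def)

lemma sets_noise_Collect: "Measurable.pred noise P \<Longrightarrow> {z. P z} \<in> sets noise"
  by (simp add: pred_def)

lemma AE_noise_fst: "AE z in white_seq. P z \<Longrightarrow> AE z in noise. P (fst z)"
  and AE_noise_snd: "AE z in white_seq. P z \<Longrightarrow> AE z in noise. P (snd z)"
proof -
  have "fst \<in> measurable noise white_seq" "snd \<in> measurable noise white_seq" by (simp_all add: noise_eq)
  then show "AE z in white_seq. P z \<Longrightarrow> AE z in noise. P (fst z)" "AE z in white_seq. P z \<Longrightarrow> AE z in noise. P (snd z)"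
    using AE_distrD[of fst noise white_seq P] AE_distrD[of snd noise white_seq P] unfolding distr_noise_fst distr_noise_snd by blast+
qed

section \<open>Events of probability tending to one\<close>

text \<open>The measurable exceptional set B covers events that may fail to be measurable, such as
  statements about all Borel sets at once or about almost every parameter.\<close>

abbreviation off_small :: "real \<Rightarrow> (observation \<Rightarrow> bool) \<Rightarrow> bool" where
  "off_small r P \<equiv> \<exists>B\<in>sets noise. measure noise B \<le> r \<and> (\<forall>z. z \<notin> B \<longrightarrow> P z)"

text \<open>As a filter, it lets finitely many statements of probability tending to one be combined
  by \<open>eventually_elim\<close>.\<close>

definition whp :: "(nat \<times> observation) filter" where
  "whp = Abs_filter (\<lambda>P. \<forall>r>0. \<forall>\<^sub>F n in sequentially. off_small r (\<lambda>z. P (n, z)))"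

abbreviation likely :: "(nat \<Rightarrow> observation \<Rightarrow> bool) \<Rightarrow> bool" where
  "likely P \<equiv> eventually (\<lambda>(n, z). P n z) whp"

lemma eventually_whp:
  "eventually P whp \<longleftrightarrow> (\<forall>r>0. \<forall>\<^sub>F n in sequentially. off_small r (\<lambda>z. P (n, z)))"
  unfolding whp_def
proof (rule eventually_Abs_filter, rule is_filter.intro)
  show "\<forall>r>0. \<forall>\<^sub>F n in sequentially. off_small r (\<lambda>z. True)"
    by (auto intro: bexI[of _ "{}"])
next
  fix P Q :: "nat \<times> observation \<Rightarrow> bool"
  assume P: "\<forall>r>0. \<forall>\<^sub>F n in sequentially. off_small r (\<lambda>z. P (n, z))"
    and Q: "\<forall>r>0. \<forall>\<^sub>F n in sequentially. off_small r (\<lambda>z. Q (n, z))"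
  show "\<forall>r>0. \<forall>\<^sub>F n in sequentially. off_small r (\<lambda>z. P (n, z) \<and> Q (n, z))"
  proof (intro allI impI)
    fix r :: real assume "0 < r"
    then have "0 < r / 2" by simp
    with P Q have "\<forall>\<^sub>F n in sequentially. (off_small (r / 2) (\<lambda>z. P (n, z)))
        \<and> (off_small (r / 2) (\<lambda>z. Q (n, z)))"
      by (intro eventually_conj) blast+
    then show "\<forall>\<^sub>F n in sequentially. off_small r (\<lambda>z. P (n, z) \<and> Q (n, z))"
    proof eventually_elim
      fix n
      assume "(off_small (r / 2) (\<lambda>z. P (n, z)))
        \<and> (off_small (r / 2) (\<lambda>z. Q (n, z)))"
      then obtain B B' where B: "B \<in> sets noise" "measure noise B \<le> r / 2" "\<forall>z. z \<notin> B \<longrightarrow> P (n, z)"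
        and B': "B' \<in> sets noise" "measure noise B' \<le> r / 2" "\<forall>z. z \<notin> B' \<longrightarrow> Q (n, z)" by blast
      have "measure noise (B \<union> B') \<le> r" using measure_Un_le[OF B(1) B'(1)] B(2) B'(2) by simp
      with B B' show "off_small r (\<lambda>z. P (n, z) \<and> Q (n, z))"
        by blast
    qed
  qed
next
  fix P Q :: "nat \<times> observation \<Rightarrow> bool"
  assume PQ: "\<forall>x. P x \<longrightarrow> Q x"
    and P: "\<forall>r>0. \<forall>\<^sub>F n in sequentially. off_small r (\<lambda>z. P (n, z))"
  show "\<forall>r>0. \<forall>\<^sub>F n in sequentially. off_small r (\<lambda>z. Q (n, z))"
  by (smt (verit) allI impI P eventually_mono PQ)
qed

lemma whp_of_eventually:
  assumes "\<forall>\<^sub>F n in sequentially. AE z in noise. P (n, z)"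
  shows "eventually P whp"
  unfolding eventually_whp
proof (intro allI impI)
  fix r :: real assume r: "0 < r"
  show "\<forall>\<^sub>F n in sequentially. off_small r (\<lambda>z. P (n, z))"
    using assms
  proof eventually_elim
    fix n assume "AE z in noise. P (n, z)"
    then obtain N where N: "{z \<in> space noise. \<not> P (n, z)} \<subseteq> N" "N \<in> sets noise" "emeasure noise N = 0"
      by (auto elim: AE_E)
    then show "off_small r (\<lambda>z. P (n, z))"
      using r by (intro bexI[of _ N]) (auto simp: measure_def)
  qed
qed

lemma whp_sequentially:
  assumes "eventually P sequentially"
  shows "likely (\<lambda>n z. P n)"
  by (rule whp_of_eventually) (use assms in \<open>auto elim: eventually_mono\<close>)

lemma sqrt_nat_at_top: "filterlim (\<lambda>n. sqrt (real n)) at_top sequentially"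
  by (rule filterlim_compose[OF sqrt_at_top filterlim_real_sequentially])

text \<open>Markov's inequality: a mean of at most \<open>a n * b n\<close> lets the level
  \<open>a n\<close> be exceeded with probability at most \<open>b n\<close>.\<close>

lemma whp_markov:
  fixes X :: "nat \<Rightarrow> observation \<Rightarrow> ennreal"
  assumes X: "\<And>n. X n \<in> borel_measurable noise"
    and le: "\<forall>\<^sub>F n in sequentially. (\<integral>\<^sup>+z. X n z \<partial>noise) \<le> ennreal (a n * b n)"
    and a: "\<And>n. 0 < a n" and b: "b \<longlonglongrightarrow> 0"
  shows "likely (\<lambda>n z. X n z \<le> ennreal (a n))"
  unfolding eventually_whp
proof (intro allI impI)
  fix r :: real assume r: "0 < r"
  have "\<forall>\<^sub>F n in sequentially. b n < r" using b r by (rule order_tendstoD)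
  with le show "\<forall>\<^sub>F n in sequentially. off_small r (\<lambda>z. (case (n, z) of (n, z) \<Rightarrow> X n z \<le> ennreal (a n)))"
  proof eventually_elim
    fix n assume le: "(\<integral>\<^sup>+z. X n z \<partial>noise) \<le> ennreal (a n * b n)" and b: "b n < r"
    note X[measurable]
    let ?B = "{z. ennreal (a n) < X n z}"
    have B: "?B \<in> sets noise" by (intro sets_noise_Collect) measurable
    have "ennreal (a n) * emeasure noise ?B = (\<integral>\<^sup>+z. ennreal (a n) * indicator ?B z \<partial>noise)"
      using B by (subst nn_integral_cmult_indicator) auto
    also have "\<dots> \<le> (\<integral>\<^sup>+z. X n z \<partial>noise)"
      by (intro nn_integral_mono) (auto simp: indicator_def)
    also have "\<dots> \<le> ennreal (a n * r)"
      using le b a[of n] by (elim order_trans) (auto intro: ennreal_leI)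
    finally have "ennreal (a n * measure noise ?B) \<le> ennreal (a n * r)"
      using a[of n] by (simp add: noise.emeasure_eq_measure ennreal_mult)
    then have "measure noise ?B \<le> r"
      using a[of n] r by (simp)
    then show "off_small r (\<lambda>z. (case (n, z) of (n, z) \<Rightarrow> X n z \<le> ennreal (a n)))"
      using B by (auto)
  qed
qed

lemma tight_bound:
  fixes Y :: "observation \<Rightarrow> real"
  assumes [measurable]: "Y \<in> borel_measurable noise" and r: "0 < r"
  obtains \<beta> where "0 < \<beta>" "measure noise {z. \<bar>Y z\<bar> > \<beta>} \<le> r"
proof -
  have m: "{z. \<bar>Y z\<bar> > x} \<in> sets noise" for x
  proof -
    have "{z\<in>space noise. \<bar>Y z\<bar> > x} \<in> sets noise" by measurable
    then show ?thesis by simp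
  qed
  have "(\<lambda>n. measure noise {z. \<bar>Y z\<bar> > real n}) \<longlonglongrightarrow> measure noise (\<Inter>n. {z. \<bar>Y z\<bar> > real n})"
    using m by (intro noise.finite_Lim_measure_decseq) (auto simp: decseq_def)
  also have "(\<Inter>n. {z. \<bar>Y z\<bar> > real n}) = {}"
    by (auto) (meson less_asym reals_Archimedean2)
  finally have "\<forall>\<^sub>F n in sequentially. measure noise {z. \<bar>Y z\<bar> > real n} < r"
    using r by (intro order_tendstoD) auto
  then have "\<forall>\<^sub>F n in sequentially. 0 < n \<and> measure noise {z. \<bar>Y z\<bar> > real n} < r"
    using eventually_gt_at_top[of 0] by eventually_elim simp
  then obtain n where "0 < n" "measure noise {z. \<bar>Y z\<bar> > real n} < r" by (auto simp: eventually_sequentially)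
  then show ?thesis by (intro that[of "real n"]) auto
qed

text \<open>A random variable that does not depend on n is bounded by a constant up to small
  probability. This reduces statements with a random constant, the chaining constant or V, to a
  fixed bound \<open>\<beta>\<close>.\<close>

lemma whp_tight:
  fixes Y :: "observation \<Rightarrow> real"
  assumes Y [measurable]: "Y \<in> borel_measurable noise"
    and P: "\<And>\<beta>. 0 < \<beta> \<Longrightarrow> likely (\<lambda>n z. \<bar>Y z\<bar> \<le> \<beta> \<longrightarrow> P n z)"
  shows "likely (\<lambda>n z. P n z)"
  unfolding eventually_whp
proof (intro allI impI)
  fix r :: real assume r: "0 < r"
  obtain \<beta> where \<beta>: "0 < \<beta>" "measure noise {z. \<bar>Y z\<bar> > \<beta>} \<le> r / 2"
    using tight_bound[OF Y, of "r / 2"] r by auto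
  have m: "{z. \<bar>Y z\<bar> > \<beta>} \<in> sets noise"
  proof -
    have "{z\<in>space noise. \<bar>Y z\<bar> > \<beta>} \<in> sets noise" by measurable
    then show ?thesis by simp
  qed
  have "\<forall>\<^sub>F n in sequentially. off_small (r / 2) (\<lambda>z. \<bar>Y z\<bar> \<le> \<beta> \<longrightarrow> P n z)"
    using P[OF \<beta>(1), unfolded eventually_whp, rule_format, of "r / 2"] r by simp
  then show "\<forall>\<^sub>F n in sequentially. off_small r (\<lambda>z. (case (n, z) of (n, z) \<Rightarrow> P n z))"
  proof eventually_elim
    fix n assume "off_small (r / 2) (\<lambda>z. \<bar>Y z\<bar> \<le> \<beta> \<longrightarrow> P n z)"
    then obtain B where B: "B \<in> sets noise" "measure noise B \<le> r / 2" "\<And>z. z \<notin> B \<Longrightarrow> \<bar>Y z\<bar> \<le> \<beta> \<Longrightarrow> P n z" by blast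
    then have "measure noise (B \<union> {z. \<bar>Y z\<bar> > \<beta>}) \<le> r"
      using measure_Un_le[OF B(1) m] \<beta> by simp
    with B m show "off_small r (\<lambda>z. (case (n, z) of (n, z) \<Rightarrow> P n z))"
      by (intro bexI[of _ "B \<union> {z. \<bar>Y z\<bar> > \<beta>}"]) auto
  qed
qed

lemma whp_small_multiple:
  fixes Y :: "observation \<Rightarrow> real"
  assumes Y: "Y \<in> borel_measurable noise" and c: "c \<longlonglongrightarrow> 0" and r: "0 < r"
  shows "likely (\<lambda>n z. \<bar>Y z\<bar> * \<bar>c n\<bar> \<le> r)"
proof (rule whp_tight[OF Y])
  fix \<beta> :: real assume \<beta>: "0 < \<beta>"
  have "\<forall>\<^sub>F n in sequentially. \<bar>c n\<bar> < r / \<beta>"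
    using tendsto_rabs_zero[OF c] r \<beta> by (intro order_tendstoD) auto
  from whp_sequentially[OF this] show "\<forall>\<^sub>F (n, z) in whp. \<bar>Y z\<bar> \<le> \<beta> \<longrightarrow> \<bar>Y z\<bar> * \<bar>c n\<bar> \<le> r"
  proof eventually_elim
    case (elim nz)
    obtain n z where nz: "nz = (n, z)" by (cases nz)
    have "\<bar>Y z\<bar> * \<bar>c n\<bar> \<le> \<beta> * (r / \<beta>)" if "\<bar>Y z\<bar> \<le> \<beta>"
      using elim that by (intro mult_mono) (auto simp: nz)
    then show ?case using \<beta> by (simp add: nz)
  qed
qed

lemma whp_case_elim: "likely (\<lambda>n z. P n z) \<Longrightarrow> (\<And>n z. P n z \<Longrightarrow> Q n z) \<Longrightarrow> likely (\<lambda>n z. Q n z)"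
  by (auto elim: eventually_mono)

section \<open>Adjoints and the least favorable direction\<close>

lemma (in onb) norm_basis_sum_finite: "finite I \<Longrightarrow> (norm (\<Sum>k\<in>I. c k *\<^sub>R e k))\<^sup>2 = (\<Sum>k\<in>I. (c k)\<^sup>2)"
  unfolding power2_norm_eq_inner
  by (simp add: inner_sum_left inner_sum_right inner_basis power2_eq_square if_distrib cong: if_cong)

text \<open>\<open>adjoint\<close> is defined by choice, so a representing vector has to be
  exhibited. Its coefficients are those of the functional on the basis; they are square summable
  because the functional is bounded, and completeness sums the expansion.\<close>

lemma adjoint_blinfun:
  fixes e :: "nat \<Rightarrow> 'h::{real_inner,banach}" and A :: "'h \<Rightarrow>\<^sub>L 'h"
  assumes "orthonormal_basis e"
  shows "A x \<bullet> y = x \<bullet> adjoint A y"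
proof -
  interpret onb e by unfold_locales fact
  have ex: "\<exists>w. \<forall>x. A x \<bullet> y = x \<bullet> w" for y
  proof -
    define c where "c = (\<lambda>k. y \<bullet> A (e k))"
    have bound: "(\<Sum>k<N. (c k)\<^sup>2) \<le> (norm y * norm A)\<^sup>2" for N
    proof -
      let ?s = "\<Sum>k<N. c k *\<^sub>R e k"
      have ns: "(norm ?s)\<^sup>2 = (\<Sum>k<N. (c k)\<^sup>2)" by (rule norm_basis_sum)
      \<comment> \<open>Testing the functional on its own truncated representer bounds the norm of
        the latter independently of N.\<close>
      have "(norm ?s)\<^sup>2 = y \<bullet> A ?s"
        unfolding ns by (simp add: c_def blinfun.sum_right blinfun.scaleR_right inner_sum_right power2_eq_square)
      also have "\<dots> \<le> norm y * (norm A * norm ?s)"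
        by (rule order_trans[OF norm_cauchy_schwarz]) (intro mult_left_mono norm_blinfun norm_ge_zero)
      finally have "norm ?s * norm ?s \<le> (norm y * norm A) * norm ?s" by (simp add: power2_eq_square)
      then have "norm ?s \<le> norm y * norm A"
        by (auto simp: mult_le_cancel_right)
      then show ?thesis unfolding ns[symmetric] by auto
    qed
    have sc: "summable (\<lambda>k. (c k)\<^sup>2)"
      by (rule summableI_nonneg_bounded[OF _ bound]) simp
    have "summable (\<lambda>k. c k *\<^sub>R e k)"
      unfolding summable_Cauchy
    proof (intro allI impI)
      fix r :: real assume r: "0 < r"
      then obtain N where N: "\<And>m n. N \<le> m \<Longrightarrow> norm (\<Sum>k=m..<n. (c k)\<^sup>2) < r\<^sup>2"
        using sc[unfolded summable_Cauchy, rule_format, of "r\<^sup>2"] by auto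
      have "norm (\<Sum>k=m..<n. c k *\<^sub>R e k) < r" if "N \<le> m" for m n
      proof -
        have "(norm (\<Sum>k=m..<n. c k *\<^sub>R e k))\<^sup>2 < r\<^sup>2"
          using N[OF that, of n] unfolding norm_basis_sum_finite[OF finite_atLeastLessThan] real_norm_def by linarith
        then show ?thesis using r by (simp add: power_less_imp_less_base)
      qed
      then show "\<exists>N. \<forall>m\<ge>N. \<forall>n. norm (\<Sum>k=m..<n. c k *\<^sub>R e k) < r" by blast
    qed
    then obtain w where w: "(\<lambda>k. c k *\<^sub>R e k) sums w" by auto
    have "A x \<bullet> y = x \<bullet> w" for x
    proof (rule LIMSEQ_unique)
      have "(\<lambda>N. A (partial_expansion N x) \<bullet> y) \<longlonglongrightarrow> A x \<bullet> y"
        by (intro tendsto_intros partial_expansion_tendsto)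
      also have "(\<lambda>N. A (partial_expansion N x) \<bullet> y) = (\<lambda>N. x \<bullet> (\<Sum>k<N. c k *\<^sub>R e k))"
        by (simp add: partial_expansion_def blinfun.sum_right blinfun.scaleR_right inner_sum_left inner_sum_right c_def inner_commute[of y] mult.commute)
      finally show "(\<lambda>N. x \<bullet> (\<Sum>k<N. c k *\<^sub>R e k)) \<longlonglongrightarrow> A x \<bullet> y" .
      show "(\<lambda>N. x \<bullet> (\<Sum>k<N. c k *\<^sub>R e k)) \<longlonglongrightarrow> x \<bullet> w"
        using w unfolding sums_def by (intro tendsto_intros)
    qed
    then show ?thesis by blast
  qed
  then have "\<exists>g. \<forall>y x. A x \<bullet> y = x \<bullet> g y" by (intro choice) blast
  then show ?thesis using adjoint_unique by metis
qed

text \<open>The weak form of the normal equations: the efficient score is orthogonal to all nuisance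
  scores. \<open>least_favorable\<close> uses \<open>inv\<close>, so T has to be shown surjective.
  It is coercive and bounded, and a damped fixed point iteration for T x = y is a
  contraction.\<close>

lemma least_favorable_equation:
  fixes e :: "nat \<Rightarrow> 'h::{real_inner,banach}" and K Kd :: "real \<Rightarrow> 'h \<Rightarrow>\<^sub>L 'h" and \<theta> :: real and f :: 'h
  assumes e: "orthonormal_basis e"
  defines "\<gamma> \<equiv> least_favorable K Kd \<theta> f"
  shows "\<gamma> \<bullet> v + K \<theta> \<gamma> \<bullet> K \<theta> v = Kd \<theta> f \<bullet> K \<theta> v"
proof -
  let ?A = "K \<theta>"
  note adj = adjoint_blinfun[OF e]
  define T where "T = (\<lambda>h. h + adjoint ?A (?A h))"
  have T: "T h \<bullet> v = h \<bullet> v + ?A h \<bullet> ?A v" for h v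
  by (metis adj inner_commute T_def inner_add_left)
  have Tdiff: "T g - T h = T (g - h)" for g h
    by (rule vector_eq_rdot[THEN iffD1]) (simp add: T inner_diff_left blinfun.diff_right)
  define C where "C = 1 + (norm ?A)\<^sup>2"
  have C: "1 \<le> C" by (simp add: C_def)
  have Tn: "norm (T h) \<le> C * norm h" for h
  proof -
    have "(norm (T h))\<^sup>2 = h \<bullet> T h + ?A h \<bullet> ?A (T h)" unfolding power2_norm_eq_inner T ..
    also have "\<dots> \<le> norm h * norm (T h) + (norm ?A * norm h) * (norm ?A * norm (T h))"
    proof (rule add_mono[OF norm_cauchy_schwarz])
      show "?A h \<bullet> ?A (T h) \<le> (norm ?A * norm h) * (norm ?A * norm (T h))"
        by (rule order_trans[OF norm_cauchy_schwarz]) (intro mult_mono norm_blinfun, simp_all)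
    qed
    also have "\<dots> = (C * norm h) * norm (T h)" by (simp add: C_def algebra_simps power2_eq_square)
    finally have "norm (T h) * norm (T h) \<le> (C * norm h) * norm (T h)" by (simp add: power2_eq_square)
    then show ?thesis using C by (auto simp: mult_le_cancel_right)
  qed
  have ex: "\<exists>x. T x = y" for y
  proof -
    \<comment> \<open>The squared contraction factor is at most
      \<open>1 - 2 * w + w\<^sup>2 * C\<^sup>2\<close>; this w is its minimiser and turns it into 1
      - w.\<close>
    define w where "w = 1 / C\<^sup>2"
    define q where "q = sqrt (1 - w)"
    have w: "0 < w" "w \<le> 1" using C by (auto simp: w_def)
    have contr: "dist (g - w *\<^sub>R (T g - y)) (h - w *\<^sub>R (T h - y)) \<le> q * dist g h" for g h
    proof -
      let ?d = "g - h"
      have eq: "(g - w *\<^sub>R (T g - y)) - (h - w *\<^sub>R (T h - y)) = ?d - w *\<^sub>R T ?d"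
        by (simp add: Tdiff[symmetric] algebra_simps)
      have "(norm (?d - w *\<^sub>R T ?d))\<^sup>2 = (norm ?d)\<^sup>2 - 2 * w * (T ?d \<bullet> ?d) + w\<^sup>2 * (norm (T ?d))\<^sup>2"
        using inner_commute[of ?d "T ?d"] unfolding power2_norm_eq_inner power2_eq_square[of w]
        by (simp only: inner_diff_left inner_diff_right inner_scaleR_right) (simp add: algebra_simps)
      also have "\<dots> \<le> (norm ?d)\<^sup>2 - 2 * w * (norm ?d)\<^sup>2 + w\<^sup>2 * (C * norm ?d)\<^sup>2"
      proof (intro add_mono diff_mono mult_left_mono power_mono Tn)
        show "(norm ?d)\<^sup>2 \<le> T ?d \<bullet> ?d" unfolding T by (simp add: power2_norm_eq_inner)
      qed (use w in auto)
      also have "w\<^sup>2 * (C * norm ?d)\<^sup>2 = w * (norm ?d)\<^sup>2"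
        by (simp add: w_def power2_eq_square)
      finally have "(norm (?d - w *\<^sub>R T ?d))\<^sup>2 \<le> (1 - w) * (norm ?d)\<^sup>2" by (simp add: algebra_simps)
      also have "\<dots> = (q * norm ?d)\<^sup>2" using w by (simp add: q_def power_mult_distrib)
      finally have "norm (?d - w *\<^sub>R T ?d) \<le> q * norm ?d"
        by (rule power2_le_imp_le) (use w in \<open>simp add: q_def\<close>)
      moreover have "dist (g - w *\<^sub>R (T g - y)) (h - w *\<^sub>R (T h - y)) = norm (?d - w *\<^sub>R T ?d)"
        by (rule trans[OF dist_norm arg_cong[where f=norm, OF eq]])
      moreover have "dist g h = norm ?d" by (rule dist_norm)
      ultimately show ?thesis by simp
    qed
    have "q < 1" "0 \<le> q" using w by (auto simp: q_def)
    then obtain x where "x - w *\<^sub>R (T x - y) = x" using banach_fix_type[of q "\<lambda>g. g - w *\<^sub>R (T g - y)"] contr by blast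
    then have "T x = y" using w by auto
    then show "\<exists>x. T x = y" by blast
  qed
  have "surj T"
  by (metis surj_def ex)
  then have "T \<gamma> = adjoint ?A (Kd \<theta> f)"
    unfolding \<gamma>_def least_favorable_def T_def[symmetric] by (simp add: surj_f_inv_f)
  then show ?thesis
    using T[of \<gamma> v] adj[of ?A v "Kd \<theta> f"]
      inner_commute[of v "adjoint ?A (Kd \<theta> f)"] inner_commute[of "?A v" "Kd \<theta> f"] by simp
qed

text \<open>Pythagoras: expand the square and test the normal equations with v = \<gamma>. In this
  form the information appears in the expansion of the likelihood.\<close>

lemma efficient_information_eq:
  fixes e :: "nat \<Rightarrow> 'h::{real_inner,banach}" and K Kd :: "real \<Rightarrow> 'h \<Rightarrow>\<^sub>L 'h" and \<theta> :: real and f :: 'h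
  assumes e: "orthonormal_basis e"
  defines "\<gamma> \<equiv> least_favorable K Kd \<theta> f"
  shows "efficient_information K Kd \<theta> f = (norm (Kd \<theta> f))\<^sup>2 - (norm \<gamma>)\<^sup>2 - (norm (K \<theta> \<gamma>))\<^sup>2"
by (smt (verit) least_favorable_equation e \<gamma>_def power2_norm_eq_inner inner_diff_right inner_commute efficient_information_def)

lemma efficient_information_pos:
  fixes K Kd :: "real \<Rightarrow> 'h::real_inner \<Rightarrow>\<^sub>L 'h"
  assumes "Kd \<theta> f \<noteq> 0"
  shows "0 < efficient_information K Kd \<theta> f"
proof -
  have "least_favorable K Kd \<theta> f \<noteq> 0 \<or> Kd \<theta> f - K \<theta> (least_favorable K Kd \<theta> f) \<noteq> 0"
    using assms by (auto)
  then show ?thesis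
    unfolding efficient_information_def
    by (metis add_nonneg_pos add_pos_nonneg norm_eq_zero zero_le_power2 zero_less_power2)
qed

section \<open>The likelihood ratio\<close>

text \<open>The constant D bounds all operator constants at once. The element \<open>covop (l n)\<close> of the RKHS approximates the
  least favorable direction, and its squared RKHS norm \<open>cov (l n) (l n)\<close> is at most \<open>n (s n)\<^sup>2\<close>.\<close>

locale inverse_model = gaussian_basis \<pi> e
  for \<pi> :: "'h::{real_inner,banach,second_countable_topology} measure" and e +
  fixes \<Theta> :: "real set" and K :: "real \<Rightarrow> 'h \<Rightarrow>\<^sub>L 'h" and dK :: "'h \<Rightarrow>\<^sub>L 'h" and \<theta>0 :: real and f0 :: 'h
    and S :: "'h set" and nS :: "'h \<Rightarrow> real" and D :: real
    and \<epsilon> s :: "nat \<Rightarrow> real" and l :: "nat \<Rightarrow> 'h"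
  assumes Theta: "compact \<Theta>" "\<theta>0 \<in> interior \<Theta>"
    and D: "1 \<le> D"
    and K_bound: "\<And>\<theta> h. \<theta> \<in> \<Theta> \<Longrightarrow> norm (K \<theta> h) \<le> D * norm h"
    and K_continuous: "\<And>h. continuous_on \<Theta> (\<lambda>\<theta>. K \<theta> h)"
    and S_space: "normed_subspace S nS"
    and S_norm: "\<And>x. x \<in> S \<Longrightarrow> norm x \<le> D * nS x"
    and S_entropy: "(\<integral>\<^sup>+\<eta>\<in>{0..1}. sqrt_log (covering_number \<eta> {h \<in> S. nS h \<le> 1}) \<partial>lborel) < \<infinity>"
    and first_order: "\<And>\<theta> h. \<theta> \<in> \<Theta> \<Longrightarrow> K \<theta> h - K \<theta>0 h \<in> S"
      "\<And>\<theta> h. \<theta> \<in> \<Theta> \<Longrightarrow> nS (K \<theta> h - K \<theta>0 h) \<le> D * \<bar>\<theta> - \<theta>0\<bar> * norm h"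
    and second_order: "\<And>\<theta> h. \<theta> \<in> \<Theta> \<Longrightarrow> K \<theta> h - K \<theta>0 h - (\<theta> - \<theta>0) *\<^sub>R dK h \<in> S"
      "\<And>\<theta> h. \<theta> \<in> \<Theta> \<Longrightarrow> nS (K \<theta> h - K \<theta>0 h - (\<theta> - \<theta>0) *\<^sub>R dK h) \<le> D * (\<theta> - \<theta>0)\<^sup>2 * norm h"
    and identified: "\<And>\<theta>. \<theta> \<in> \<Theta> \<Longrightarrow> \<theta> \<noteq> \<theta>0 \<Longrightarrow> K \<theta> f0 \<noteq> K \<theta>0 f0"
    and eps: "\<And>n. 0 < \<epsilon> n" "\<epsilon> \<longlonglongrightarrow> 0" "filterlim (\<lambda>n. real n * (\<epsilon> n)\<^sup>2) at_top sequentially"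
    and small_ball: "\<And>n. 1 \<le> n \<Longrightarrow> exp (- (real n * (\<epsilon> n)\<^sup>2) - 1) \<le> measure \<pi> {f. norm f \<le> \<epsilon> n}"
      "\<And>n. 1 \<le> n \<Longrightarrow> exp (- (real n * (\<epsilon> n)\<^sup>2) - 1) \<le> measure \<pi> {f. norm (f - f0) \<le> 3 * \<epsilon> n}"
    and shift_size: "\<And>n. 0 < s n" "\<And>n. 1 \<le> n \<Longrightarrow> cov (l n) (l n) \<le> real n * (s n)\<^sup>2"
begin

abbreviation borel_Theta :: "real measure" where
  "borel_Theta \<equiv> restrict_space borel \<Theta>"

definition rate :: "nat \<Rightarrow> real" where
  "rate n = real n * (\<epsilon> n)\<^sup>2"

lemma theta0_in: "\<theta>0 \<in> \<Theta>"
  using Theta interior_subset by blast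

lemma rate_nonneg: "0 \<le> rate n"
  by (simp add: rate_def)

lemma rate_at_top: "filterlim rate at_top sequentially"
  unfolding rate_def using eps by simp

lemma exp_rate_tendsto: "0 < c \<Longrightarrow> (\<lambda>n. exp (- c * rate n)) \<longlonglongrightarrow> 0"
proof -
  assume c: "0 < c"
  have "filterlim (\<lambda>n. - c * rate n) at_bot sequentially"
    using filterlim_tendsto_pos_mult_at_top[OF tendsto_const c rate_at_top]
    by (simp add: filterlim_uminus_at_bot)
  then show ?thesis by (rule filterlim_compose[OF exp_at_bot])
qed

lemma K_diff_norm:
  assumes "\<theta> \<in> \<Theta>"
  shows "norm (K \<theta> h - K \<theta>0 h) \<le> D\<^sup>2 * \<bar>\<theta> - \<theta>0\<bar> * norm h"
proof -
  have "norm (K \<theta> h - K \<theta>0 h) \<le> D * (D * \<bar>\<theta> - \<theta>0\<bar> * norm h)"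
    using S_norm[OF first_order(1)[OF assms]] mult_left_mono[OF first_order(2)[OF assms, of h], of D] D
    by (smt)
  then show ?thesis by (simp add: power2_eq_square)
qed

text \<open>For fixed h, \<open>K \<theta> h\<close> is continuous in \<open>\<theta>\<close>; a
  random h is reached through its partial expansions, in which K acts on the fixed vectors
  \<open>e k\<close> only.\<close>

lemma K_measurable [measurable (raw)]:
  assumes [measurable]: "t \<in> measurable M borel_Theta" "f \<in> borel_measurable M"
  shows "(\<lambda>x. K (t x) (f x)) \<in> borel_measurable M"
proof (rule borel_measurable_LIMSEQ_metric)
  fix N
  have "(\<lambda>\<theta>. K \<theta> h) \<in> borel_measurable borel_Theta" for h
    using borel_measurable_continuous_on_restrict[OF K_continuous] .
  note this[measurable]
  have "(\<lambda>x. K (t x) (partial_expansion N (f x))) = (\<lambda>x. \<Sum>k<N. (f x \<bullet> e k) *\<^sub>R K (t x) (e k))"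
    by (simp add: partial_expansion_def blinfun.sum_right blinfun.scaleR_right)
  also have "\<dots> \<in> borel_measurable M" by measurable
  finally show "(\<lambda>x. K (t x) (partial_expansion N (f x))) \<in> borel_measurable M" .
next
  fix x
  show "(\<lambda>N. K (t x) (partial_expansion N (f x))) \<longlonglongrightarrow> K (t x) (f x)"
    by (intro tendsto_intros partial_expansion_tendsto)
qed

definition resid :: "real \<Rightarrow> 'h \<Rightarrow> 'h" where
  "resid \<theta> f = K \<theta> f - K \<theta>0 f0"

text \<open>The log likelihood ratio of \<open>(\<theta>, f)\<close> against the true
  \<open>(\<theta>0, f0)\<close> as a function of the noise: the signals enter through their
  differences from the truth.\<close>

definition ell :: "nat \<Rightarrow> observation \<Rightarrow> real \<Rightarrow> 'h \<Rightarrow> real" where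
  "ell n z \<theta> f = (sqrt (real n) * pairing e (fst z) (f - f0) - real n / 2 * (norm (f - f0))\<^sup>2)
     + (sqrt (real n) * pairing e (snd z) (resid \<theta> f) - real n / 2 * (norm (resid \<theta> f))\<^sup>2)"

abbreviation lr :: "nat \<Rightarrow> observation \<Rightarrow> real \<Rightarrow> 'h \<Rightarrow> ennreal" where
  "lr n z \<theta> f \<equiv> ennreal (exp (ell n z \<theta> f))"

lemma resid_measurable [measurable (raw)]:
  assumes [measurable]: "t \<in> measurable M borel_Theta" "f \<in> borel_measurable M"
  shows "(\<lambda>x. resid (t x) (f x)) \<in> borel_measurable M"
  unfolding resid_def by measurable

lemma fst_noise_measurable: "z \<in> measurable M noise \<Longrightarrow> (\<lambda>x. fst (z x)) \<in> measurable M white_seq"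
  and snd_noise_measurable: "z \<in> measurable M noise \<Longrightarrow> (\<lambda>x. snd (z x)) \<in> measurable M white_seq"
  unfolding noise_eq by (auto)

lemma ell_measurable [measurable (raw)]:
  assumes z: "z \<in> measurable M noise" and t [measurable]: "t \<in> measurable M borel_Theta" and f [measurable]: "f \<in> borel_measurable M"
  shows "(\<lambda>x. ell n (z x) (t x) (f x)) \<in> borel_measurable M"
by (simp add: fst_noise_measurable z measurable snd_noise_measurable ell_def)

lemma nn_integral_exp_pairing:
  "(\<integral>\<^sup>+z. ennreal (exp (c * pairing e z h - c\<^sup>2 / 2 * (norm h)\<^sup>2)) \<partial>white_seq) = 1"
proof -
  have "(\<integral>\<^sup>+z. ennreal (exp (c * pairing e z h - c\<^sup>2 / 2 * (norm h)\<^sup>2)) \<partial>white_seq)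
     = (\<integral>\<^sup>+z. ennreal (exp (- (c\<^sup>2 / 2 * (norm h)\<^sup>2))) * ennreal (exp (c * pairing e z h)) \<partial>white_seq)"
    by (simp add: ennreal_mult[symmetric] exp_add[symmetric])
  also have "\<dots> = ennreal (exp (- (c\<^sup>2 / 2 * (norm h)\<^sup>2))) * ennreal (exp (c\<^sup>2 * (norm h)\<^sup>2 / 2))"
    by (subst nn_integral_cmult) (auto simp: mgf_pairing)
  also have "\<dots> = 1" by (simp add: ennreal_mult[symmetric] exp_add[symmetric])
  finally show ?thesis .
qed

lemma nn_integral_ell: "(\<integral>\<^sup>+z. lr n z \<theta> f \<partial>noise) = 1"
proof -
  let ?F = "\<lambda>h z. ennreal (exp (sqrt (real n) * pairing e z h - real n / 2 * (norm h)\<^sup>2))"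
  have F: "(\<integral>\<^sup>+z. ?F h z \<partial>white_seq) = 1" for h
    using nn_integral_exp_pairing[of "sqrt (real n)" h] by simp
  have "(\<integral>\<^sup>+z. lr n z \<theta> f \<partial>noise) = (\<integral>\<^sup>+z. ?F (f - f0) (fst z) * ?F (resid \<theta> f) (snd z) \<partial>noise)"
    by (simp add: ell_def exp_add ennreal_mult)
  also have "\<dots> = 1"
    by (subst nn_integral_noise_mult[where F="?F (f - f0)" and G="?F (resid \<theta> f)"]) (simp_all only: F, auto)
  finally show ?thesis .
qed

end

text \<open>The prior of \<open>\<theta>\<close> is kept abstract so that the contraction results
  serve both \<open>theta_prior \<Theta> p\<close> and the point mass at
  \<open>\<theta>0\<close>.\<close>

locale model_prior = inverse_model +
  fixes \<eta> :: "real measure"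
  assumes prob_eta: "prob_space \<eta>" and sets_eta [measurable_cong]: "sets \<eta> = sets (restrict_space borel \<Theta>)"
    and eta_mass: "\<exists>c. \<forall>\<^sub>F n in sequentially. exp (- c * (real n * (\<epsilon> n)\<^sup>2)) \<le> measure \<eta> {\<theta> \<in> \<Theta>. \<bar>\<theta> - \<theta>0\<bar> \<le> \<epsilon> n}"
begin

lemma space_eta: "space \<eta> = \<Theta>"
  using sets_eq_imp_space_eq[OF sets_eta] by (simp add: space_restrict_space)

interpretation eta: prob_space \<eta> by (rule prob_eta)

definition Q :: "(real \<times> 'a) measure" where "Q = \<eta> \<Otimes>\<^sub>M \<pi>"

lemma sets_Q [measurable_cong]: "sets Q = sets (borel_Theta \<Otimes>\<^sub>M borel)"
  unfolding Q_def by (intro sets_pair_measure_cong sets_eta sets_pi)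

lemma space_Q: "space Q = \<Theta> \<times> UNIV"
  by (simp add: Q_def space_pair_measure space_eta)

sublocale Q: prob_space Q
  unfolding Q_def by (intro prob_space_pair prob_eta prob_space_axioms)

sublocale NQ: pair_prob_space noise Q
  by unfold_locales

definition evid :: "nat \<Rightarrow> (real \<times> 'a \<Rightarrow> bool) \<Rightarrow> observation \<Rightarrow> ennreal" where
  "evid n P z = (\<integral>\<^sup>+q. indicator {q. P q} q * lr n z (fst q) (snd q) \<partial>Q)"

abbreviation total :: "nat \<Rightarrow> observation \<Rightarrow> ennreal" where
  "total n \<equiv> evid n (\<lambda>_. True)"

lemma fst_Q_measurable [measurable (raw)]: "q \<in> measurable M Q \<Longrightarrow> (\<lambda>x. fst (q x)) \<in> measurable M borel_Theta"
  and snd_Q_measurable [measurable (raw)]: "q \<in> measurable M Q \<Longrightarrow> (\<lambda>x. snd (q x)) \<in> borel_measurable M"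
  by (auto simp: measurable_cong_sets[OF refl sets_Q])

lemma ell_NQ_measurable [measurable]: "(\<lambda>p. ell n (fst p) (fst (snd p)) (snd (snd p))) \<in> borel_measurable (noise \<Otimes>\<^sub>M Q)"
  by simp

lemma ell_Q_measurable [measurable]: "(\<lambda>q. ell n z (fst q) (snd q)) \<in> borel_measurable Q"
  by simp

lemma evid_measurable [measurable]:
  assumes [measurable]: "Measurable.pred Q P"
  shows "evid n P \<in> borel_measurable noise"
  unfolding evid_def by measurable

lemma evid_mono:
  "(\<And>q. q \<in> space Q \<Longrightarrow> P q \<Longrightarrow> P' q) \<Longrightarrow> evid n P z \<le> evid n P' z"
  unfolding evid_def by (intro nn_integral_mono) (auto simp: indicator_def)

lemma evid_disj_le:
  assumes [measurable]: "Measurable.pred Q P" "Measurable.pred Q P'"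
  shows "evid n (\<lambda>q. P q \<or> P' q) z \<le> evid n P z + evid n P' z"
  unfolding evid_def
  by (subst nn_integral_add[symmetric]) (auto intro: nn_integral_mono simp: indicator_def)

text \<open>The weight w will be the indicator of a noise event, so that means of evidences can be
  taken on this event only.\<close>

lemma tonelli_evid:
  assumes [measurable]: "Measurable.pred Q P" "w \<in> borel_measurable noise"
  shows "(\<integral>\<^sup>+z. w z * evid n P z \<partial>noise)
     = (\<integral>\<^sup>+q. indicator {q. P q} q * (\<integral>\<^sup>+z. w z * lr n z (fst q) (snd q) \<partial>noise) \<partial>Q)"
proof -
  have "(\<integral>\<^sup>+z. w z * evid n P z \<partial>noise)
      = (\<integral>\<^sup>+z. \<integral>\<^sup>+q. w z * (indicator {q. P q} q * lr n z (fst q) (snd q)) \<partial>Q \<partial>noise)"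
    unfolding evid_def by (subst nn_integral_cmult) auto
  also have "\<dots> = (\<integral>\<^sup>+q. \<integral>\<^sup>+z. w z * (indicator {q. P q} q * lr n z (fst q) (snd q)) \<partial>noise \<partial>Q)"
    by (rule NQ.Fubini'[symmetric]) measurable
  also have "\<dots> = (\<integral>\<^sup>+q. indicator {q. P q} q * (\<integral>\<^sup>+z. w z * lr n z (fst q) (snd q) \<partial>noise) \<partial>Q)"
  proof (intro nn_integral_cong)
    fix q assume "q \<in> space Q"
    then have [measurable]: "(\<lambda>z. ell n z (fst q) (snd q)) \<in> borel_measurable noise"
      by simp
    show "(\<integral>\<^sup>+z. w z * (indicator {q. P q} q * lr n z (fst q) (snd q)) \<partial>noise)
      = indicator {q. P q} q * (\<integral>\<^sup>+z. w z * lr n z (fst q) (snd q) \<partial>noise)"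
      by (subst nn_integral_cmult[symmetric]) (auto simp: mult_ac)
  qed
  finally show ?thesis .
qed

lemma nn_integral_evid:
  assumes [measurable]: "Measurable.pred Q P"
  shows "(\<integral>\<^sup>+z. evid n P z \<partial>noise) = emeasure Q {q \<in> space Q. P q}"
proof -
  have "(\<integral>\<^sup>+z. evid n P z \<partial>noise) = (\<integral>\<^sup>+q. indicator {q. P q} q \<partial>Q)"
    using tonelli_evid[OF assms, of "\<lambda>_. 1" n] by (simp add: nn_integral_ell)
  also have "\<dots> = (\<integral>\<^sup>+q. indicator {q \<in> space Q. P q} q \<partial>Q)"
    by (intro nn_integral_cong) (auto simp: indicator_def)
  finally show ?thesis by simp
qed

lemma AE_evid_finite: "AE z in noise. evid n P z \<noteq> \<infinity>"
proof -
  have "(\<integral>\<^sup>+z. total n z \<partial>noise) \<noteq> \<infinity>"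
    by (subst nn_integral_evid) (auto)
  then have "AE z in noise. total n z \<noteq> \<infinity>"
    by (intro nn_integral_PInf_AE) measurable
  then show ?thesis
  proof eventually_elim
    fix z assume "total n z \<noteq> \<infinity>"
    then show "evid n P z \<noteq> \<infinity>"
      using evid_mono[of P "\<lambda>_. True" n z] by (auto simp: top_unique)
  qed
qed

text \<open>Fubini for null sets. It turns properties that hold almost surely for each fixed vector,
  such as membership in \<open>paired\<close> or the chaining bound, into properties at almost every
  parameter for almost every noise.\<close>

lemma AE_noise_Q:
  assumes "Measurable.pred (noise \<Otimes>\<^sub>M Q) (\<lambda>p. R (fst p) (snd p))"
    and "\<And>q. q \<in> space Q \<Longrightarrow> AE z in noise. R z q"
  shows "AE z in noise. AE q in Q. R z q"
  using assms by (subst NQ.AE_commute) (auto)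

end

section \<open>Posterior contraction\<close>

context inverse_model
begin

text \<open>The function \<open>half_evidence\<close> has mean one and, by rotation invariance of the Gaussian prior, its square
  is a multiple of \<open>tempered_evidence\<close>. The resulting bound on \<open>tempered_evidence\<close> replaces sieves and entropy
  bounds in the contraction argument.\<close>

definition half_evidence :: "nat \<Rightarrow> 'h \<Rightarrow> (nat \<Rightarrow> real) \<Rightarrow> ennreal" where
  "half_evidence n v z = (\<integral>\<^sup>+f. ennreal (exp (sqrt (real n / 2) * pairing e z (f - v) - real n / 4 * (norm (f - v))\<^sup>2)) \<partial>\<pi>)"

definition tempered_evidence :: "nat \<Rightarrow> (nat \<Rightarrow> real) \<Rightarrow> ennreal" where
  "tempered_evidence n z = (\<integral>\<^sup>+f. ennreal (exp (sqrt (real n) * pairing e z (f - f0) - real n / 4 * (norm (f - f0))\<^sup>2)) \<partial>\<pi>)"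

definition small_ball_transform :: "nat \<Rightarrow> ennreal" where
  "small_ball_transform n = (\<integral>\<^sup>+f. ennreal (exp (- (real n / 4 * (norm f)\<^sup>2))) \<partial>\<pi>)"

lemma half_evidence_measurable [measurable]: "half_evidence n v \<in> borel_measurable white_seq"
proof -
  show ?thesis unfolding half_evidence_def by measurable
qed

lemma tempered_evidence_measurable [measurable]: "tempered_evidence n \<in> borel_measurable white_seq"
proof -
  show ?thesis unfolding tempered_evidence_def by measurable
qed

lemma nn_integral_half_evidence: "(\<integral>\<^sup>+z. half_evidence n v z \<partial>white_seq) = 1"
proof -
  interpret wp: pair_prob_space white_seq \<pi> ..
  have "(\<integral>\<^sup>+z. half_evidence n v z \<partial>white_seq)
      = (\<integral>\<^sup>+f. \<integral>\<^sup>+z. ennreal (exp (sqrt (real n / 2) * pairing e z (f - v) - real n / 4 * (norm (f - v))\<^sup>2)) \<partial>white_seq \<partial>\<pi>)"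
    unfolding half_evidence_def by (rule wp.Fubini'[symmetric]) measurable
  also have "\<dots> = (\<integral>\<^sup>+f. 1 \<partial>\<pi>)"
    using nn_integral_exp_pairing[of "sqrt (real n / 2)"] by simp
  finally show ?thesis using emeasure_space_1 by simp
qed

lemma AE_white_paired: "AE z in white_seq. AE f in \<pi>. f \<in> paired z"
proof -
  interpret wp: pair_prob_space white_seq \<pi> ..
  have "Measurable.pred (white_seq \<Otimes>\<^sub>M \<pi>) (\<lambda>p. snd p \<in> paired (fst p))"
    by (rule paired_measurable) measurable
  then show ?thesis
    by (subst wp.AE_commute) (auto simp: pred_def AE_paired)
qed

lemma half_evidence_square:
  "AE z in white_seq. (half_evidence n (f0 /\<^sub>R sqrt 2) z)\<^sup>2 = tempered_evidence n z * small_ball_transform n"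
  using AE_white_paired AE_paired[of f0]
proof eventually_elim
  fix z assume AEf: "AE f in \<pi>. f \<in> paired z" and pf0: "f0 \<in> paired z"
  interpret pp: pair_prob_space \<pi> \<pi> ..
  \<comment> \<open>With this centre, x - v and y - v sum to sqrt 2 times u - f0, where u is the
    first component of \<open>rotate\<close>, while their difference does not see the
    centre.\<close>
  let ?v = "f0 /\<^sub>R sqrt 2"
  define h where "h = (\<lambda>f. ennreal (exp (sqrt (real n / 2) * pairing e z (f - ?v) - real n / 4 * (norm (f - ?v))\<^sup>2)))"
  define F where "F = (\<lambda>f. ennreal (exp (sqrt (real n) * pairing e z (f - f0) - real n / 4 * (norm (f - f0))\<^sup>2)))"
  define g where "g = (\<lambda>f::'h. ennreal (exp (- (real n / 4 * (norm f)\<^sup>2))))"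
  have [measurable]: "h \<in> borel_measurable \<pi>" "F \<in> borel_measurable \<pi>" "g \<in> borel_measurable \<pi>"
    unfolding h_def F_def g_def by measurable
  have pv: "?v \<in> paired z" by (rule paired_scaleR[OF pf0])
  have eq: "h x * h y = F (fst (rotate (x, y))) * g (snd (rotate (x, y)))"
    if x: "x \<in> paired z" and y: "y \<in> paired z" for x y
  proof -
    define u where "u = (x + y) /\<^sub>R sqrt 2"
    define w where "w = (x - y) /\<^sub>R sqrt 2"
    have ru: "fst (rotate (x, y)) = u" "snd (rotate (x, y)) = w" by (simp_all add: rotate_def u_def w_def)
    have pu: "u \<in> paired z" unfolding u_def by (intro paired_scaleR paired_add x y)
    have xv: "x - ?v \<in> paired z" "y - ?v \<in> paired z" by (intro paired_diff x y pv)+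
    have s1: "(x - ?v) + (y - ?v) = sqrt 2 *\<^sub>R (u - f0)"
    proof -
      have "sqrt 2 *\<^sub>R u = x + y" by (simp add: u_def)
      moreover have "?v + ?v = sqrt 2 *\<^sub>R f0"
      proof -
        have "?v + ?v = (2 / sqrt 2) *\<^sub>R f0" by (simp add: scaleR_2[symmetric] divide_inverse)
        also have "2 / sqrt 2 = sqrt 2" by (simp add: real_div_sqrt)
        finally show ?thesis .
      qed
      ultimately show ?thesis by (simp add: algebra_simps)
    qed
    have s2: "(x - ?v) - (y - ?v) = sqrt 2 *\<^sub>R w" by (simp add: w_def)
    have par: "(norm (x - ?v))\<^sup>2 + (norm (y - ?v))\<^sup>2 = (norm (u - f0))\<^sup>2 + (norm w)\<^sup>2"
    proof -
      have "(norm (a + b))\<^sup>2 + (norm (a - b))\<^sup>2 = 2 * ((norm a)\<^sup>2 + (norm b)\<^sup>2)" for a b :: 'h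
        by (simp add: power2_norm_eq_inner inner_add_left inner_add_right inner_diff_left inner_diff_right)
      from this[of "x - ?v" "y - ?v"] show ?thesis
        unfolding s1 s2 by (simp add: power_mult_distrib)
    qed
    have "pairing e z (x - ?v) + pairing e z (y - ?v) = sqrt 2 * pairing e z (u - f0)"
      using pairing_add[OF xv] pairing_scaleR[OF paired_diff[OF pu pf0], of "sqrt 2"] s1 by simp
    then have p: "sqrt (real n / 2) * pairing e z (x - ?v) + sqrt (real n / 2) * pairing e z (y - ?v) = sqrt (real n) * pairing e z (u - f0)"
    proof -
      assume "pairing e z (x - ?v) + pairing e z (y - ?v) = sqrt 2 * pairing e z (u - f0)"
      then have "sqrt (real n / 2) * (pairing e z (x - ?v) + pairing e z (y - ?v)) = sqrt (real n / 2) * sqrt 2 * pairing e z (u - f0)"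
        by simp
      also have "sqrt (real n / 2) * sqrt 2 = sqrt (real n)" by (simp add: real_sqrt_divide)
      finally show ?thesis by (simp only: distrib_left)
    qed
    have "(sqrt (real n / 2) * pairing e z (x - ?v) - real n / 4 * (norm (x - ?v))\<^sup>2)
        + (sqrt (real n / 2) * pairing e z (y - ?v) - real n / 4 * (norm (y - ?v))\<^sup>2)
        = (sqrt (real n) * pairing e z (u - f0) - real n / 4 * (norm (u - f0))\<^sup>2) + (- (real n / 4 * (norm w)\<^sup>2))"
      using p arg_cong[OF par, of "\<lambda>x. real n / 4 * x"] by (simp add: algebra_simps)
    then show ?thesis
      unfolding h_def F_def g_def ru by (simp add: ennreal_mult[symmetric] exp_add[symmetric])
  qed
  have AE2: "AE p in \<pi> \<Otimes>\<^sub>M \<pi>. fst p \<in> paired z \<and> snd p \<in> paired z"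
  proof (rule pp.AE_pair_measure)
    have "Measurable.pred (\<pi> \<Otimes>\<^sub>M \<pi>) (\<lambda>p. fst p \<in> paired z)" "Measurable.pred (\<pi> \<Otimes>\<^sub>M \<pi>) (\<lambda>p. snd p \<in> paired z)"
      by (rule paired_measurable; auto)+
    then show "{p \<in> space (\<pi> \<Otimes>\<^sub>M \<pi>). fst p \<in> paired z \<and> snd p \<in> paired z} \<in> sets (\<pi> \<Otimes>\<^sub>M \<pi>)"
      by (simp only: pred_def[symmetric] pred_intros_logic)
    show "AE x in \<pi>. AE y in \<pi>. fst (x, y) \<in> paired z \<and> snd (x, y) \<in> paired z"
      using AEf by (use AEf in simp)
  qed
  have "(\<integral>\<^sup>+f. h f \<partial>\<pi>)\<^sup>2 = (\<integral>\<^sup>+x. \<integral>\<^sup>+y. h x * h y \<partial>\<pi> \<partial>\<pi>)"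
    by (simp add: nn_integral_cmult nn_integral_multc power2_eq_square)
  also have "\<dots> = (\<integral>\<^sup>+p. h (fst p) * h (snd p) \<partial>(\<pi> \<Otimes>\<^sub>M \<pi>))"
    by (subst nn_integral_fst[symmetric]) auto
  also have "\<dots> = (\<integral>\<^sup>+p. F (fst (rotate p)) * g (snd (rotate p)) \<partial>(\<pi> \<Otimes>\<^sub>M \<pi>))"
  proof (rule nn_integral_cong_AE)
    show "AE p in \<pi> \<Otimes>\<^sub>M \<pi>. h (fst p) * h (snd p) = F (fst (rotate p)) * g (snd (rotate p))"
      using AE2 eq by auto
  qed
  also have "\<dots> = (\<integral>\<^sup>+p. F (fst p) * g (snd p) \<partial>(\<pi> \<Otimes>\<^sub>M \<pi>))"
    by (rule nn_integral_rotate[of "\<lambda>p. F (fst p) * g (snd p)"]) measurable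
  also have "\<dots> = (\<integral>\<^sup>+x. \<integral>\<^sup>+y. F x * g y \<partial>\<pi> \<partial>\<pi>)"
    by (subst nn_integral_fst[symmetric]) auto
  also have "\<dots> = (\<integral>\<^sup>+f. F f \<partial>\<pi>) * (\<integral>\<^sup>+f. g f \<partial>\<pi>)"
    by (simp add: nn_integral_cmult nn_integral_multc)
  finally show "(half_evidence n ?v z)\<^sup>2 = tempered_evidence n z * small_ball_transform n"
    unfolding half_evidence_def tempered_evidence_def small_ball_transform_def h_def F_def g_def .
qed

text \<open>On the ball of radius \<open>\<epsilon> n\<close> the integrand is at least
  \<open>exp (- rate n / 4)\<close>, and the ball has mass at least
  \<open>exp (- rate n - 1)\<close>.\<close>

lemma small_ball_transform_ge:
  assumes "1 \<le> n"
  shows "ennreal (exp (- (5 / 4) * rate n - 1)) \<le> small_ball_transform n"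
proof -
  let ?B = "{f::'h. norm f \<le> \<epsilon> n}"
  have "ennreal (exp (- (5 / 4) * rate n - 1)) = ennreal (exp (- (real n / 4 * (\<epsilon> n)\<^sup>2))) * ennreal (exp (- rate n - 1))"
    by (simp add: rate_def ennreal_mult[symmetric] exp_add[symmetric])
  also have "\<dots> \<le> ennreal (exp (- (real n / 4 * (\<epsilon> n)\<^sup>2))) * emeasure \<pi> ?B"
    using small_ball[OF assms] by (intro mult_left_mono) (auto simp: emeasure_eq_measure rate_def)
  also have "\<dots> = (\<integral>\<^sup>+f. ennreal (exp (- (real n / 4 * (\<epsilon> n)\<^sup>2))) * indicator ?B f \<partial>\<pi>)"
    by (subst nn_integral_cmult_indicator) auto
  also have "\<dots> \<le> small_ball_transform n"
    unfolding small_ball_transform_def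
    by (intro nn_integral_mono) (auto simp: indicator_def mult_left_mono power_mono)
  finally show ?thesis .
qed

text \<open>Markov's inequality gives \<open>half_evidence\<close> at most
  \<open>exp (rate n)\<close>, hence its square at most \<open>exp (2 * rate n)\<close>. Dividing by
  \<open>small_ball_transform\<close>, which is at least
  \<open>exp (- (5 / 4) * rate n - 1)\<close>, leaves an exponent below
  \<open>5 * rate n\<close>.\<close>

lemma whp_tempered_evidence: "likely (\<lambda>n z. tempered_evidence n (fst z) \<le> ennreal (exp (5 * rate n)))"
proof -
  have "likely (\<lambda>n z. half_evidence n (f0 /\<^sub>R sqrt 2) (fst z) \<le> ennreal (exp (rate n)))"
  proof (rule whp_markov[where b="\<lambda>n. exp (- 1 * rate n)"])
    show "(\<lambda>z. half_evidence n (f0 /\<^sub>R sqrt 2) (fst z)) \<in> borel_measurable noise" for n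
      by simp
    have "(\<integral>\<^sup>+z. half_evidence n (f0 /\<^sub>R sqrt 2) (fst z) \<partial>noise) = 1" for n
      using nn_integral_noise_mult[of "half_evidence n (f0 /\<^sub>R sqrt 2)" "\<lambda>_. 1"] white.emeasure_space_1
      by (simp add: nn_integral_half_evidence)
    then show "\<forall>\<^sub>F n in sequentially. (\<integral>\<^sup>+z. half_evidence n (f0 /\<^sub>R sqrt 2) (fst z) \<partial>noise) \<le> ennreal (exp (rate n) * exp (- 1 * rate n))"
      by (simp add: exp_minus)
    show "(\<lambda>n. exp (- 1 * rate n)) \<longlonglongrightarrow> 0" by (rule exp_rate_tendsto) simp
  qed simp
  moreover have "likely (\<lambda>n z. (half_evidence n (f0 /\<^sub>R sqrt 2) (fst z))\<^sup>2 = tempered_evidence n (fst z) * small_ball_transform n)"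
    by (rule whp_of_eventually) (auto intro!: always_eventually AE_noise_fst half_evidence_square)
  moreover have "likely (\<lambda>n z. 1 \<le> n \<and> 4 \<le> rate n)"
    using rate_at_top
    by (intro whp_sequentially eventually_conj) (auto simp: filterlim_at_top)
  ultimately show ?thesis
  proof eventually_elim
    case (elim nz)
    obtain n z where nz: "nz = (n, z)" by (cases nz)
    have n: "1 \<le> n" "4 \<le> rate n" and h: "half_evidence n (f0 /\<^sub>R sqrt 2) (fst z) \<le> ennreal (exp (rate n))"
      and sq: "(half_evidence n (f0 /\<^sub>R sqrt 2) (fst z))\<^sup>2 = tempered_evidence n (fst z) * small_ball_transform n"
      using elim by (auto simp: nz)
    have "tempered_evidence n (fst z) * ennreal (exp (- (5 / 4) * rate n - 1)) \<le> tempered_evidence n (fst z) * small_ball_transform n"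
      by (intro mult_left_mono small_ball_transform_ge n) simp
    also have "\<dots> \<le> (ennreal (exp (rate n)))\<^sup>2" unfolding sq[symmetric] by (intro power_mono h) simp
    also have "\<dots> = ennreal (exp (2 * rate n))" by (simp add: ennreal_power exp_double)
    finally have "tempered_evidence n (fst z) * ennreal (exp (- (5 / 4) * rate n - 1)) * ennreal (exp (5 / 4 * rate n + 1))
        \<le> ennreal (exp (2 * rate n)) * ennreal (exp (5 / 4 * rate n + 1))"
      by (rule mult_right_mono) simp
    also have "tempered_evidence n (fst z) * ennreal (exp (- (5 / 4) * rate n - 1)) * ennreal (exp (5 / 4 * rate n + 1)) = tempered_evidence n (fst z)"
      by (simp add: mult.assoc ennreal_mult[symmetric] exp_add[symmetric])
    also have "ennreal (exp (2 * rate n)) * ennreal (exp (5 / 4 * rate n + 1)) \<le> ennreal (exp (5 * rate n))"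
      using n by (simp add: ennreal_mult[symmetric] exp_add[symmetric])
    finally show ?case by (simp add: nz)
  qed
qed

end

section \<open>Evidence bound and contraction of f and of theta\<close>

context model_prior
begin

interpretation eta: prob_space \<eta> by (rule prob_eta)

lemma emeasure_Q_prod:
  assumes A: "A \<in> sets \<eta>" and B: "B \<in> sets \<pi>"
  shows "emeasure Q {q \<in> space Q. fst q \<in> A \<and> snd q \<in> B} = ennreal (measure \<eta> A * measure \<pi> B)"
proof -
  have "{q \<in> space Q. fst q \<in> A \<and> snd q \<in> B} = A \<times> B"
    using sets.sets_into_space[OF A] by (auto simp: space_Q space_eta)
  then show ?thesis
    using emeasure_pair_measure_Times[OF A B] by (simp add: Q_def eta.emeasure_eq_measure emeasure_eq_measure ennreal_mult)
qed

lemma measure_Q_prod: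
  assumes "A \<in> sets \<eta>" "B \<in> sets \<pi>"
  shows "measure Q {q \<in> space Q. fst q \<in> A \<and> snd q \<in> B} = measure \<eta> A * measure \<pi> B"
  using emeasure_Q_prod[OF assms] by (simp add: Q.emeasure_eq_measure)

text \<open>On the prior neighbourhood B the deterministic part of \<open>ell\<close> is of order
  \<open>rate n\<close>. The noise part exceeds that order only at bad parameters, whose expected
  prior mass is a vanishing fraction of that of B, so at least half of the mass of B
  contributes.\<close>

lemma evidence_lower_bound:
  "\<exists>C. likely (\<lambda>n z. ennreal (exp (- C * rate n)) \<le> total n z)"
proof -
  obtain c where c: "\<forall>\<^sub>F n in sequentially. exp (- c * rate n) \<le> measure \<eta> {\<theta> \<in> \<Theta>. \<bar>\<theta> - \<theta>0\<bar> \<le> \<epsilon> n}"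
    using eta_mass unfolding rate_def by blast
  \<comment> \<open>Bounds both signal differences on B in units of \<open>\<epsilon> n\<close>: f -
    f0 by 3, and \<open>resid\<close> by \<open>3 * D\<close> from f - f0 plus
    \<open>D\<^sup>2 * norm f0\<close> from the change of \<open>\<theta>\<close>.\<close>
  define c1 where "c1 = 3 + D\<^sup>2 * norm f0 + 3 * D"
  have c1: "3 \<le> c1" using D by (simp add: c1_def)
  define B where "B = (\<lambda>n q. \<bar>fst q - \<theta>0\<bar> \<le> \<epsilon> n \<and> norm (snd q - f0) \<le> 3 * \<epsilon> n)"
  define bad where "bad = (\<lambda>n z q. \<bar>pairing e (fst z) (snd q - f0)\<bar> > sqrt (real n) * (\<epsilon> n)\<^sup>2
      \<or> \<bar>pairing e (snd z) (resid (fst q) (snd q))\<bar> > sqrt (real n) * (\<epsilon> n)\<^sup>2)"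
  have Bn: "norm (snd q - f0) \<le> c1 * \<epsilon> n" "norm (resid (fst q) (snd q)) \<le> c1 * \<epsilon> n"
    if q: "q \<in> space Q" "B n q" for q n
  proof -
    have th: "fst q \<in> \<Theta>" using q(1) by (auto simp: space_Q)
    have a: "norm (snd q - f0) \<le> 3 * \<epsilon> n" and t: "\<bar>fst q - \<theta>0\<bar> \<le> \<epsilon> n" using q(2) by (auto simp: B_def)
    show "norm (snd q - f0) \<le> c1 * \<epsilon> n" by (rule order_trans[OF a], rule mult_right_mono[OF c1]) (simp add: less_imp_le eps)
    have "resid (fst q) (snd q) = K (fst q) (snd q - f0) + (K (fst q) f0 - K \<theta>0 f0)"
      by (simp add: resid_def blinfun.diff_right)
    then have "norm (resid (fst q) (snd q)) \<le> norm (K (fst q) (snd q - f0)) + norm (K (fst q) f0 - K \<theta>0 f0)"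
      by (metis norm_triangle_ineq)
    also have "\<dots> \<le> D * (3 * \<epsilon> n) + D\<^sup>2 * \<epsilon> n * norm f0"
    proof (rule add_mono)
      show "norm (K (fst q) (snd q - f0)) \<le> D * (3 * \<epsilon> n)"
        using K_bound[OF th, of "snd q - f0"] mult_left_mono[OF a, of D] D by linarith
      show "norm (K (fst q) f0 - K \<theta>0 f0) \<le> D\<^sup>2 * \<epsilon> n * norm f0"
        by (rule order_trans[OF K_diff_norm[OF th]]) (intro mult_right_mono mult_left_mono t; simp)
    qed
    also have "\<dots> \<le> c1 * \<epsilon> n" using eps(1)[of n] by (simp add: c1_def algebra_simps)
    finally show "norm (resid (fst q) (snd q)) \<le> c1 * \<epsilon> n" .
  qed
  have Bm [measurable]: "Measurable.pred Q (B n)" for n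
  proof -
    have [measurable]: "(\<lambda>q. fst q) \<in> borel_measurable Q"
      by (rule measurable_compose[OF fst_Q_measurable[OF measurable_ident_sets[OF refl]]]) (auto intro: measurable_restrict_space1)
    show ?thesis unfolding B_def by measurable
  qed
  have badm [measurable]: "Measurable.pred (noise \<Otimes>\<^sub>M Q) (\<lambda>p. bad n (fst p) (snd p))" for n
    unfolding bad_def by measurable
  define \<beta> where "\<beta> = (\<lambda>n z. \<integral>\<^sup>+q. indicator {q. B n q \<and> bad n z q} q \<partial>Q)"
  define mB where "mB = (\<lambda>n. measure Q {q \<in> space Q. B n q})"
  define d where "d = (\<lambda>n. 4 * exp (- (1 / (2 * c1\<^sup>2)) * rate n))"
  have mB: "exp (- c * rate n) * exp (- rate n - 1) \<le> mB n" if n: "1 \<le> n" "exp (- c * rate n) \<le> measure \<eta> {\<theta> \<in> \<Theta>. \<bar>\<theta> - \<theta>0\<bar> \<le> \<epsilon> n}" for n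
  proof -
    have A: "{\<theta> \<in> \<Theta>. \<bar>\<theta> - \<theta>0\<bar> \<le> \<epsilon> n} \<in> sets \<eta>"
    by (simp add: Theta compact_imp_closed sets_eta sets_restrict_space_iff)
    have "{q \<in> space Q. B n q} = {q \<in> space Q. fst q \<in> {\<theta> \<in> \<Theta>. \<bar>\<theta> - \<theta>0\<bar> \<le> \<epsilon> n} \<and> snd q \<in> {f. norm (f - f0) \<le> 3 * \<epsilon> n}}"
      by (auto simp: B_def space_Q)
    then have "mB n = measure \<eta> {\<theta> \<in> \<Theta>. \<bar>\<theta> - \<theta>0\<bar> \<le> \<epsilon> n} * measure \<pi> {f. norm (f - f0) \<le> 3 * \<epsilon> n}"
      unfolding mB_def by (simp only:) (intro measure_Q_prod A, simp)
    then show ?thesis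
      using n small_ball[] by (auto simp: rate_def mult_mono)
  qed
  have mB0: "0 \<le> mB n" for n by (simp add: mB_def)
  \<comment> \<open>The conditional summand keeps the Markov level positive for all n;
    \<open>mB n\<close> is positive eventually.\<close>
  have whp1: "likely (\<lambda>n z. \<beta> n z \<le> ennreal (mB n / 2 + (if mB n = 0 then 1 else 0)))"
  proof (rule whp_markov[where b="\<lambda>n. 2 * d n"])
    show "\<beta> n \<in> borel_measurable noise" for n unfolding \<beta>_def by measurable
    show "(\<lambda>n. 2 * d n) \<longlonglongrightarrow> 0"
      unfolding d_def using tendsto_mult[OF tendsto_const exp_rate_tendsto[of "1 / (2 * c1\<^sup>2)"], of 8] c1 by simp
    show "0 < mB n / 2 + (if mB n = 0 then 1 else 0)" for n using mB0[of n] by auto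
    have "(\<integral>\<^sup>+z. \<beta> n z \<partial>noise) \<le> ennreal (mB n / 2 * (2 * d n))" if n: "1 \<le> n" for n
    proof -
      have "(\<integral>\<^sup>+z. \<beta> n z \<partial>noise) = (\<integral>\<^sup>+q. \<integral>\<^sup>+z. indicator {q. B n q \<and> bad n z q} q \<partial>noise \<partial>Q)"
        unfolding \<beta>_def by (rule NQ.Fubini'[symmetric]) measurable
      also have "\<dots> \<le> (\<integral>\<^sup>+q. ennreal (d n) * indicator {q \<in> space Q. B n q} q \<partial>Q)"
      proof (intro nn_integral_mono)
        fix q assume q: "q \<in> space Q"
        show "(\<integral>\<^sup>+z. indicator {q. B n q \<and> bad n z q} q \<partial>noise) \<le> ennreal (d n) * indicator {q \<in> space Q. B n q} q"
        proof (cases "B n q")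
          case True
          let ?x = "sqrt (real n) * (\<epsilon> n)\<^sup>2"
          have x0: "0 \<le> ?x" by simp
          have e0: "0 < c1 * \<epsilon> n" using c1 eps(1) by simp
          have ex: "2 * exp (- ?x\<^sup>2 / (2 * (c1 * \<epsilon> n)\<^sup>2)) = d n / 2"
            by (simp add: d_def rate_def power2_eq_square)
          have t: "measure white_seq {z. \<bar>pairing e z h\<bar> > ?x} \<le> d n / 2" if "norm h \<le> c1 * \<epsilon> n" for h
            using pairing_tail[OF that e0 x0] unfolding ex .
          let ?A1 = "{z. \<bar>pairing e z (snd q - f0)\<bar> > ?x}" and ?A2 = "{z. \<bar>pairing e z (resid (fst q) (snd q))\<bar> > ?x}"
          have "(\<integral>\<^sup>+z. indicator {q. B n q \<and> bad n z q} q \<partial>noise) \<le> (\<integral>\<^sup>+z. indicator {z. fst z \<in> ?A1} z + indicator {z. snd z \<in> ?A2} z \<partial>noise)"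
            by (intro nn_integral_mono) (auto simp: indicator_def bad_def)
          also have "\<dots> = emeasure noise {z. fst z \<in> ?A1} + emeasure noise {z. snd z \<in> ?A2}"
          proof -
            have "{z. fst z \<in> ?A1} \<in> sets noise" "{z. snd z \<in> ?A2} \<in> sets noise"
              using measurable_sets[OF measurable_fst, of ?A1 white_seq white_seq] measurable_sets[OF measurable_snd, of ?A2 white_seq white_seq]
              by (auto simp: space_pair_measure)
            then show ?thesis by (subst nn_integral_add) auto
          qed
          also have "\<dots> = ennreal (measure white_seq ?A1 + measure white_seq ?A2)"
            by (subst emeasure_noise_fst, simp, subst emeasure_noise_snd, simp) (simp add: white.emeasure_eq_measure)
          also have "\<dots> \<le> ennreal (d n)"
            using t[OF Bn(1)[OF q True]] t[OF Bn(2)[OF q True]] by (intro ennreal_leI) simp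
          finally show ?thesis using True q by simp
        qed simp
      qed
      also have "\<dots> = ennreal (d n) * emeasure Q {q \<in> space Q. B n q}"
        by (subst nn_integral_cmult_indicator) auto
      also have "\<dots> = ennreal (mB n / 2 * (2 * d n))"
        by (simp add: Q.emeasure_eq_measure mB_def ennreal_mult[symmetric] d_def)
      finally show ?thesis .
    qed
    then have "(\<integral>\<^sup>+z. \<beta> n z \<partial>noise) \<le> ennreal ((mB n / 2 + (if mB n = 0 then 1 else 0)) * (2 * d n))" if n: "1 \<le> n" for n
      by (rule order_trans[OF _ ennreal_leI]) (use that in \<open>auto simp: d_def intro!: mult_right_mono\<close>)
    then show "\<forall>\<^sub>F n in sequentially. (\<integral>\<^sup>+z. \<beta> n z \<partial>noise) \<le> ennreal ((mB n / 2 + (if mB n = 0 then 1 else 0)) * (2 * d n))"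
      by (rule)
  qed
  \<comment> \<open>The part \<open>2 + c1\<^sup>2\<close> comes from \<open>ell\<close> and
    \<open>\<bar>c\<bar> + 1\<close> from the prior mass of B; the remaining 2 absorb the constant
    factors once \<open>rate n\<close> is large.\<close>
  define C where "C = 4 + c1\<^sup>2 + \<bar>c\<bar> + 1"
  have "likely (\<lambda>n z. 1 \<le> n \<and> 2 \<le> rate n \<and> exp (- c * rate n) \<le> measure \<eta> {\<theta> \<in> \<Theta>. \<bar>\<theta> - \<theta>0\<bar> \<le> \<epsilon> n})"
    using rate_at_top c
    by (intro whp_sequentially eventually_conj) (auto simp: filterlim_at_top)
  with whp1 have "likely (\<lambda>n z. ennreal (exp (- C * rate n)) \<le> total n z)"
  proof eventually_elim
    case (elim nz)
    obtain n z where nz: "nz = (n, z)" by (cases nz)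
    have n: "1 \<le> n" "2 \<le> rate n" "exp (- c * rate n) \<le> measure \<eta> {\<theta> \<in> \<Theta>. \<bar>\<theta> - \<theta>0\<bar> \<le> \<epsilon> n}"
      using elim by (auto simp: nz)
    have mBn: "exp (- c * rate n) * exp (- rate n - 1) \<le> mB n" using mB[OF n(1) n(3)] .
    then have mBpos: "0 < mB n" by (smt exp_gt_zero mult_pos_pos)
    have b: "\<beta> n z \<le> ennreal (mB n / 2)" using elim mBpos by (simp add: nz)
    have bm: "Measurable.pred Q (\<lambda>q. bad n z q)"
      using measurable_compose[OF measurable_Pair1'[of z noise Q] badm[of n]] by simp
    let ?lo = "exp (- (2 + c1\<^sup>2) * rate n)"
    have lo: "?lo \<le> exp (ell n z (fst q) (snd q))" if q: "q \<in> space Q" "B n q" "\<not> bad n z q" for q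
    proof -
      have nb: "\<bar>pairing e (fst z) (snd q - f0)\<bar> \<le> sqrt (real n) * (\<epsilon> n)\<^sup>2"
        "\<bar>pairing e (snd z) (resid (fst q) (snd q))\<bar> \<le> sqrt (real n) * (\<epsilon> n)\<^sup>2"
        using q(3) by (auto simp: bad_def)
      have p: "- rate n \<le> sqrt (real n) * w" if "\<bar>w\<bar> \<le> sqrt (real n) * (\<epsilon> n)\<^sup>2" for w
      proof -
        have "sqrt (real n) * (- w) \<le> sqrt (real n) * (sqrt (real n) * (\<epsilon> n)\<^sup>2)"
          using that by (intro mult_left_mono) auto
        then show ?thesis by (simp add: rate_def mult.assoc[symmetric])
      qed
      have r: "real n / 2 * (norm h)\<^sup>2 \<le> c1\<^sup>2 / 2 * rate n" if "norm h \<le> c1 * \<epsilon> n" for h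
      proof -
        have "(norm h)\<^sup>2 \<le> (c1 * \<epsilon> n)\<^sup>2" using that by (intro power_mono) auto
        then have "real n / 2 * (norm h)\<^sup>2 \<le> real n / 2 * (c1 * \<epsilon> n)\<^sup>2" by (intro mult_left_mono) auto
        then show ?thesis by (simp add: rate_def power_mult_distrib mult_ac)
      qed
      have "- (2 + c1\<^sup>2) * rate n \<le> ell n z (fst q) (snd q)"
        using p[OF nb(1)] p[OF nb(2)] r[OF Bn(1)[OF q(1,2)]] r[OF Bn(2)[OF q(1,2)]]
        unfolding ell_def by (simp add: algebra_simps)
      then show ?thesis by simp
    qed
    have "ennreal (mB n) = emeasure Q {q \<in> space Q. B n q}"
      by (simp add: mB_def Q.emeasure_eq_measure)
    also have "\<dots> = (\<integral>\<^sup>+q. indicator {q \<in> space Q. B n q} q \<partial>Q)" by simp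
    also have "\<dots> \<le> (\<integral>\<^sup>+q. indicator {q. B n q \<and> bad n z q} q + indicator {q. B n q \<and> \<not> bad n z q} q \<partial>Q)"
      by (intro nn_integral_mono) (auto simp: indicator_def)
    also have "\<dots> = \<beta> n z + (\<integral>\<^sup>+q. indicator {q. B n q \<and> \<not> bad n z q} q \<partial>Q)"
      unfolding \<beta>_def bm[measurable] by (intro nn_integral_add) measurable
    also have "\<dots> \<le> ennreal (mB n / 2) + (\<integral>\<^sup>+q. indicator {q. B n q \<and> \<not> bad n z q} q \<partial>Q)"
      by (intro add_right_mono b)
    finally have "ennreal (mB n) - ennreal (mB n / 2) \<le> (\<integral>\<^sup>+q. indicator {q. B n q \<and> \<not> bad n z q} q \<partial>Q)"
      by (simp add: ennreal_minus_le_iff)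
    then have half: "ennreal (mB n / 2) \<le> (\<integral>\<^sup>+q. indicator {q. B n q \<and> \<not> bad n z q} q \<partial>Q)"
      using mBpos by (simp add: ennreal_minus)
    have "ennreal (exp (- C * rate n)) \<le> ennreal (?lo * (mB n / 2))"
    proof (rule ennreal_leI)
      have "exp (- C * rate n) \<le> exp (- (2 + c1\<^sup>2) * rate n + (- c * rate n + (- rate n - 1)) - 1)"
      proof -
        have "c * rate n \<le> \<bar>c\<bar> * rate n" using n(2) by auto
        then have "- C * rate n \<le> - (2 + c1\<^sup>2) * rate n + (- c * rate n + (- rate n - 1)) - 1"
        proof -
          assume cr: "c * rate n \<le> \<bar>c\<bar> * rate n"
          have "- C * rate n = - (2 + c1\<^sup>2) * rate n - \<bar>c\<bar> * rate n - 3 * rate n" by (simp add: C_def algebra_simps)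
          with cr n(2) show ?thesis by linarith
        qed
        then show ?thesis by simp
      qed
      also have "\<dots> = ?lo * ((exp (- c * rate n) * exp (- rate n - 1)) * exp (- 1))"
        by (simp add: exp_add[symmetric])
      also have "\<dots> \<le> ?lo * (mB n * (1 / 2))"
      proof (intro mult_left_mono mult_mono mBn)
        show "exp (- 1) \<le> (1 / 2 :: real)"
          using exp_ge_add_one_self[of 1] by (simp add: exp_minus field_simps)
      qed (use mBpos in auto)
      also have "\<dots> = ?lo * (mB n / 2)" by simp
      finally show "exp (- C * rate n) \<le> ?lo * (mB n / 2)" .
    qed
    also have "\<dots> = ennreal ?lo * ennreal (mB n / 2)" using mBpos by (intro ennreal_mult) auto
    also have "\<dots> \<le> ennreal ?lo * (\<integral>\<^sup>+q. indicator {q. B n q \<and> \<not> bad n z q} q \<partial>Q)"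
      by (intro mult_left_mono half) simp
    also have "\<dots> = (\<integral>\<^sup>+q. ennreal ?lo * indicator {q. B n q \<and> \<not> bad n z q} q \<partial>Q)"
      using bm[measurable] by (intro nn_integral_cmult[symmetric]) measurable
    also have "\<dots> \<le> total n z"
      unfolding evid_def using lo by (intro nn_integral_mono) (auto simp: indicator_def)
    finally show ?case by (simp add: nz)
  qed
  then show ?thesis by blast
qed

lemma posterior_mass_small:
  assumes C: "likely (\<lambda>n z. ennreal (exp (- C * rate n)) \<le> total n z)"
    and P: "likely (\<lambda>n z. evid n (P n) z \<le> ennreal (exp (- (C + 1) * rate n)))"
    and \<kappa>: "0 < \<kappa>"
  shows "likely (\<lambda>n z. evid n (P n) z \<le> ennreal \<kappa> * total n z)"
proof -
  have "\<forall>\<^sub>F n in sequentially. exp (- 1 * rate n) < \<kappa>"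
    using exp_rate_tendsto[of 1] \<kappa> by (intro order_tendstoD) auto
  then have "likely (\<lambda>n z. exp (- 1 * rate n) < \<kappa>)" by (rule whp_sequentially)
  with C P show ?thesis
  proof eventually_elim
    case (elim nz)
    obtain n z where nz: "nz = (n, z)" by (cases nz)
    have "evid n (P n) z \<le> ennreal (exp (- (C + 1) * rate n))" using elim by (simp add: nz)
    also have "\<dots> = ennreal (exp (- 1 * rate n)) * ennreal (exp (- C * rate n))"
      by (simp add: ennreal_mult[symmetric] exp_add[symmetric] algebra_simps)
    also have "\<dots> \<le> ennreal \<kappa> * total n z"
      using elim by (intro mult_mono) (auto simp: nz ennreal_leI)
    finally show ?case by (simp add: nz)
  qed
qed

lemma theta_Q_measurable [measurable]: "(\<lambda>q. fst q) \<in> borel_measurable Q"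
  by (rule measurable_compose[OF fst_Q_measurable[OF measurable_ident_sets[OF refl]]]) (auto intro: measurable_restrict_space1)

text \<open>The factor of the second sequence has mean one for each \<open>\<theta>\<close> and
  integrates out. In the factor of the first sequence half of the quadratic penalty yields
  \<open>exp (- (M\<^sup>2 / 4) * rate n)\<close>, and the rest is \<open>tempered_evidence\<close>,
  at most \<open>exp (5 * rate n)\<close> on the event selected by w. One further unit of
  \<open>rate n\<close> is spent in Markov's inequality, hence the 6.\<close>

lemma contraction_direct:
  "likely (\<lambda>n z. evid n (\<lambda>q. norm (snd q - f0) > M * \<epsilon> n) z \<le> ennreal (exp (- (M\<^sup>2 / 4 - 6) * rate n)))" if M: "0 \<le> M"
proof -
  define w where "w = (\<lambda>n (z :: observation). indicator {z. tempered_evidence n (fst z) \<le> ennreal (exp (5 * rate n))} z :: ennreal)"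
  have wm [measurable]: "w n \<in> borel_measurable noise" for n
  by (simp add: w_def)
  have P [measurable]: "Measurable.pred Q (\<lambda>q. norm (snd q - f0) > M * \<epsilon> n)" for n by measurable
  have bound: "(\<integral>\<^sup>+z. w n z * evid n (\<lambda>q. norm (snd q - f0) > M * \<epsilon> n) z \<partial>noise)
      \<le> ennreal (exp (- (M\<^sup>2 / 4 - 6) * rate n) * exp (- 1 * rate n))" for n
  proof -
    let ?w = "\<lambda>z. indicator {z. tempered_evidence n z \<le> ennreal (exp (5 * rate n))} z :: ennreal"
    let ?h = "\<lambda>f z. ennreal (exp (sqrt (real n) * pairing e z (f - f0) - real n / 4 * (norm (f - f0))\<^sup>2))"
    let ?c = "ennreal (exp (- (M\<^sup>2 / 4) * rate n))"
    have inner: "indicator {q. norm (snd q - f0) > M * \<epsilon> n} q * (\<integral>\<^sup>+z. w n z * lr n z (fst q) (snd q) \<partial>noise)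
        \<le> ?c * (\<integral>\<^sup>+z. ?w z * ?h (snd q) z \<partial>white_seq)" for q
    proof (cases "norm (snd q - f0) > M * \<epsilon> n")
      case True
      let ?f = "snd q" and ?r = "resid (fst q) (snd q)"
      let ?g = "\<lambda>h z. ennreal (exp (sqrt (real n) * pairing e z h - real n / 2 * (norm h)\<^sup>2))"
      have g1: "(\<integral>\<^sup>+z. ?g h z \<partial>white_seq) = 1" for h
        using nn_integral_exp_pairing[of "sqrt (real n)" h] by simp
      have "(\<integral>\<^sup>+z. w n z * lr n z (fst q) (snd q) \<partial>noise)
          = (\<integral>\<^sup>+z. (?w (fst z) * ?g (?f - f0) (fst z)) * ?g ?r (snd z) \<partial>noise)"
        by (intro nn_integral_cong) (simp add: ell_def exp_add ennreal_mult w_def indicator_def)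
      also have "\<dots> = (\<integral>\<^sup>+z. ?w z * ?g (?f - f0) z \<partial>white_seq) * (\<integral>\<^sup>+z. ?g ?r z \<partial>white_seq)"
        by (rule nn_integral_noise_mult[where F="\<lambda>z. ?w z * ?g (?f - f0) z"]) measurable
      also have "\<dots> = (\<integral>\<^sup>+z. ?w z * ?g (?f - f0) z \<partial>white_seq)" unfolding g1 by simp
      also have "\<dots> \<le> (\<integral>\<^sup>+z. ?c * (?w z * ?h ?f z) \<partial>white_seq)"
      proof (intro nn_integral_mono)
        fix z
        have "(M * \<epsilon> n)\<^sup>2 \<le> (norm (?f - f0))\<^sup>2" using True M eps(1)[of n] by auto
        then have "real n / 4 * (M * \<epsilon> n)\<^sup>2 \<le> real n / 4 * (norm (?f - f0))\<^sup>2" by (intro mult_left_mono) auto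
        then have "M\<^sup>2 / 4 * rate n \<le> real n / 4 * (norm (?f - f0))\<^sup>2" by (simp add: rate_def power_mult_distrib mult_ac)
        then have "?g (?f - f0) z \<le> ?c * ?h ?f z"
          by (simp add: ennreal_mult[symmetric] exp_add[symmetric])
        then show "?w z * ?g (?f - f0) z \<le> ?c * (?w z * ?h ?f z)" by (simp add: indicator_def)
      qed
      also have "\<dots> = ?c * (\<integral>\<^sup>+z. ?w z * ?h ?f z \<partial>white_seq)" by (rule nn_integral_cmult) measurable
      finally show ?thesis using True by simp
    qed simp
    interpret wp: pair_prob_space white_seq \<pi> ..
    have "(\<integral>\<^sup>+z. w n z * evid n (\<lambda>q. norm (snd q - f0) > M * \<epsilon> n) z \<partial>noise)
        \<le> (\<integral>\<^sup>+q. ?c * (\<integral>\<^sup>+z. ?w z * ?h (snd q) z \<partial>white_seq) \<partial>Q)"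
      unfolding tonelli_evid[OF P wm] by (intro nn_integral_mono inner)
    also have "\<dots> = (\<integral>\<^sup>+\<theta>. \<integral>\<^sup>+f. ?c * (\<integral>\<^sup>+z. ?w z * ?h f z \<partial>white_seq) \<partial>\<pi> \<partial>\<eta>)"
      unfolding Q_def by (subst nn_integral_fst[symmetric]) (measurable)
    also have "\<dots> = (\<integral>\<^sup>+f. ?c * (\<integral>\<^sup>+z. ?w z * ?h f z \<partial>white_seq) \<partial>\<pi>)"
      using eta.emeasure_space_1 by simp
    also have "\<dots> = ?c * (\<integral>\<^sup>+f. (\<integral>\<^sup>+z. ?w z * ?h f z \<partial>white_seq) \<partial>\<pi>)"
      by (rule nn_integral_cmult) measurable
    also have "(\<integral>\<^sup>+f. (\<integral>\<^sup>+z. ?w z * ?h f z \<partial>white_seq) \<partial>\<pi>) = (\<integral>\<^sup>+z. \<integral>\<^sup>+f. ?w z * ?h f z \<partial>\<pi> \<partial>white_seq)"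
      by (rule wp.Fubini') measurable
    also have "\<dots> = (\<integral>\<^sup>+z. ?w z * tempered_evidence n z \<partial>white_seq)"
    proof (intro nn_integral_cong)
      fix z
      show "(\<integral>\<^sup>+f. ?w z * ?h f z \<partial>\<pi>) = ?w z * tempered_evidence n z"
        unfolding tempered_evidence_def by (rule nn_integral_cmult) measurable
    qed
    also have "\<dots> \<le> (\<integral>\<^sup>+z. ennreal (exp (5 * rate n)) \<partial>white_seq)"
      by (intro nn_integral_mono) (auto simp: indicator_def)
    also have "\<dots> = ennreal (exp (5 * rate n))" using white.emeasure_space_1 by simp
    also have "?c * ennreal (exp (5 * rate n)) = ennreal (exp (- (M\<^sup>2 / 4 - 6) * rate n) * exp (- 1 * rate n))"
      by (simp add: ennreal_mult[symmetric] exp_add[symmetric] algebra_simps)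
    finally show ?thesis by (simp add: mult_left_mono)
  qed
  have "likely (\<lambda>n z. w n z * evid n (\<lambda>q. norm (snd q - f0) > M * \<epsilon> n) z \<le> ennreal (exp (- (M\<^sup>2 / 4 - 6) * rate n)))"
    by (rule whp_markov[where b="\<lambda>n. exp (- 1 * rate n)"]) (use bound exp_rate_tendsto[of 1] in \<open>auto intro!: always_eventually\<close>)
  with whp_tempered_evidence show ?thesis
    by eventually_elim (auto simp: w_def)
qed

text \<open>The mean of the evidence is a prior mass, and under the prior
  \<open>f \<bullet> l n\<close> is centred Gaussian with variance at most
  \<open>n * (s n)\<^sup>2\<close>, so the threshold lies at least \<open>L * sqrt (rate n)\<close>
  standard deviations out.\<close>

lemma contraction_shift:
  assumes L: "0 \<le> L"
  shows "likely (\<lambda>n z. evid n (\<lambda>q. \<bar>snd q \<bullet> l n\<bar> > L * real n * \<epsilon> n * s n) z \<le> ennreal (exp (- (L\<^sup>2 / 2 - 1) * rate n)))"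
proof (rule whp_markov[where b="\<lambda>n. 2 * exp (- 1 * rate n)"])
  fix n
  have [measurable]: "Measurable.pred Q (\<lambda>q. \<bar>snd q \<bullet> l n\<bar> > L * real n * \<epsilon> n * s n)" by measurable
  then show "evid n (\<lambda>q. \<bar>snd q \<bullet> l n\<bar> > L * real n * \<epsilon> n * s n) \<in> borel_measurable noise" by measurable
next
  have le: "(\<integral>\<^sup>+z. evid n (\<lambda>q. \<bar>snd q \<bullet> l n\<bar> > L * real n * \<epsilon> n * s n) z \<partial>noise)
      \<le> ennreal (exp (- (L\<^sup>2 / 2 - 1) * rate n) * (2 * exp (- 1 * rate n)))" if n: "1 \<le> n" for n
  proof -
    let ?x = "L * real n * \<epsilon> n * s n" and ?B = "sqrt (real n) * s n"
    have B: "0 < ?B" "0 \<le> ?x" using n shift_size[of n] eps(1)[of n] L by auto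
    let ?A = "{f \<in> space \<pi>. \<bar>f \<bullet> l n\<bar> > ?x}"
    have A: "?A \<in> sets \<pi>" by measurable
    have mg: "(\<integral>\<^sup>+f. ennreal (exp (t * (f \<bullet> l n))) \<partial>\<pi>) \<le> ennreal (exp (t\<^sup>2 * ?B\<^sup>2 / 2))" for t
      unfolding mgf_inner using shift_size(2)[OF n]
      by (auto simp: power_mult_distrib mult_left_mono)
    have "(\<integral>\<^sup>+z. evid n (\<lambda>q. \<bar>snd q \<bullet> l n\<bar> > ?x) z \<partial>noise) = emeasure Q {q \<in> space Q. fst q \<in> \<Theta> \<and> snd q \<in> ?A}"
      by (subst nn_integral_evid) (auto intro: arg_cong[where f="emeasure Q"] simp: space_Q)
    also have "\<dots> = ennreal (measure \<eta> \<Theta> * measure \<pi> ?A)"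
      by (rule emeasure_Q_prod[OF _ A]) (metis sets.top space_eta)
    also have "\<dots> \<le> ennreal (1 * (2 * exp (- ?x\<^sup>2 / (2 * ?B\<^sup>2))))"
      by (intro ennreal_leI mult_mono mgf_tail_bound mg B) (auto)
    also have "?x\<^sup>2 / (2 * ?B\<^sup>2) = L\<^sup>2 / 2 * rate n"
      using shift_size[of n] by (simp add: rate_def power2_eq_square)
    then have "- ?x\<^sup>2 / (2 * ?B\<^sup>2) = - (L\<^sup>2 / 2 - 1) * rate n + (- 1 * rate n)" by (simp add: algebra_simps)
    also have "exp (- (L\<^sup>2 / 2 - 1) * rate n + (- 1 * rate n)) = exp (- (L\<^sup>2 / 2 - 1) * rate n) * exp (- 1 * rate n)"
      by (rule exp_add)
    finally show ?thesis by (simp add: mult_ac)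
  qed
  show "\<forall>\<^sub>F n in sequentially. (\<integral>\<^sup>+z. evid n (\<lambda>q. \<bar>snd q \<bullet> l n\<bar> > L * real n * \<epsilon> n * s n) z \<partial>noise)
      \<le> ennreal (exp (- (L\<^sup>2 / 2 - 1) * rate n) * (2 * exp (- 1 * rate n)))"
    by (rule eventually_mono[OF eventually_ge_at_top[of 1] le])
  show "(\<lambda>n. 2 * exp (- 1 * rate n)) \<longlonglongrightarrow> 0"
    using tendsto_mult[OF tendsto_const exp_rate_tendsto[of 1], of 2] by simp
qed simp

lemma Theta_bounded: obtains R where "0 \<le> R" "\<And>\<theta>. \<theta> \<in> \<Theta> \<Longrightarrow> \<bar>\<theta> - \<theta>0\<bar> \<le> R"
by (smt (verit) compact_imp_bounded Theta bounded_any_center theta0_in dist_real_def abs_minus_commute)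

text \<open>Compactness and continuity make identifiability uniform away from
  \<open>\<theta>0\<close>.\<close>

lemma Theta_separated:
  assumes \<tau>: "0 < \<tau>"
  obtains c where "0 < c" "\<And>\<theta>. \<theta> \<in> \<Theta> \<Longrightarrow> \<tau> \<le> \<bar>\<theta> - \<theta>0\<bar> \<Longrightarrow> c \<le> norm (K \<theta> f0 - K \<theta>0 f0)"
proof -
  let ?T = "\<Theta> \<inter> {\<theta>. \<tau> \<le> \<bar>\<theta> - \<theta>0\<bar>}"
  show ?thesis
  proof (cases "?T = {}")
    case True
    then show ?thesis by (intro that[of 1]) auto
  next
    case False
    have "compact ?T"
      by (intro compact_Int_closed Theta closed_Collect_le continuous_intros)
    moreover have "continuous_on ?T (\<lambda>\<theta>. norm (K \<theta> f0 - K \<theta>0 f0))"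
      by (intro continuous_intros continuous_on_subset[OF K_continuous]) auto
    ultimately obtain \<theta>1 where t1: "\<theta>1 \<in> ?T" "\<And>\<theta>. \<theta> \<in> ?T \<Longrightarrow> norm (K \<theta>1 f0 - K \<theta>0 f0) \<le> norm (K \<theta> f0 - K \<theta>0 f0)"
      using continuous_attains_inf[OF _ False] by blast
    have "K \<theta>1 f0 \<noteq> K \<theta>0 f0" using t1(1) \<tau> by (intro identified) auto
    then show ?thesis using t1 by (intro that[of "norm (K \<theta>1 f0 - K \<theta>0 f0)"]) auto
  qed
qed

text \<open>Here \<open>resid\<close> is bounded away from 0, and the likelihood has mean one only
  because its noise term compensates a penalty of order n. On the event
  \<open>Y \<le> \<beta>\<close> the noise paired with \<open>d\<close>, the increment of K at f, is
  at most \<open>A\<close>, which contributes only a multiple of sqrt n; the other part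
  \<open>k\<close> is of size \<open>\<epsilon> n\<close> and costs a multiple of
  \<open>rate n\<close>.\<close>

lemma contraction_theta:
  assumes \<tau>: "0 < \<tau>" and M: "0 \<le> M"
  shows "likely (\<lambda>n z. evid n (\<lambda>q. \<bar>fst q - \<theta>0\<bar> > \<tau> \<and> norm (snd q - f0) \<le> M * \<epsilon> n) z \<le> ennreal (exp (- C * rate n)))"
proof -
  obtain Y where Y: "Y \<in> borel_measurable white_seq" "\<And>z. 0 \<le> Y z"
    "\<And>x. x \<in> S \<Longrightarrow> AE z in white_seq. \<bar>pairing e z x\<bar> \<le> Y z * nS x"
    by (rule dudley_bound[OF S_space S_entropy]) blast
  obtain R where R: "0 \<le> R" "\<And>\<theta>. \<theta> \<in> \<Theta> \<Longrightarrow> \<bar>\<theta> - \<theta>0\<bar> \<le> R" by (rule Theta_bounded) blast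
  obtain c where c: "0 < c" "\<And>\<theta>. \<theta> \<in> \<Theta> \<Longrightarrow> \<tau> \<le> \<bar>\<theta> - \<theta>0\<bar> \<Longrightarrow> c \<le> norm (K \<theta> f0 - K \<theta>0 f0)"
    by (rule Theta_separated[OF \<tau>]) blast
  define P where "P = (\<lambda>n q. \<bar>fst q - \<theta>0\<bar> > \<tau> \<and> norm (snd q - f0) \<le> M * \<epsilon> n)"
  have Pm [measurable]: "Measurable.pred Q (P n)" for n unfolding P_def by measurable
  define F where "F = norm f0 + M"
  have "likely (\<lambda>n z. \<bar>Y (snd z)\<bar> \<le> \<beta> \<longrightarrow> evid n (P n) z \<le> ennreal (exp (- C * rate n)))" if \<beta>: "0 < \<beta>" for \<beta>
  proof -
    define w where "w = (\<lambda>z :: observation. indicator {z. Y (snd z) \<le> \<beta>} z :: ennreal)"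
    have wm [measurable]: "w \<in> borel_measurable noise"
    proof -
      have [measurable]: "(\<lambda>z. Y (snd z)) \<in> borel_measurable noise"
        using Y(1) by measurable
      show ?thesis unfolding w_def by measurable
    qed
    define A where "A = \<beta> * (D * R * F)"
    define B where "B = D\<^sup>2 * M\<^sup>2 / 2"
    have inner: "indicator {q. P n q} q * (\<integral>\<^sup>+z. w z * lr n z (fst q) (snd q) \<partial>noise)
        \<le> ennreal (exp (sqrt (real n) * A - real n * c\<^sup>2 / 8 + B * rate n))"
      if q: "q \<in> space Q" and n: "\<epsilon> n \<le> 1" "D * M * \<epsilon> n \<le> c / 2" for q n
    proof (cases "P n q")
      case True
      define \<theta> f where "\<theta> = fst q" and "f = snd q"
      have th: "\<theta> \<in> \<Theta>" using q by (auto simp: \<theta>_def space_Q)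
      have a: "norm (f - f0) \<le> M * \<epsilon> n" and t: "\<tau> \<le> \<bar>\<theta> - \<theta>0\<bar>" using True by (auto simp: P_def \<theta>_def f_def)
      have nf: "norm f \<le> F"
      proof -
        have "norm f \<le> norm f0 + norm (f - f0)" using norm_triangle_ineq[of f0 "f - f0"] by simp
        also have "norm (f - f0) \<le> M * 1" using a mult_left_mono[OF n(1) M] by linarith
        finally show ?thesis by (simp add: F_def)
      qed
      define d where "d = K \<theta> f - K \<theta>0 f"
      define k where "k = K \<theta>0 (f - f0)"
      have rdk: "resid \<theta> f = d + k" by (simp add: resid_def d_def k_def blinfun.diff_right)
      have dS: "d \<in> S" and nd: "nS d \<le> D * R * F"
      proof -
        show "d \<in> S" unfolding d_def by (rule first_order[OF th])
        have "nS d \<le> D * \<bar>\<theta> - \<theta>0\<bar> * norm f" unfolding d_def by (rule first_order[OF th])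
        also have "\<dots> \<le> D * R * F" using R(2)[OF th] nf D by (intro mult_mono) auto
        finally show "nS d \<le> D * R * F" .
      qed
      have nk: "norm k \<le> D * (M * \<epsilon> n)"
        unfolding k_def using K_bound[OF theta0_in, of "f - f0"] mult_left_mono[OF a, of D] D by linarith
      have nr: "c / 2 \<le> norm (resid \<theta> f)"
      proof -
        have "resid \<theta> f = (K \<theta> f0 - K \<theta>0 f0) + K \<theta> (f - f0)" by (simp add: resid_def blinfun.diff_right)
        then have "norm (K \<theta> f0 - K \<theta>0 f0) \<le> norm (resid \<theta> f) + norm (K \<theta> (f - f0))"
          by (metis add_diff_cancel_right' norm_triangle_ineq4)
        moreover have "norm (K \<theta> (f - f0)) \<le> D * (M * \<epsilon> n)"
          using K_bound[OF th, of "f - f0"] mult_left_mono[OF a, of D] D by linarith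
        ultimately show ?thesis using c(2)[OF th t] n(2) by (simp)
      qed
      have nr2: "real n * c\<^sup>2 / 8 \<le> real n / 2 * (norm (resid \<theta> f))\<^sup>2"
      proof -
        have "(c / 2)\<^sup>2 \<le> (norm (resid \<theta> f))\<^sup>2" using nr c(1) by auto
        then have "real n / 2 * (c / 2)\<^sup>2 \<le> real n / 2 * (norm (resid \<theta> f))\<^sup>2" by (intro mult_left_mono) auto
        then show ?thesis by (simp add: power_divide)
      qed
      let ?g1 = "\<lambda>z. ennreal (exp (sqrt (real n) * pairing e z (f - f0) - (sqrt (real n))\<^sup>2 / 2 * (norm (f - f0))\<^sup>2))"
      let ?g2 = "\<lambda>z. ennreal (exp (sqrt (real n) * pairing e z k))"
      let ?c = "ennreal (exp (sqrt (real n) * A - real n * c\<^sup>2 / 8))"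
      have "(\<integral>\<^sup>+z. w z * lr n z (fst q) (snd q) \<partial>noise) \<le> (\<integral>\<^sup>+z. ?c * (?g1 (fst z) * ?g2 (snd z)) \<partial>noise)"
      proof (rule nn_integral_mono_AE)
        show "AE z in noise. w z * lr n z (fst q) (snd q) \<le> ?c * (?g1 (fst z) * ?g2 (snd z))"
          using AE_noise_snd[OF Y(3)[OF dS]] AE_noise_snd[OF AE_paired[of d]] AE_noise_snd[OF AE_paired[of k]]
        proof eventually_elim
          fix z :: observation
          assume yz: "\<bar>pairing e (snd z) d\<bar> \<le> Y (snd z) * nS d" and pd: "d \<in> paired (snd z)" and pk: "k \<in> paired (snd z)"
          show "w z * lr n z (fst q) (snd q) \<le> ?c * (?g1 (fst z) * ?g2 (snd z))"
          proof (cases "Y (snd z) \<le> \<beta>")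
            case True
            have "nS d \<ge> 0" using S_space dS unfolding normed_subspace_def by blast
            then have "Y (snd z) * nS d \<le> A"
              unfolding A_def using True nd \<beta> by (intro mult_mono) auto
            then have "pairing e (snd z) d \<le> A" using yz by linarith
            then have "sqrt (real n) * pairing e (snd z) d \<le> sqrt (real n) * A" by (intro mult_left_mono) auto
            then have "ell n z \<theta> f \<le> (sqrt (real n) * A - real n * c\<^sup>2 / 8)
                + ((sqrt (real n) * pairing e (fst z) (f - f0) - (sqrt (real n))\<^sup>2 / 2 * (norm (f - f0))\<^sup>2) + sqrt (real n) * pairing e (snd z) k)"
              using nr2 pairing_add[OF pd pk] by (simp add: ell_def rdk distrib_left)
            then show ?thesis
              using True by (simp add: w_def \<theta>_def f_def ennreal_mult[symmetric] exp_add[symmetric])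
          qed (simp add: w_def)
        qed
      qed
      also have "\<dots> = ?c * ((\<integral>\<^sup>+z. ?g1 z \<partial>white_seq) * (\<integral>\<^sup>+z. ?g2 z \<partial>white_seq))"
      proof -
        have m: "?g1 \<in> borel_measurable white_seq" "?g2 \<in> borel_measurable white_seq" by measurable
        have "(\<lambda>z. ?g1 (fst z) * ?g2 (snd z)) \<in> borel_measurable noise"
          by simp
        then have "(\<integral>\<^sup>+z. ?c * (?g1 (fst z) * ?g2 (snd z)) \<partial>noise) = ?c * (\<integral>\<^sup>+z. ?g1 (fst z) * ?g2 (snd z) \<partial>noise)"
          by (rule nn_integral_cmult)
        then show ?thesis by (simp only: nn_integral_noise_mult[OF m])
      qed
      also have "\<dots> = ?c * ennreal (exp (real n * (norm k)\<^sup>2 / 2))"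
        by (simp only: nn_integral_exp_pairing mgf_pairing) simp
      also have "\<dots> \<le> ?c * ennreal (exp (B * rate n))"
      proof (intro mult_left_mono ennreal_leI)
        have "(norm k)\<^sup>2 \<le> (D * (M * \<epsilon> n))\<^sup>2" using nk by (intro power_mono) auto
        then have "real n * (norm k)\<^sup>2 / 2 \<le> real n * (D * (M * \<epsilon> n))\<^sup>2 / 2" by (intro divide_right_mono mult_left_mono) auto
        then show "exp (real n * (norm k)\<^sup>2 / 2) \<le> exp (B * rate n)"
          by (simp add: B_def rate_def power_mult_distrib mult_ac)
      qed simp
      also have "\<dots> = ennreal (exp (sqrt (real n) * A - real n * c\<^sup>2 / 8 + B * rate n))"
        by (simp add: ennreal_mult[symmetric] exp_add[symmetric])
      finally show ?thesis using True by simp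
    qed simp
    have ev: "\<forall>\<^sub>F n in sequentially. (\<integral>\<^sup>+z. w z * evid n (P n) z \<partial>noise) \<le> ennreal (exp (- C * rate n) * exp (- 1 * rate n))"
    proof -
      have "(\<lambda>n. D * M * \<epsilon> n) \<longlonglongrightarrow> D * M * 0" by (intro tendsto_intros eps)
      then have e1: "\<forall>\<^sub>F n in sequentially. D * M * \<epsilon> n < c / 2" using c(1) by (intro order_tendstoD) auto
      have e2: "\<forall>\<^sub>F n in sequentially. \<epsilon> n < 1" using eps(2) by (rule order_tendstoD) simp
      note sqrt_nat_at_top
      \<comment> \<open>The exponent divided by n: every term but the penalty
        \<open>c\<^sup>2 / 8\<close> vanishes, whatever C is.\<close>
      then have "(\<lambda>n. A * inverse (sqrt (real n)) + (B + C + 1) * (\<epsilon> n)\<^sup>2) \<longlonglongrightarrow> A * 0 + (B + C + 1) * 0\<^sup>2"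
        by (intro tendsto_intros eps tendsto_inverse_0_at_top)
      then have e3: "\<forall>\<^sub>F n in sequentially. A * inverse (sqrt (real n)) + (B + C + 1) * (\<epsilon> n)\<^sup>2 < c\<^sup>2 / 8"
        using c(1) by (intro order_tendstoD) auto
      show ?thesis
        using e1 e2 e3 eventually_gt_at_top[of 0]
      proof eventually_elim
        fix n assume n: "D * M * \<epsilon> n < c / 2" "\<epsilon> n < 1" "A * inverse (sqrt (real n)) + (B + C + 1) * (\<epsilon> n)\<^sup>2 < c\<^sup>2 / 8" "0 < n"
        have "(\<integral>\<^sup>+z. w z * evid n (P n) z \<partial>noise) \<le> (\<integral>\<^sup>+q. ennreal (exp (sqrt (real n) * A - real n * c\<^sup>2 / 8 + B * rate n)) \<partial>Q)"
          unfolding tonelli_evid[OF Pm wm] using n by (intro nn_integral_mono inner) auto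
        also have "\<dots> = ennreal (exp (sqrt (real n) * A - real n * c\<^sup>2 / 8 + B * rate n))"
          using Q.emeasure_space_1 by simp
        also have "\<dots> \<le> ennreal (exp (- C * rate n) * exp (- 1 * rate n))"
        proof (rule ennreal_leI)
          have "real n * (A * inverse (sqrt (real n)) + (B + C + 1) * (\<epsilon> n)\<^sup>2) \<le> real n * (c\<^sup>2 / 8)"
            using n by auto
          moreover have "real n * (A * inverse (sqrt (real n)) + (B + C + 1) * (\<epsilon> n)\<^sup>2) = A * sqrt (real n) + (B + C + 1) * rate n"
          proof -
            have "real n * inverse (sqrt (real n)) = sqrt (real n)"
              by (simp add: real_div_sqrt divide_inverse[symmetric])
            then show ?thesis by (simp only: distrib_left rate_def mult.left_commute)
          qed
          ultimately have "A * sqrt (real n) + (B * rate n + C * rate n + rate n) \<le> real n * c\<^sup>2 / 8"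
            by (simp add: ring_distribs)
          then have "sqrt (real n) * A - real n * c\<^sup>2 / 8 + B * rate n \<le> - C * rate n + - 1 * rate n"
            by (simp add: mult.commute)
          then show "exp (sqrt (real n) * A - real n * c\<^sup>2 / 8 + B * rate n) \<le> exp (- C * rate n) * exp (- 1 * rate n)"
            by (simp only: exp_add[symmetric] exp_le_cancel_iff)
        qed
        finally show "(\<integral>\<^sup>+z. w z * evid n (P n) z \<partial>noise) \<le> ennreal (exp (- C * rate n) * exp (- 1 * rate n))" .
      qed
    qed
    have "likely (\<lambda>n z. w z * evid n (P n) z \<le> ennreal (exp (- C * rate n)))"
      by (rule whp_markov[where b="\<lambda>n. exp (- 1 * rate n)"]) (use ev exp_rate_tendsto[of 1] in auto)
    then show ?thesis by eventually_elim (auto simp: w_def)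
  qed
  note key = this
  have "(\<lambda>z. Y (snd z)) \<in> borel_measurable noise"
    unfolding noise_eq by (rule measurable_compose[OF measurable_snd Y(1)])
  from whp_tight[OF this key] have "likely (\<lambda>n z. evid n (P n) z \<le> ennreal (exp (- C * rate n)))" .
  then show ?thesis by (simp add: P_def)
qed

definition outside :: "real \<Rightarrow> real \<Rightarrow> real \<Rightarrow> nat \<Rightarrow> real \<times> 'a \<Rightarrow> bool" where
  "outside \<tau> M L n q \<longleftrightarrow> \<bar>fst q - \<theta>0\<bar> > \<tau> \<or> norm (snd q - f0) > M * \<epsilon> n \<or> \<bar>snd q \<bullet> l n\<bar> > L * real n * \<epsilon> n * s n"

lemma outside_measurable [measurable]: "Measurable.pred Q (outside \<tau> M L n)"
  unfolding outside_def by measurable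

theorem posterior_contraction:
  "\<exists>M0 L0. \<forall>M\<ge>M0. \<forall>L\<ge>L0. \<forall>\<tau>>0. \<forall>\<kappa>>0.
     likely (\<lambda>n z. evid n (outside \<tau> M L n) z \<le> ennreal \<kappa> * total n z)"
proof -
  obtain C where C: "likely (\<lambda>n z. ennreal (exp (- C * rate n)) \<le> total n z)"
    using evidence_lower_bound by blast
  \<comment> \<open>M0 makes \<open>M\<^sup>2 / 4 - 6\<close> at least C + 1, and L0 does the same
    for \<open>L\<^sup>2 / 2 - 1\<close>, so both masses beat the evidence bound
    \<open>exp (- C * rate n)\<close>.\<close>
  define M0 where "M0 = 2 * sqrt (\<bar>C\<bar> + 7)"
  define L0 where "L0 = 2 * sqrt (\<bar>C\<bar> + 2)"
  show ?thesis
  proof (rule exI[of _ M0], rule exI[of _ L0], intro allI impI)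
    fix M L \<tau> \<kappa> :: real
    assume M: "M0 \<le> M" and L: "L0 \<le> L" and \<tau>: "0 < \<tau>" and \<kappa>: "0 < \<kappa>"
    have M1: "0 \<le> M" using M by (rule order_trans[rotated]) (simp add: M0_def)
    have L1: "0 \<le> L" using L by (rule order_trans[rotated]) (simp add: L0_def)
    have "M0\<^sup>2 \<le> M\<^sup>2" using M by (intro power_mono) (auto simp: M0_def)
    then have M2: "C + 1 \<le> M\<^sup>2 / 4 - 6" by (simp add: M0_def)
    have "L0\<^sup>2 \<le> L\<^sup>2" using L by (intro power_mono) (auto simp: L0_def)
    then have L2: "C + 1 \<le> L\<^sup>2 / 2 - 1" by (simp add: L0_def)
    have weaken: "likely (\<lambda>n z. evid n (P n) z \<le> ennreal (exp (- (C + 1) * rate n)))"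
      if "likely (\<lambda>n z. evid n (P n) z \<le> ennreal (exp (- C' * rate n)))" "C + 1 \<le> C'" for P C'
      using that(1)
    proof eventually_elim
      case (elim nz)
      obtain n z where nz: "nz = (n, z)" by (cases nz)
      have "exp (- C' * rate n) \<le> exp (- (C + 1) * rate n)"
      proof -
        have "- C' * rate n \<le> - (C + 1) * rate n"
          using mult_right_mono[OF that(2) rate_nonneg[of n]] unfolding mult_minus_left by (rule le_imp_neg_le)
        then show ?thesis by simp
      qed
      then show ?case using elim by (auto simp: nz intro: order_trans)
    qed
    have k3: "0 < \<kappa> / 3" using \<kappa> by simp
    note 1 = posterior_mass_small[OF C weaken[OF contraction_direct[OF M1] M2] k3]
    note 2 = posterior_mass_small[OF C weaken[OF contraction_shift[OF L1] L2] k3]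
    note 3 = posterior_mass_small[OF C contraction_theta[OF \<tau> M1, of "C + 1"] k3]
    show "likely (\<lambda>n z. evid n (outside \<tau> M L n) z \<le> ennreal \<kappa> * total n z)"
      using 1 2 3
    proof eventually_elim
      case (elim nz)
      obtain n z where nz: "nz = (n, z)" by (cases nz)
      let ?A = "\<lambda>q. norm (snd q - f0) > M * \<epsilon> n" and ?B = "\<lambda>q. \<bar>snd q \<bullet> l n\<bar> > L * real n * \<epsilon> n * s n"
        and ?C = "\<lambda>q. \<bar>fst q - \<theta>0\<bar> > \<tau> \<and> norm (snd q - f0) \<le> M * \<epsilon> n"
      have "evid n (outside \<tau> M L n) z \<le> evid n (\<lambda>q. (?A q \<or> ?B q) \<or> ?C q) z"
        by (rule evid_mono) (auto simp: outside_def)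
      also have "\<dots> \<le> (evid n ?A z + evid n ?B z) + evid n ?C z"
      proof -
        have "evid n (\<lambda>q. (?A q \<or> ?B q) \<or> ?C q) z \<le> evid n (\<lambda>q. ?A q \<or> ?B q) z + evid n ?C z"
          by (rule evid_disj_le) measurable
        also have "evid n (\<lambda>q. ?A q \<or> ?B q) z \<le> evid n ?A z + evid n ?B z"
          by (rule evid_disj_le) measurable
        finally show ?thesis by simp
      qed
      also have "\<dots> \<le> (ennreal (\<kappa> / 3) * total n z + ennreal (\<kappa> / 3) * total n z) + ennreal (\<kappa> / 3) * total n z"
        using elim by (intro add_mono) (auto simp: nz)
      also have "\<dots> = ennreal \<kappa> * total n z"
        using \<kappa> by (simp add: distrib_right[symmetric] ennreal_plus[symmetric])
      finally show ?case by (simp add: nz)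
    qed
  qed
qed

end

section \<open>The expansion of the log likelihood ratio\<close>

text \<open>The four cases of the theorem reach the analysis only through these assumptions:
  \<open>bias\<close> separates vanishing \<open>sqrt n * (\<epsilon> n)\<^sup>2\<close> from
  constant norms, and the sequences r and s will both be of order \<open>\<rho> n\<close> or, if
  \<open>\<gamma>\<close> lies in the RKHS, both of order 1 / sqrt n.\<close>

locale bvm_model = inverse_model +
  fixes \<gamma> :: 'a and r :: "nat \<Rightarrow> real" and info :: real
  assumes least_favorable: "\<And>v. \<gamma> \<bullet> v + K \<theta>0 \<gamma> \<bullet> K \<theta>0 v = dK f0 \<bullet> K \<theta>0 v"
    and info: "info = (norm (dK f0))\<^sup>2 - (norm \<gamma>)\<^sup>2 - (norm (K \<theta>0 \<gamma>))\<^sup>2" "0 < info"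
    and approx: "\<And>n. 1 \<le> n \<Longrightarrow> norm (covop (l n) - \<gamma>) \<le> r n"
    and r_rate: "r \<longlonglongrightarrow> 0" "(\<lambda>n. sqrt (real n) * \<epsilon> n * r n) \<longlonglongrightarrow> 0"
    and s_rate: "s \<longlonglongrightarrow> 0" "(\<lambda>n. sqrt (real n) * \<epsilon> n * s n) \<longlonglongrightarrow> 0"
    and bias: "(\<lambda>n. sqrt (real n) * (\<epsilon> n)\<^sup>2) \<longlonglongrightarrow> 0 \<or> (\<forall>\<theta>\<in>\<Theta>. \<forall>h. norm (K \<theta> h) = norm (K \<theta>0 h))"
begin

text \<open>The efficient score as a function of the noise alone; it does not depend on n and is
  therefore tight.\<close>

definition V :: "observation \<Rightarrow> real" where
  "V z = pairing e (snd z) (dK f0) - pairing e (fst z) \<gamma> - pairing e (snd z) (K \<theta>0 \<gamma>)"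

definition lan_exponent :: "nat \<Rightarrow> observation \<Rightarrow> real \<Rightarrow> real" where
  "lan_exponent n z t = sqrt (real n) * t * V z - real n * t\<^sup>2 * info / 2"

definition lan_error :: "nat \<Rightarrow> observation \<Rightarrow> real \<Rightarrow> 'a \<Rightarrow> real" where
  "lan_error n z \<theta> f = \<bar>ell n z \<theta> f - ell n z \<theta>0 (f + (\<theta> - \<theta>0) *\<^sub>R covop (l n)) - lan_exponent n z (\<theta> - \<theta>0)\<bar>"

definition wrem :: "real \<Rightarrow> 'a \<Rightarrow> 'a" where
  "wrem \<theta> f = K \<theta> f - K \<theta>0 f - (\<theta> - \<theta>0) *\<^sub>R dK f0"

text \<open>Splitting f into f - f0 and f0 allows the first order bound for the small part and the
  second order bound for the fixed part.\<close>

lemma wrem_bound: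
  assumes "\<theta> \<in> \<Theta>"
  shows "wrem \<theta> f \<in> S" "nS (wrem \<theta> f) \<le> D * \<bar>\<theta> - \<theta>0\<bar> * norm (f - f0) + D * (\<theta> - \<theta>0)\<^sup>2 * norm f0"
proof -
  define w1 where "w1 = K \<theta> (f - f0) - K \<theta>0 (f - f0)"
  define w0 where "w0 = K \<theta> f0 - K \<theta>0 f0 - (\<theta> - \<theta>0) *\<^sub>R dK f0"
  have w: "wrem \<theta> f = w1 + w0"
    by (simp add: w1_def w0_def wrem_def blinfun.diff_right)
  have S1: "w1 \<in> S" "nS w1 \<le> D * \<bar>\<theta> - \<theta>0\<bar> * norm (f - f0)" and S0: "w0 \<in> S" "nS w0 \<le> D * (\<theta> - \<theta>0)\<^sup>2 * norm f0"
    unfolding w1_def w0_def using first_order[OF assms, of "f - f0"] second_order[OF assms, of f0] by auto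
  have "w1 + w0 \<in> S" "nS (w1 + w0) \<le> nS w1 + nS w0"
    using S_space S1(1) S0(1) unfolding normed_subspace_def by (auto intro: subspace_add)
  then show "wrem \<theta> f \<in> S" "nS (wrem \<theta> f) \<le> D * \<bar>\<theta> - \<theta>0\<bar> * norm (f - f0) + D * (\<theta> - \<theta>0)\<^sup>2 * norm f0"
    using S1(2) S0(2) w by auto
qed

lemma norm_add_square: "(norm (p + q))\<^sup>2 = (norm p)\<^sup>2 + 2 * (p \<bullet> q) + (norm q)\<^sup>2" for p q :: 'a
  by (simp add: power2_norm_eq_inner inner_add_right inner_commute)

text \<open>In use a is f - f0, A its image under \<open>K \<theta>0\<close>, u is
  \<open>dK f0\<close>, and x, G are \<open>\<gamma>\<close> and its image. The leading terms that
  are linear in t and in the unknown a cancel because of the normal equations; this is what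
  determines the direction of the shift.\<close>

lemma quadratic_identity:
  fixes a A u w x xn G Gn :: 'a and t i :: real
  assumes "x \<bullet> a + G \<bullet> A = u \<bullet> A" "i = (norm u)\<^sup>2 - (norm x)\<^sup>2 - (norm G)\<^sup>2"
  shows "(norm a)\<^sup>2 - (norm (a + t *\<^sub>R xn))\<^sup>2 + (norm (A + t *\<^sub>R u + w))\<^sup>2 - (norm (A + t *\<^sub>R Gn))\<^sup>2
    = t\<^sup>2 * i + (t\<^sup>2 * ((norm x)\<^sup>2 - (norm xn)\<^sup>2 + (norm G)\<^sup>2 - (norm Gn)\<^sup>2) + 2 * t * (u \<bullet> w) + (norm w)\<^sup>2
        + 2 * (w \<bullet> A) + 2 * t * ((x - xn) \<bullet> a + (G - Gn) \<bullet> A))"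
proof -
  note n1 = norm_add_square
  have "(norm a)\<^sup>2 - (norm (a + t *\<^sub>R xn))\<^sup>2 = - 2 * t * (xn \<bullet> a) - t\<^sup>2 * (norm xn)\<^sup>2"
    by (simp add: n1 power_mult_distrib inner_commute)
  moreover have "(norm (A + t *\<^sub>R u + w))\<^sup>2 = (norm A)\<^sup>2 + 2 * t * (u \<bullet> A) + t\<^sup>2 * (norm u)\<^sup>2 + 2 * (w \<bullet> A) + 2 * t * (u \<bullet> w) + (norm w)\<^sup>2"
    by (simp add: n1 power_mult_distrib inner_add_left inner_commute[of A])
  moreover have "(norm (A + t *\<^sub>R Gn))\<^sup>2 = (norm A)\<^sup>2 + 2 * t * (Gn \<bullet> A) + t\<^sup>2 * (norm Gn)\<^sup>2"
    by (simp add: n1 power_mult_distrib inner_commute)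
  moreover have "2 * t * (u \<bullet> A) = 2 * t * (x \<bullet> a) + 2 * t * (G \<bullet> A)"
    using assms(1) by (metis distrib_left)
  ultimately show ?thesis
    unfolding assms(2) by (simp add: algebra_simps)
qed

lemma lan_identity:
  fixes z :: observation
  assumes p: "f - f0 \<in> paired (fst z)" "\<gamma> \<in> paired (fst z)" "covop (l n) \<in> paired (fst z)"
    "K \<theta>0 (f - f0) \<in> paired (snd z)" "wrem \<theta> f \<in> paired (snd z)" "dK f0 \<in> paired (snd z)"
    "K \<theta>0 \<gamma> \<in> paired (snd z)" "K \<theta>0 (covop (l n)) \<in> paired (snd z)"
  defines "t \<equiv> \<theta> - \<theta>0" and "a \<equiv> f - f0" and "w \<equiv> wrem \<theta> f" and "h \<equiv> covop (l n)"
  shows "ell n z \<theta> f - ell n z \<theta>0 (f + t *\<^sub>R h) - (sqrt (real n) * t * V z - real n * t\<^sup>2 * info / 2)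
    = sqrt (real n) * pairing e (snd z) w
      - sqrt (real n) * t * (pairing e (fst z) (h - \<gamma>) + pairing e (snd z) (K \<theta>0 (h - \<gamma>)))
      - real n / 2 * (t\<^sup>2 * ((norm \<gamma>)\<^sup>2 - (norm h)\<^sup>2 + (norm (K \<theta>0 \<gamma>))\<^sup>2 - (norm (K \<theta>0 h))\<^sup>2)
        + 2 * t * (dK f0 \<bullet> w) + (norm w)\<^sup>2 + 2 * (w \<bullet> K \<theta>0 a)
        + 2 * t * ((\<gamma> - h) \<bullet> a + (K \<theta>0 \<gamma> - K \<theta>0 h) \<bullet> K \<theta>0 a))"
proof -
  have r1: "resid \<theta> f = K \<theta>0 a + t *\<^sub>R dK f0 + w"
    by (simp add: resid_def a_def w_def wrem_def t_def blinfun.diff_right)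
  have r2: "resid \<theta>0 (f + t *\<^sub>R h) = K \<theta>0 a + t *\<^sub>R K \<theta>0 h"
    by (simp add: resid_def a_def blinfun.diff_right blinfun.add_right blinfun.scaleR_right)
  have fh: "f + t *\<^sub>R h - f0 = a + t *\<^sub>R h" by (simp add: a_def)
  note p' = p[folded a_def w_def h_def]
  have G1: "pairing e (fst z) (a + t *\<^sub>R h) = pairing e (fst z) a + t * pairing e (fst z) h"
    using p' by (simp add: pairing_add pairing_scaleR paired_scaleR)
  have G2: "pairing e (snd z) (resid \<theta> f) = pairing e (snd z) (K \<theta>0 a) + t * pairing e (snd z) (dK f0) + pairing e (snd z) w"
    unfolding r1 using p' by (simp add: pairing_add pairing_scaleR paired_scaleR paired_add)
  have G3: "pairing e (snd z) (resid \<theta>0 (f + t *\<^sub>R h)) = pairing e (snd z) (K \<theta>0 a) + t * pairing e (snd z) (K \<theta>0 h)"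
    unfolding r2 using p' by (simp add: pairing_add pairing_scaleR paired_scaleR)
  have G4: "pairing e (fst z) (h - \<gamma>) = pairing e (fst z) h - pairing e (fst z) \<gamma>"
    "pairing e (snd z) (K \<theta>0 (h - \<gamma>)) = pairing e (snd z) (K \<theta>0 h) - pairing e (snd z) (K \<theta>0 \<gamma>)"
    using p' by (simp_all add: pairing_diff blinfun.diff_right)
  define N where "N = (norm a)\<^sup>2 - (norm (a + t *\<^sub>R h))\<^sup>2 + (norm (resid \<theta> f))\<^sup>2 - (norm (resid \<theta>0 (f + t *\<^sub>R h)))\<^sup>2"
  have N: "N = t\<^sup>2 * info + (t\<^sup>2 * ((norm \<gamma>)\<^sup>2 - (norm h)\<^sup>2 + (norm (K \<theta>0 \<gamma>))\<^sup>2 - (norm (K \<theta>0 h))\<^sup>2)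
        + 2 * t * (dK f0 \<bullet> w) + (norm w)\<^sup>2 + 2 * (w \<bullet> K \<theta>0 a)
        + 2 * t * ((\<gamma> - h) \<bullet> a + (K \<theta>0 \<gamma> - K \<theta>0 h) \<bullet> K \<theta>0 a))"
    unfolding N_def r1 r2 by (rule quadratic_identity[OF least_favorable info(1)])
  have "ell n z \<theta> f - ell n z \<theta>0 (f + t *\<^sub>R h)
     = sqrt (real n) * (t * pairing e (snd z) (dK f0) + pairing e (snd z) w - t * pairing e (snd z) (K \<theta>0 h) - t * pairing e (fst z) h)
       - real n / 2 * N"
    unfolding ell_def fh a_def[symmetric] G1 G2 G3 N_def by (simp add: algebra_simps)
  then show ?thesis
    unfolding N V_def G4 by (simp add: algebra_simps)
qed

text \<open>Sorts the remainder into multiples of \<open>sqrt n * \<bar>t\<bar>\<close> and of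
  \<open>n * t\<^sup>2\<close>, the scales that the quadratic expansion tolerates. The critical term
  T6 pairs the increment \<open>w1\<close> with \<open>K \<theta>0 a\<close>; in general it is
  linear in t and quadratic in f - f0.\<close>

lemma lan_remainder:
  fixes z :: observation
  assumes p: "f - f0 \<in> paired (fst z)" "\<gamma> \<in> paired (fst z)" "covop (l n) \<in> paired (fst z)"
    "K \<theta>0 (f - f0) \<in> paired (snd z)" "wrem \<theta> f \<in> paired (snd z)" "dK f0 \<in> paired (snd z)"
    "K \<theta>0 \<gamma> \<in> paired (snd z)" "K \<theta>0 (covop (l n)) \<in> paired (snd z)"
    and th: "\<theta> \<in> \<Theta>" and tau: "\<bar>\<theta> - \<theta>0\<bar> \<le> \<tau>" and a: "norm (f - f0) \<le> e1" and n: "1 \<le> n"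
    and y: "\<bar>pairing e (snd z) (wrem \<theta> f)\<bar> \<le> y * (D * \<bar>\<theta> - \<theta>0\<bar> * norm (f - f0) + D * (\<theta> - \<theta>0)\<^sup>2 * norm f0)" "0 \<le> y"
    and b: "0 \<le> b" "(\<forall>\<theta>\<in>\<Theta>. \<forall>h. norm (K \<theta> h) = norm (K \<theta>0 h)) \<or> sqrt (real n) * e1\<^sup>2 \<le> b"
  defines "t \<equiv> \<theta> - \<theta>0" and "h \<equiv> covop (l n)" and "c \<equiv> e1 + \<tau> * norm f0"
  shows "\<bar>ell n z \<theta> f - ell n z \<theta>0 (f + t *\<^sub>R h) - (sqrt (real n) * t * V z - real n * t\<^sup>2 * info / 2)\<bar>
    \<le> (sqrt (real n) * \<bar>t\<bar>) * (y * D * e1 + \<bar>pairing e (fst z) (h - \<gamma>)\<bar> + \<bar>pairing e (snd z) (K \<theta>0 (h - \<gamma>))\<bar>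
          + sqrt (real n) * ((1 + D\<^sup>2) * r n * e1) + D ^ 3 * b)
      + (real n * t\<^sup>2) * (y * D * norm f0 / sqrt (real n) + (1 + D\<^sup>2) * (r n * (2 * norm \<gamma> + r n)) / 2
          + norm (dK f0) * (D\<^sup>2 * c) + (D\<^sup>2 * c)\<^sup>2 / 2 + D\<^sup>2 * norm f0 * (D * e1) + (D\<^sup>2 * e1)\<^sup>2 / 2)"
proof -
  define a where "a = f - f0"
  define w where "w = wrem \<theta> f"
  define w1 where "w1 = K \<theta> a - K \<theta>0 a"
  define w0 where "w0 = K \<theta> f0 - K \<theta>0 f0 - t *\<^sub>R dK f0"
  have w: "w = w1 + w0"
    by (simp add: w_def w1_def w0_def wrem_def a_def t_def blinfun.diff_right)
  have D0: "0 \<le> D" using D by simp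
  have na: "norm a \<le> e1" using a by (simp add: a_def)
  have e0: "0 \<le> e1" using na norm_ge_zero order_trans by blast
  have tt: "\<bar>t\<bar> \<le> \<tau>" using tau by (simp add: t_def)
  have tau0: "0 \<le> \<tau>" using tt by linarith
  have hr: "norm (h - \<gamma>) \<le> r n" unfolding h_def by (rule approx[OF n])
  have r0: "0 \<le> r n" using hr norm_ge_zero order_trans by blast
  have S0: "w0 \<in> S" "nS w0 \<le> D * t\<^sup>2 * norm f0"
    unfolding w0_def t_def using second_order[OF th, of f0] by auto
  have nSw: "D * \<bar>t\<bar> * norm a + D * t\<^sup>2 * norm f0 \<le> D * \<bar>t\<bar> * e1 + D * t\<^sup>2 * norm f0"
    using mult_left_mono[OF na, of "D * \<bar>t\<bar>"] D0 by simp
  have nw1: "norm w1 \<le> D\<^sup>2 * \<bar>t\<bar> * e1"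
    unfolding w1_def t_def using K_diff_norm[OF th, of a] mult_left_mono[OF na, of "D\<^sup>2 * \<bar>\<theta> - \<theta>0\<bar>"] by simp
  have nw0: "norm w0 \<le> D\<^sup>2 * t\<^sup>2 * norm f0"
    using S_norm[OF S0(1)] mult_left_mono[OF S0(2) D0] by (simp add: power2_eq_square)
  have nw: "norm w \<le> \<bar>t\<bar> * (D\<^sup>2 * c)"
  proof -
    have "norm w \<le> norm w1 + norm w0" unfolding w by (rule norm_triangle_ineq)
    also have "norm w0 \<le> D\<^sup>2 * (\<bar>t\<bar> * \<tau>) * norm f0"
      by (rule order_trans[OF nw0], intro mult_right_mono mult_left_mono)
        (use mult_left_mono[OF tt abs_ge_zero[of t]] in \<open>auto simp: power2_eq_square\<close>)
    finally show ?thesis using nw1 by (simp add: c_def algebra_simps)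
  qed
  have nA: "norm (K \<theta>0 a) \<le> D * e1"
    using K_bound[OF theta0_in, of a] mult_left_mono[OF na D0] by simp
  have T1: "\<bar>sqrt (real n) * pairing e (snd z) w\<bar> \<le> (sqrt (real n) * \<bar>t\<bar>) * (y * D * e1) + (real n * t\<^sup>2) * (y * D * norm f0 / sqrt (real n))"
  proof -
    have "\<bar>pairing e (snd z) w\<bar> \<le> y * (D * \<bar>t\<bar> * e1 + D * t\<^sup>2 * norm f0)"
      using y(1) mult_left_mono[OF nSw y(2)] unfolding w_def t_def a_def by (rule order_trans)
    then have "sqrt (real n) * \<bar>pairing e (snd z) w\<bar> \<le> sqrt (real n) * (y * (D * \<bar>t\<bar> * e1 + D * t\<^sup>2 * norm f0))"
      by (intro mult_left_mono) auto
    also have "\<dots> = (sqrt (real n) * \<bar>t\<bar>) * (y * D * e1) + (real n / sqrt (real n)) * t\<^sup>2 * (y * D * norm f0)"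
      by (simp add: real_div_sqrt algebra_simps)
    finally show ?thesis by (simp add: abs_mult)
  qed
  have T2: "\<bar>sqrt (real n) * t * (pairing e (fst z) (h - \<gamma>) + pairing e (snd z) (K \<theta>0 (h - \<gamma>)))\<bar>
      \<le> (sqrt (real n) * \<bar>t\<bar>) * (\<bar>pairing e (fst z) (h - \<gamma>)\<bar> + \<bar>pairing e (snd z) (K \<theta>0 (h - \<gamma>))\<bar>)"
    unfolding abs_mult by (simp add: mult_left_mono)
  have sqd: "\<bar>(norm x)\<^sup>2 - (norm x')\<^sup>2\<bar> \<le> d * (2 * norm x + d)" if "norm (x' - x) \<le> d" for x x' :: 'a and d
  proof -
    have "(norm x)\<^sup>2 - (norm x')\<^sup>2 = (norm x - norm x') * (norm x + norm x')" by (simp add: power2_eq_square algebra_simps)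
    moreover have "\<bar>norm x - norm x'\<bar> \<le> d" using that norm_triangle_ineq3[of x x'] by (simp add: norm_minus_commute)
    ultimately show ?thesis by (simp add: abs_mult) (intro mult_mono, auto)
  qed
  have T3: "\<bar>t\<^sup>2 * ((norm \<gamma>)\<^sup>2 - (norm h)\<^sup>2 + (norm (K \<theta>0 \<gamma>))\<^sup>2 - (norm (K \<theta>0 h))\<^sup>2)\<bar> \<le> t\<^sup>2 * ((1 + D\<^sup>2) * (r n * (2 * norm \<gamma> + r n)))"
  proof -
    have "norm (K \<theta>0 h - K \<theta>0 \<gamma>) \<le> D * r n"
      using K_bound[OF theta0_in, of "h - \<gamma>"] mult_left_mono[OF hr D0] by (simp add: blinfun.diff_right)
    from sqd[OF this] have "\<bar>(norm (K \<theta>0 \<gamma>))\<^sup>2 - (norm (K \<theta>0 h))\<^sup>2\<bar> \<le> D * r n * (2 * norm (K \<theta>0 \<gamma>) + D * r n)" .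
    also have "\<dots> \<le> D * r n * (2 * (D * norm \<gamma>) + D * r n)"
      using K_bound[OF theta0_in, of \<gamma>] D0 r0 by (intro mult_left_mono) auto
    also have "\<dots> = D\<^sup>2 * (r n * (2 * norm \<gamma> + r n))" by (simp add: power2_eq_square algebra_simps)
    finally have "\<bar>(norm (K \<theta>0 \<gamma>))\<^sup>2 - (norm (K \<theta>0 h))\<^sup>2\<bar> \<le> D\<^sup>2 * (r n * (2 * norm \<gamma> + r n))" .
    then have "\<bar>(norm \<gamma>)\<^sup>2 - (norm h)\<^sup>2 + (norm (K \<theta>0 \<gamma>))\<^sup>2 - (norm (K \<theta>0 h))\<^sup>2\<bar> \<le> (1 + D\<^sup>2) * (r n * (2 * norm \<gamma> + r n))"
      using sqd[OF hr] by (simp only: distrib_right)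
    then show ?thesis unfolding abs_mult by (simp add: mult_left_mono)
  qed
  have T4: "\<bar>2 * t * (dK f0 \<bullet> w)\<bar> \<le> 2 * t\<^sup>2 * (norm (dK f0) * (D\<^sup>2 * c))"
  proof -
    have "\<bar>dK f0 \<bullet> w\<bar> \<le> norm (dK f0) * (\<bar>t\<bar> * (D\<^sup>2 * c))"
      by (rule order_trans[OF Cauchy_Schwarz_ineq2]) (intro mult_left_mono nw norm_ge_zero)
    then have "\<bar>t\<bar> * \<bar>dK f0 \<bullet> w\<bar> \<le> \<bar>t\<bar> * (norm (dK f0) * (\<bar>t\<bar> * (D\<^sup>2 * c)))" by (intro mult_left_mono) auto
    also have "\<dots> = t\<^sup>2 * (norm (dK f0) * (D\<^sup>2 * c))"
    by (simp add: power2_eq_square)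
    finally show ?thesis by (simp add: abs_mult)
  qed
  have T5: "\<bar>(norm w)\<^sup>2\<bar> \<le> t\<^sup>2 * (D\<^sup>2 * c)\<^sup>2"
    using power_mono[OF nw norm_ge_zero, of 2] by (simp add: power_mult_distrib)
  have T6: "\<bar>2 * (w \<bullet> K \<theta>0 a)\<bar> \<le> 2 * t\<^sup>2 * (D\<^sup>2 * norm f0 * (D * e1)) + t\<^sup>2 * (D\<^sup>2 * e1)\<^sup>2 + 2 / real n * ((sqrt (real n) * \<bar>t\<bar>) * (D ^ 3 * b))"
  proof -
    have A0: "\<bar>w0 \<bullet> K \<theta>0 a\<bar> \<le> (D\<^sup>2 * t\<^sup>2 * norm f0) * (D * e1)"
      by (rule order_trans[OF Cauchy_Schwarz_ineq2]) (intro mult_mono nw0 nA, auto)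
    have A1: "\<bar>2 * (w1 \<bullet> K \<theta>0 a)\<bar> \<le> t\<^sup>2 * (D\<^sup>2 * e1)\<^sup>2 + 2 / real n * ((sqrt (real n) * \<bar>t\<bar>) * (D ^ 3 * b))"
      using b(2)
    proof
      assume "\<forall>\<theta>\<in>\<Theta>. \<forall>h. norm (K \<theta> h) = norm (K \<theta>0 h)"
      \<comment> \<open>The vector \<open>w1 + K \<theta>0 a\<close> is \<open>K \<theta> a\<close>,
        so equal norms make the inner product minus half the squared norm of \<open>w1\<close>,
        hence quadratic in t.\<close>
      then have "norm (w1 + K \<theta>0 a) = norm (K \<theta>0 a)" using th by (simp add: w1_def)
      then have "(norm (w1 + K \<theta>0 a))\<^sup>2 = (norm (K \<theta>0 a))\<^sup>2" by simp
      then have "2 * (w1 \<bullet> K \<theta>0 a) = - (norm w1)\<^sup>2"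
        unfolding norm_add_square by linarith
      then have "\<bar>2 * (w1 \<bullet> K \<theta>0 a)\<bar> = (norm w1)\<^sup>2" by simp
      also have "\<dots> \<le> (D\<^sup>2 * \<bar>t\<bar> * e1)\<^sup>2" using nw1 by (intro power_mono) auto
      also have "\<dots> = t\<^sup>2 * (D\<^sup>2 * e1)\<^sup>2" by (simp add: power_mult_distrib)
      also have "\<dots> \<le> t\<^sup>2 * (D\<^sup>2 * e1)\<^sup>2 + 2 / real n * ((sqrt (real n) * \<bar>t\<bar>) * (D ^ 3 * b))"
        using b(1) D0 by simp
      finally show ?thesis .
    next
      assume be: "sqrt (real n) * e1\<^sup>2 \<le> b"
      have "\<bar>w1 \<bullet> K \<theta>0 a\<bar> \<le> (D\<^sup>2 * \<bar>t\<bar> * e1) * (D * e1)"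
        by (rule order_trans[OF Cauchy_Schwarz_ineq2]) (intro mult_mono nw1 nA, use e0 in auto)
      also have "\<dots> = \<bar>t\<bar> * D ^ 3 * e1\<^sup>2" by (simp add: power2_eq_square power3_eq_cube)
      also have "\<dots> = 1 / real n * ((sqrt (real n) * \<bar>t\<bar>) * (D ^ 3 * (sqrt (real n) * e1\<^sup>2)))"
        using n by (simp add: field_simps)
      also have "\<dots> \<le> 1 / real n * ((sqrt (real n) * \<bar>t\<bar>) * (D ^ 3 * b))"
        using be D0 by (intro mult_left_mono) auto
      finally have "\<bar>2 * (w1 \<bullet> K \<theta>0 a)\<bar> \<le> 2 / real n * ((sqrt (real n) * \<bar>t\<bar>) * (D ^ 3 * b))" by simp
      moreover have "0 \<le> t\<^sup>2 * (D\<^sup>2 * e1)\<^sup>2" by simp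
      ultimately show ?thesis by (rule add_increasing[rotated])
    qed
    have "2 * (w \<bullet> K \<theta>0 a) = 2 * (w1 \<bullet> K \<theta>0 a) + 2 * (w0 \<bullet> K \<theta>0 a)" by (simp add: w inner_add_left)
    then have "\<bar>2 * (w \<bullet> K \<theta>0 a)\<bar> \<le> \<bar>2 * (w1 \<bullet> K \<theta>0 a)\<bar> + 2 * \<bar>w0 \<bullet> K \<theta>0 a\<bar>" by simp
    also have "2 * \<bar>w0 \<bullet> K \<theta>0 a\<bar> \<le> 2 * t\<^sup>2 * (D\<^sup>2 * norm f0 * (D * e1))" using A0 by (simp add: algebra_simps)
    finally show ?thesis using A1 by linarith
  qed
  have T7: "\<bar>2 * t * ((\<gamma> - h) \<bullet> a + (K \<theta>0 \<gamma> - K \<theta>0 h) \<bullet> K \<theta>0 a)\<bar> \<le> 2 * \<bar>t\<bar> * ((1 + D\<^sup>2) * r n * e1)"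
  proof -
    have "\<bar>(\<gamma> - h) \<bullet> a\<bar> \<le> r n * e1"
      by (rule order_trans[OF Cauchy_Schwarz_ineq2]) (intro mult_mono na, use hr r0 in \<open>auto simp: norm_minus_commute\<close>)
    moreover have "\<bar>(K \<theta>0 \<gamma> - K \<theta>0 h) \<bullet> K \<theta>0 a\<bar> \<le> (D * r n) * (D * e1)"
    proof (rule order_trans[OF Cauchy_Schwarz_ineq2], intro mult_mono nA)
      show "norm (K \<theta>0 \<gamma> - K \<theta>0 h) \<le> D * r n"
        using K_bound[OF theta0_in, of "\<gamma> - h"] mult_left_mono[OF hr D0] by (simp add: blinfun.diff_right norm_minus_commute)
    qed (use D0 r0 in auto)
    ultimately have "\<bar>(\<gamma> - h) \<bullet> a + (K \<theta>0 \<gamma> - K \<theta>0 h) \<bullet> K \<theta>0 a\<bar> \<le> (1 + D\<^sup>2) * r n * e1"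
      by (simp add: power2_eq_square algebra_simps)
    then have "\<bar>t\<bar> * \<bar>(\<gamma> - h) \<bullet> a + (K \<theta>0 \<gamma> - K \<theta>0 h) \<bullet> K \<theta>0 a\<bar> \<le> \<bar>t\<bar> * ((1 + D\<^sup>2) * r n * e1)"
      by (intro mult_left_mono) auto
    then show ?thesis by (simp add: abs_mult)
  qed
  let ?X = "t\<^sup>2 * ((norm \<gamma>)\<^sup>2 - (norm h)\<^sup>2 + (norm (K \<theta>0 \<gamma>))\<^sup>2 - (norm (K \<theta>0 h))\<^sup>2)
        + 2 * t * (dK f0 \<bullet> w) + (norm w)\<^sup>2 + 2 * (w \<bullet> K \<theta>0 a)
        + 2 * t * ((\<gamma> - h) \<bullet> a + (K \<theta>0 \<gamma> - K \<theta>0 h) \<bullet> K \<theta>0 a)"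
  let ?Y = "t\<^sup>2 * ((1 + D\<^sup>2) * (r n * (2 * norm \<gamma> + r n))) + 2 * t\<^sup>2 * (norm (dK f0) * (D\<^sup>2 * c)) + t\<^sup>2 * (D\<^sup>2 * c)\<^sup>2
      + (2 * t\<^sup>2 * (D\<^sup>2 * norm f0 * (D * e1)) + t\<^sup>2 * (D\<^sup>2 * e1)\<^sup>2 + 2 / real n * ((sqrt (real n) * \<bar>t\<bar>) * (D ^ 3 * b)))
      + 2 * \<bar>t\<bar> * ((1 + D\<^sup>2) * r n * e1)"
  have abs5: "\<bar>x1 + x2 + x3 + x4 + x5\<bar> \<le> y1 + y2 + y3 + y4 + y5"
    if "\<bar>x1\<bar> \<le> y1" "\<bar>x2\<bar> \<le> y2" "\<bar>x3\<bar> \<le> y3" "\<bar>x4\<bar> \<le> y4" "\<bar>x5\<bar> \<le> y5" for x1 x2 x3 x4 x5 y1 y2 y3 y4 y5 :: real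
    using that by linarith
  have "\<bar>?X\<bar> \<le> ?Y" by (rule abs5[OF T3 T4 T5 T6 T7])
  then have "real n / 2 * \<bar>?X\<bar> \<le> real n / 2 * ?Y" by (intro mult_left_mono) auto
  then have T8: "\<bar>real n / 2 * ?X\<bar> \<le> real n / 2 * ?Y" by (simp add: abs_mult)
  have Yeq: "real n / 2 * ?Y = (sqrt (real n) * \<bar>t\<bar>) * (sqrt (real n) * ((1 + D\<^sup>2) * r n * e1) + D ^ 3 * b)
      + (real n * t\<^sup>2) * ((1 + D\<^sup>2) * (r n * (2 * norm \<gamma> + r n)) / 2
          + norm (dK f0) * (D\<^sup>2 * c) + (D\<^sup>2 * c)\<^sup>2 / 2 + D\<^sup>2 * norm f0 * (D * e1) + (D\<^sup>2 * e1)\<^sup>2 / 2)"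
  proof -
    \<comment> \<open>Stated for free variables, with \<open>sN * sN = N\<close> as the only fact
      about the square root, this is a purely algebraic identity.\<close>
    have gen: "N / 2 * (m * A1 + 2 * m * A2 + m * A3 + (2 * m * A4 + m * A5 + 2 / N * ((sN * t) * B)) + 2 * t * q)
        = (sN * t) * (sN * q + B) + (N * m) * (A1 / 2 + A2 + A3 / 2 + A4 + A5 / 2)"
      if "N \<noteq> 0" "sN * sN = N" for N m A1 A2 A3 A4 A5 sN t B q :: real
    proof -
      have "N / 2 * (m * A1 + 2 * m * A2 + m * A3 + (2 * m * A4 + m * A5 + 2 / N * ((sN * t) * B)) + 2 * t * q)
          = N / 2 * (2 / N * ((sN * t) * B)) + N * t * q + (N * m) * (A1 / 2 + A2 + A3 / 2 + A4 + A5 / 2)"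
        by (simp add: algebra_simps)
      also have "N / 2 * (2 / N * ((sN * t) * B)) = (sN * t) * B" using that(1) by simp
      also have "N * t * q = (sN * t) * (sN * q)" unfolding that[symmetric] by (simp)
      finally show ?thesis by (simp add: distrib_left)
    qed
    show ?thesis by (rule gen) (use n in simp_all)
  qed
  have abs3: "\<bar>x1 - x2 - x3\<bar> \<le> y1 + y2 + y3" if "\<bar>x1\<bar> \<le> y1" "\<bar>x2\<bar> \<le> y2" "\<bar>x3\<bar> \<le> y3" for x1 x2 x3 y1 y2 y3 :: real
    using that by linarith
  have eqn: "ell n z \<theta> f - ell n z \<theta>0 (f + t *\<^sub>R h) - (sqrt (real n) * t * V z - real n * t\<^sup>2 * info / 2)
      = sqrt (real n) * pairing e (snd z) w
      - sqrt (real n) * t * (pairing e (fst z) (h - \<gamma>) + pairing e (snd z) (K \<theta>0 (h - \<gamma>))) - real n / 2 * ?X"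
    unfolding t_def h_def w_def a_def by (rule lan_identity[OF p])
  have le: "\<bar>sqrt (real n) * pairing e (snd z) w
      - sqrt (real n) * t * (pairing e (fst z) (h - \<gamma>) + pairing e (snd z) (K \<theta>0 (h - \<gamma>))) - real n / 2 * ?X\<bar> \<le> ((sqrt (real n) * \<bar>t\<bar>) * (y * D * e1) + (real n * t\<^sup>2) * (y * D * norm f0 / sqrt (real n)))
      + (sqrt (real n) * \<bar>t\<bar>) * (\<bar>pairing e (fst z) (h - \<gamma>)\<bar> + \<bar>pairing e (snd z) (K \<theta>0 (h - \<gamma>))\<bar>) + real n / 2 * ?Y"
    by (rule abs3[OF T1 T2 T8])
  have fin: "\<bar>ell n z \<theta> f - ell n z \<theta>0 (f + t *\<^sub>R h) - (sqrt (real n) * t * V z - real n * t\<^sup>2 * info / 2)\<bar>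
      \<le> ((sqrt (real n) * \<bar>t\<bar>) * (y * D * e1) + (real n * t\<^sup>2) * (y * D * norm f0 / sqrt (real n)))
      + (sqrt (real n) * \<bar>t\<bar>) * (\<bar>pairing e (fst z) (h - \<gamma>)\<bar> + \<bar>pairing e (snd z) (K \<theta>0 (h - \<gamma>))\<bar>) + real n / 2 * ?Y"
    by (rule ord_eq_le_trans[OF arg_cong[where f=abs, OF eqn] le])
  have gen: "u * A1 + m * B1 + u * (p1 + p2) + (u * (q1 + q2) + m * (b1 + b2 + b3 + b4 + b5))
      = u * (A1 + p1 + p2 + q1 + q2) + m * (B1 + b1 + b2 + b3 + b4 + b5)" for u m A1 B1 p1 p2 q1 q2 b1 b2 b3 b4 b5 :: real
    by (simp add: algebra_simps)
  show ?thesis by (rule ord_le_eq_trans[OF fin[unfolded Yeq] gen])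
qed

end

section \<open>Integrating out the nuisance parameter\<close>

context onb
begin

lemma second_moment_pairing: "(\<integral>\<^sup>+z. ennreal ((pairing e z v)\<^sup>2) \<partial>white_seq) = ennreal ((norm v)\<^sup>2)"
proof -
  have "(\<integral>\<^sup>+z. ennreal ((pairing e z v)\<^sup>2) \<partial>white_seq) = (\<integral>\<^sup>+x. ennreal (x\<^sup>2) \<partial>distr white_seq borel (\<lambda>z. pairing e z v))"
    by (subst nn_integral_distr) auto
  also have "\<dots> = ennreal (LINT x|normal_measure 0 ((norm v)\<^sup>2). x\<^sup>2)"
    unfolding distr_pairing by (intro nn_integral_eq_integral normal_measure_moments) auto
  finally show ?thesis by (simp add: normal_measure_moments)
qed

lemma whp_pairing_small:
  assumes v: "\<forall>\<^sub>F n in sequentially. norm (v n) \<le> B n" and B: "B \<longlonglongrightarrow> 0" and \<kappa>: "0 < \<kappa>"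
  shows "likely (\<lambda>n z. \<bar>pairing e (fst z) (v n)\<bar> \<le> \<kappa>)" "likely (\<lambda>n z. \<bar>pairing e (snd z) (v n)\<bar> \<le> \<kappa>)"
proof -
  have *: "likely (\<lambda>n z. ennreal ((pairing e (p z) (v n))\<^sup>2) \<le> ennreal (\<kappa>\<^sup>2))"
    if m: "\<And>n. (\<lambda>z. ennreal ((pairing e (p z) (v n))\<^sup>2)) \<in> borel_measurable noise"
      and i: "\<And>n. (\<integral>\<^sup>+z. ennreal ((pairing e (p z) (v n))\<^sup>2) \<partial>noise) = ennreal ((norm (v n))\<^sup>2)" for p
  proof (rule whp_markov[where b="\<lambda>n. (B n)\<^sup>2 / \<kappa>\<^sup>2"])
    show "\<forall>\<^sub>F n in sequentially. (\<integral>\<^sup>+z. ennreal ((pairing e (p z) (v n))\<^sup>2) \<partial>noise) \<le> ennreal (\<kappa>\<^sup>2 * ((B n)\<^sup>2 / \<kappa>\<^sup>2))"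
      using v
    proof eventually_elim
      fix n assume "norm (v n) \<le> B n"
      then have "(norm (v n))\<^sup>2 \<le> (B n)\<^sup>2" by (intro power_mono) auto
      then show "(\<integral>\<^sup>+z. ennreal ((pairing e (p z) (v n))\<^sup>2) \<partial>noise) \<le> ennreal (\<kappa>\<^sup>2 * ((B n)\<^sup>2 / \<kappa>\<^sup>2))"
        unfolding i using \<kappa> by (simp)
    qed
    have "(\<lambda>n. (B n)\<^sup>2 / \<kappa>\<^sup>2) \<longlonglongrightarrow> 0\<^sup>2 / \<kappa>\<^sup>2" using \<kappa> by (intro tendsto_intros B) auto
    then show "(\<lambda>n. (B n)\<^sup>2 / \<kappa>\<^sup>2) \<longlonglongrightarrow> 0" by simp
  qed (use m \<kappa> in auto)
  have sq: "\<bar>x\<bar> \<le> \<kappa>" if "ennreal (x\<^sup>2) \<le> ennreal (\<kappa>\<^sup>2)" for x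
    using that \<kappa> by (simp add: abs_le_square_iff[symmetric])
  have m: "(\<lambda>z. ennreal ((pairing e z u)\<^sup>2)) \<in> borel_measurable white_seq" for u by measurable
  have "likely (\<lambda>n z. ennreal ((pairing e (fst z) (v n))\<^sup>2) \<le> ennreal (\<kappa>\<^sup>2))"
  proof (rule *)
    show "(\<lambda>z. ennreal ((pairing e (fst z) (v n))\<^sup>2)) \<in> borel_measurable noise" for n
      by simp
    show "(\<integral>\<^sup>+z. ennreal ((pairing e (fst z) (v n))\<^sup>2) \<partial>noise) = ennreal ((norm (v n))\<^sup>2)" for n
      using nn_integral_noise_mult[OF m[of "v n"], of "\<lambda>_. 1"] white.emeasure_space_1 by (simp add: second_moment_pairing)
  qed
  then show "likely (\<lambda>n z. \<bar>pairing e (fst z) (v n)\<bar> \<le> \<kappa>)"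
    by (rule whp_case_elim) (rule sq)
  have "likely (\<lambda>n z. ennreal ((pairing e (snd z) (v n))\<^sup>2) \<le> ennreal (\<kappa>\<^sup>2))"
  proof (rule *)
    show "(\<lambda>z. ennreal ((pairing e (snd z) (v n))\<^sup>2)) \<in> borel_measurable noise" for n
      by simp
    show "(\<integral>\<^sup>+z. ennreal ((pairing e (snd z) (v n))\<^sup>2) \<partial>noise) = ennreal ((norm (v n))\<^sup>2)" for n
      using nn_integral_noise_mult[OF _ m[of "v n"], of "\<lambda>_. 1"] white.emeasure_space_1 by (simp add: second_moment_pairing)
  qed
  then show "likely (\<lambda>n z. \<bar>pairing e (snd z) (v n)\<bar> \<le> \<kappa>)"
    by (rule whp_case_elim) (rule sq)
qed

end

section \<open>Evidences at the true theta under shifts of f\<close>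

context inverse_model
begin

text \<open>Cameron-Martin applied to F divided by the density: the shift and its weight together
  leave the integral unchanged.\<close>

lemma cameron_martin_shift:
  assumes [measurable]: "F \<in> borel_measurable borel"
  shows "(\<integral>\<^sup>+f. F (f + t *\<^sub>R covop k) * ennreal (exp (- t * (f \<bullet> k) - t\<^sup>2 * cov k k / 2)) \<partial>\<pi>) = (\<integral>\<^sup>+f. F f \<partial>\<pi>)"
proof -
  let ?G = "\<lambda>f. F f * ennreal (exp (- t * (f \<bullet> k) + t\<^sup>2 * cov k k / 2))"
  have "(\<integral>\<^sup>+f. F (f + t *\<^sub>R covop k) * ennreal (exp (- t * (f \<bullet> k) - t\<^sup>2 * cov k k / 2)) \<partial>\<pi>)
      = (\<integral>\<^sup>+f. ?G (f + covop (t *\<^sub>R k)) \<partial>\<pi>)"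
    by (simp add: covop_scaleR covop_inner algebra_simps power2_eq_square)
  also have "\<dots> = (\<integral>\<^sup>+f. ?G f * ennreal (exp (f \<bullet> (t *\<^sub>R k) - cov (t *\<^sub>R k) (t *\<^sub>R k) / 2)) \<partial>\<pi>)"
    by (rule cameron_martin) measurable
  also have "\<dots> = (\<integral>\<^sup>+f. F f \<partial>\<pi>)"
    by (simp add: mult.assoc ennreal_mult[symmetric] exp_add[symmetric] cov_simps power2_eq_square)
  finally show ?thesis .
qed

definition inside :: "real \<Rightarrow> real \<Rightarrow> nat \<Rightarrow> 'h \<Rightarrow> bool" where
  "inside M L n f \<longleftrightarrow> norm (f - f0) \<le> M * \<epsilon> n \<and> \<bar>f \<bullet> l n\<bar> \<le> L * real n * \<epsilon> n * s n"

abbreviation base :: "nat \<Rightarrow> observation \<Rightarrow> ennreal" where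
  "base n z \<equiv> \<integral>\<^sup>+f. lr n z \<theta>0 f \<partial>\<pi>"

abbreviation base_in :: "real \<Rightarrow> real \<Rightarrow> nat \<Rightarrow> observation \<Rightarrow> ennreal" where
  "base_in M L n z \<equiv> \<integral>\<^sup>+f. indicator {f. inside M L n f} f * lr n z \<theta>0 f \<partial>\<pi>"

abbreviation base_out :: "real \<Rightarrow> real \<Rightarrow> nat \<Rightarrow> observation \<Rightarrow> ennreal" where
  "base_out M L n z \<equiv> \<integral>\<^sup>+f. indicator {f. \<not> inside M L n f} f * lr n z \<theta>0 f \<partial>\<pi>"

lemma inside_measurable [measurable]: "Measurable.pred borel (inside M L n)"
  unfolding inside_def by measurable

lemma ell0_measurable [measurable]: "(\<lambda>f. ell n z \<theta>0 f) \<in> borel_measurable borel"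
  by (auto simp: space_restrict_space theta0_in)

text \<open>On \<open>inside\<close> the weight of \<open>cameron_martin_shift\<close> is at least
  the reciprocal of the exponential factor on the right; insert it at that price, drop the indicator
  and undo the shift.\<close>

lemma shifted_evidence_upper:
  assumes n: "1 \<le> n"
  shows "(\<integral>\<^sup>+f. indicator {f. inside M L n f} f * lr n z \<theta>0 (f + t *\<^sub>R covop (l n)) \<partial>\<pi>)
    \<le> ennreal (exp (\<bar>t\<bar> * (L * real n * \<epsilon> n * s n) + t\<^sup>2 * (real n * (s n)\<^sup>2) / 2)) * base n z"
proof -
  let ?c = "\<bar>t\<bar> * (L * real n * \<epsilon> n * s n) + t\<^sup>2 * (real n * (s n)\<^sup>2) / 2"
  let ?w = "\<lambda>f. - t * (f \<bullet> l n) - t\<^sup>2 * cov (l n) (l n) / 2"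
  let ?F = "\<lambda>f. lr n z \<theta>0 f"
  have w: "0 \<le> ?c + ?w f" if "inside M L n f" for f
  proof -
    have "\<bar>t * (f \<bullet> l n)\<bar> \<le> \<bar>t\<bar> * (L * real n * \<epsilon> n * s n)"
      unfolding abs_mult using that by (intro mult_left_mono) (auto simp: inside_def)
    moreover have "t\<^sup>2 * cov (l n) (l n) \<le> t\<^sup>2 * (real n * (s n)\<^sup>2)"
      using shift_size(2)[OF n] by (intro mult_left_mono) auto
    ultimately show ?thesis by simp
  qed
  have "(\<integral>\<^sup>+f. indicator {f. inside M L n f} f * ?F (f + t *\<^sub>R covop (l n)) \<partial>\<pi>)
      \<le> (\<integral>\<^sup>+f. ennreal (exp ?c) * (?F (f + t *\<^sub>R covop (l n)) * ennreal (exp (?w f))) \<partial>\<pi>)"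
  proof (intro nn_integral_mono)
    fix f
    show "indicator {f. inside M L n f} f * ?F (f + t *\<^sub>R covop (l n)) \<le> ennreal (exp ?c) * (?F (f + t *\<^sub>R covop (l n)) * ennreal (exp (?w f)))"
    proof (cases "inside M L n f")
      case True
      have "exp (ell n z \<theta>0 (f + t *\<^sub>R covop (l n))) \<le> exp ?c * (exp (ell n z \<theta>0 (f + t *\<^sub>R covop (l n))) * exp (?w f))"
        using w[OF True] by (simp only: exp_add[symmetric] exp_le_cancel_iff)
      then show ?thesis using True by (simp add: ennreal_mult[symmetric])
    qed simp
  qed
  also have "\<dots> = ennreal (exp ?c) * (\<integral>\<^sup>+f. ?F (f + t *\<^sub>R covop (l n)) * ennreal (exp (?w f)) \<partial>\<pi>)"
    by (rule nn_integral_cmult) (auto intro: )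
  also have "(\<integral>\<^sup>+f. ?F (f + t *\<^sub>R covop (l n)) * ennreal (exp (?w f)) \<partial>\<pi>) = (\<integral>\<^sup>+f. ?F f \<partial>\<pi>)"
    by (rule cameron_martin_shift) measurable
  finally show ?thesis .
qed

text \<open>The converse estimate starts from the smaller set with M / 2 and L / 2, because shifting
  moves a point by up to the other half of each bound.\<close>

lemma shifted_evidence_lower:
  assumes n: "1 \<le> n" and sh: "\<bar>t\<bar> * norm (covop (l n)) \<le> M / 2 * \<epsilon> n" "\<bar>t\<bar> * (real n * (s n)\<^sup>2) \<le> L / 2 * real n * \<epsilon> n * s n"
  shows "base_in (M / 2) (L / 2) n z
    \<le> ennreal (exp (\<bar>t\<bar> * (L * real n * \<epsilon> n * s n))) *
      (\<integral>\<^sup>+f. indicator {f. inside M L n f} f * lr n z \<theta>0 (f + t *\<^sub>R covop (l n)) \<partial>\<pi>)"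
proof -
  let ?c = "\<bar>t\<bar> * (L * real n * \<epsilon> n * s n)"
  let ?w = "\<lambda>f. - t * (f \<bullet> l n) - t\<^sup>2 * cov (l n) (l n) / 2"
  let ?F = "\<lambda>f. indicator {f. inside (M / 2) (L / 2) n f} f * lr n z \<theta>0 f"
  let ?E = "\<lambda>f. lr n z \<theta>0 (f + t *\<^sub>R covop (l n))"
  have q: "cov (l n) (l n) \<le> real n * (s n)\<^sup>2" by (rule shift_size(2)[OF n])
  have ins: "inside M L n f" if "inside (M / 2) (L / 2) n (f + t *\<^sub>R covop (l n))" for f
  proof -
    have "norm (f - f0) \<le> norm (f + t *\<^sub>R covop (l n) - f0) + norm (t *\<^sub>R covop (l n))"
      using norm_triangle_ineq4[of "f + t *\<^sub>R covop (l n) - f0" "t *\<^sub>R covop (l n)"] by simp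
    also have "\<dots> \<le> M / 2 * \<epsilon> n + M / 2 * \<epsilon> n"
      using that sh(1) by (auto simp: inside_def)
    finally have 1: "norm (f - f0) \<le> M * \<epsilon> n" by simp
    have "(f + t *\<^sub>R covop (l n)) \<bullet> l n = f \<bullet> l n + t * cov (l n) (l n)" by (simp add: inner_add_left covop_inner)
    then have "\<bar>f \<bullet> l n\<bar> \<le> \<bar>(f + t *\<^sub>R covop (l n)) \<bullet> l n\<bar> + \<bar>t * cov (l n) (l n)\<bar>" by linarith
    also have "\<bar>t * cov (l n) (l n)\<bar> \<le> \<bar>t\<bar> * (real n * (s n)\<^sup>2)"
      unfolding abs_mult using q cov_nonneg[of "l n"] by (intro mult_left_mono) auto
    finally have "\<bar>f \<bullet> l n\<bar> \<le> L / 2 * real n * \<epsilon> n * s n + L / 2 * real n * \<epsilon> n * s n"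
      using that sh(2) by (auto simp: inside_def)
    then show ?thesis using 1 by (simp add: inside_def)
  qed
  have w: "?w f \<le> ?c" if "inside M L n f" for f
  proof -
    have "\<bar>t * (f \<bullet> l n)\<bar> \<le> ?c"
      unfolding abs_mult using that by (intro mult_left_mono) (auto simp: inside_def)
    moreover have "0 \<le> t\<^sup>2 * cov (l n) (l n)" using cov_nonneg by simp
    ultimately show ?thesis by simp
  qed
  have "(\<integral>\<^sup>+f. ?F f \<partial>\<pi>) = (\<integral>\<^sup>+f. ?F (f + t *\<^sub>R covop (l n)) * ennreal (exp (?w f)) \<partial>\<pi>)"
    by (rule cameron_martin_shift[symmetric]) measurable
  also have "\<dots> \<le> (\<integral>\<^sup>+f. ennreal (exp ?c) * (indicator {f. inside M L n f} f * ?E f) \<partial>\<pi>)"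
  proof (intro nn_integral_mono)
    fix f
    show "?F (f + t *\<^sub>R covop (l n)) * ennreal (exp (?w f)) \<le> ennreal (exp ?c) * (indicator {f. inside M L n f} f * ?E f)"
    proof (cases "inside (M / 2) (L / 2) n (f + t *\<^sub>R covop (l n))")
      case True
      then have i: "inside M L n f" by (rule ins)
      have "?E f * ennreal (exp (?w f)) \<le> ?E f * ennreal (exp ?c)"
        using w[OF i] by (intro mult_left_mono) auto
      then show ?thesis using True i by (simp add: mult.commute)
    qed simp
  qed
  also have "\<dots> = ennreal (exp ?c) * (\<integral>\<^sup>+f. indicator {f. inside M L n f} f * ?E f \<partial>\<pi>)"
    by (rule nn_integral_cmult) (auto)
  finally show ?thesis .
qed

end

context inverse_model
begin

lemma prob_space_return_theta0: "prob_space (return borel_Theta \<theta>0)"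
  using theta0_in by (intro prob_space_return) (simp add: space_restrict_space)

text \<open>Contraction with \<open>\<theta>0\<close> known, obtained from the point mass at
  \<open>\<theta>0\<close> as prior. It lets \<open>base_in\<close> replace \<open>base\<close>, the
  common factor of the bounds for the marginal of \<open>\<theta>\<close>.\<close>

lemma known_theta_contraction:
  "\<exists>M0 L0. \<forall>M\<ge>M0. \<forall>L\<ge>L0. \<forall>\<kappa>>0. likely (\<lambda>n z.
     base_out M L n z \<le> ennreal \<kappa> * base n z
     \<and> base n z < \<infinity>)"
proof -
  interpret known: model_prior \<pi> e \<Theta> K dK \<theta>0 f0 S nS D \<epsilon> s l "return borel_Theta \<theta>0"
  proof (intro model_prior.intro model_prior_axioms.intro)
    have m: "{\<theta> \<in> \<Theta>. \<bar>\<theta> - \<theta>0\<bar> \<le> \<epsilon> n} \<in> sets borel_Theta" for n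
    by (simp add: Theta compact_imp_closed sets_restrict_space_iff)
    have "measure (return borel_Theta \<theta>0) {\<theta> \<in> \<Theta>. \<bar>\<theta> - \<theta>0\<bar> \<le> \<epsilon> n} = 1" for n
      using measure_return[OF m[of n], of \<theta>0] theta0_in eps(1)[of n] by simp
    then show "\<exists>c. \<forall>\<^sub>F n in sequentially. exp (- c * (real n * (\<epsilon> n)\<^sup>2)) \<le> measure (return borel_Theta \<theta>0) {\<theta> \<in> \<Theta>. \<bar>\<theta> - \<theta>0\<bar> \<le> \<epsilon> n}"
      by (intro exI[of _ 0]) simp
  qed (simp_all add: prob_space_return_theta0 inverse_model_axioms)
  have ev: "known.evid n P z = (\<integral>\<^sup>+f. indicator {f. P (\<theta>0, f)} f * lr n z \<theta>0 f \<partial>\<pi>)"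
    if [measurable]: "Measurable.pred known.Q P" for n P z
  proof -
    have "known.evid n P z = (\<integral>\<^sup>+\<theta>. \<integral>\<^sup>+f. indicator {q. P q} (\<theta>, f) * lr n z \<theta> f \<partial>\<pi> \<partial>return borel_Theta \<theta>0)"
      unfolding known.evid_def known.Q_def
      by (subst nn_integral_fst[symmetric]) (auto)
    also have "\<dots> = (\<integral>\<^sup>+f. indicator {q. P q} (\<theta>0, f) * lr n z \<theta>0 f \<partial>\<pi>)"
    proof (rule nn_integral_return)
      show "\<theta>0 \<in> space borel_Theta" using theta0_in by (simp add: space_restrict_space)
      then have "(\<lambda>q. indicator {q. P q} q * lr n z (fst q) (snd q)) \<in> borel_measurable (return borel_Theta \<theta>0 \<Otimes>\<^sub>M \<pi>)"
        by simp
      from borel_measurable_nn_integral_fst[OF this]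
      show "(\<lambda>\<theta>. \<integral>\<^sup>+f. indicator {q. P q} (\<theta>, f) * lr n z \<theta> f \<partial>\<pi>) \<in> borel_measurable borel_Theta"
        by simp
    qed
    finally show ?thesis by (simp add: indicator_def)
  qed
  obtain M0 L0 where post: "\<And>M L \<tau> \<kappa>. M0 \<le> M \<Longrightarrow> L0 \<le> L \<Longrightarrow> 0 < \<tau> \<Longrightarrow> 0 < \<kappa> \<Longrightarrow>
     likely (\<lambda>n z. known.evid n (known.outside \<tau> M L n) z \<le> ennreal \<kappa> * known.total n z)"
    using known.posterior_contraction by blast
  show ?thesis
  proof (rule exI[of _ M0], rule exI[of _ L0], intro allI impI)
    fix M L \<kappa> :: real assume M: "M0 \<le> M" and L: "L0 \<le> L" and \<kappa>: "0 < \<kappa>"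
    have fin: "likely (\<lambda>n z. known.total n z \<noteq> \<infinity>)"
      by (rule whp_of_eventually) (auto intro: always_eventually known.AE_evid_finite simp del: infinity_ennreal_def)
    show "likely (\<lambda>n z.
     base_out M L n z \<le> ennreal \<kappa> * base n z
     \<and> base n z < \<infinity>)"
      using post[OF M L zero_less_one \<kappa>] fin
    proof eventually_elim
      case (elim nz)
      obtain n z where nz: "nz = (n, z)" by (cases nz)
      have "known.outside 1 M L n (\<theta>0, f) \<longleftrightarrow> \<not> inside M L n f" for f
        by (auto simp: known.outside_def inside_def)
      then have e1: "known.evid n (known.outside 1 M L n) z = base_out M L n z"
        by (subst ev) auto
      have e2: "known.total n z = base n z"
        by (subst ev) auto
      show ?case using elim nz e1 e2 by (simp add: less_top)
    qed
  qed
qed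

end

section \<open>Uniform local asymptotic normality\<close>

locale bvm_prior = bvm_model + model_prior
begin

text \<open>The coefficients in \<open>lan_remainder\<close> vanish in probability except for those
  with \<open>\<tau> * norm f0\<close>, which persist as n grows and are made small by the choice of
  \<open>\<tau>\<close>. Hence \<open>\<tau>0\<close> depends on \<open>\<kappa>\<close> and not on
  n.\<close>

theorem whp_lan:
  assumes M: "0 \<le> M" and \<kappa>: "0 < \<kappa>"
  shows "\<exists>\<tau>0>0. \<forall>\<tau>. 0 < \<tau> \<longrightarrow> \<tau> \<le> \<tau>0 \<longrightarrow> likely (\<lambda>n z. AE q in Q.
    \<bar>fst q - \<theta>0\<bar> \<le> \<tau> \<longrightarrow> norm (snd q - f0) \<le> M * \<epsilon> n \<longrightarrow>
    lan_error n z (fst q) (snd q) \<le> \<kappa> * (1 + real n * (fst q - \<theta>0)\<^sup>2))"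
proof -
  obtain Y where Y: "Y \<in> borel_measurable white_seq" "\<And>z. 0 \<le> Y z"
    "\<And>x. x \<in> S \<Longrightarrow> AE z in white_seq. \<bar>pairing e z x\<bar> \<le> Y z * nS x"
    by (rule dudley_bound[OF S_space S_entropy]) blast
  have Ym: "(\<lambda>z. Y (snd z)) \<in> borel_measurable noise"
    unfolding noise_eq by (rule measurable_compose[OF measurable_snd Y(1)])
  define const where "const \<longleftrightarrow> (\<forall>\<theta>\<in>\<Theta>. \<forall>h. norm (K \<theta> h) = norm (K \<theta>0 h))"
  \<comment> \<open>The allowance for the critical cross term; 0 under constant norms, where that
    term is quadratic in t.\<close>
  define b where "b = (\<lambda>n. if const then 0 else sqrt (real n) * (M * \<epsilon> n)\<^sup>2)"
  have b0: "0 \<le> b n" for n by (simp add: b_def)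
  have bb: "const \<or> sqrt (real n) * (M * \<epsilon> n)\<^sup>2 \<le> b n" for n by (simp add: b_def)
  have blim: "b \<longlonglongrightarrow> 0"
  proof (cases const)
    case False
    then have "(\<lambda>n. sqrt (real n) * (\<epsilon> n)\<^sup>2) \<longlonglongrightarrow> 0" using bias by (auto simp: const_def)
    from tendsto_mult[OF tendsto_const[of "M\<^sup>2"] this] False show ?thesis
      by (simp add: b_def[abs_def] power_mult_distrib mult.left_commute)
  qed (simp add: b_def[abs_def])
  define B0 where "B0 = D\<^sup>2 * norm f0"
  have B0: "0 \<le> B0" by (simp add: B0_def)
  define q0 where "q0 = norm (dK f0) * B0 + B0\<^sup>2 + 1"
  have q0: "0 < q0" using B0 by (simp add: q0_def add_nonneg_pos)
  \<comment> \<open>Gives \<open>\<tau> * q0 \<le> \<kappa> / 8\<close>; as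
    \<open>\<tau>\<^sup>2 \<le> \<tau>\<close>, this dominates the limit of
    \<open>k2\<close>.\<close>
  define \<tau>0 where "\<tau>0 = min 1 (\<kappa> / (8 * q0))"
  have \<tau>0: "0 < \<tau>0" using \<kappa> q0 by (simp add: \<tau>0_def)
  show ?thesis
  proof (intro exI[of _ \<tau>0] conjI \<tau>0 allI impI)
    fix \<tau> assume \<tau>: "0 < \<tau>" "\<tau> \<le> \<tau>0"
    define c where "c = (\<lambda>n. M * \<epsilon> n + \<tau> * norm f0)"
    define k1 where "k1 = (\<lambda>n. sqrt (real n) * ((1 + D\<^sup>2) * r n * (M * \<epsilon> n)) + D ^ 3 * b n)"
    define k2 where "k2 = (\<lambda>n. (1 + D\<^sup>2) * (r n * (2 * norm \<gamma> + r n)) / 2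
          + norm (dK f0) * (D\<^sup>2 * c n) + (D\<^sup>2 * c n)\<^sup>2 / 2 + D\<^sup>2 * norm f0 * (D * (M * \<epsilon> n)) + (D\<^sup>2 * (M * \<epsilon> n))\<^sup>2 / 2)"
    have k1lim: "k1 \<longlonglongrightarrow> 0"
    proof -
      have "(\<lambda>n. ((1 + D\<^sup>2) * M) * (sqrt (real n) * \<epsilon> n * r n) + D ^ 3 * b n) \<longlonglongrightarrow> ((1 + D\<^sup>2) * M) * 0 + D ^ 3 * 0"
        by (intro tendsto_intros r_rate blim)
      then show ?thesis by (simp add: k1_def mult_ac)
    qed
    have k2lim: "k2 \<longlonglongrightarrow> norm (dK f0) * (B0 * \<tau>) + (B0 * \<tau>)\<^sup>2 / 2"
    proof -
      have "c \<longlonglongrightarrow> M * 0 + \<tau> * norm f0" unfolding c_def by (intro tendsto_intros eps)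
      then have "k2 \<longlonglongrightarrow> (1 + D\<^sup>2) * (0 * (2 * norm \<gamma> + 0)) / 2
          + norm (dK f0) * (D\<^sup>2 * (M * 0 + \<tau> * norm f0)) + (D\<^sup>2 * (M * 0 + \<tau> * norm f0))\<^sup>2 / 2 + D\<^sup>2 * norm f0 * (D * (M * 0)) + (D\<^sup>2 * (M * 0))\<^sup>2 / 2"
        unfolding k2_def by (intro tendsto_intros eps r_rate) auto
      then show ?thesis by (simp add: B0_def mult_ac)
    qed
    have klim: "norm (dK f0) * (B0 * \<tau>) + (B0 * \<tau>)\<^sup>2 / 2 < \<kappa> / 4"
    proof -
      have t1: "\<tau> \<le> 1" "\<tau> * q0 \<le> \<kappa> / 8" using \<tau> q0 by (auto simp: \<tau>0_def field_simps)
      have "\<tau>\<^sup>2 \<le> \<tau>" using \<tau>(1) t1(1) by (simp add: power2_eq_square)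
      then have "B0\<^sup>2 * \<tau>\<^sup>2 \<le> B0\<^sup>2 * \<tau>" by (intro mult_left_mono) auto
      then have "norm (dK f0) * (B0 * \<tau>) + (B0 * \<tau>)\<^sup>2 / 2 \<le> \<tau> * q0 - \<tau> - B0\<^sup>2 * \<tau> / 2"
        by (simp add: q0_def algebra_simps)
      moreover have "0 \<le> B0\<^sup>2 * \<tau> / 2" using \<tau>(1) by simp
      ultimately show ?thesis using t1(2) \<tau>(1) \<kappa> by linarith
    qed
    have ev1: "likely (\<lambda>n z. k1 n < \<kappa> / 4 \<and> k2 n < \<kappa> / 4 \<and> 1 \<le> n)"
      using order_tendstoD[OF k1lim, of "\<kappa> / 4"] order_tendstoD(2)[OF k2lim klim] \<kappa>
      by (intro whp_sequentially eventually_conj) auto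
    have ev2: "likely (\<lambda>n z. \<bar>Y (snd z)\<bar> * \<bar>D * (M * \<epsilon> n)\<bar> \<le> \<kappa> / 12)"
    proof (rule whp_small_multiple[OF Ym])
      have "(\<lambda>n. D * (M * \<epsilon> n)) \<longlonglongrightarrow> D * (M * 0)" by (intro tendsto_intros eps)
      then show "(\<lambda>n. D * (M * \<epsilon> n)) \<longlonglongrightarrow> 0" by simp
    qed (use \<kappa> in simp)
    have ev3: "likely (\<lambda>n z. \<bar>Y (snd z)\<bar> * \<bar>D * norm f0 * inverse (sqrt (real n))\<bar> \<le> \<kappa> / 4)"
    proof (rule whp_small_multiple[OF Ym])
      note sqrt_nat_at_top
      then have "(\<lambda>n. D * norm f0 * inverse (sqrt (real n))) \<longlonglongrightarrow> D * norm f0 * 0"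
        by (intro tendsto_intros tendsto_inverse_0_at_top)
      then show "(\<lambda>n. D * norm f0 * inverse (sqrt (real n))) \<longlonglongrightarrow> 0" by simp
    qed (use \<kappa> in simp)
    have hr: "\<forall>\<^sub>F n in sequentially. norm (covop (l n) - \<gamma>) \<le> r n"
      using eventually_ge_at_top[of 1] by eventually_elim (rule approx)
    have ev4: "likely (\<lambda>n z. \<bar>pairing e (fst z) (covop (l n) - \<gamma>)\<bar> \<le> \<kappa> / 12)"
      by (rule whp_pairing_small[OF hr r_rate(1)]) (use \<kappa> in simp)
    have ev5: "likely (\<lambda>n z. \<bar>pairing e (snd z) (K \<theta>0 (covop (l n) - \<gamma>))\<bar> \<le> \<kappa> / 12)"
    proof (rule whp_pairing_small(2)[where B="\<lambda>n. D * r n"])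
      show "\<forall>\<^sub>F n in sequentially. norm (K \<theta>0 (covop (l n) - \<gamma>)) \<le> D * r n"
        using hr
      proof eventually_elim
        fix n assume "norm (covop (l n) - \<gamma>) \<le> r n"
        then have "D * norm (covop (l n) - \<gamma>) \<le> D * r n" using D by auto
        then show "norm (K \<theta>0 (covop (l n) - \<gamma>)) \<le> D * r n"
          using K_bound[OF theta0_in, of "covop (l n) - \<gamma>"] by linarith
      qed
      have "(\<lambda>n. D * r n) \<longlonglongrightarrow> D * 0" by (intro tendsto_intros r_rate)
      then show "(\<lambda>n. D * r n) \<longlonglongrightarrow> 0" by simp
    qed (use \<kappa> in simp)
    have ev6: "likely (\<lambda>n z. \<gamma> \<in> paired (fst z) \<and> covop (l n) \<in> paired (fst z) \<and> dK f0 \<in> paired (snd z)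
        \<and> K \<theta>0 \<gamma> \<in> paired (snd z) \<and> K \<theta>0 (covop (l n)) \<in> paired (snd z))"
      by (rule whp_of_eventually) (auto intro!: always_eventually AE_noise_fst AE_noise_snd AE_paired)
    define good where "good = (\<lambda>z q. snd q - f0 \<in> paired (fst z) \<and> K \<theta>0 (snd q - f0) \<in> paired (snd z)
        \<and> wrem (fst q) (snd q) \<in> paired (snd z)
        \<and> \<bar>pairing e (snd z) (wrem (fst q) (snd q))\<bar> \<le> Y (snd z) * (D * \<bar>fst q - \<theta>0\<bar> * norm (snd q - f0) + D * (fst q - \<theta>0)\<^sup>2 * norm f0))"
    \<comment> \<open>The chaining bound is wanted at \<open>wrem\<close>, which varies with the
      parameter; for a given z it is available at almost every q.\<close>
    have AEgood: "AE z in noise. AE q in Q. good z q"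
    proof (rule AE_noise_Q)
      have m1: "(\<lambda>p. fst (fst p)) \<in> measurable (noise \<Otimes>\<^sub>M Q) white_seq" "(\<lambda>p. snd (fst p)) \<in> measurable (noise \<Otimes>\<^sub>M Q) white_seq"
        by auto
      have t0: "(\<lambda>p. \<theta>0) \<in> measurable (noise \<Otimes>\<^sub>M Q) borel_Theta"
        using theta0_in by (simp add: space_restrict_space)
      have w [measurable]: "(\<lambda>p. wrem (fst (snd p)) (snd (snd p))) \<in> borel_measurable (noise \<Otimes>\<^sub>M Q)"
        unfolding wrem_def t0[measurable] by measurable
      have K0 [measurable]: "(\<lambda>p. K \<theta>0 (snd (snd p) - f0)) \<in> borel_measurable (noise \<Otimes>\<^sub>M Q)"
        by (rule K_measurable[OF t0]) measurable
      have mA1: "Measurable.pred (noise \<Otimes>\<^sub>M Q) (\<lambda>p. snd (snd p) - f0 \<in> paired (fst (fst p)))"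
        by (rule paired_measurable[OF m1(1)]) measurable
      have mA2: "Measurable.pred (noise \<Otimes>\<^sub>M Q) (\<lambda>p. K \<theta>0 (snd (snd p) - f0) \<in> paired (snd (fst p)))"
        by (rule paired_measurable[OF m1(2)]) measurable
      have mA3: "Measurable.pred (noise \<Otimes>\<^sub>M Q) (\<lambda>p. wrem (fst (snd p)) (snd (snd p)) \<in> paired (snd (fst p)))"
        by (rule paired_measurable[OF m1(2)]) measurable
      have mB1: "(\<lambda>p. pairing e (snd (fst p)) (wrem (fst (snd p)) (snd (snd p)))) \<in> borel_measurable (noise \<Otimes>\<^sub>M Q)"
        by simp
      have mB2: "(\<lambda>p. Y (snd (fst p))) \<in> borel_measurable (noise \<Otimes>\<^sub>M Q)"
        by (rule measurable_compose[OF m1(2) Y(1)])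
      have mB3: "(\<lambda>p. fst (snd p)) \<in> borel_measurable (noise \<Otimes>\<^sub>M Q)"
        by simp
      have mB4: "(\<lambda>p. norm (snd (snd p) - f0)) \<in> borel_measurable (noise \<Otimes>\<^sub>M Q)" by measurable
      show "Measurable.pred (noise \<Otimes>\<^sub>M Q) (\<lambda>p. good (fst p) (snd p))"
        unfolding good_def
      proof (intro pred_intros_logic(3) mA1 mA2 mA3)
        show "Measurable.pred (noise \<Otimes>\<^sub>M Q) (\<lambda>p. \<bar>pairing e (snd (fst p)) (wrem (fst (snd p)) (snd (snd p)))\<bar>
          \<le> Y (snd (fst p)) * (D * \<bar>fst (snd p) - \<theta>0\<bar> * norm (snd (snd p) - f0) + D * (fst (snd p) - \<theta>0)\<^sup>2 * norm f0))"
          unfolding pred_def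
          by (intro borel_measurable_le borel_measurable_abs borel_measurable_times borel_measurable_add
              borel_measurable_diff borel_measurable_power borel_measurable_const mB1 mB2 mB3 mB4)
      qed
      fix q assume "q \<in> space Q"
      then have th: "fst q \<in> \<Theta>" by (auto simp: space_Q)
      note wb = wrem_bound[OF th, of "snd q"]
      show "AE z in noise. good z q"
        using AE_noise_fst[OF AE_paired[of "snd q - f0"]] AE_noise_snd[OF AE_paired[of "K \<theta>0 (snd q - f0)"]]
          AE_noise_snd[OF AE_paired[of "wrem (fst q) (snd q)"]] AE_noise_snd[OF Y(3)[OF wb(1)]]
      proof eventually_elim
        fix z :: observation
        assume "snd q - f0 \<in> paired (fst z)" "K \<theta>0 (snd q - f0) \<in> paired (snd z)" "wrem (fst q) (snd q) \<in> paired (snd z)"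
          and "\<bar>pairing e (snd z) (wrem (fst q) (snd q))\<bar> \<le> Y (snd z) * nS (wrem (fst q) (snd q))"
        then show "good z q"
          unfolding good_def using mult_left_mono[OF wb(2) Y(2)[of "snd z"]] by (auto)
      qed
    qed
    have ev7: "likely (\<lambda>n z. AE q in Q. good z q)"
      by (rule whp_of_eventually) (simp add: AEgood)
    show "likely (\<lambda>n z. AE q in Q.
      \<bar>fst q - \<theta>0\<bar> \<le> \<tau> \<longrightarrow> norm (snd q - f0) \<le> M * \<epsilon> n \<longrightarrow>
      lan_error n z (fst q) (snd q) \<le> \<kappa> * (1 + real n * (fst q - \<theta>0)\<^sup>2))"
      using ev1 ev2 ev3 ev4 ev5 ev6 ev7
    proof eventually_elim
      case (elim nz)
      obtain n z where nz: "nz = (n, z)" by (cases nz)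
      have kk: "k1 n < \<kappa> / 4" "k2 n < \<kappa> / 4" and n: "1 \<le> n"
        and y1: "Y (snd z) * (D * (M * \<epsilon> n)) \<le> \<kappa> / 12" and y2: "Y (snd z) * (D * norm f0 * inverse (sqrt (real n))) \<le> \<kappa> / 4"
        and g1: "\<bar>pairing e (fst z) (covop (l n) - \<gamma>)\<bar> \<le> \<kappa> / 12" and g2: "\<bar>pairing e (snd z) (K \<theta>0 (covop (l n) - \<gamma>))\<bar> \<le> \<kappa> / 12"
        and pz: "\<gamma> \<in> paired (fst z)" "covop (l n) \<in> paired (fst z)" "dK f0 \<in> paired (snd z)"
          "K \<theta>0 \<gamma> \<in> paired (snd z)" "K \<theta>0 (covop (l n)) \<in> paired (snd z)"
        and ae: "AE q in Q. good z q"
        using elim by (auto simp: nz abs_mult[symmetric])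
      have spQ: "AE q in Q. q \<in> space Q" by simp
      show ?case
        unfolding nz prod.case using ae spQ
      proof eventually_elim
        fix q assume gq: "good z q" and "q \<in> space Q"
        then have th: "fst q \<in> \<Theta>" by (auto simp: space_Q)
        show "\<bar>fst q - \<theta>0\<bar> \<le> \<tau> \<longrightarrow> norm (snd q - f0) \<le> M * \<epsilon> n \<longrightarrow>
          lan_error n z (fst q) (snd q) \<le> \<kappa> * (1 + real n * (fst q - \<theta>0)\<^sup>2)"
        proof (intro impI)
          assume t: "\<bar>fst q - \<theta>0\<bar> \<le> \<tau>" and a: "norm (snd q - f0) \<le> M * \<epsilon> n"
          let ?t = "fst q - \<theta>0"
          have g: "snd q - f0 \<in> paired (fst z)" "K \<theta>0 (snd q - f0) \<in> paired (snd z)" "wrem (fst q) (snd q) \<in> paired (snd z)"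
            "\<bar>pairing e (snd z) (wrem (fst q) (snd q))\<bar> \<le> Y (snd z) * (D * \<bar>?t\<bar> * norm (snd q - f0) + D * ?t\<^sup>2 * norm f0)"
            using gq by (auto simp: good_def)
          have "lan_error n z (fst q) (snd q)
            \<le> (sqrt (real n) * \<bar>?t\<bar>) * (Y (snd z) * D * (M * \<epsilon> n) + \<bar>pairing e (fst z) (covop (l n) - \<gamma>)\<bar> + \<bar>pairing e (snd z) (K \<theta>0 (covop (l n) - \<gamma>))\<bar>
              + sqrt (real n) * ((1 + D\<^sup>2) * r n * (M * \<epsilon> n)) + D ^ 3 * b n)
            + (real n * ?t\<^sup>2) * (Y (snd z) * D * norm f0 / sqrt (real n) + (1 + D\<^sup>2) * (r n * (2 * norm \<gamma> + r n)) / 2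
              + norm (dK f0) * (D\<^sup>2 * (M * \<epsilon> n + \<tau> * norm f0)) + (D\<^sup>2 * (M * \<epsilon> n + \<tau> * norm f0))\<^sup>2 / 2
              + D\<^sup>2 * norm f0 * (D * (M * \<epsilon> n)) + (D\<^sup>2 * (M * \<epsilon> n))\<^sup>2 / 2)"
            unfolding lan_error_def lan_exponent_def by (rule lan_remainder[OF g(1) pz(1,2) g(2,3) pz(3,4,5) th t a n g(4) Y(2) b0 bb[unfolded const_def]])
          also have "\<dots> \<le> (sqrt (real n) * \<bar>?t\<bar>) * (\<kappa> / 2) + (real n * ?t\<^sup>2) * (\<kappa> / 2)"
          proof (intro add_mono mult_left_mono)
            show "Y (snd z) * D * (M * \<epsilon> n) + \<bar>pairing e (fst z) (covop (l n) - \<gamma>)\<bar> + \<bar>pairing e (snd z) (K \<theta>0 (covop (l n) - \<gamma>))\<bar>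
              + sqrt (real n) * ((1 + D\<^sup>2) * r n * (M * \<epsilon> n)) + D ^ 3 * b n \<le> \<kappa> / 2"
              using y1 g1 g2 kk(1) k1_def by (simp)
            show "Y (snd z) * D * norm f0 / sqrt (real n) + (1 + D\<^sup>2) * (r n * (2 * norm \<gamma> + r n)) / 2
              + norm (dK f0) * (D\<^sup>2 * (M * \<epsilon> n + \<tau> * norm f0)) + (D\<^sup>2 * (M * \<epsilon> n + \<tau> * norm f0))\<^sup>2 / 2
              + D\<^sup>2 * norm f0 * (D * (M * \<epsilon> n)) + (D\<^sup>2 * (M * \<epsilon> n))\<^sup>2 / 2 \<le> \<kappa> / 2"
            using y2 kk k2_def c_def by (simp add: field_simps)
          qed auto
          also have "\<dots> \<le> \<kappa> * (1 + real n * ?t\<^sup>2)"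
          proof -
            have sq: "(sqrt (real n) * \<bar>?t\<bar>)\<^sup>2 = real n * ?t\<^sup>2" by (simp add: power_mult_distrib)
            \<comment> \<open>The linear scale is dominated by \<open>1 + n * t\<^sup>2\<close>, so
              a single form of the error suffices.\<close>
            have "0 \<le> (sqrt (real n) * \<bar>?t\<bar> - 1)\<^sup>2" by simp
            then have "sqrt (real n) * \<bar>?t\<bar> \<le> 1 + real n * ?t\<^sup>2"
              unfolding sq[symmetric] by (simp add: power2_diff) (use zero_le_power2[of "sqrt (real n) * \<bar>?t\<bar>"] in linarith)
            then have "(sqrt (real n) * \<bar>?t\<bar>) * (\<kappa> / 2) \<le> (1 + real n * ?t\<^sup>2) * (\<kappa> / 2)"
              using \<kappa> by auto
            then show ?thesis using \<kappa> by (simp add: algebra_simps)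
          qed
          finally show "lan_error n z (fst q) (snd q)
            \<le> \<kappa> * (1 + real n * ?t\<^sup>2)" .
        qed
      qed
    qed
  qed
qed

end

section \<open>Comparison with the normal law\<close>

lemma exp_quadratic_eq_normal_density:
  assumes "0 < c"
  shows "exp (a * t - c * t\<^sup>2 / 2) = sqrt (2 * pi / c) * exp (a\<^sup>2 / (2 * c)) * normal_density (m + a / c) (sqrt (1 / c)) (m + t)"
proof -
  have "normal_density (m + a / c) (sqrt (1 / c)) (m + t) = 1 / sqrt (2 * pi / c) * exp (- (t - a / c)\<^sup>2 / (2 / c))"
    using assms by (simp add: normal_density_def)
  moreover have "- (t - a / c)\<^sup>2 / (2 / c) = a * t - c * t\<^sup>2 / 2 - a\<^sup>2 / (2 * c)"
    using assms by (simp add: field_simps power2_eq_square)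
  ultimately show ?thesis
    using assms by (simp add: exp_diff)
qed

section \<open>The prior density of theta\<close>

locale bvm_density = bvm_model +
  fixes p :: "real \<Rightarrow> real" and p_lower p_upper :: real
  assumes p_continuous: "continuous_on \<Theta> p"
    and p_bounds: "0 < p_lower" "\<And>\<theta>. \<theta> \<in> \<Theta> \<Longrightarrow> p_lower \<le> p \<theta> \<and> p \<theta> \<le> p_upper"
    and p_prob: "prob_space (theta_prior \<Theta> p)"
    and nondegenerate: "\<exists>k. 0 < cov k k"
begin

lemma Theta_borel: "\<Theta> \<in> sets borel"
  using Theta(1) by (simp add: compact_imp_closed)

lemma sets_prior: "sets (theta_prior \<Theta> p) = sets borel_Theta"
  by (simp add: theta_prior_def sets_restrict_space_cong[of lborel borel])

lemma p_measurable: "p \<in> borel_measurable borel_Theta"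
  by (rule borel_measurable_continuous_on_restrict[OF p_continuous])

lemma density_pos: "0 < p \<theta>0"
  using p_bounds(1) p_bounds(2)[OF theta0_in] by linarith

lemma nn_integral_prior:
  assumes F: "F \<in> borel_measurable borel_Theta"
  shows "(\<integral>\<^sup>+\<theta>. F \<theta> \<partial>theta_prior \<Theta> p) = (\<integral>\<^sup>+\<theta>. ennreal (p \<theta>) * F \<theta> * indicator \<Theta> \<theta> \<partial>lborel)"
proof -
  have "(\<integral>\<^sup>+\<theta>. F \<theta> \<partial>theta_prior \<Theta> p) = (\<integral>\<^sup>+\<theta>. ennreal (p \<theta>) * F \<theta> \<partial>restrict_space lborel \<Theta>)"
    unfolding theta_prior_def using F p_measurable
    by (intro nn_integral_density) (auto)
  also have "\<dots> = (\<integral>\<^sup>+\<theta>. ennreal (p \<theta>) * F \<theta> * indicator \<Theta> \<theta> \<partial>lborel)"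
    using Theta_borel by (intro nn_integral_restrict_space) simp
  finally show ?thesis .
qed

lemma emeasure_prior:
  assumes "A \<in> sets borel" "A \<subseteq> \<Theta>"
  shows "ennreal p_lower * emeasure lborel A \<le> emeasure (theta_prior \<Theta> p) A"
proof -
  have A: "A \<in> sets borel_Theta" using assms Theta_borel by (simp add: sets_restrict_space_iff)
  have "emeasure (theta_prior \<Theta> p) A = (\<integral>\<^sup>+\<theta>. indicator A \<theta> \<partial>theta_prior \<Theta> p)"
    using A by (simp add: sets_prior)
  also have "\<dots> = (\<integral>\<^sup>+\<theta>. ennreal (p \<theta>) * indicator A \<theta> * indicator \<Theta> \<theta> \<partial>lborel)"
    using A by (intro nn_integral_prior) simp
  also have "\<dots> \<ge> (\<integral>\<^sup>+\<theta>. ennreal p_lower * indicator A \<theta> \<partial>lborel)"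
    using assms(2) p_bounds by (intro nn_integral_mono) (auto simp: indicator_def ennreal_leI)
  finally show ?thesis using assms(1) by (simp add: nn_integral_cmult_indicator)
qed

lemma theta_neighbourhood:
  obtains \<tau> where "0 < \<tau>" "\<And>\<theta>. \<bar>\<theta> - \<theta>0\<bar> \<le> \<tau> \<Longrightarrow> \<theta> \<in> \<Theta>"
proof -
  obtain e where e: "0 < e" "ball \<theta>0 e \<subseteq> \<Theta>"
    using Theta(2) by (meson mem_interior)
  show ?thesis
  proof (rule that[of "e / 2"])
    fix \<theta> assume "\<bar>\<theta> - \<theta>0\<bar> \<le> e / 2"
    then show "\<theta> \<in> \<Theta>" using e by (auto simp: dist_real_def abs_minus_commute)
  qed (use e in simp)
qed

text \<open>A ball of radius \<open>\<epsilon> n\<close> has prior mass at most a multiple of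
  \<open>\<epsilon> n\<close>, but at least \<open>exp (- rate n - 1)\<close> by assumption. So the
  interval of that radius around \<open>\<theta>0\<close> eventually has mass at least
  \<open>exp (- 2 * rate n)\<close>, as \<open>eta_mass\<close> requires.\<close>

lemma eps_lower_bound: "\<exists>c>0. \<forall>n\<ge>1. c * exp (- rate n) \<le> \<epsilon> n"
proof -
  obtain k where k: "0 < cov k k" using nondegenerate by blast
  define c where "c = sqrt (2 * pi * cov k k) / (2 * norm k * exp 1)"
  have "k \<noteq> 0"
  using cov_def k by auto
  then have c: "0 < c" using k by (simp add: c_def)
  have "c * exp (- rate n) \<le> \<epsilon> n" if n: "1 \<le> n" for n
  proof -
    have "exp (- rate n - 1) \<le> 2 * (norm k * \<epsilon> n) / sqrt (2 * pi * cov k k)"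
      using small_ball[OF n] small_ball_upper[OF k, of "\<epsilon> n"] eps(1)[of n] by (simp add: rate_def)
    then have "c * exp 1 * exp (- rate n - 1) \<le> c * exp 1 * (2 * (norm k * \<epsilon> n) / sqrt (2 * pi * cov k k))"
      using c by (intro mult_left_mono) auto
    also have "\<dots> = \<epsilon> n" using k \<open>k \<noteq> 0\<close> by (simp add: c_def)
    also have "c * exp 1 * exp (- rate n - 1) = c * exp (- rate n)" by (simp add: exp_diff)
    finally show ?thesis .
  qed
  then show ?thesis using c by blast
qed

lemma prior_mass: "\<exists>c. \<forall>\<^sub>F n in sequentially. exp (- c * (real n * (\<epsilon> n)\<^sup>2)) \<le> measure (theta_prior \<Theta> p) {\<theta> \<in> \<Theta>. \<bar>\<theta> - \<theta>0\<bar> \<le> \<epsilon> n}"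
proof -
  interpret eta: prob_space "theta_prior \<Theta> p" by (rule p_prob)
  obtain \<tau> where \<tau>: "0 < \<tau>" "\<And>\<theta>. \<bar>\<theta> - \<theta>0\<bar> \<le> \<tau> \<Longrightarrow> \<theta> \<in> \<Theta>" by (rule theta_neighbourhood) blast
  obtain c where c: "0 < c" "\<And>n. 1 \<le> n \<Longrightarrow> c * exp (- rate n) \<le> \<epsilon> n" using eps_lower_bound by blast
  have e1: "\<forall>\<^sub>F n in sequentially. exp (- 1 * rate n) < p_lower * (2 * c)"
    using exp_rate_tendsto[of 1] p_bounds(1) c(1) by (intro order_tendstoD) auto
  have e2: "\<forall>\<^sub>F n in sequentially. \<epsilon> n < \<tau>" using eps(2) \<tau>(1) by (intro order_tendstoD)
  have "\<forall>\<^sub>F n in sequentially. exp (- 2 * (real n * (\<epsilon> n)\<^sup>2)) \<le> measure (theta_prior \<Theta> p) {\<theta> \<in> \<Theta>. \<bar>\<theta> - \<theta>0\<bar> \<le> \<epsilon> n}"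
    using e1 e2 eventually_ge_at_top[of 1]
  proof eventually_elim
    fix n assume n: "exp (- 1 * rate n) < p_lower * (2 * c)" "\<epsilon> n < \<tau>" "1 \<le> n"
    have eq: "{\<theta> \<in> \<Theta>. \<bar>\<theta> - \<theta>0\<bar> \<le> \<epsilon> n} = {\<theta>0 - \<epsilon> n..\<theta>0 + \<epsilon> n}"
      using \<tau>(2) n(2) by (auto)
    have "{\<theta>0 - \<epsilon> n..\<theta>0 + \<epsilon> n} \<subseteq> \<Theta>" using eq by auto
    from emeasure_prior[OF _ this] have "ennreal p_lower * ennreal (2 * \<epsilon> n) \<le> ennreal (measure (theta_prior \<Theta> p) {\<theta>0 - \<epsilon> n..\<theta>0 + \<epsilon> n})"
      using eps(1)[of n] by (simp add: eta.emeasure_eq_measure)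
    then have "p_lower * (2 * \<epsilon> n) \<le> measure (theta_prior \<Theta> p) {\<theta>0 - \<epsilon> n..\<theta>0 + \<epsilon> n}"
      using p_bounds(1) eps(1)[of n] by (simp add: ennreal_mult[symmetric])
    moreover have "exp (- 2 * rate n) \<le> p_lower * (2 * \<epsilon> n)"
    proof -
      have "exp (- 2 * rate n) = exp (- 1 * rate n) * exp (- rate n)" by (simp add: exp_add[symmetric])
      also have "\<dots> \<le> (p_lower * (2 * c)) * exp (- rate n)" using n(1) by auto
      also have "\<dots> \<le> p_lower * (2 * \<epsilon> n)" using c(2)[OF n(3)] p_bounds(1) by simp
      finally show ?thesis .
    qed
    ultimately show "exp (- 2 * (real n * (\<epsilon> n)\<^sup>2)) \<le> measure (theta_prior \<Theta> p) {\<theta> \<in> \<Theta>. \<bar>\<theta> - \<theta>0\<bar> \<le> \<epsilon> n}"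
      unfolding eq by (simp add: rate_def)
  qed
  then show ?thesis by blast
qed

sublocale bvm_prior \<pi> e \<Theta> K dK \<theta>0 f0 S nS D \<epsilon> s l \<gamma> r info "theta_prior \<Theta> p"
proof -
  have "model_prior_axioms \<Theta> \<theta>0 \<epsilon> (theta_prior \<Theta> p)"
    by (rule model_prior_axioms.intro) (fact p_prob sets_prior prior_mass)+
  then show "bvm_prior \<pi> e \<Theta> K dK \<theta>0 f0 S nS D \<epsilon> s l \<gamma> r info (theta_prior \<Theta> p)"
    by (intro bvm_prior.intro model_prior.intro bvm_model_axioms inverse_model_axioms)
qed

text \<open>The marginal posterior density of \<open>\<theta>\<close> relative to the prior,
  unnormalised and localised in f.\<close>

definition slice :: "real \<Rightarrow> real \<Rightarrow> nat \<Rightarrow> observation \<Rightarrow> real \<Rightarrow> ennreal" where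
  "slice M L n z \<theta> = (\<integral>\<^sup>+f. indicator {f. inside M L n f} f * lr n z \<theta> f \<partial>\<pi>)"

lemma evid_Pair:
  assumes [measurable]: "Measurable.pred Q P"
  shows "evid n P z = (\<integral>\<^sup>+\<theta>. \<integral>\<^sup>+f. indicator {q. P q} (\<theta>, f) * lr n z \<theta> f \<partial>\<pi> \<partial>theta_prior \<Theta> p)"
  unfolding evid_def Q_def
  by (subst nn_integral_fst[symmetric]) (auto)

lemma inside_Q_measurable [measurable]: "Measurable.pred Q (\<lambda>q. inside M L n (snd q))"
  by simp

lemma slice_measurable: "slice M L n z \<in> borel_measurable borel_Theta"
proof -
  have "(\<lambda>q. indicator {q. inside M L n (snd q)} q * lr n z (fst q) (snd q)) \<in> borel_measurable Q" by measurable
  then have "(\<lambda>q. indicator {q. inside M L n (snd q)} q * lr n z (fst q) (snd q)) \<in> borel_measurable (theta_prior \<Theta> p \<Otimes>\<^sub>M \<pi>)"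
    by simp
  from borel_measurable_nn_integral_fst[OF this] show ?thesis
    unfolding slice_def[abs_def] by (simp)
qed

lemma evid_slice:
  assumes A: "A \<in> sets borel"
  shows "evid n (\<lambda>q. fst q \<in> A \<and> inside M L n (snd q)) z = (\<integral>\<^sup>+\<theta>. ennreal (p \<theta>) * (indicator A \<theta> * slice M L n z \<theta>) * indicator \<Theta> \<theta> \<partial>lborel)"
proof -
  have [measurable]: "Measurable.pred Q (\<lambda>q. fst q \<in> A)"
    using A by auto
  have "evid n (\<lambda>q. fst q \<in> A \<and> inside M L n (snd q)) z
      = (\<integral>\<^sup>+\<theta>. indicator A \<theta> * slice M L n z \<theta> \<partial>theta_prior \<Theta> p)"
    by (subst evid_Pair) (auto intro: nn_integral_cong simp: slice_def indicator_def)
  also have "\<dots> = (\<integral>\<^sup>+\<theta>. ennreal (p \<theta>) * (indicator A \<theta> * slice M L n z \<theta>) * indicator \<Theta> \<theta> \<partial>lborel)"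
  proof (rule nn_integral_prior)
    have "indicator A \<in> (borel_measurable borel_Theta :: (real \<Rightarrow> ennreal) set)"
      using A by (intro measurable_restrict_space1) simp
    then show "(\<lambda>\<theta>. indicator A \<theta> * slice M L n z \<theta>) \<in> borel_measurable borel_Theta"
      using slice_measurable by auto
  qed
  finally show ?thesis .
qed

text \<open>Since p is positive on \<open>\<Theta>\<close>, prior null sets of
  \<open>\<theta>\<close> are Lebesgue null sets within \<open>\<Theta>\<close>.\<close>

lemma AE_slice:
  assumes "AE q in Q. P (fst q) (snd q)"
  shows "AE \<theta> in lborel. \<theta> \<in> \<Theta> \<longrightarrow> (AE f in \<pi>. P \<theta> f)"
proof -
  interpret eta: prob_space "theta_prior \<Theta> p" by (rule p_prob)
  interpret pair_sigma_finite "theta_prior \<Theta> p" \<pi> by unfold_locales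
  have "AE \<theta> in theta_prior \<Theta> p. AE f in \<pi>. P \<theta> f"
    using AE_pair[OF assms[unfolded Q_def]] by simp
  then have "AE \<theta> in restrict_space lborel \<Theta>. 0 < ennreal (p \<theta>) \<longrightarrow> (AE f in \<pi>. P \<theta> f)"
    unfolding theta_prior_def using p_measurable
    by (subst (asm) AE_density) (auto)
  then have "AE \<theta> in lborel. \<theta> \<in> \<Theta> \<longrightarrow> (0 < ennreal (p \<theta>) \<longrightarrow> (AE f in \<pi>. P \<theta> f))"
    using Theta_borel by (subst (asm) AE_restrict_space_iff) auto
  then show ?thesis
  using p_bounds by fastforce
qed

end

lemma abs_le_one_plus_square: "\<bar>x\<bar> \<le> 1 + x\<^sup>2" for x :: real
proof -
  have "0 \<le> (\<bar>x\<bar> - 1)\<^sup>2" by simp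
  then have "2 * \<bar>x\<bar> \<le> 1 + x\<^sup>2" by (simp add: power2_diff)
  then show ?thesis by simp
qed

lemma normal_measure_tail:
  assumes v: "0 \<le> v" and a: "0 < a"
  shows "measure (normal_measure \<mu> v) {x. a \<le> \<bar>x - \<mu>\<bar>} \<le> v / a\<^sup>2"
proof -
  interpret P: prob_space "normal_measure 0 v" by (rule prob_space_normal_measure[OF v])
  have "normal_measure \<mu> v = distr (normal_measure 0 v) borel (\<lambda>x. \<mu> + x)"
    unfolding normal_measure_eq_distr[OF v] by (subst distr_distr) (auto simp: comp_def)
  moreover have "{x. a \<le> \<bar>x - \<mu>\<bar>} \<in> sets borel"
    by simp
  ultimately have "measure (normal_measure \<mu> v) {x. a \<le> \<bar>x - \<mu>\<bar>} = measure (normal_measure 0 v) {x \<in> space (normal_measure 0 v). a \<le> \<bar>x - P.expectation (\<lambda>x. x)\<bar>}"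
    by (simp add: measure_distr normal_measure_moments[OF v])
  also have "\<dots> \<le> P.variance (\<lambda>x. x) / a\<^sup>2"
    using normal_measure_moments(1)[OF v] by (intro P.Chebyshev_inequality a) auto
  also have "P.variance (\<lambda>x. x) = v" by (simp add: normal_measure_moments[OF v])
  finally show ?thesis .
qed

section \<open>Upper and lower bounds for the marginal of theta\<close>

context bvm_density
begin

lemma V_measurable [measurable]: "V \<in> borel_measurable noise"
proof -
  have "(\<lambda>z. pairing e (fst z) h) \<in> borel_measurable noise" "(\<lambda>z. pairing e (snd z) h) \<in> borel_measurable noise" for h
    by auto
  show ?thesis unfolding V_def[abs_def] by measurable
qed

definition lan_at :: "real \<Rightarrow> real \<Rightarrow> nat \<Rightarrow> observation \<Rightarrow> real \<Rightarrow> bool" where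
  "lan_at \<kappa> M n z \<theta> \<longleftrightarrow> (AE f in \<pi>. norm (f - f0) \<le> M * \<epsilon> n \<longrightarrow>
     lan_error n z \<theta> f \<le> \<kappa> * (1 + real n * (\<theta> - \<theta>0)\<^sup>2))"

text \<open>One \<open>\<kappa>\<close> pays for the expansion of the likelihood, the other for the
  Cameron-Martin weight.\<close>

lemma slice_upper:
  assumes n: "1 \<le> n" and th: "\<theta> \<in> \<Theta>" and lan: "lan_at \<kappa> M n z \<theta>"
    and small: "\<bar>\<theta> - \<theta>0\<bar> * (L * real n * \<epsilon> n * s n) + (\<theta> - \<theta>0)\<^sup>2 * (real n * (s n)\<^sup>2) / 2 \<le> \<kappa> * (1 + real n * (\<theta> - \<theta>0)\<^sup>2)"
  shows "slice M L n z \<theta> \<le> ennreal (exp (lan_exponent n z (\<theta> - \<theta>0) + 2 * \<kappa> * (1 + real n * (\<theta> - \<theta>0)\<^sup>2))) * base n z"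
proof -
  let ?t = "\<theta> - \<theta>0" and ?k = "\<kappa> * (1 + real n * (\<theta> - \<theta>0)\<^sup>2)"
  let ?g = "\<lambda>f. indicator {f. inside M L n f} f * lr n z \<theta>0 (f + ?t *\<^sub>R covop (l n))"
  have "slice M L n z \<theta> \<le> (\<integral>\<^sup>+f. ennreal (exp (lan_exponent n z ?t + ?k)) * ?g f \<partial>\<pi>)"
    unfolding slice_def
  proof (intro nn_integral_mono_AE, use lan[unfolded lan_at_def lan_error_def] in eventually_elim)
    fix f
    assume f: "norm (f - f0) \<le> M * \<epsilon> n \<longrightarrow>
      \<bar>ell n z \<theta> f - ell n z \<theta>0 (f + ?t *\<^sub>R covop (l n)) - lan_exponent n z ?t\<bar> \<le> ?k"
    have "ell n z \<theta> f \<le> (lan_exponent n z ?t + ?k) + ell n z \<theta>0 (f + ?t *\<^sub>R covop (l n))" if "inside M L n f"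
      using f that unfolding inside_def by linarith
    then show "indicator {f. inside M L n f} f * lr n z \<theta> f \<le> ennreal (exp (lan_exponent n z ?t + ?k)) * ?g f"
      by (auto simp: indicator_def ennreal_mult[symmetric] exp_add[symmetric])
  qed
  also have "\<dots> = ennreal (exp (lan_exponent n z ?t + ?k)) * (\<integral>\<^sup>+f. ?g f \<partial>\<pi>)"
    by (intro nn_integral_cmult) measurable
  also have "\<dots> \<le> ennreal (exp (lan_exponent n z ?t + ?k)) * (ennreal (exp ?k) * base n z)"
    by (intro mult_left_mono order_trans[OF shifted_evidence_upper[OF n]] mult_right_mono) (use small in auto)
  also have "\<dots> = ennreal (exp (lan_exponent n z ?t + 2 * \<kappa> * (1 + real n * ?t\<^sup>2))) * base n z"
    by (simp add: mult.assoc[symmetric] ennreal_mult[symmetric] exp_add[symmetric] add.commute)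
  finally show ?thesis .
qed

lemma slice_lower:
  assumes n: "1 \<le> n" and th: "\<theta> \<in> \<Theta>" and lan: "lan_at \<kappa> M n z \<theta>"
    and sh: "\<bar>\<theta> - \<theta>0\<bar> * norm (covop (l n)) \<le> M / 2 * \<epsilon> n" "\<bar>\<theta> - \<theta>0\<bar> * (real n * (s n)\<^sup>2) \<le> L / 2 * real n * \<epsilon> n * s n"
    and small: "\<bar>\<theta> - \<theta>0\<bar> * (L * real n * \<epsilon> n * s n) \<le> \<kappa> * (1 + real n * (\<theta> - \<theta>0)\<^sup>2)"
  shows "ennreal (exp (lan_exponent n z (\<theta> - \<theta>0) - 2 * \<kappa> * (1 + real n * (\<theta> - \<theta>0)\<^sup>2)))
      * base_in (M / 2) (L / 2) n z \<le> slice M L n z \<theta>"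
proof -
  let ?t = "\<theta> - \<theta>0" and ?k = "\<kappa> * (1 + real n * (\<theta> - \<theta>0)\<^sup>2)"
  let ?g = "\<lambda>f. indicator {f. inside M L n f} f * lr n z \<theta>0 (f + ?t *\<^sub>R covop (l n))"
  let ?N = "base_in (M / 2) (L / 2) n z"
  have "ennreal (exp (lan_exponent n z ?t - 2 * \<kappa> * (1 + real n * ?t\<^sup>2))) * ?N
      \<le> ennreal (exp (lan_exponent n z ?t - 2 * \<kappa> * (1 + real n * ?t\<^sup>2))) * (ennreal (exp ?k) * (\<integral>\<^sup>+f. ?g f \<partial>\<pi>))"
    by (intro mult_left_mono order_trans[OF shifted_evidence_lower[OF n sh]] mult_right_mono) (use small in auto)
  also have "\<dots> = ennreal (exp (lan_exponent n z ?t - ?k)) * (\<integral>\<^sup>+f. ?g f \<partial>\<pi>)"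
    by (simp add: mult.assoc[symmetric] ennreal_mult[symmetric] exp_add[symmetric])
  also have "\<dots> = (\<integral>\<^sup>+f. ennreal (exp (lan_exponent n z ?t - ?k)) * ?g f \<partial>\<pi>)"
    by (intro nn_integral_cmult[symmetric]) measurable
  also have "\<dots> \<le> slice M L n z \<theta>"
    unfolding slice_def
  proof (intro nn_integral_mono_AE, use lan[unfolded lan_at_def lan_error_def] in eventually_elim)
    fix f
    assume f: "norm (f - f0) \<le> M * \<epsilon> n \<longrightarrow>
      \<bar>ell n z \<theta> f - ell n z \<theta>0 (f + ?t *\<^sub>R covop (l n)) - lan_exponent n z ?t\<bar> \<le> ?k"
    have "(lan_exponent n z ?t - ?k) + ell n z \<theta>0 (f + ?t *\<^sub>R covop (l n)) \<le> ell n z \<theta> f" if "inside M L n f"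
      using f that unfolding inside_def by linarith
    then show "ennreal (exp (lan_exponent n z ?t - ?k)) * ?g f \<le> indicator {f. inside M L n f} f * lr n z \<theta> f"
      by (auto simp: indicator_def ennreal_mult[symmetric] exp_add[symmetric])
  qed
  finally show ?thesis .
qed

lemma whp_lan_at:
  assumes "0 \<le> M" "0 < \<kappa>"
  shows "\<exists>\<tau>0>0. \<forall>\<tau>. 0 < \<tau> \<longrightarrow> \<tau> \<le> \<tau>0 \<longrightarrow> likely (\<lambda>n z. AE \<theta> in lborel. \<theta> \<in> \<Theta> \<longrightarrow> \<bar>\<theta> - \<theta>0\<bar> \<le> \<tau> \<longrightarrow> lan_at \<kappa> M n z \<theta>)"
proof -
  obtain \<tau>0 where \<tau>0: "0 < \<tau>0" "\<And>\<tau>. 0 < \<tau> \<Longrightarrow> \<tau> \<le> \<tau>0 \<Longrightarrow> likely (\<lambda>n z. AE q in Q.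
     \<bar>fst q - \<theta>0\<bar> \<le> \<tau> \<longrightarrow> norm (snd q - f0) \<le> M * \<epsilon> n \<longrightarrow>
     lan_error n z (fst q) (snd q) \<le> \<kappa> * (1 + real n * (fst q - \<theta>0)\<^sup>2))"
    using whp_lan[OF assms] by blast
  have "likely (\<lambda>n z. AE \<theta> in lborel. \<theta> \<in> \<Theta> \<longrightarrow> \<bar>\<theta> - \<theta>0\<bar> \<le> \<tau> \<longrightarrow> lan_at \<kappa> M n z \<theta>)" if "0 < \<tau>" "\<tau> \<le> \<tau>0" for \<tau>
  proof (rule whp_case_elim[OF \<tau>0(2)[OF that]])
    fix n z
    assume "AE q in Q.
     \<bar>fst q - \<theta>0\<bar> \<le> \<tau> \<longrightarrow> norm (snd q - f0) \<le> M * \<epsilon> n \<longrightarrow>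
     lan_error n z (fst q) (snd q) \<le> \<kappa> * (1 + real n * (fst q - \<theta>0)\<^sup>2)"
    from AE_slice[OF this] show "AE \<theta> in lborel. \<theta> \<in> \<Theta> \<longrightarrow> \<bar>\<theta> - \<theta>0\<bar> \<le> \<tau> \<longrightarrow> lan_at \<kappa> M n z \<theta>"
      by (auto simp: lan_at_def)
  qed
  then show ?thesis using \<tau>0(1) by blast
qed

definition limit_density :: "nat \<Rightarrow> observation \<Rightarrow> real \<Rightarrow> real" where
  "limit_density n z \<theta> = normal_density (\<theta>0 + V z / (info * sqrt (real n))) (sqrt (1 / (real n * info))) \<theta>"

definition limit_law :: "nat \<Rightarrow> observation \<Rightarrow> real measure" where
  "limit_law n z = normal_measure (\<theta>0 + V z / (info * sqrt (real n))) (1 / (real n * info))"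

text \<open>The total mass over the line of
  \<open>exp (sqrt n * t * V z - n * t\<^sup>2 * i / 2)\<close>; the information i is a parameter
  because upper bounds use a perturbed one.\<close>

definition laplace :: "real \<Rightarrow> nat \<Rightarrow> observation \<Rightarrow> real" where
  "laplace i n z = sqrt (2 * pi / (real n * i)) * exp ((V z)\<^sup>2 / (2 * i))"

lemma laplace_nonneg: "0 \<le> i \<Longrightarrow> 0 \<le> laplace i n z"
  by (simp add: laplace_def)

lemma exp_lan_exponent:
  assumes "1 \<le> n"
  shows "exp (lan_exponent n z (\<theta> - \<theta>0)) = laplace info n z * limit_density n z \<theta>"
proof -
  have "sqrt (real n) / real n = 1 / sqrt (real n)"
    using assms by (simp add: field_simps)
  then have "sqrt (real n) * V z / (real n * info) = V z / (info * sqrt (real n))"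
    by (simp add: divide_simps)
  then show ?thesis
    using exp_quadratic_eq_normal_density[of "real n * info" "sqrt (real n) * V z" "\<theta> - \<theta>0" \<theta>0] assms info(2)
    by (simp add: lan_exponent_def laplace_def limit_density_def power_mult_distrib mult_ac)
qed

lemma emeasure_limit_law:
  assumes "1 \<le> n" "A \<in> sets borel"
  shows "emeasure (limit_law n z) A = (\<integral>\<^sup>+\<theta>. ennreal (limit_density n z \<theta>) * indicator A \<theta> \<partial>lborel)"
  using assms info(2) limit_law_def normal_measure_def limit_density_def
  by (simp add: emeasure_density)

lemma nn_integral_exp_quadratic:
  assumes n: "1 \<le> n" and i: "0 < i"
  shows "(\<integral>\<^sup>+\<theta>. ennreal (exp (sqrt (real n) * (\<theta> - \<theta>0) * V z - real n * (\<theta> - \<theta>0)\<^sup>2 * i / 2)) \<partial>lborel) = ennreal (laplace i n z)"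
proof -
  let ?m = "\<theta>0 + sqrt (real n) * V z / (real n * i)"
  have c: "0 < real n * i" using n i by simp
  interpret g: prob_space "density lborel (\<lambda>\<theta>. ennreal (normal_density ?m (sqrt (1 / (real n * i))) \<theta>))"
    by (rule prob_space_normal_density) (use c in simp)
  have "exp (sqrt (real n) * (\<theta> - \<theta>0) * V z - real n * (\<theta> - \<theta>0)\<^sup>2 * i / 2) = laplace i n z * normal_density ?m (sqrt (1 / (real n * i))) \<theta>" for \<theta>
    using exp_quadratic_eq_normal_density[OF c, of "sqrt (real n) * V z" "\<theta> - \<theta>0" \<theta>0] by (simp add: laplace_def power_mult_distrib mult_ac)
  then have "(\<integral>\<^sup>+\<theta>. ennreal (exp (sqrt (real n) * (\<theta> - \<theta>0) * V z - real n * (\<theta> - \<theta>0)\<^sup>2 * i / 2)) \<partial>lborel)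
      = (\<integral>\<^sup>+\<theta>. ennreal (laplace i n z) * ennreal (normal_density ?m (sqrt (1 / (real n * i))) \<theta>) \<partial>lborel)"
    using i by (simp add: ennreal_mult laplace_def)
  also have "\<dots> = ennreal (laplace i n z) * emeasure (density lborel (\<lambda>\<theta>. ennreal (normal_density ?m (sqrt (1 / (real n * i))) \<theta>))) UNIV"
    by (subst nn_integral_cmult) (auto simp: emeasure_density)
  also have "\<dots> = ennreal (laplace i n z)" using g.emeasure_space_1 by simp
  finally show ?thesis .
qed

lemma limit_density_measurable [measurable]: "limit_density n z \<in> borel_measurable borel"
  unfolding limit_density_def[abs_def] by measurable

text \<open>The error \<open>2 * \<kappa> * (1 + n * t\<^sup>2)\<close> is harmless on the whole
  neighbourhood: it lowers the information to \<open>info - 4 * \<kappa>\<close> and adds a factor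
  \<open>exp (2 * \<kappa>)\<close>, so the dominating integral remains Gaussian.\<close>

lemma evid_upper:
  assumes n: "1 \<le> n" and \<kappa>: "0 < \<kappa>" "0 < info - 4 * \<kappa>"
    and lan: "AE \<theta> in lborel. \<theta> \<in> \<Theta> \<longrightarrow> \<bar>\<theta> - \<theta>0\<bar> \<le> \<tau> \<longrightarrow> lan_at \<kappa> M n z \<theta>"
    and p_le: "\<And>\<theta>. \<theta> \<in> \<Theta> \<Longrightarrow> \<bar>\<theta> - \<theta>0\<bar> \<le> \<tau> \<Longrightarrow> p \<theta> \<le> (1 + \<kappa>) * p \<theta>0"
    and small: "\<And>t. \<bar>t\<bar> * (L * real n * \<epsilon> n * s n) + t\<^sup>2 * (real n * (s n)\<^sup>2) / 2 \<le> \<kappa> * (1 + real n * t\<^sup>2)"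
  shows "evid n (\<lambda>q. fst q \<in> {\<theta>. \<bar>\<theta> - \<theta>0\<bar> \<le> \<tau>} \<and> inside M L n (snd q)) z
    \<le> ennreal ((1 + \<kappa>) * p \<theta>0 * exp (2 * \<kappa>) * laplace (info - 4 * \<kappa>) n z) * base n z"
proof -
  let ?A = "{\<theta>. \<bar>\<theta> - \<theta>0\<bar> \<le> \<tau>}" and ?i = "info - 4 * \<kappa>"
  let ?g = "\<lambda>\<theta>. ennreal (exp (sqrt (real n) * (\<theta> - \<theta>0) * V z - real n * (\<theta> - \<theta>0)\<^sup>2 * ?i / 2))"
  have A: "?A \<in> sets borel" by simp
  note p0 = density_pos
  let ?c = "(1 + \<kappa>) * p \<theta>0 * exp (2 * \<kappa>)"
  have c: "0 \<le> ?c" using p0 \<kappa> by simp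
  have "evid n (\<lambda>q. fst q \<in> ?A \<and> inside M L n (snd q)) z
      \<le> (\<integral>\<^sup>+\<theta>. (ennreal ?c * base n z) * ?g \<theta> \<partial>lborel)"
    unfolding evid_slice[OF A]
  proof (intro nn_integral_mono_AE, use lan in eventually_elim)
    fix \<theta> assume l: "\<theta> \<in> \<Theta> \<longrightarrow> \<bar>\<theta> - \<theta>0\<bar> \<le> \<tau> \<longrightarrow> lan_at \<kappa> M n z \<theta>"
    show "ennreal (p \<theta>) * (indicator ?A \<theta> * slice M L n z \<theta>) * indicator \<Theta> \<theta> \<le> (ennreal ?c * base n z) * ?g \<theta>"
    proof (cases "\<theta> \<in> \<Theta> \<and> \<bar>\<theta> - \<theta>0\<bar> \<le> \<tau>")
      case True
      have "slice M L n z \<theta> \<le> ennreal (exp (lan_exponent n z (\<theta> - \<theta>0) + 2 * \<kappa> * (1 + real n * (\<theta> - \<theta>0)\<^sup>2))) * base n z"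
        using True l by (intro slice_upper[OF n _ _ small]) auto
      also have "lan_exponent n z (\<theta> - \<theta>0) + 2 * \<kappa> * (1 + real n * (\<theta> - \<theta>0)\<^sup>2)
          = 2 * \<kappa> + (sqrt (real n) * (\<theta> - \<theta>0) * V z - real n * (\<theta> - \<theta>0)\<^sup>2 * ?i / 2)"
        by (simp add: lan_exponent_def field_simps)
      finally have sl: "slice M L n z \<theta> \<le> ennreal (exp (2 * \<kappa>)) * ?g \<theta> * base n z"
        by (simp only: exp_add ennreal_mult exp_ge_zero)
      have "ennreal (p \<theta>) * slice M L n z \<theta> \<le> ennreal ((1 + \<kappa>) * p \<theta>0) * (ennreal (exp (2 * \<kappa>)) * ?g \<theta> * base n z)"
        using True p_le by (intro mult_mono ennreal_leI sl) auto
      also have "\<dots> = (ennreal ((1 + \<kappa>) * p \<theta>0) * ennreal (exp (2 * \<kappa>)) * base n z) * ?g \<theta>"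
        by (simp only: mult_ac)
      also have "ennreal ((1 + \<kappa>) * p \<theta>0) * ennreal (exp (2 * \<kappa>)) = ennreal ?c"
        using p0 \<kappa> by (intro ennreal_mult[symmetric]) auto
      finally show ?thesis using True by simp
    qed (auto)
  qed
  also have "\<dots> = (ennreal ?c * base n z) * (\<integral>\<^sup>+\<theta>. ?g \<theta> \<partial>lborel)"
    by (intro nn_integral_cmult) measurable
  also have "\<dots> = ennreal (?c * laplace ?i n z) * base n z"
    unfolding nn_integral_exp_quadratic[OF n \<kappa>(2)] ennreal_mult[OF c laplace_nonneg[OF less_imp_le[OF \<kappa>(2)]]] by (simp only: mult_ac)
  finally show ?thesis .
qed

text \<open>Only \<open>\<bar>\<theta> - \<theta>0\<bar> \<le> B / sqrt n\<close> is kept, where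
  \<open>n * t\<^sup>2\<close> is at most \<open>B\<^sup>2\<close> and the error is a constant
  factor. This leaves the exact limit density, which is what a comparison on arbitrary F
  requires.\<close>

lemma evid_lower:
  assumes n: "1 \<le> n" and \<kappa>: "0 < \<kappa>" "\<kappa> < 1" and F: "F \<in> sets borel"
    and lan: "AE \<theta> in lborel. \<theta> \<in> \<Theta> \<longrightarrow> \<bar>\<theta> - \<theta>0\<bar> \<le> \<tau> \<longrightarrow> lan_at \<kappa> M n z \<theta>"
    and p_ge: "\<And>\<theta>. \<bar>\<theta> - \<theta>0\<bar> \<le> \<tau> \<Longrightarrow> \<theta> \<in> \<Theta> \<and> (1 - \<kappa>) * p \<theta>0 \<le> p \<theta>"
    and B: "0 < B" "B / sqrt (real n) \<le> \<tau>"
    and sh: "B / sqrt (real n) * norm (covop (l n)) \<le> M / 2 * \<epsilon> n" "B / sqrt (real n) * (real n * (s n)\<^sup>2) \<le> L / 2 * real n * \<epsilon> n * s n"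
    and small: "\<And>t. \<bar>t\<bar> * (L * real n * \<epsilon> n * s n) \<le> \<kappa> * (1 + real n * t\<^sup>2)"
    and known: "ennreal (1 - \<kappa>) * base n z \<le> base_in (M / 2) (L / 2) n z"
  shows "ennreal ((1 - \<kappa>)\<^sup>2 * p \<theta>0 * exp (- 2 * \<kappa> * (1 + B\<^sup>2)) * laplace info n z) *
      emeasure (limit_law n z) (F \<inter> {\<theta>. \<bar>\<theta> - \<theta>0\<bar> \<le> B / sqrt (real n)}) * base n z
    \<le> evid n (\<lambda>q. fst q \<in> F) z"
proof -
  let ?A = "F \<inter> {\<theta>. \<bar>\<theta> - \<theta>0\<bar> \<le> B / sqrt (real n)}"
  have "{\<theta>. \<bar>\<theta> - \<theta>0\<bar> \<le> B / sqrt (real n)} \<in> sets borel"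
    by simp
  then have A [measurable]: "?A \<in> sets borel" using F by auto
  note p0 = density_pos
  let ?N = "base_in (M / 2) (L / 2) n z"
  let ?c = "(1 - \<kappa>)\<^sup>2 * p \<theta>0 * exp (- 2 * \<kappa> * (1 + B\<^sup>2)) * laplace info n z"
  let ?h = "\<lambda>\<theta>. ennreal (limit_density n z \<theta>) * indicator ?A \<theta>"
  have lap: "0 \<le> laplace info n z" using info(2) by (simp add: laplace_def)
  have "ennreal ?c * emeasure (limit_law n z) ?A * base n z = (\<integral>\<^sup>+\<theta>. (ennreal ?c * base n z) * ?h \<theta> \<partial>lborel)"
    unfolding emeasure_limit_law[OF n A] by (subst nn_integral_cmult) (auto simp: mult_ac)
  also have "\<dots> \<le> evid n (\<lambda>q. fst q \<in> ?A \<and> inside M L n (snd q)) z"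
    unfolding evid_slice[OF A]
  proof (intro nn_integral_mono_AE, use lan in eventually_elim)
    fix \<theta> assume l: "\<theta> \<in> \<Theta> \<longrightarrow> \<bar>\<theta> - \<theta>0\<bar> \<le> \<tau> \<longrightarrow> lan_at \<kappa> M n z \<theta>"
    show "(ennreal ?c * base n z) * ?h \<theta> \<le> ennreal (p \<theta>) * (indicator ?A \<theta> * slice M L n z \<theta>) * indicator \<Theta> \<theta>"
    proof (cases "\<theta> \<in> ?A")
      case True
      let ?t = "\<theta> - \<theta>0"
      have t: "\<bar>?t\<bar> \<le> B / sqrt (real n)" using True by auto
      then have tau: "\<bar>?t\<bar> \<le> \<tau>" using B(2) by linarith
      have th: "\<theta> \<in> \<Theta>" "(1 - \<kappa>) * p \<theta>0 \<le> p \<theta>" using p_ge[OF tau] by auto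
      have "?t\<^sup>2 \<le> (B / sqrt (real n))\<^sup>2" using t B(1) by (simp add: abs_le_square_iff[symmetric])
      then have "real n * ?t\<^sup>2 \<le> B\<^sup>2" using n by (simp add: field_simps)
      then have e: "- 2 * \<kappa> * (1 + B\<^sup>2) \<le> - 2 * \<kappa> * (1 + real n * ?t\<^sup>2)"
        using \<kappa>(1) by auto
      have sh': "\<bar>?t\<bar> * norm (covop (l n)) \<le> M / 2 * \<epsilon> n" "\<bar>?t\<bar> * (real n * (s n)\<^sup>2) \<le> L / 2 * real n * \<epsilon> n * s n"
        using order_trans[OF mult_right_mono[OF t] sh(1)] order_trans[OF mult_right_mono[OF t] sh(2)] by auto
      have sl: "ennreal (exp (lan_exponent n z ?t - 2 * \<kappa> * (1 + real n * ?t\<^sup>2))) * ?N \<le> slice M L n z \<theta>"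
        using l th tau by (intro slice_lower[OF n _ _ sh' small]) auto
      have "ennreal ?c * base n z * ennreal (limit_density n z \<theta>)
          = ennreal ((1 - \<kappa>) * p \<theta>0) * (ennreal (exp (- 2 * \<kappa> * (1 + B\<^sup>2)) * (laplace info n z * limit_density n z \<theta>)) * (ennreal (1 - \<kappa>) * base n z))"
      proof -
        have "ennreal ?c = ennreal ((1 - \<kappa>) * p \<theta>0) * (ennreal (exp (- 2 * \<kappa> * (1 + B\<^sup>2))) * ennreal (laplace info n z) * ennreal (1 - \<kappa>))"
          using \<kappa> p0 lap by (simp add: ennreal_mult[symmetric] power2_eq_square)
        moreover have "ennreal (exp (- 2 * \<kappa> * (1 + B\<^sup>2)) * (laplace info n z * limit_density n z \<theta>))
            = ennreal (exp (- 2 * \<kappa> * (1 + B\<^sup>2))) * (ennreal (laplace info n z) * ennreal (limit_density n z \<theta>))"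
          using lap by (simp add: ennreal_mult limit_density_def)
        ultimately show ?thesis by (simp only: mult_ac)
      qed
      also have "\<dots> \<le> ennreal (p \<theta>) * (ennreal (exp (lan_exponent n z ?t - 2 * \<kappa> * (1 + real n * ?t\<^sup>2))) * ?N)"
      proof (intro mult_mono known ennreal_leI th)
        show "exp (- 2 * \<kappa> * (1 + B\<^sup>2)) * (laplace info n z * limit_density n z \<theta>) \<le> exp (lan_exponent n z ?t - 2 * \<kappa> * (1 + real n * ?t\<^sup>2))"
          unfolding exp_lan_exponent[OF n, symmetric] exp_add[symmetric] using e by simp
      qed auto
      also have "\<dots> \<le> ennreal (p \<theta>) * slice M L n z \<theta>" by (intro mult_left_mono sl) simp
      finally show ?thesis using True th(1) by simp
    qed (auto)
  qed
  also have "\<dots> \<le> evid n (\<lambda>q. fst q \<in> F) z" by (rule evid_mono) auto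
  finally show ?thesis .
qed

text \<open>In the quotient of two \<open>laplace\<close> values n cancels, so for
  \<open>\<bar>V z\<bar> \<le> \<beta>\<close> both sides are compared through functions of
  \<open>\<kappa>\<close> alone. Without the factor 1 - \<delta> these agree in the limit as
  \<kappa> tends to 0, hence the inequality with that factor holds for small \<kappa>.\<close>

lemma laplace_comparison:
  assumes \<delta>: "0 < \<delta>" and \<beta>: "0 \<le> \<beta>"
  obtains \<kappa> where "0 < \<kappa>" "\<kappa> < 1" "0 < info - 4 * \<kappa>"
    "\<And>n z. 1 \<le> n \<Longrightarrow> \<bar>V z\<bar> \<le> \<beta> \<Longrightarrow> (1 - \<delta>) * ((1 + \<kappa>) * p \<theta>0 * exp (2 * \<kappa>) * laplace (info - 4 * \<kappa>) n z)
       \<le> (1 - \<kappa>) * ((1 - \<kappa>)\<^sup>2 * p \<theta>0 * exp (- 2 * \<kappa> * (1 + B\<^sup>2)) * laplace info n z)"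
proof -
  \<comment> \<open>N and d are the two sides without 1 - \<delta>, divided by
    \<open>p \<theta>0 * laplace info n z\<close>, with V replaced by its worst case
    \<beta>.\<close>
  define N where "N = (\<lambda>\<kappa>. (1 + \<kappa>) * exp (2 * \<kappa>) * sqrt (info / (info - 4 * \<kappa>)) * exp (\<beta>\<^sup>2 / 2 * (1 / (info - 4 * \<kappa>) - 1 / info)))"
  define d where "d = (\<lambda>\<kappa>. (1 - \<kappa>) ^ 3 * exp (- 2 * \<kappa> * (1 + B\<^sup>2)))"
  have "((\<lambda>\<kappa>. d \<kappa> - (1 - \<delta>) * N \<kappa>) \<longlongrightarrow> (1 - 0) ^ 3 * exp (- 2 * 0 * (1 + B\<^sup>2))
      - (1 - \<delta>) * ((1 + 0) * exp (2 * 0) * sqrt (info / (info - 4 * 0)) * exp (\<beta>\<^sup>2 / 2 * (1 / (info - 4 * 0) - 1 / info)))) (at_right 0)"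
    unfolding d_def N_def using info(2) by (intro tendsto_intros) auto
  then have lim: "((\<lambda>\<kappa>. d \<kappa> - (1 - \<delta>) * N \<kappa>) \<longlongrightarrow> \<delta>) (at_right 0)" using info(2) by simp
  have "\<forall>\<^sub>F \<kappa> in at_right 0. 0 < \<kappa> \<and> \<kappa> < min 1 (info / 4)"
    using info(2) by (intro eventually_at_rightI[of 0 "min 1 (info / 4)"]) auto
  then have "\<forall>\<^sub>F \<kappa> in at_right 0. 0 < \<kappa> \<and> \<kappa> < min 1 (info / 4) \<and> 0 < d \<kappa> - (1 - \<delta>) * N \<kappa>"
    using order_tendstoD(1)[OF lim \<delta>] by eventually_elim auto
  then obtain \<kappa> where "0 < \<kappa> \<and> \<kappa> < min 1 (info / 4) \<and> 0 < d \<kappa> - (1 - \<delta>) * N \<kappa>"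
    using eventually_happens by fastforce
  then have \<kappa>: "0 < \<kappa>" "\<kappa> < 1" "0 < info - 4 * \<kappa>" "(1 - \<delta>) * N \<kappa> \<le> d \<kappa>" by auto
  define i where "i = info - 4 * \<kappa>"
  have i: "0 < i" "i \<le> info" using \<kappa> by (auto simp: i_def)
  note p0 = density_pos
  show ?thesis
  proof (rule that[OF \<kappa>(1-3)])
    fix n :: nat and z assume n: "1 \<le> n" and V: "\<bar>V z\<bar> \<le> \<beta>"
    have lap0: "0 \<le> laplace info n z" by (rule laplace_nonneg) (use info in simp)
    have inv: "1 / info \<le> 1 / i" using i by (intro divide_left_mono) auto
    have sq: "(V z)\<^sup>2 \<le> \<beta>\<^sup>2" using V by (simp add: abs_le_square_iff[symmetric])
    have "laplace i n z = laplace info n z * (sqrt (info / i) * exp ((V z)\<^sup>2 / 2 * (1 / i - 1 / info)))"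
    proof -
      have "sqrt (2 * pi / (real n * i)) = sqrt (2 * pi / (real n * info)) * sqrt (info / i)"
        using i by (simp add: real_sqrt_mult[symmetric])
      moreover have "(V z)\<^sup>2 / (2 * i) = (V z)\<^sup>2 / (2 * info) + (V z)\<^sup>2 / 2 * (1 / i - 1 / info)"
        by (simp add: field_simps)
      ultimately show ?thesis by (simp add: laplace_def exp_add)
    qed
    also have "\<dots> \<le> laplace info n z * (sqrt (info / i) * exp (\<beta>\<^sup>2 / 2 * (1 / i - 1 / info)))"
      using sq inv i by (intro mult_left_mono lap0) (auto intro: mult_right_mono)
    finally have lap: "laplace i n z \<le> laplace info n z * (sqrt (info / i) * exp (\<beta>\<^sup>2 / 2 * (1 / i - 1 / info)))" .
    have lapi: "0 \<le> laplace i n z" by (rule laplace_nonneg) (use i in simp)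
    show "(1 - \<delta>) * ((1 + \<kappa>) * p \<theta>0 * exp (2 * \<kappa>) * laplace (info - 4 * \<kappa>) n z)
       \<le> (1 - \<kappa>) * ((1 - \<kappa>)\<^sup>2 * p \<theta>0 * exp (- 2 * \<kappa> * (1 + B\<^sup>2)) * laplace info n z)"
    proof (cases "\<delta> \<le> 1")
      case True
      have "(1 - \<delta>) * ((1 + \<kappa>) * p \<theta>0 * exp (2 * \<kappa>) * laplace i n z)
          \<le> (1 - \<delta>) * ((1 + \<kappa>) * p \<theta>0 * exp (2 * \<kappa>) * (laplace info n z * (sqrt (info / i) * exp (\<beta>\<^sup>2 / 2 * (1 / i - 1 / info)))))"
        using True \<kappa>(1) p0 by (intro mult_left_mono lap) auto
      also have "\<dots> = (p \<theta>0 * laplace info n z) * ((1 - \<delta>) * N \<kappa>)"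
        by (simp only: N_def i_def mult_ac)
      also have "\<dots> \<le> (p \<theta>0 * laplace info n z) * d \<kappa>"
        using p0 lap0 by (intro mult_left_mono \<kappa>) auto
      also have "\<dots> = (1 - \<kappa>) * ((1 - \<kappa>)\<^sup>2 * p \<theta>0 * exp (- 2 * \<kappa> * (1 + B\<^sup>2)) * laplace info n z)"
        unfolding d_def power3_eq_cube power2_eq_square by (simp)
      finally show ?thesis by (simp add: i_def)
    next
      case False
      have "(1 - \<delta>) * ((1 + \<kappa>) * p \<theta>0 * exp (2 * \<kappa>) * laplace i n z) \<le> 0"
        using False \<kappa>(1) p0 lapi by (intro mult_nonpos_nonneg) auto
      also have "0 \<le> (1 - \<kappa>) * ((1 - \<kappa>)\<^sup>2 * p \<theta>0 * exp (- 2 * \<kappa> * (1 + B\<^sup>2)) * laplace info n z)"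
        using \<kappa>(2) p0 lap0 by auto
      finally show ?thesis by (simp add: i_def)
    qed
  qed
qed

lemma ennreal_remove_fraction:
  assumes le: "(t :: ennreal) \<le> u + ennreal \<kappa> * t" and fin: "t < \<infinity>" and \<kappa>: "0 \<le> \<kappa>" "\<kappa> \<le> 1"
  shows "ennreal (1 - \<kappa>) * t \<le> u"
proof -
  have "ennreal \<kappa> * t + ennreal (1 - \<kappa>) * t = (ennreal \<kappa> + ennreal (1 - \<kappa>)) * t" by (simp only: distrib_right)
  also have "ennreal \<kappa> + ennreal (1 - \<kappa>) = 1" using \<kappa> by (simp flip: ennreal_plus)
  finally have "ennreal \<kappa> * t + ennreal (1 - \<kappa>) * t \<le> ennreal \<kappa> * t + u" using le by (simp add: add.commute)
  moreover have "ennreal \<kappa> * t \<noteq> \<infinity>" using fin by (simp add: ennreal_mult_eq_top_iff)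
  ultimately show ?thesis by simp
qed

text \<open>With \<open>w = sqrt n\<close>, the exponent of the Cameron-Martin weight is, up to
  constants, \<open>\<bar>w * t\<bar>\<close> times the vanishing
  \<open>w * \<epsilon> n * s n\<close> plus \<open>w\<^sup>2 * t\<^sup>2\<close> times the
  vanishing \<open>(s n)\<^sup>2\<close>. Shifts with t of order 1 / w are small compared to
  \<open>\<epsilon> n\<close> because \<open>w * \<epsilon> n\<close> diverges.\<close>

lemma eventually_small_shift:
  assumes B: "0 < B" and \<kappa>: "0 < \<kappa>" and M: "0 < M" and L: "0 < L" and \<tau>: "0 < \<tau>"
  shows "\<forall>\<^sub>F n in sequentially. 1 \<le> n \<and> B / sqrt (real n) \<le> \<tau>
    \<and> B / sqrt (real n) * norm (covop (l n)) \<le> M / 2 * \<epsilon> n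
    \<and> B / sqrt (real n) * (real n * (s n)\<^sup>2) \<le> L / 2 * real n * \<epsilon> n * s n
    \<and> (\<forall>t. \<bar>t\<bar> * (L * real n * \<epsilon> n * s n) + t\<^sup>2 * (real n * (s n)\<^sup>2) / 2 \<le> \<kappa> * (1 + real n * t\<^sup>2))"
proof -
  \<comment> \<open>Once \<open>sqrt n * \<epsilon> n\<close> exceeds C, both conditions on shifts
    of size \<open>B / sqrt n\<close> hold: \<open>norm \<gamma> + 1\<close> bounds the norm of
    \<open>covop (l n)\<close>, and \<open>s n\<close> is below 1.\<close>
  define C where "C = max (2 * B * (norm \<gamma> + 1) / M) (2 * B / L)"
  have "filterlim (\<lambda>n. sqrt (rate n)) at_top sequentially"
    by (rule filterlim_compose[OF sqrt_at_top rate_at_top])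
  moreover have "sqrt (rate n) = sqrt (real n) * \<epsilon> n" for n
    using eps(1)[of n] by (simp add: rate_def real_sqrt_mult)
  ultimately have "filterlim (\<lambda>n. sqrt (real n) * \<epsilon> n) at_top sequentially" by simp
  then have e1: "\<forall>\<^sub>F n in sequentially. C \<le> sqrt (real n) * \<epsilon> n" by (simp add: filterlim_at_top)
  note sqrt_nat_at_top
  then have "(\<lambda>n. B * inverse (sqrt (real n))) \<longlonglongrightarrow> B * 0" by (intro tendsto_intros tendsto_inverse_0_at_top)
  then have e2: "\<forall>\<^sub>F n in sequentially. B / sqrt (real n) < \<tau>"
    using \<tau> by (intro order_tendstoD) (auto simp: divide_inverse)
  have "(\<lambda>n. L * (sqrt (real n) * \<epsilon> n * s n)) \<longlonglongrightarrow> L * 0" by (intro tendsto_intros s_rate)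
  then have e3: "\<forall>\<^sub>F n in sequentially. L * (sqrt (real n) * \<epsilon> n * s n) < \<kappa> / 2" using \<kappa> by (intro order_tendstoD) auto
  have e4: "\<forall>\<^sub>F n in sequentially. s n < min 1 (sqrt \<kappa>)" using s_rate(1) \<kappa> by (intro order_tendstoD) auto
  have e5: "\<forall>\<^sub>F n in sequentially. r n < 1" using r_rate(1) by (intro order_tendstoD) auto
  show ?thesis using e1 e2 e3 e4 e5 eventually_ge_at_top[of 1]
  proof eventually_elim
    fix n assume C: "C \<le> sqrt (real n) * \<epsilon> n" and tau: "B / sqrt (real n) < \<tau>" and es: "L * (sqrt (real n) * \<epsilon> n * s n) < \<kappa> / 2"
      and sn: "s n < min 1 (sqrt \<kappa>)" and rn: "r n < 1" and n: "1 \<le> n"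
    define w where "w = sqrt (real n)"
    have w: "0 < w" "real n = w * w" using n by (auto simp: w_def)
    have s0: "0 < s n" by (rule shift_size)
    have "norm (covop (l n)) \<le> norm \<gamma> + 1"
      using approx[OF n] norm_triangle_ineq2[of "covop (l n)" \<gamma>] rn by linarith
    then have "B * norm (covop (l n)) \<le> B * (norm \<gamma> + 1)" using B by auto
    also have "\<dots> = M / 2 * (2 * B * (norm \<gamma> + 1) / M)" using M by simp
    also have "\<dots> \<le> M / 2 * (w * \<epsilon> n)" using C M by (intro mult_left_mono) (auto simp: C_def w_def)
    finally have c1: "B / w * norm (covop (l n)) \<le> M / 2 * \<epsilon> n" using w(1) by (simp add: field_simps)
    have "B * s n \<le> B * 1" using sn B by auto
    also have "\<dots> = L / 2 * (2 * B / L)" using L by simp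
    also have "\<dots> \<le> L / 2 * (w * \<epsilon> n)" using C L by (intro mult_left_mono) (auto simp: C_def w_def)
    finally have "(w * s n) * (B * s n) \<le> (w * s n) * (L / 2 * (w * \<epsilon> n))" using w s0 by auto
    then have c2: "B / w * (real n * (s n)\<^sup>2) \<le> L / 2 * real n * \<epsilon> n * s n"
      using w by (simp add: power2_eq_square mult_ac)
    have c3: "\<bar>t\<bar> * (L * real n * \<epsilon> n * s n) + t\<^sup>2 * (real n * (s n)\<^sup>2) / 2 \<le> \<kappa> * (1 + real n * t\<^sup>2)" for t
    proof -
      have ab: "\<bar>w * t\<bar> \<le> 1 + real n * t\<^sup>2"
        using abs_le_one_plus_square[of "w * t"] w by (simp add: power2_eq_square mult_ac)
      have "\<bar>t\<bar> * (L * real n * \<epsilon> n * s n) = \<bar>w * t\<bar> * (L * (w * \<epsilon> n * s n))"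
        using w by (simp add: abs_mult)
      also have "\<dots> \<le> (1 + real n * t\<^sup>2) * (\<kappa> / 2)"
        using es L w s0 eps(1)[of n] by (intro mult_mono ab) auto
      finally have t1: "\<bar>t\<bar> * (L * real n * \<epsilon> n * s n) \<le> (1 + real n * t\<^sup>2) * (\<kappa> / 2)" .
      have "(s n)\<^sup>2 \<le> (sqrt \<kappa>)\<^sup>2" using sn s0 by (intro power_mono) auto
      then have "(real n * t\<^sup>2) * (s n)\<^sup>2 \<le> (real n * t\<^sup>2) * \<kappa>" using \<kappa> by (intro mult_left_mono) auto
      then have "t\<^sup>2 * (real n * (s n)\<^sup>2) / 2 \<le> (real n * t\<^sup>2) * \<kappa> / 2" by (simp add: mult_ac)
      moreover have "\<kappa> * (1 + real n * t\<^sup>2) = (1 + real n * t\<^sup>2) * (\<kappa> / 2) + (real n * t\<^sup>2) * \<kappa> / 2 + \<kappa> / 2" by (simp add: field_simps)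
      ultimately show ?thesis using t1 \<kappa> by linarith
    qed
    show "1 \<le> n \<and> B / sqrt (real n) \<le> \<tau>
    \<and> B / sqrt (real n) * norm (covop (l n)) \<le> M / 2 * \<epsilon> n
    \<and> B / sqrt (real n) * (real n * (s n)\<^sup>2) \<le> L / 2 * real n * \<epsilon> n * s n
    \<and> (\<forall>t. \<bar>t\<bar> * (L * real n * \<epsilon> n * s n) + t\<^sup>2 * (real n * (s n)\<^sup>2) / 2 \<le> \<kappa> * (1 + real n * t\<^sup>2))"
      using n tau c1 c2 c3 w_def by simp
  qed
qed

lemma density_neighbourhood:
  assumes \<kappa>: "0 < \<kappa>"
  obtains \<tau> where "0 < \<tau>" "\<And>\<theta>. \<bar>\<theta> - \<theta>0\<bar> \<le> \<tau> \<Longrightarrow> \<theta> \<in> \<Theta> \<and> (1 - \<kappa>) * p \<theta>0 \<le> p \<theta> \<and> p \<theta> \<le> (1 + \<kappa>) * p \<theta>0"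
proof -
  obtain \<tau>1 where \<tau>1: "0 < \<tau>1" "\<And>\<theta>. \<bar>\<theta> - \<theta>0\<bar> \<le> \<tau>1 \<Longrightarrow> \<theta> \<in> \<Theta>" by (rule theta_neighbourhood) blast
  note p0 = density_pos
  then obtain d where d: "0 < d" "\<And>\<theta>. \<theta> \<in> \<Theta> \<Longrightarrow> dist \<theta> \<theta>0 < d \<Longrightarrow> dist (p \<theta>) (p \<theta>0) < \<kappa> * p \<theta>0"
    using p_continuous[unfolded continuous_on_iff, rule_format, OF theta0_in, of "\<kappa> * p \<theta>0"] \<kappa> by auto
  show ?thesis
  proof (rule that[of "min \<tau>1 (d / 2)"])
    fix \<theta> assume th: "\<bar>\<theta> - \<theta>0\<bar> \<le> min \<tau>1 (d / 2)"
    then have in_Theta: "\<theta> \<in> \<Theta>" using \<tau>1 by simp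
    moreover have "\<bar>p \<theta> - p \<theta>0\<bar> < \<kappa> * p \<theta>0" using d(2)[OF in_Theta] th d(1) by (simp add: dist_real_def)
    ultimately show "\<theta> \<in> \<Theta> \<and> (1 - \<kappa>) * p \<theta>0 \<le> p \<theta> \<and> p \<theta> \<le> (1 + \<kappa>) * p \<theta>0" by (auto simp: algebra_simps)
  qed (use \<tau>1 d in auto)
qed

text \<open>The upper bound for \<open>total\<close> and the lower bound for the evidence of F both
  contain \<open>base\<close>; eliminating it leaves the constants of
  \<open>laplace_comparison\<close>. Constants are fixed in the order \<kappa> from \<delta>, B and
  \<beta>, then M and L, then \<tau>, and only then n.\<close>

theorem whp_local_comparison:
  assumes \<delta>: "0 < \<delta>" "\<delta> \<le> 1" and B: "0 < B" and \<beta>: "0 \<le> \<beta>"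
  shows "likely (\<lambda>n z. \<bar>V z\<bar> \<le> \<beta> \<longrightarrow> (\<forall>F\<in>sets borel.
    ennreal (1 - \<delta>) * emeasure (limit_law n z) (F \<inter> {\<theta>. \<bar>\<theta> - \<theta>0\<bar> \<le> B / sqrt (real n)}) * total n z
      \<le> evid n (\<lambda>q. fst q \<in> F) z))"
proof -
  obtain \<kappa> where \<kappa>: "0 < \<kappa>" "\<kappa> < 1" "0 < info - 4 * \<kappa>"
    and comp: "\<And>n z. 1 \<le> n \<Longrightarrow> \<bar>V z\<bar> \<le> \<beta> \<Longrightarrow> (1 - \<delta>) * ((1 + \<kappa>) * p \<theta>0 * exp (2 * \<kappa>) * laplace (info - 4 * \<kappa>) n z)
       \<le> (1 - \<kappa>) * ((1 - \<kappa>)\<^sup>2 * p \<theta>0 * exp (- 2 * \<kappa> * (1 + B\<^sup>2)) * laplace info n z)"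
    using laplace_comparison[OF \<delta>(1) \<beta>] by blast
  obtain M1 L1 where post: "\<And>M L \<tau> \<kappa>. M1 \<le> M \<Longrightarrow> L1 \<le> L \<Longrightarrow> 0 < \<tau> \<Longrightarrow> 0 < \<kappa> \<Longrightarrow>
     likely (\<lambda>n z. evid n (outside \<tau> M L n) z \<le> ennreal \<kappa> * total n z)"
    using posterior_contraction by blast
  obtain M2 L2 where known: "\<And>M L \<kappa>. M2 \<le> M \<Longrightarrow> L2 \<le> L \<Longrightarrow> 0 < \<kappa> \<Longrightarrow> likely (\<lambda>n z.
     base_out M L n z \<le> ennreal \<kappa> * base n z
     \<and> base n z < \<infinity>)"
    using known_theta_contraction by blast
  \<comment> \<open>Doubled, because contraction at known \<open>\<theta>0\<close> is applied with M
    / 2 and L / 2.\<close>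
  define M L where "M = 2 * max 1 (max M1 M2)" and "L = 2 * max 1 (max L1 L2)"
  have M: "M1 \<le> M" "M2 \<le> M / 2" "0 < M" and L: "L1 \<le> L" "L2 \<le> L / 2" "0 < L"
    by (auto simp: M_def L_def)
  obtain \<tau>1 where \<tau>1: "0 < \<tau>1" "\<And>\<theta>. \<bar>\<theta> - \<theta>0\<bar> \<le> \<tau>1 \<Longrightarrow> \<theta> \<in> \<Theta> \<and> (1 - \<kappa>) * p \<theta>0 \<le> p \<theta> \<and> p \<theta> \<le> (1 + \<kappa>) * p \<theta>0"
    using density_neighbourhood[OF \<kappa>(1)] by blast
  obtain \<tau>0 where \<tau>0: "0 < \<tau>0" "\<And>\<tau>. 0 < \<tau> \<Longrightarrow> \<tau> \<le> \<tau>0 \<Longrightarrow>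
      likely (\<lambda>n z. AE \<theta> in lborel. \<theta> \<in> \<Theta> \<longrightarrow> \<bar>\<theta> - \<theta>0\<bar> \<le> \<tau> \<longrightarrow> lan_at \<kappa> M n z \<theta>)"
    using whp_lan_at[of M \<kappa>] M(3) \<kappa>(1) by auto
  define \<tau> where "\<tau> = min \<tau>0 \<tau>1"
  have \<tau>: "0 < \<tau>" "\<tau> \<le> \<tau>0" "\<And>\<theta>. \<bar>\<theta> - \<theta>0\<bar> \<le> \<tau> \<Longrightarrow> \<theta> \<in> \<Theta> \<and> (1 - \<kappa>) * p \<theta>0 \<le> p \<theta> \<and> p \<theta> \<le> (1 + \<kappa>) * p \<theta>0"
    using \<tau>0 \<tau>1 by (auto simp: \<tau>_def)
  have fin: "likely (\<lambda>n z. total n z \<noteq> \<infinity>)"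
    by (rule whp_of_eventually) (auto intro: always_eventually AE_evid_finite simp del: infinity_ennreal_def)
  show ?thesis
    using post[OF M(1) L(1) \<tau>(1) \<kappa>(1)] known[OF M(2) L(2) \<kappa>(1)] \<tau>0(2)[OF \<tau>(1,2)] fin
      whp_sequentially[OF eventually_small_shift[OF B \<kappa>(1) M(3) L(3) \<tau>(1)]]
  proof eventually_elim
    case (elim nz)
    obtain n z where nz: "nz = (n, z)" by (cases nz)
    let ?T = "total n z" and ?J = "base n z"
    let ?in = "base_in (M / 2) (L / 2) n z"
    let ?out = "base_out (M / 2) (L / 2) n z"
    let ?U = "(1 + \<kappa>) * p \<theta>0 * exp (2 * \<kappa>) * laplace (info - 4 * \<kappa>) n z"
    let ?c = "(1 - \<kappa>)\<^sup>2 * p \<theta>0 * exp (- 2 * \<kappa> * (1 + B\<^sup>2)) * laplace info n z"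
    have p: "evid n (outside \<tau> M L n) z \<le> ennreal \<kappa> * ?T" and T: "?T < \<infinity>"
      and k: "?out \<le> ennreal \<kappa> * ?J" "?J < \<infinity>"
      and lan: "AE \<theta> in lborel. \<theta> \<in> \<Theta> \<longrightarrow> \<bar>\<theta> - \<theta>0\<bar> \<le> \<tau> \<longrightarrow> lan_at \<kappa> M n z \<theta>"
      and n: "1 \<le> n" and Bn: "B / sqrt (real n) \<le> \<tau>"
      and sh: "B / sqrt (real n) * norm (covop (l n)) \<le> M / 2 * \<epsilon> n" "B / sqrt (real n) * (real n * (s n)\<^sup>2) \<le> L / 2 * real n * \<epsilon> n * s n"
      and small: "\<And>t. \<bar>t\<bar> * (L * real n * \<epsilon> n * s n) + t\<^sup>2 * (real n * (s n)\<^sup>2) / 2 \<le> \<kappa> * (1 + real n * t\<^sup>2)"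
      using elim unfolding nz by (simp_all add: less_top)
    have small': "\<bar>t\<bar> * (L * real n * \<epsilon> n * s n) \<le> \<kappa> * (1 + real n * t\<^sup>2)" for t
      using small[of t] by (rule order_trans[rotated]) simp
    have J: "ennreal (1 - \<kappa>) * ?J \<le> ?in"
    proof (rule ennreal_remove_fraction)
      have "?J = ?in + ?out"
        by (subst nn_integral_add[symmetric]) (auto intro: nn_integral_cong simp: indicator_def)
      also have "\<dots> \<le> ?in + ennreal \<kappa> * ?J" by (intro add_left_mono k)
      finally show "?J \<le> ?in + ennreal \<kappa> * ?J" .
    qed (use k \<kappa> in auto)
    have T1: "ennreal (1 - \<kappa>) * ?T \<le> ennreal ?U * ?J"
    proof (rule ennreal_remove_fraction)
      have "?T \<le> evid n (\<lambda>q. (fst q \<in> {\<theta>. \<bar>\<theta> - \<theta>0\<bar> \<le> \<tau>} \<and> inside M L n (snd q)) \<or> outside \<tau> M L n q) z"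
        by (rule evid_mono) (auto simp: inside_def outside_def)
      also have "\<dots> \<le> evid n (\<lambda>q. fst q \<in> {\<theta>. \<bar>\<theta> - \<theta>0\<bar> \<le> \<tau>} \<and> inside M L n (snd q)) z + evid n (outside \<tau> M L n) z"
      by (simp add: evid_disj_le)
      also have "\<dots> \<le> ennreal ?U * ?J + ennreal \<kappa> * ?T"
        by (intro add_mono p evid_upper[OF n \<kappa>(1,3) lan _ small]) (use \<tau>(3) in auto)
      finally show "?T \<le> ennreal ?U * ?J + ennreal \<kappa> * ?T" .
    qed (use T \<kappa> in auto)
    have "ennreal (1 - \<delta>) * emeasure (limit_law n z) (F \<inter> {\<theta>. \<bar>\<theta> - \<theta>0\<bar> \<le> B / sqrt (real n)}) * ?T \<le> evid n (\<lambda>q. fst q \<in> F) z"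
      if V: "\<bar>V z\<bar> \<le> \<beta>" and F: "F \<in> sets borel" for F
    proof -
      let ?q = "emeasure (limit_law n z) (F \<inter> {\<theta>. \<bar>\<theta> - \<theta>0\<bar> \<le> B / sqrt (real n)})"
      have low: "ennreal ?c * ?q * ?J \<le> evid n (\<lambda>q. fst q \<in> F) z"
        by (rule evid_lower[OF n \<kappa>(1,2) F lan _ B Bn sh small' J]) (use \<tau>(3) in auto)
      have "ennreal (1 - \<kappa>) * (ennreal (1 - \<delta>) * ?q * ?T) = ennreal (1 - \<delta>) * ?q * (ennreal (1 - \<kappa>) * ?T)"
        by (simp only: mult_ac)
      also have "\<dots> \<le> ennreal (1 - \<delta>) * ?q * (ennreal ?U * ?J)" by (intro mult_left_mono T1) simp
      also have "\<dots> = (ennreal (1 - \<delta>) * ennreal ?U) * (?q * ?J)" by (simp only: mult_ac)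
      also have "ennreal (1 - \<delta>) * ennreal ?U = ennreal ((1 - \<delta>) * ?U)"
        using \<delta> by (intro ennreal_mult'[symmetric]) simp
      also have "ennreal ((1 - \<delta>) * ?U) * (?q * ?J) \<le> ennreal ((1 - \<kappa>) * ?c) * (?q * ?J)"
        by (intro mult_right_mono ennreal_leI comp n V) simp
      also have "ennreal ((1 - \<kappa>) * ?c) = ennreal (1 - \<kappa>) * ennreal ?c"
        using \<kappa> by (intro ennreal_mult') simp
      also have "\<dots> * (?q * ?J) = ennreal (1 - \<kappa>) * (ennreal ?c * ?q * ?J)" by (simp only: mult_ac)
      also have "\<dots> \<le> ennreal (1 - \<kappa>) * evid n (\<lambda>q. fst q \<in> F) z" by (intro mult_left_mono low) simp
      finally show ?thesis
        using \<kappa>(2) by (subst (asm) ennreal_mult_le_mult_iff) auto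
    qed
    then show ?case unfolding nz by auto
  qed
qed

lemma prob_space_limit_law: "1 \<le> n \<Longrightarrow> prob_space (limit_law n z)"
  unfolding limit_law_def by (rule prob_space_normal_measure) (use info in simp)

lemma sets_limit_law [measurable_cong]: "sets (limit_law n z) = sets borel"
  by (simp add: limit_law_def)

lemma limit_law_tail:
  assumes n: "1 \<le> n" and V: "\<bar>V z\<bar> \<le> \<beta>" and B: "\<beta> / info < B"
  shows "measure (limit_law n z) {\<theta>. B / sqrt (real n) < \<bar>\<theta> - \<theta>0\<bar>} \<le> 1 / (info * (B - \<beta> / info)\<^sup>2)"
proof -
  interpret P: prob_space "limit_law n z" by (rule prob_space_limit_law[OF n])
  let ?m = "V z / (info * sqrt (real n))" and ?a = "(B - \<beta> / info) / sqrt (real n)"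
  have "\<bar>?m\<bar> = \<bar>V z\<bar> / info / sqrt (real n)" using info(2) by (simp)
  also have "\<dots> \<le> \<beta> / info / sqrt (real n)" using V info(2) by (intro divide_right_mono) auto
  finally have m: "\<bar>?m\<bar> \<le> \<beta> / info / sqrt (real n)" .
  have "measure (limit_law n z) {\<theta>. B / sqrt (real n) < \<bar>\<theta> - \<theta>0\<bar>} \<le> measure (limit_law n z) {\<theta>. ?a \<le> \<bar>\<theta> - (\<theta>0 + ?m)\<bar>}"
  proof (rule P.finite_measure_mono)
    show "{\<theta>. B / sqrt (real n) < \<bar>\<theta> - \<theta>0\<bar>} \<subseteq> {\<theta>. ?a \<le> \<bar>\<theta> - (\<theta>0 + ?m)\<bar>}"
    by (smt (verit) Collect_mono impI diff_divide_distrib m)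
    show "{\<theta>. ?a \<le> \<bar>\<theta> - (\<theta>0 + ?m)\<bar>} \<in> P.events"
      by simp
  qed
  also have "\<dots> \<le> 1 / (real n * info) / ?a\<^sup>2"
    unfolding limit_law_def using n info(2) B by (intro normal_measure_tail) auto
  also have "\<dots> = 1 / (info * (B - \<beta> / info)\<^sup>2)" using n by (simp add: power_divide)
  finally show ?thesis .
qed

text \<open>While V is bounded, a window of size B / sqrt n loses at most \<delta> / 2 of the normal
  law, uniformly over F; the other half of \<delta> is the multiplicative loss of the local
  comparison.\<close>

theorem whp_posterior_dominates:
  assumes \<delta>: "0 < \<delta>" "\<delta> \<le> 1"
  shows "likely (\<lambda>n z. \<forall>F\<in>sets borel.
    ennreal (measure (limit_law n z) F - \<delta>) * total n z \<le> evid n (\<lambda>q. fst q \<in> F) z)"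
proof (rule whp_tight[OF V_measurable])
  fix \<beta> :: real assume \<beta>: "0 < \<beta>"
  \<comment> \<open>The first summand covers the random centre of the normal law, the second makes
    Chebyshev's bound equal to \<open>\<delta> / 2\<close>.\<close>
  define B where "B = \<beta> / info + sqrt (2 / (info * \<delta>))"
  have B: "0 < B" "\<beta> / info < B" using \<beta> info(2) \<delta> by (auto simp: B_def add_pos_pos)
  have tail: "1 / (info * (B - \<beta> / info)\<^sup>2) = \<delta> / 2"
    using info(2) \<delta> by (simp add: B_def)
  have "likely (\<lambda>n z. \<bar>V z\<bar> \<le> \<beta> \<longrightarrow> (\<forall>F\<in>sets borel.
    ennreal (1 - \<delta> / 2) * emeasure (limit_law n z) (F \<inter> {\<theta>. \<bar>\<theta> - \<theta>0\<bar> \<le> B / sqrt (real n)}) * total n z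
      \<le> evid n (\<lambda>q. fst q \<in> F) z))"
    using \<delta> \<beta> by (intro whp_local_comparison B) auto
  then show "likely (\<lambda>n z. \<bar>V z\<bar> \<le> \<beta> \<longrightarrow> (\<forall>F\<in>sets borel.
    ennreal (measure (limit_law n z) F - \<delta>) * total n z \<le> evid n (\<lambda>q. fst q \<in> F) z))"
    using whp_sequentially[OF eventually_ge_at_top[of 1]]
  proof eventually_elim
    case (elim nz)
    obtain n z where nz: "nz = (n, z)" by (cases nz)
    have n: "1 \<le> n" using elim by (simp add: nz)
    interpret P: prob_space "limit_law n z" by (rule prob_space_limit_law[OF n])
    have "ennreal (measure (limit_law n z) F - \<delta>) * total n z \<le> evid n (\<lambda>q. fst q \<in> F) z"
      if V: "\<bar>V z\<bar> \<le> \<beta>" and F: "F \<in> sets borel" for F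
    proof -
      let ?E = "{\<theta>. \<bar>\<theta> - \<theta>0\<bar> \<le> B / sqrt (real n)}" and ?E' = "{\<theta>. B / sqrt (real n) < \<bar>\<theta> - \<theta>0\<bar>}"
      have "measure (limit_law n z) F \<le> measure (limit_law n z) (F \<inter> ?E \<union> ?E')"
        using F by (intro P.finite_measure_mono) (auto)
      also have "\<dots> \<le> measure (limit_law n z) (F \<inter> ?E) + measure (limit_law n z) ?E'"
        using F by (intro measure_Un_le) (auto)
      also have "\<dots> \<le> measure (limit_law n z) (F \<inter> ?E) + \<delta> / 2"
        using limit_law_tail[OF n V B(2)] tail by simp
      finally have q: "measure (limit_law n z) F - \<delta> \<le> measure (limit_law n z) (F \<inter> ?E) - \<delta> / 2" by simp
      also have "\<dots> \<le> (1 - \<delta> / 2) * measure (limit_law n z) (F \<inter> ?E)"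
        using \<delta>(1) by (simp add: algebra_simps)
      finally have "ennreal (measure (limit_law n z) F - \<delta>) \<le> ennreal (1 - \<delta> / 2) * emeasure (limit_law n z) (F \<inter> ?E)"
        using \<delta> by (simp add: P.emeasure_eq_measure ennreal_mult[symmetric])
      then have "ennreal (measure (limit_law n z) F - \<delta>) * total n z
          \<le> ennreal (1 - \<delta> / 2) * emeasure (limit_law n z) (F \<inter> ?E) * total n z"
        by (intro mult_right_mono) auto
      also have "\<dots> \<le> evid n (\<lambda>q. fst q \<in> F) z" using elim V F by (simp add: nz)
      finally show ?thesis .
    qed
    then show ?case by (simp add: nz)
  qed
qed

end

section \<open>Total variation\<close>

text \<open>The one-sided bound at the complement of F is the missing bound at F.\<close>

lemma tv_dist_le:
  assumes P: "prob_space P" and Q: "prob_space Q" and sets: "sets P = sets Q"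
    and le: "\<And>F. F \<in> sets P \<Longrightarrow> measure Q F - \<delta> \<le> measure P F"
  shows "tv_dist P Q \<le> 2 * \<delta>"
proof -
  interpret P: prob_space P by (rule P)
  interpret Q: prob_space Q by (rule Q)
  have "\<bar>measure P F - measure Q F\<bar> \<le> \<delta>" if F: "F \<in> sets P" for F
    using le[OF F] le[of "space P - F"] F P.prob_compl[OF F] Q.prob_compl[of F] sets sets_eq_imp_space_eq[OF sets]
    by (auto)
  then have "(SUP F\<in>sets P. \<bar>measure P F - measure Q F\<bar>) \<le> \<delta>"
    by (intro cSUP_least) auto
  then show ?thesis by (simp add: tv_dist_def)
qed

text \<open>Finite unions of basic open sets: a countable family that approximates every Borel set
  in any finite measure, so that \<open>tv_dist\<close> becomes a countable supremum and measurable
  in the observation.\<close>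

definition basic_opens :: "'a::second_countable_topology set set" where
  "basic_opens = Union ` {A. finite A \<and> A \<subseteq> (SOME B. countable B \<and> topological_basis B)}"

lemma countable_basis_choice: "countable (SOME B :: 'a::second_countable_topology set set. countable B \<and> topological_basis B)"
    "topological_basis (SOME B :: 'a::second_countable_topology set set. countable B \<and> topological_basis B)"
proof -
  have "\<exists>B :: 'a set set. countable B \<and> topological_basis B" using ex_countable_basis by blast
  from someI_ex[OF this] show "countable (SOME B :: 'a set set. countable B \<and> topological_basis B)"
    "topological_basis (SOME B :: 'a set set. countable B \<and> topological_basis B)" by auto
qed

lemma countable_basic_opens: "countable basic_opens"
  unfolding basic_opens_def by (intro countable_image countable_Collect_finite_subset countable_basis_choice)

lemma open_basic_opens: "A \<in> basic_opens \<Longrightarrow> open A"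
  using countable_basis_choice(2) unfolding basic_opens_def by (auto intro: topological_basis_open)

lemma borel_basic_opens: "A \<in> basic_opens \<Longrightarrow> A \<in> sets borel"
  by (intro borel_open open_basic_opens)

lemma open_exhausted_by_basic_opens:
  fixes U :: "'a::second_countable_topology set"
  assumes U: "open U"
  obtains A :: "nat \<Rightarrow> 'a set" where "\<And>n. A n \<in> basic_opens" "incseq A" "(\<Union>n. A n) = U"
proof -
  let ?B = "SOME B :: 'a set set. countable B \<and> topological_basis B"
  obtain B' where B': "B' \<subseteq> ?B" "\<Union>B' = U"
    using countable_basis_choice(2) U unfolding topological_basis_def by blast
  have "countable (insert {} B')" using B' countable_basis_choice(1) countable_subset by blast
  then obtain b :: "nat \<Rightarrow> 'a set" where b: "range b = insert {} B'" using range_from_nat_into[of "insert {} B'"] by blast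
  show ?thesis
  proof (rule that[of "\<lambda>n. \<Union>i\<le>n. b i"])
    fix n
    have "(\<Union>i\<le>n. b i) = \<Union>(b ` {..n} - {{}})" by auto
    moreover have "b ` {..n} - {{}} \<subseteq> ?B" using b B'(1) by auto
    ultimately show "(\<Union>i\<le>n. b i) \<in> basic_opens" unfolding basic_opens_def by auto
  next
    show "incseq (\<lambda>n. \<Union>i\<le>n. b i)" by (intro incseq_SucI UN_mono) auto
    have "(\<Union>n. \<Union>i\<le>n. b i) = \<Union>(range b)" by auto
    then show "(\<Union>n. \<Union>i\<le>n. b i) = U" using b B' by auto
  qed
qed

lemma borel_open_superset:
  fixes F :: "'a::polish_space set"
  assumes F: "F \<in> sets borel" and M: "finite_measure M" "sets M = sets borel" and \<delta>: "0 < \<delta>"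
  obtains U where "open U" "F \<subseteq> U" "measure M (U - F) < \<delta>"
proof -
  interpret finite_measure M by (rule M)
  have "emeasure M F = (INF U\<in>{U. F \<subseteq> U \<and> open U}. emeasure M U)"
    using M F by (intro outer_regular) (auto)
  moreover have "emeasure M F < ennreal (measure M F + \<delta>)"
    using \<delta> emeasure_eq_measure by (auto)
  ultimately obtain U where U: "F \<subseteq> U" "open U" "emeasure M U < ennreal (measure M F + \<delta>)"
    by (auto simp: INF_less_iff)
  then have "measure M (U - F) < \<delta>"
    using F M(2) finite_measure_Diff[of U F] by (simp add: emeasure_eq_measure ennreal_less_iff)
  with U show ?thesis by (intro that)
qed

text \<open>One set must serve both measures: intersect an outer open approximation for each, then
  exhaust the intersection from inside far enough for both.\<close>

lemma borel_approx_basic_opens: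
  fixes F :: "'a::polish_space set"
  assumes F: "F \<in> sets borel" and P: "finite_measure P" "sets P = sets borel" and Q: "finite_measure Q" "sets Q = sets borel"
    and \<delta>: "0 < \<delta>"
  obtains A where "A \<in> basic_opens" "measure P (A - F) + measure P (F - A) \<le> \<delta>" "measure Q (A - F) + measure Q (F - A) \<le> \<delta>"
proof -
  obtain U1 where U1: "open U1" "F \<subseteq> U1" "measure P (U1 - F) < \<delta> / 2"
    using borel_open_superset[OF F P, of "\<delta> / 2"] \<delta> by auto
  obtain U2 where U2: "open U2" "F \<subseteq> U2" "measure Q (U2 - F) < \<delta> / 2"
    using borel_open_superset[OF F Q, of "\<delta> / 2"] \<delta> by auto
  define U where "U = U1 \<inter> U2"
  have oU: "open U" using U1 U2 by (simp add: U_def open_Int)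
  obtain A where A: "\<And>n. A n \<in> basic_opens" "incseq A" "(\<Union>n. A n) = U"
    by (rule open_exhausted_by_basic_opens[OF oU]) blast
  have inner: "\<forall>\<^sub>F n in sequentially. measure M (A n - F) + measure M (F - A n) \<le> \<delta>"
    if M: "finite_measure M" "sets M = sets borel" and W: "open W" "U \<subseteq> W" "F \<subseteq> U" "measure M (W - F) < \<delta> / 2" for M W
  proof -
    interpret finite_measure M by (rule M)
    have s: "A n \<in> sets M" "F \<in> sets M" "U \<in> sets M" "W \<in> sets M" for n
      using borel_basic_opens[OF A(1)] F oU W(1) M(2) by auto
    have "(\<lambda>n. measure M (A n)) \<longlonglongrightarrow> measure M (\<Union>n. A n)"
      using s A(2) by (intro finite_Lim_measure_incseq) auto
    then have "\<forall>\<^sub>F n in sequentially. measure M U - \<delta> / 2 < measure M (A n)"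
      unfolding A(3) using \<delta> by (intro order_tendstoD) auto
    then show ?thesis
    proof eventually_elim
      fix n assume n: "measure M U - \<delta> / 2 < measure M (A n)"
      have AU: "A n \<subseteq> U" using A(3) by auto
      have "measure M (F - A n) \<le> measure M (U - A n)" using s W by (intro finite_measure_mono) auto
      also have "\<dots> = measure M U - measure M (A n)" using s AU by (intro finite_measure_Diff)
      finally have "measure M (F - A n) \<le> \<delta> / 2" using n by simp
      moreover have "measure M (A n - F) \<le> measure M (W - F)" using s AU W by (intro finite_measure_mono) auto
      ultimately show "measure M (A n - F) + measure M (F - A n) \<le> \<delta>" using W by linarith
    qed
  qed
  have "\<forall>\<^sub>F n in sequentially. measure P (A n - F) + measure P (F - A n) \<le> \<delta> \<and> measure Q (A n - F) + measure Q (F - A n) \<le> \<delta>"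
    using U1 U2 by (intro eventually_conj inner[OF P U1(1)] inner[OF Q U2(1)]) (auto simp: U_def)
  then obtain n where "measure P (A n - F) + measure P (F - A n) \<le> \<delta>" "measure Q (A n - F) + measure Q (F - A n) \<le> \<delta>"
    by (auto simp: eventually_sequentially)
  then show ?thesis by (intro that[OF A(1)])
qed

lemma (in finite_measure) abs_measure_diff_le:
  assumes "A \<in> sets M" "B \<in> sets M"
  shows "\<bar>measure M A - measure M B\<bar> \<le> measure M (A - B) + measure M (B - A)"
proof -
  have "measure M A \<le> measure M (A - B) + measure M B"
    using finite_measure_mono[of A "(A - B) \<union> B"] measure_Un_le[of "A - B" M B] assms by auto
  moreover have "measure M B \<le> measure M (B - A) + measure M A"
    using finite_measure_mono[of B "(B - A) \<union> A"] measure_Un_le[of "B - A" M A] assms by auto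
  ultimately show ?thesis using measure_nonneg[of M "A - B"] measure_nonneg[of M "B - A"] by linarith
qed

lemma tv_dist_basic_opens:
  fixes P Q :: "'a::polish_space measure"
  assumes P: "finite_measure P" "sets P = sets borel" and Q: "finite_measure Q" "sets Q = sets borel"
  shows "tv_dist P Q = 2 * (SUP F\<in>basic_opens. \<bar>measure P F - measure Q F\<bar>)"
    and "bdd_above ((\<lambda>F. \<bar>measure P F - measure Q F\<bar>) ` basic_opens)"
proof -
  interpret P: finite_measure P by (rule P)
  interpret Q: finite_measure Q by (rule Q)
  let ?d = "\<lambda>F. \<bar>measure P F - measure Q F\<bar>"
  have "?d F \<le> measure P (space P) + measure Q (space Q)" for F
    using P.bounded_measure[of F] Q.bounded_measure[of F] measure_nonneg[of P F] measure_nonneg[of Q F] by linarith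
  then have bdd: "bdd_above (?d ` X)" for X by (intro bdd_aboveI2)
  have sub: "basic_opens \<subseteq> sets P" using borel_basic_opens P(2) by auto
  have ne: "(basic_opens :: 'a set set) \<noteq> {}"
    unfolding basic_opens_def by (auto)
  have "?d F \<le> (SUP F\<in>basic_opens. ?d F)" if F: "F \<in> sets P" for F
  proof (rule field_le_epsilon)
    fix \<delta> :: real assume \<delta>: "0 < \<delta>"
    obtain U where U: "U \<in> basic_opens" "measure P (U - F) + measure P (F - U) \<le> \<delta> / 2" "measure Q (U - F) + measure Q (F - U) \<le> \<delta> / 2"
      using borel_approx_basic_opens[OF _ P Q, of F "\<delta> / 2"] F P(2) \<delta> by auto
    have s: "U \<in> sets P" "F \<in> sets P" "U \<in> sets Q" "F \<in> sets Q" using U sub F P(2) Q(2) by auto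
    have "?d F \<le> ?d U + \<delta>"
      using U(2,3) P.abs_measure_diff_le[OF s(1,2)] Q.abs_measure_diff_le[OF s(3,4)] by linarith
    also have "?d U \<le> (SUP F\<in>basic_opens. ?d F)" using U by (intro cSUP_upper bdd)
    finally show "?d F \<le> (SUP F\<in>basic_opens. ?d F) + \<delta>" by simp
  qed
  then have "(SUP F\<in>sets P. ?d F) \<le> (SUP F\<in>basic_opens. ?d F)"
    by (intro cSUP_least) auto
  moreover have "(SUP F\<in>basic_opens. ?d F) \<le> (SUP F\<in>sets P. ?d F)"
    by (intro cSUP_subset_mono ne bdd sub) simp
  ultimately show "tv_dist P Q = 2 * (SUP F\<in>basic_opens. ?d F)" unfolding tv_dist_def by simp
  show "bdd_above (?d ` basic_opens)" by (rule bdd)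
qed

text \<open>Measurability is a part of \<open>tendsto_in_prob\<close>, so it is owed for the
  distance between two random measures.\<close>

lemma tv_dist_measurable:
  fixes P Q :: "'b \<Rightarrow> 'a::polish_space measure"
  assumes P: "\<And>x. finite_measure (P x)" "\<And>x. sets (P x) = sets borel" and Q: "\<And>x. finite_measure (Q x)" "\<And>x. sets (Q x) = sets borel"
    and m: "\<And>F. F \<in> sets borel \<Longrightarrow> (\<lambda>x. measure (P x) F) \<in> borel_measurable M"
      "\<And>F. F \<in> sets borel \<Longrightarrow> (\<lambda>x. measure (Q x) F) \<in> borel_measurable M"
  shows "(\<lambda>x. tv_dist (P x) (Q x)) \<in> borel_measurable M"
by (simp add: m countable_basic_opens tv_dist_basic_opens P Q borel_basic_opens measurable)

text \<open>Transported to \<open>std_normal\<close>, the random mean moves from the measure into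
  the integrand, where joint measurability applies.\<close>

lemma measure_normal_measurable:
  assumes m [measurable]: "m \<in> borel_measurable M" and v: "0 \<le> v" and F [measurable]: "F \<in> sets borel"
  shows "(\<lambda>x. measure (normal_measure (m x) v) F) \<in> borel_measurable M"
proof -
  interpret std: prob_space std_normal by (rule prob_space_std_normal)
  have "measure (normal_measure (m x) v) F = enn2real (\<integral>\<^sup>+y. indicator F (m x + sqrt v * y) \<partial>std_normal)" for x
  proof -
    have "emeasure (normal_measure (m x) v) F = (\<integral>\<^sup>+y. indicator F y \<partial>normal_measure (m x) v)"
      by simp
    also have "\<dots> = (\<integral>\<^sup>+y. indicator F (m x + sqrt v * y) \<partial>std_normal)"
      unfolding normal_measure_eq_distr[OF v] by (subst nn_integral_distr) auto
    finally show ?thesis by (simp add: measure_def)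
  qed
  moreover have "(\<lambda>x. \<integral>\<^sup>+y. indicator F (m x + sqrt v * y) \<partial>std_normal) \<in> borel_measurable M"
    by simp
  ultimately show ?thesis by simp
qed

section \<open>The posterior under the data law\<close>

context onb
begin

lemma pairing_signal:
  assumes h: "h \<in> paired z"
  shows "pairing e (\<lambda>k. g \<bullet> e k + z k / c) h = g \<bullet> h + pairing e z h / c"
proof -
  have s: "(\<lambda>k. (g \<bullet> e k) * (h \<bullet> e k)) sums (g \<bullet> h)" by (rule parseval_inner)
  have "(\<lambda>k. z k * (h \<bullet> e k)) sums pairing e z h"
    using h by (simp add: paired_def pairing_def summable_sums)
  then have "(\<lambda>k. z k * (h \<bullet> e k) / c) sums (pairing e z h / c)" by (rule sums_divide)
  from sums_add[OF s this] show ?thesis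
    unfolding pairing_def by (simp add: sums_iff distrib_right)
qed

end

context bvm_density
begin

definition observe :: "nat \<Rightarrow> observation \<Rightarrow> observation" where
  "observe n = (\<lambda>(z1, z2). ((\<lambda>k. f0 \<bullet> e k + z1 k / sqrt (real n)), (\<lambda>k. K \<theta>0 f0 \<bullet> e k + z2 k / sqrt (real n))))"

lemma sets_sample_algebra: "sets sample_algebra = sets noise"
  unfolding sample_algebra_def noise_eq by (intro sets_pair_measure_cong sets_white_seq[symmetric])

lemma data_law_observe: "data_law e K n \<theta>0 f0 = distr noise sample_algebra (observe n)"
  by (simp add: data_law_def observe_def)

lemma observe_measurable [measurable]: "observe n \<in> measurable noise sample_algebra"
by (simp add: measurable_PiM_single' measurable observe_def sample_algebra_def)

abbreviation lik :: "nat \<Rightarrow> observation \<Rightarrow> real \<times> 'a \<Rightarrow> ennreal" where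
  "lik n x q \<equiv> ennreal (likelihood e K n x (fst q) (snd q))"

lemma likelihood_measurable [measurable (raw)]:
  assumes x: "x \<in> measurable M noise" and t [measurable]: "t \<in> measurable M borel_Theta" and f [measurable]: "f \<in> borel_measurable M"
  shows "(\<lambda>y. likelihood e K n (x y) (t y) (f y)) \<in> borel_measurable M"
proof -
  note fst_noise_measurable[OF x, measurable] snd_noise_measurable[OF x, measurable]
  moreover have "(\<lambda>y. pairing e (snd (x y)) (K (t y) (f y))) \<in> borel_measurable M"
    by simp
  ultimately show ?thesis unfolding likelihood_def by measurable
qed

definition marginal :: "nat \<Rightarrow> real set \<Rightarrow> observation \<Rightarrow> ennreal" where
  "marginal n F x = (\<integral>\<^sup>+q. indicator F (fst q) * lik n x q \<partial>Q)"

lemma lik_Q_measurable [measurable]: "lik n x \<in> borel_measurable Q"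
  by simp

lemma fst_Q_indicator_measurable:
  assumes [measurable]: "F \<in> sets borel"
  shows "(\<lambda>q. indicator F (fst q) :: ennreal) \<in> borel_measurable Q"
  by simp

lemma marginal_measurable:
  assumes F: "F \<in> sets borel"
  shows "marginal n F \<in> borel_measurable noise"
proof -
  have [measurable]: "(\<lambda>p. indicator F (fst (snd p)) :: ennreal) \<in> borel_measurable (noise \<Otimes>\<^sub>M Q)"
    by (rule measurable_compose[OF measurable_snd fst_Q_indicator_measurable[OF F]])
  show ?thesis unfolding marginal_def[abs_def] by measurable
qed

abbreviation post :: "nat \<Rightarrow> observation \<Rightarrow> real measure" where
  "post n x \<equiv> theta_posterior e K (theta_prior \<Theta> p \<Otimes>\<^sub>M \<pi>) n x"

lemma emeasure_theta_posterior:
  assumes F: "F \<in> sets borel"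
  shows "emeasure (post n x) F = marginal n F x / marginal n UNIV x"
proof -
  note [measurable] = fst_Q_indicator_measurable[OF F] theta_Q_measurable
  let ?g = "\<lambda>q. lik n x q / marginal n UNIV x"
  have "posterior e K (theta_prior \<Theta> p \<Otimes>\<^sub>M \<pi>) n x = density Q ?g"
    unfolding posterior_def Q_def[symmetric] by (simp add: marginal_def case_prod_beta')
  then have "emeasure (post n x) F = emeasure (density Q ?g) (fst -` F \<inter> space Q)"
    unfolding theta_posterior_def using F by (simp add: emeasure_distr)
  also have "\<dots> = (\<integral>\<^sup>+q. ?g q * indicator (fst -` F \<inter> space Q) q \<partial>Q)"
    using measurable_sets[OF theta_Q_measurable F] by (intro emeasure_density) auto
  also have "\<dots> = (\<integral>\<^sup>+q. indicator F (fst q) * lik n x q / marginal n UNIV x \<partial>Q)"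
    by (intro nn_integral_cong) (auto simp: indicator_def)
  also have "\<dots> = marginal n F x / marginal n UNIV x"
    unfolding marginal_def[of n F] by (intro nn_integral_divide) measurable
  finally show ?thesis .
qed

lemma sets_theta_posterior: "sets (theta_posterior e K prior n x) = sets borel"
  by (simp add: theta_posterior_def)

lemma marginal_UNIV_pos: "0 < marginal n UNIV x"
proof -
  have "marginal n UNIV x \<noteq> 0"
    unfolding marginal_def by (subst nn_integral_0_iff_AE) (auto simp: likelihood_def)
  then show ?thesis by (simp add: zero_less_iff_neq_zero)
qed

text \<open>Where the normalising integral is infinite, the quotient is 0 and the posterior is the
  zero measure. Measurability of the distance is therefore proved for finite measures; that the
  posterior is a probability measure is shown only off an exceptional event.\<close>

lemma finite_measure_theta_posterior: "finite_measure (post n x)"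
proof (rule finite_measureI)
  have "space (post n x) = UNIV" by (simp add: theta_posterior_def)
  moreover have "marginal n UNIV x / marginal n UNIV x \<noteq> \<infinity>"
    by (auto simp: ennreal_divide_eq_top_iff)
  ultimately show "emeasure (post n x) (space (post n x)) \<noteq> \<infinity>"
    using emeasure_theta_posterior[of UNIV n x] by simp
qed

lemma likelihood_observe:
  assumes n: "1 \<le> n" and p: "f \<in> paired (fst z)" "f0 \<in> paired (fst z)" "K \<theta> f \<in> paired (snd z)" "K \<theta>0 f0 \<in> paired (snd z)"
  shows "likelihood e K n (observe n z) \<theta> f
    = exp (sqrt (real n) * (pairing e (fst z) f0 + pairing e (snd z) (K \<theta>0 f0)) + real n / 2 * ((norm f0)\<^sup>2 + (norm (K \<theta>0 f0))\<^sup>2))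
      * exp (ell n z \<theta> f)"
proof -
  define w where "w = sqrt (real n)"
  have w: "w \<noteq> 0" "real n = w * w" using n by (auto simp: w_def)
  have sq: "(norm (x - y))\<^sup>2 = (norm x)\<^sup>2 - 2 * (y \<bullet> x) + (norm y)\<^sup>2" for x y :: 'a
    by (simp add: power2_norm_eq_inner inner_diff_right inner_commute)
  have a: "pairing e (fst (observe n z)) f = f0 \<bullet> f + pairing e (fst z) f / w"
    using pairing_signal[OF p(1), of f0 w] by (simp add: observe_def split_beta w_def)
  have b: "pairing e (snd (observe n z)) (K \<theta> f) = K \<theta>0 f0 \<bullet> K \<theta> f + pairing e (snd z) (K \<theta> f) / w"
    using pairing_signal[OF p(3), of "K \<theta>0 f0" w] by (simp add: observe_def split_beta w_def)
  show ?thesis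
    unfolding likelihood_def ell_def resid_def a b sq pairing_diff[OF p(1,2)] pairing_diff[OF p(3,4)] exp_add[symmetric] w_def[symmetric]
    unfolding w(2) by (simp add: algebra_simps)
qed

text \<open>The factor between the likelihood and \<open>exp (ell n z \<theta> f)\<close> depends on
  z alone, so it cancels in the posterior. A single null set in z serves all F.\<close>

lemma AE_marginal_observe:
  assumes n: "1 \<le> n"
  shows "AE z in noise. \<exists>c>0. \<forall>F\<in>sets borel. marginal n F (observe n z) = ennreal c * evid n (\<lambda>q. fst q \<in> F) z"
proof -
  have "AE z in noise. AE q in Q. snd q \<in> paired (fst z)"
  proof (rule AE_noise_Q)
    show "Measurable.pred (noise \<Otimes>\<^sub>M Q) (\<lambda>p. snd (snd p) \<in> paired (fst (fst p)))"
      by (rule paired_measurable) (auto)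
  qed (auto intro: AE_noise_fst AE_paired)
  moreover have "AE z in noise. AE q in Q. K (fst q) (snd q) \<in> paired (snd z)"
  proof (rule AE_noise_Q)
    show "Measurable.pred (noise \<Otimes>\<^sub>M Q) (\<lambda>p. K (fst (snd p)) (snd (snd p)) \<in> paired (snd (fst p)))"
    by (simp add: paired_measurable)
  qed (auto intro: AE_noise_snd AE_paired)
  moreover have "AE z in noise. f0 \<in> paired (fst z)" "AE z in noise. K \<theta>0 f0 \<in> paired (snd z)"
    by (auto intro: AE_noise_fst AE_noise_snd AE_paired)
  ultimately show ?thesis
  proof eventually_elim
    fix z assume z: "AE q in Q. snd q \<in> paired (fst z)" "AE q in Q. K (fst q) (snd q) \<in> paired (snd z)"
      "f0 \<in> paired (fst z)" "K \<theta>0 f0 \<in> paired (snd z)"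
    define c where "c = exp (sqrt (real n) * (pairing e (fst z) f0 + pairing e (snd z) (K \<theta>0 f0)) + real n / 2 * ((norm f0)\<^sup>2 + (norm (K \<theta>0 f0))\<^sup>2))"
    have "marginal n F (observe n z) = ennreal c * evid n (\<lambda>q. fst q \<in> F) z" if F: "F \<in> sets borel" for F
    proof -
      have [measurable]: "Measurable.pred Q (\<lambda>q. fst q \<in> F)"
        using F by auto
      have "marginal n F (observe n z) = (\<integral>\<^sup>+q. ennreal c * (indicator {q. fst q \<in> F} q * lr n z (fst q) (snd q)) \<partial>Q)"
        unfolding marginal_def
      proof (intro nn_integral_cong_AE, use z(1,2) in eventually_elim)
        fix q assume q: "snd q \<in> paired (fst z)" "K (fst q) (snd q) \<in> paired (snd z)"
        show "indicator F (fst q) * lik n (observe n z) q = ennreal c * (indicator {q. fst q \<in> F} q * lr n z (fst q) (snd q))"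
          unfolding likelihood_observe[OF n q(1) z(3) q(2) z(4)] by (simp add: c_def ennreal_mult indicator_def)
      qed
      also have "\<dots> = ennreal c * evid n (\<lambda>q. fst q \<in> F) z"
        unfolding evid_def by (intro nn_integral_cmult) measurable
      finally show ?thesis .
    qed
    moreover have "0 < c" by (simp add: c_def)
    ultimately show "\<exists>c>0. \<forall>F\<in>sets borel. marginal n F (observe n z) = ennreal c * evid n (\<lambda>q. fst q \<in> F) z" by blast
  qed
qed

text \<open>The data are the image of the noise under \<open>observe\<close>, so the distance is
  studied at \<open>observe n z\<close> and the result transported back; the centre of the normal
  law becomes \<open>\<theta>0 + V z / (info * sqrt n)\<close> there.\<close>

theorem posterior_tv_tendsto:
  assumes Kd: "Kd \<theta>0 = dK" and g: "\<gamma> = least_favorable K Kd \<theta>0 f0" and i: "info = efficient_information K Kd \<theta>0 f0"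
  shows "tendsto_in_prob (\<lambda>n. data_law e K n \<theta>0 f0)
           (\<lambda>n x. tv_dist (post n x)
              (normal_measure (\<theta>0 + 1 / sqrt (real n) * efficient_center e K Kd n \<theta>0 f0 x)
                 (1 / real n * inverse (efficient_information K Kd \<theta>0 f0)))) 0"
    (is "tendsto_in_prob ?P ?Y 0")
proof -
  let ?m = "\<lambda>n x. \<theta>0 + 1 / sqrt (real n) * efficient_center e K Kd n \<theta>0 f0 x"
  let ?v = "\<lambda>n. 1 / real n * inverse (efficient_information K Kd \<theta>0 f0)"
  let ?norm = "\<lambda>n x. normal_measure (?m n x) (?v n)"
  have v: "0 \<le> ?v n" for n using info(2) i by simp
  have center_measurable: "?m n \<in> borel_measurable noise" for n
  by (simp add: efficient_center_def Let_def white_noise1_def white_noise2_def)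
  have post_measurable: "(\<lambda>x. measure (post n x) F) \<in> borel_measurable noise" if F: "F \<in> sets borel" for n F
  by (simp add: measurable marginal_measurable F measure_def emeasure_theta_posterior)
  have Y_noise: "?Y n \<in> borel_measurable noise" for n
    by (intro tv_dist_measurable finite_measure_theta_posterior sets_theta_posterior sets_normal_measure post_measurable
        measure_normal_measurable center_measurable v prob_space.finite_measure[OF prob_space_normal_measure])
  then have Y: "?Y n \<in> borel_measurable sample_algebra" for n
    by (simp add: measurable_cong_sets[OF sets_sample_algebra refl])
  have norm_eq: "likely (\<lambda>n z. ?norm n (observe n z) = limit_law n z)"
  proof (rule whp_of_eventually, use eventually_ge_at_top[of 1] in eventually_elim)
    fix n :: nat assume n: "1 \<le> n"
    have "AE z in noise. \<gamma> \<in> paired (fst z)" "AE z in noise. dK f0 \<in> paired (snd z)" "AE z in noise. K \<theta>0 \<gamma> \<in> paired (snd z)"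
      by (auto intro: AE_noise_fst AE_noise_snd AE_paired)
    then show "AE z in noise. case (n, z) of (n, z) \<Rightarrow> ?norm n (observe n z) = limit_law n z"
    proof eventually_elim
      fix z assume z: "\<gamma> \<in> paired (fst z)" "dK f0 \<in> paired (snd z)" "K \<theta>0 \<gamma> \<in> paired (snd z)"
      have w1: "white_noise1 e n f0 (observe n z) h = pairing e (fst z) h" if "h \<in> paired (fst z)" for h
        using pairing_signal[OF that, of f0 "sqrt (real n)"] n by (simp add: white_noise1_def observe_def split_beta)
      have w2: "white_noise2 e K n \<theta>0 f0 (observe n z) h = pairing e (snd z) h" if "h \<in> paired (snd z)" for h
        using pairing_signal[OF that, of "K \<theta>0 f0" "sqrt (real n)"] n by (simp add: white_noise2_def observe_def split_beta)
      have "efficient_center e K Kd n \<theta>0 f0 (observe n z) = V z / info"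
        unfolding efficient_center_def Let_def Kd g[symmetric] i[symmetric] V_def w1[OF z(1)] w2[OF z(2)] w2[OF z(3)] by simp
      then have "?m n (observe n z) = \<theta>0 + V z / (info * sqrt (real n))" by simp
      moreover have "?v n = 1 / (real n * info)" by (simp add: i[symmetric] divide_inverse)
      ultimately have "?norm n (observe n z) = limit_law n z" by (simp only: limit_law_def)
      then show "case (n, z) of (n, z) \<Rightarrow> ?norm n (observe n z) = limit_law n z" by simp
    qed
  qed
  have fin: "likely (\<lambda>n z. total n z \<noteq> \<infinity>)"
    by (rule whp_of_eventually) (auto intro: always_eventually AE_evid_finite simp del: infinity_ennreal_def)
  have marg: "likely (\<lambda>n z. \<exists>c>0. \<forall>F\<in>sets borel. marginal n F (observe n z) = ennreal c * evid n (\<lambda>q. fst q \<in> F) z)"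
    by (rule whp_of_eventually, rule eventually_mono[OF eventually_ge_at_top[of 1]]) (simp add: AE_marginal_observe)
  have small: "likely (\<lambda>n z. \<bar>?Y n (observe n z)\<bar> \<le> 2 * \<delta>)" if \<delta>: "0 < \<delta>" "\<delta> \<le> 1" for \<delta>
    using whp_posterior_dominates[OF \<delta>] fin marg norm_eq whp_sequentially[OF eventually_ge_at_top[of 1]]
  proof eventually_elim
    case (elim nz)
    obtain n z where nz: "nz = (n, z)" by (cases nz)
    let ?x = "observe n z" and ?T = "total n z"
    have n: "1 \<le> n" and T: "?T < \<infinity>" and eq: "?norm n ?x = limit_law n z"
      and dom: "\<And>F. F \<in> sets borel \<Longrightarrow> ennreal (measure (limit_law n z) F - \<delta>) * ?T \<le> evid n (\<lambda>q. fst q \<in> F) z"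
      using elim unfolding nz by (simp_all add: less_top)
    obtain c where c: "0 < c" "\<And>F. F \<in> sets borel \<Longrightarrow> marginal n F ?x = ennreal c * evid n (\<lambda>q. fst q \<in> F) z"
      using elim nz by blast
    have mU: "marginal n UNIV ?x = ennreal c * ?T" using c(2) by simp
    have fin: "marginal n UNIV ?x < \<infinity>" unfolding mU using T by (simp add: ennreal_mult_less_top)
    have sp: "space (post n ?x) = UNIV" using sets_eq_imp_space_eq[OF sets_theta_posterior] by simp
    have P: "prob_space (post n ?x)"
    proof (rule prob_spaceI)
      show "emeasure (post n ?x) (space (post n ?x)) = 1"
        unfolding sp emeasure_theta_posterior[OF sets.top[of borel, unfolded space_borel]]
        using marginal_UNIV_pos[of n ?x] fin by auto
    qed
    then interpret P: prob_space "post n ?x" .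
    have Q: "prob_space (limit_law n z)" by (rule prob_space_limit_law[OF n])
    have "?Y n ?x \<le> 2 * \<delta>"
      unfolding eq
    proof (rule tv_dist_le[OF P Q])
      show "sets (post n ?x) = sets (limit_law n z)" by (simp add: sets_theta_posterior sets_limit_law)
      fix F assume "F \<in> sets (post n ?x)"
      then have F: "F \<in> sets borel" by (simp add: sets_theta_posterior)
      have "ennreal (measure (limit_law n z) F - \<delta>) * marginal n UNIV ?x = ennreal c * (ennreal (measure (limit_law n z) F - \<delta>) * ?T)"
        unfolding mU by (simp only: mult_ac)
      also have "\<dots> \<le> ennreal c * evid n (\<lambda>q. fst q \<in> F) z" by (intro mult_left_mono dom F) simp
      also have "\<dots> = marginal n F ?x" by (rule c(2)[OF F, symmetric])
      finally have "ennreal (measure (limit_law n z) F - \<delta>) * marginal n UNIV ?x / marginal n UNIV ?x \<le> marginal n F ?x / marginal n UNIV ?x"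
        by (rule divide_right_mono_ennreal)
      then have "ennreal (measure (limit_law n z) F - \<delta>) \<le> emeasure (post n ?x) F"
        using marginal_UNIV_pos[of n ?x] fin emeasure_theta_posterior[OF F]
        by (simp add: ennreal_mult_divide_eq)
      then show "measure (limit_law n z) F - \<delta> \<le> measure (post n ?x) F"
        by (simp add: P.emeasure_eq_measure)
    qed
    \<comment> \<open>The supremum is real valued, so a lower bound requires a bounded family; the
      empty set contributes the value 0.\<close>
    moreover have "0 \<le> ?Y n ?x"
    proof -
      have "0 \<le> (SUP F\<in>basic_opens. \<bar>measure (post n ?x) F - measure (?norm n ?x) F\<bar>)"
      proof (rule cSUP_upper2[of _ _ "{}"])
        show "bdd_above ((\<lambda>F. \<bar>measure (post n ?x) F - measure (?norm n ?x) F\<bar>) ` basic_opens)"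
          by (intro tv_dist_basic_opens(2) finite_measure_theta_posterior sets_theta_posterior sets_normal_measure v prob_space.finite_measure[OF prob_space_normal_measure])
        show "{} \<in> basic_opens" unfolding basic_opens_def by (auto intro: image_eqI[of _ _ "{}"])
      qed simp
      then show ?thesis using v[of n]
        by (subst tv_dist_basic_opens) (auto intro!: sets_theta_posterior prob_space.finite_measure[OF prob_space_normal_measure])
    qed
    ultimately show ?case by (simp add: nz)
  qed
  show ?thesis
    unfolding tendsto_in_prob_def
  proof (intro conjI allI impI always_eventually)
    show "?Y n \<in> borel_measurable (?P n)" for n
      using Y[of n] by (simp add: data_law_observe)
    fix \<eta> :: real assume \<eta>: "0 < \<eta>"
    define \<delta> where "\<delta> = min 1 (\<eta> / 2)"
    have \<delta>: "0 < \<delta>" "\<delta> \<le> 1" "2 * \<delta> \<le> \<eta>" using \<eta> by (auto simp: \<delta>_def)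
    have eq: "measure (?P n) {x \<in> space (?P n). \<bar>?Y n x - 0\<bar> > \<eta>} = measure noise {z. \<bar>?Y n (observe n z)\<bar> > \<eta>}" for n
    proof -
      have "{x \<in> space sample_algebra. \<bar>?Y n x - 0\<bar> > \<eta>} \<in> sets sample_algebra" using Y[of n] by measurable
      then show ?thesis
        using measurable_space[OF observe_measurable]
        unfolding data_law_observe by (subst measure_distr) (auto)
    qed
    show "(\<lambda>n. measure (?P n) {x \<in> space (?P n). \<bar>?Y n x - 0\<bar> > \<eta>}) \<longlonglongrightarrow> 0"
      unfolding eq
    proof (rule LIMSEQ_I)
      fix r :: real assume r: "0 < r"
      have "\<forall>\<^sub>F n in sequentially. off_small (r / 2) (\<lambda>z. \<bar>?Y n (observe n z)\<bar> \<le> 2 * \<delta>)"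
        using small[OF \<delta>(1,2), unfolded eventually_whp, rule_format, of "r / 2"] r by simp
      then have "\<forall>\<^sub>F n in sequentially. norm (measure noise {z. \<bar>?Y n (observe n z)\<bar> > \<eta>} - 0) < r"
      proof eventually_elim
        fix n assume "off_small (r / 2) (\<lambda>z. \<bar>?Y n (observe n z)\<bar> \<le> 2 * \<delta>)"
        then obtain B where B: "B \<in> sets noise" "measure noise B \<le> r / 2" "\<And>z. z \<notin> B \<Longrightarrow> \<bar>?Y n (observe n z)\<bar> \<le> 2 * \<delta>" by blast
        have "{z. \<bar>?Y n (observe n z)\<bar> > \<eta>} \<subseteq> B" using B(3) \<delta>(3) by (auto) (meson less_le_trans not_le)
        then have "measure noise {z. \<bar>?Y n (observe n z)\<bar> > \<eta>} \<le> measure noise B" by (intro noise.finite_measure_mono B)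
        then show "norm (measure noise {z. \<bar>?Y n (observe n z)\<bar> > \<eta>} - 0) < r" using B(2) r by simp
      qed
      then show "\<exists>no. \<forall>n\<ge>no. norm (measure noise {z. \<bar>?Y n (observe n z)\<bar> > \<eta>} - 0) < r" by (simp add: eventually_sequentially)
    qed
  qed
qed

end

section \<open>The Bernstein-von Mises theorem\<close>

text \<open>A finite bound excludes the value infinity in the supremum, so the unit ball is mapped
  into S; homogeneity of \<open>nS\<close> extends this to all h.\<close>

lemma opnorm_into_bound:
  assumes S: "normed_subspace S nS" and A: "opnorm_into S nS A \<le> ereal c"
  shows "blinfun_apply A h \<in> S" "nS (A h) \<le> c * norm h"
proof -
  have sub: "subspace S" and hom: "\<And>x a. x \<in> S \<Longrightarrow> nS (a *\<^sub>R x) = \<bar>a\<bar> * nS x"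
    using S by (auto simp: normed_subspace_def)
  have nS0: "nS 0 = 0" using hom[OF subspace_0[OF sub], of 0] by simp
  have unit: "A u \<in> S \<and> nS (A u) \<le> c" if "norm u \<le> 1" for u
  proof -
    have "(if A u \<in> S then ereal (nS (A u)) else \<infinity>) \<le> ereal c"
      by (rule order_trans[OF SUP_upper A[unfolded opnorm_into_def]]) (use that in simp)
    then show ?thesis by (auto split: if_splits)
  qed
  have "A h \<in> S \<and> nS (A h) \<le> c * norm h"
  proof (cases "h = 0")
    case True
    then show ?thesis using nS0 subspace_0[OF sub] by (simp)
  next
    case False
    let ?u = "h /\<^sub>R norm h"
    have u: "A ?u \<in> S" "nS (A ?u) \<le> c" using unit[of ?u] False by auto
    have "A h = norm h *\<^sub>R A ?u" using False by (simp add: blinfun.scaleR_right)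
    then show ?thesis
      using subspace_scale[OF sub u(1), of "norm h"] hom[OF u(1), of "norm h"] mult_left_mono[OF u(2), of "norm h"] by (simp add: mult.commute)
  qed
  then show "A h \<in> S" "nS (A h) \<le> c * norm h" by auto
qed

section \<open>Choice of the shifts and positivity of a variance\<close>

context gaussian_basis
begin

text \<open>Take both r and s to be \<open>2 * \<rho> n\<close>; the factor 2 leaves room for the
  slack of \<open>decentering_approx\<close>.\<close>

lemma shift_sequence_decentering:
  assumes \<rho>: "\<And>n. 0 < \<rho> n" "\<rho> \<longlonglongrightarrow> 0" and dec: "\<And>n. 1 \<le> n \<Longrightarrow> decentering \<pi> \<gamma> (\<rho> n) \<le> ereal (real n * (\<rho> n)\<^sup>2)"
    and \<epsilon>: "\<And>n. 0 < \<epsilon> n" and rate: "(\<lambda>n. real n * (\<epsilon> n)\<^sup>2 * (\<rho> n)\<^sup>2) \<longlonglongrightarrow> 0"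
  shows "\<exists>l r s. (\<forall>n. 0 < s n) \<and> (\<forall>n\<ge>1. cov (l n) (l n) \<le> real n * (s n)\<^sup>2) \<and> (\<forall>n\<ge>1. norm (covop (l n) - \<gamma>) \<le> r n)
    \<and> r \<longlonglongrightarrow> 0 \<and> (\<lambda>n. sqrt (real n) * \<epsilon> n * r n) \<longlonglongrightarrow> 0 \<and> s \<longlonglongrightarrow> 0 \<and> (\<lambda>n. sqrt (real n) * \<epsilon> n * s n) \<longlonglongrightarrow> 0"
proof -
  have "\<exists>l. 1 \<le> n \<longrightarrow> norm (covop l - \<gamma>) \<le> 2 * \<rho> n \<and> cov l l \<le> real n * (2 * \<rho> n)\<^sup>2" for n
  proof (cases "1 \<le> n")
    case True
    define \<delta> where "\<delta> = min (\<rho> n) (real n * (\<rho> n)\<^sup>2)"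
    have \<delta>: "0 < \<delta>" using \<rho>(1)[of n] True by (simp add: \<delta>_def)
    obtain l where l: "norm (covop l - \<gamma>) \<le> \<rho> n + \<delta>" "cov l l \<le> real n * (\<rho> n)\<^sup>2 + \<delta>"
      by (rule decentering_approx[OF dec[OF True] \<delta>])
    have "\<delta> \<le> \<rho> n" "\<delta> \<le> real n * (\<rho> n)\<^sup>2" by (auto simp: \<delta>_def)
    moreover have "0 \<le> real n * (\<rho> n)\<^sup>2" by simp
    ultimately have "norm (covop l - \<gamma>) \<le> 2 * \<rho> n \<and> cov l l \<le> 4 * (real n * (\<rho> n)\<^sup>2)" using l by linarith
    then show ?thesis by auto
  qed auto
  then obtain l where l: "\<And>n. 1 \<le> n \<Longrightarrow> norm (covop (l n) - \<gamma>) \<le> 2 * \<rho> n" "\<And>n. 1 \<le> n \<Longrightarrow> cov (l n) (l n) \<le> real n * (2 * \<rho> n)\<^sup>2"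
    by metis
  have lim: "(\<lambda>n. 2 * \<rho> n) \<longlonglongrightarrow> 0" using tendsto_mult[OF tendsto_const[of 2] \<rho>(2)] by simp
  have "(\<lambda>n. 2 * sqrt (real n * (\<epsilon> n)\<^sup>2 * (\<rho> n)\<^sup>2)) \<longlonglongrightarrow> 2 * sqrt 0" by (intro tendsto_intros rate)
  moreover have "2 * sqrt (real n * (\<epsilon> n)\<^sup>2 * (\<rho> n)\<^sup>2) = sqrt (real n) * \<epsilon> n * (2 * \<rho> n)" for n
    using \<epsilon>[of n] \<rho>(1)[of n] by (simp add: real_sqrt_mult)
  ultimately have rate': "(\<lambda>n. sqrt (real n) * \<epsilon> n * (2 * \<rho> n)) \<longlonglongrightarrow> 0" by simp
  show ?thesis
    by (rule , rule exI[of _ "\<lambda>n. 2 * \<rho> n"], rule exI[of _ "\<lambda>n. 2 * \<rho> n"]) (use l lim rate' \<rho>(1) in auto)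
qed

text \<open>For \<gamma> in the RKHS the shifts keep an RKHS norm of at most C while approaching
  \<gamma> at rate 1 / sqrt n, so s is C / sqrt n and \<open>sqrt n * \<epsilon> n * s n\<close> is
  \<open>C * \<epsilon> n\<close>.\<close>

lemma shift_sequence_rkhs:
  assumes \<gamma>: "\<gamma> \<in> rkhs \<pi>" and \<epsilon>: "\<epsilon> \<longlonglongrightarrow> 0"
  shows "\<exists>l r s. (\<forall>n. 0 < s n) \<and> (\<forall>n\<ge>1. cov (l n) (l n) \<le> real n * (s n)\<^sup>2) \<and> (\<forall>n\<ge>1. norm (covop (l n) - \<gamma>) \<le> r n)
    \<and> r \<longlonglongrightarrow> 0 \<and> (\<lambda>n. sqrt (real n) * \<epsilon> n * r n) \<longlonglongrightarrow> 0 \<and> s \<longlonglongrightarrow> 0 \<and> (\<lambda>n. sqrt (real n) * \<epsilon> n * s n) \<longlonglongrightarrow> 0"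
proof -
  define C where "C = sqrt ((rkhs_norm \<pi> \<gamma>)\<^sup>2 + 1)"
  have C: "0 < C" "C\<^sup>2 = (rkhs_norm \<pi> \<gamma>)\<^sup>2 + 1" by (auto simp: C_def add_nonneg_pos)
  \<comment> \<open>The maximum avoids division by zero at n = 0 and equals n otherwise.\<close>
  define w where "w = (\<lambda>n. sqrt (max 1 (real n)))"
  have w: "1 \<le> w n" for n by (simp add: w_def)
  have "\<exists>l. norm (covop l - \<gamma>) \<le> 1 / w n \<and> cov l l \<le> C\<^sup>2" for n
  proof -
    have pos: "0 < 1 / w n" and le: "1 / w n \<le> 1" using w[of n] by (auto)
    obtain l where l: "norm (covop l - \<gamma>) \<le> 1 / w n" "cov l l \<le> (rkhs_norm \<pi> \<gamma>)\<^sup>2 + 1 / w n"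
      by (rule rkhs_approx[OF \<gamma> pos])
    then have "cov l l \<le> C\<^sup>2" using le C(2) by linarith
    with l(1) show ?thesis by blast
  qed
  then obtain l where l: "\<And>n. norm (covop (l n) - \<gamma>) \<le> 1 / w n" "\<And>n. cov (l n) (l n) \<le> C\<^sup>2" by metis
  have wn: "w n = sqrt (real n)" if "1 \<le> n" for n using that by (simp add: w_def)
  note sqrt_nat_at_top
  then have "(\<lambda>n. inverse (sqrt (real n))) \<longlonglongrightarrow> 0" by (rule tendsto_inverse_0_at_top)
  then have "(\<lambda>n. inverse (w n)) \<longlonglongrightarrow> 0"
    by (rule Lim_transform_eventually) (rule eventually_mono[OF eventually_ge_at_top[of 1]], simp add: wn)
  then have lim: "(\<lambda>n. c / w n) \<longlonglongrightarrow> 0" for c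
    using tendsto_mult[OF tendsto_const[of c]] by (fastforce simp: divide_inverse)
  have rate: "(\<lambda>n. sqrt (real n) * \<epsilon> n * (c / w n)) \<longlonglongrightarrow> 0" for c
  proof (rule Lim_transform_eventually)
    show "(\<lambda>n. c * \<epsilon> n) \<longlonglongrightarrow> 0" using tendsto_mult[OF tendsto_const[of c] \<epsilon>] by simp
    show "\<forall>\<^sub>F n in sequentially. c * \<epsilon> n = sqrt (real n) * \<epsilon> n * (c / w n)"
      using eventually_ge_at_top[of 1] by eventually_elim (simp add: wn)
  qed
  have "0 < C / w n" for n using C(1) w[of n] by simp
  moreover have "cov (l n) (l n) \<le> real n * (C / w n)\<^sup>2" if "1 \<le> n" for n
    using l(2)that by (simp add: wn[OF that] power_divide)
  ultimately show ?thesis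
    by (intro exI[of _ l] exI[of _ "\<lambda>n. 1 / w n"] exI[of _ "\<lambda>n. C / w n"] conjI allI impI lim rate l)
qed

text \<open>If all variances vanish, every \<open>covop l\<close> is 0, and a finite concentration
  function forces f0 to lie within \<open>2 * \<epsilon> n\<close> of 0, which is impossible for
  large n.\<close>

lemma exists_positive_variance:
  assumes f0: "f0 \<noteq> 0" and \<epsilon>: "\<And>n. 0 < \<epsilon> n" "\<epsilon> \<longlonglongrightarrow> 0"
    and conc: "\<And>n. 1 \<le> n \<Longrightarrow> concentration \<pi> f0 (\<epsilon> n) \<le> ereal (real n * (\<epsilon> n)\<^sup>2)"
  shows "\<exists>k. 0 < cov k k"
proof (rule ccontr)
  assume "\<not> (\<exists>k. 0 < cov k k)"
  then have cov0: "cov k k = 0" for k using cov_nonneg[of k] by (meson antisym not_less)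
  have "cov k h = 0" for k h using cov0[of "k + h"] cov0[of k] cov0[of h] by (simp add: cov_simps cov_commute[of h k])
  then have covop0: "covop l = 0" for l
    by (intro vector_eq_rdot[THEN iffD1]) (simp add: covop_inner)
  have "\<forall>\<^sub>F n in sequentially. \<epsilon> n < norm f0 / 2" using f0 by (intro order_tendstoD[OF \<epsilon>(2)]) simp
  then have "\<forall>\<^sub>F n in sequentially. \<epsilon> n < norm f0 / 2 \<and> 1 \<le> n" using eventually_ge_at_top[of 1] by eventually_elim simp
  then obtain n where n: "\<epsilon> n < norm f0 / 2" "1 \<le> n" by (auto simp: eventually_sequentially)
  obtain l where "norm (covop l - f0) \<le> \<epsilon> n + \<epsilon> n"
    by (rule concentration_approx[OF conc[OF n(2)] \<epsilon>(1) \<epsilon>(1)[of n]])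
  with n(1) show False by (simp add: covop0)
qed

end

theorem proposition4p1:
  fixes \<Theta> :: "real set"
    and K Kd :: "real \<Rightarrow> 'h::{real_inner,banach,second_countable_topology} \<Rightarrow>\<^sub>L 'h"
    and e :: "nat \<Rightarrow> 'h"
    and p :: "real \<Rightarrow> real" and p_lower p_upper :: real
    and \<pi>f :: "'h measure"
    and \<theta>0 :: real and f0 :: 'h
    and S :: "'h set" and normS :: "'h \<Rightarrow> real"
    and D0 D1 D2 D3 :: real
    and \<epsilon> \<rho> :: "nat \<Rightarrow> real"
  assumes Theta: "compact \<Theta>"
    and basis: "orthonormal_basis e"
    and p_continuous: "continuous_on \<Theta> p"
    and p_bounds: "0 < p_lower" "\<forall>\<theta>\<in>\<Theta>. p_lower \<le> p \<theta> \<and> p \<theta> \<le> p_upper"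
    and p_prob: "prob_space (theta_prior \<Theta> p)"
    and gaussian: "centered_gaussian \<pi>f"
    and theta0: "\<theta>0 \<in> interior \<Theta>"
    and nondegenerate: "Kd \<theta>0 f0 \<noteq> 0"
    and identifiable: "\<forall>\<theta>\<in>\<Theta>. \<theta> \<noteq> \<theta>0 \<longrightarrow> K \<theta> f0 \<noteq> K \<theta>0 f0"
    and a_space: "normed_subspace S normS" "stronger_norm S normS"
    and a_range: "\<forall>\<theta>\<in>\<Theta>. \<forall>h. K \<theta> h \<in> S"
    and a_entropy: "(\<integral>\<^sup>+\<eta>\<in>{0..1}. sqrt_log (covering_number \<eta> {h \<in> S. normS h \<le> 1}) \<partial>lborel) < \<infinity>"
    and b_derivative: "\<forall>\<theta>\<in>\<Theta>. \<forall>f.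
          ((\<lambda>s. (K (\<theta> + s) f - K \<theta> f) /\<^sub>R s) \<longlongrightarrow> Kd \<theta> f) (at 0 within {s. \<theta> + s \<in> \<Theta>})"
    and b_bounded: "\<forall>\<theta>\<in>\<Theta>. norm (K \<theta>) \<le> D0 \<and> norm (Kd \<theta>) \<le> D0"
    and b_first_order: "\<forall>\<theta>\<in>\<Theta>. opnorm_into S normS (K \<theta> - K \<theta>0) \<le> ereal (D1 * \<bar>\<theta> - \<theta>0\<bar>)"
    and b_second_order: "\<forall>\<theta>\<in>\<Theta>.
          opnorm_into S normS (K \<theta> - K \<theta>0 - (\<theta> - \<theta>0) *\<^sub>R Kd \<theta>0) \<le> ereal (D2 * (\<theta> - \<theta>0)\<^sup>2)"
    and b_lipschitz: "\<forall>\<theta>1\<in>\<Theta>. \<forall>\<theta>2\<in>\<Theta>. \<forall>f1 f2.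
          norm (K \<theta>1 f1 - K \<theta>2 f2)
            \<le> D3 * \<bar>\<theta>1 - \<theta>2\<bar> * min (norm f1) (norm f2) + D3 * norm (f1 - f2)"
    and eps_rate: "\<forall>n. 0 < \<epsilon> n" "decseq \<epsilon>" "\<epsilon> \<longlonglongrightarrow> 0"
          "filterlim (\<lambda>n. real n * (\<epsilon> n)\<^sup>2) at_top sequentially"
    and eps_concentration: "\<forall>n\<ge>1. concentration \<pi>f f0 (\<epsilon> n) \<le> ereal (real n * (\<epsilon> n)\<^sup>2)"
    and rho_rate: "\<forall>n. 0 < \<rho> n" "decseq \<rho>" "\<rho> \<longlonglongrightarrow> 0"
    and rho_decentering: "\<forall>n\<ge>1.
          decentering \<pi>f (least_favorable K Kd \<theta>0 f0) (\<rho> n) \<le> ereal (real n * (\<rho> n)\<^sup>2)"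
    and cases:
      "((\<lambda>n. real n * (\<epsilon> n) ^ 4 + real n * (\<epsilon> n)\<^sup>2 * (\<rho> n)\<^sup>2) \<longlonglongrightarrow> 0)
       \<or> ((\<lambda>n. real n * (\<epsilon> n) ^ 4) \<longlonglongrightarrow> 0) \<and> least_favorable K Kd \<theta>0 f0 \<in> rkhs \<pi>f
       \<or> (\<forall>f. (\<lambda>\<theta>. norm (K \<theta> f)) constant_on \<Theta>)
           \<and> ((\<lambda>n. real n * (\<epsilon> n)\<^sup>2 * (\<rho> n)\<^sup>2) \<longlonglongrightarrow> 0)
       \<or> (\<forall>f. (\<lambda>\<theta>. norm (K \<theta> f)) constant_on \<Theta>) \<and> least_favorable K Kd \<theta>0 f0 \<in> rkhs \<pi>f"
  shows "tendsto_in_prob (\<lambda>n. data_law e K n \<theta>0 f0)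
           (\<lambda>n x. tv_dist
              (theta_posterior e K (theta_prior \<Theta> p \<Otimes>\<^sub>M \<pi>f) n x)
              (normal_measure
                 (\<theta>0 + 1 / sqrt (real n) * efficient_center e K Kd n \<theta>0 f0 x)
                 (1 / real n * inverse (efficient_information K Kd \<theta>0 f0))))
           0"
proof -
  interpret gaussian_basis \<pi>f e by unfold_locales (fact)+
  define \<gamma> where "\<gamma> = least_favorable K Kd \<theta>0 f0"
  define info where "info = efficient_information K Kd \<theta>0 f0"
  obtain C where C: "\<And>x. x \<in> S \<Longrightarrow> norm x \<le> C * normS x" using a_space(2) by (auto simp: stronger_norm_def)
  have nS: "0 \<le> normS x" if "x \<in> S" for x using a_space(1) that by (auto simp: normed_subspace_def)
  define D where "D = Max {1, C, D0, D1, D2}"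
  have D: "1 \<le> D" "C \<le> D" "D0 \<le> D" "D1 \<le> D" "D2 \<le> D" by (auto simp: D_def)
  have th0: "\<theta>0 \<in> \<Theta>" using theta0 interior_subset by blast
  have first: "K \<theta> h - K \<theta>0 h \<in> S \<and> normS (K \<theta> h - K \<theta>0 h) \<le> D1 * \<bar>\<theta> - \<theta>0\<bar> * norm h" if "\<theta> \<in> \<Theta>" for \<theta> h
    using opnorm_into_bound[OF a_space(1) b_first_order[rule_format, OF that], of h] by (simp add: blinfun.diff_left)
  have second: "K \<theta> h - K \<theta>0 h - (\<theta> - \<theta>0) *\<^sub>R Kd \<theta>0 h \<in> S \<and> normS (K \<theta> h - K \<theta>0 h - (\<theta> - \<theta>0) *\<^sub>R Kd \<theta>0 h) \<le> D2 * (\<theta> - \<theta>0)\<^sup>2 * norm h"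
    if "\<theta> \<in> \<Theta>" for \<theta> h
    using opnorm_into_bound[OF a_space(1) b_second_order[rule_format, OF that], of h]
    by (simp add: blinfun.diff_left blinfun.scaleR_left)
  have f0: "f0 \<noteq> 0" using nondegenerate by (auto)
  \<comment> \<open>The Lipschitz condition at equal arguments; the absolute value of
    \<open>D3\<close> supplies a nonnegative Lipschitz constant.\<close>
  have continuous: "continuous_on \<Theta> (\<lambda>\<theta>. K \<theta> h)" for h
  proof (rule lipschitz_on_continuous_on[OF lipschitz_onI])
    fix \<theta>1 \<theta>2 assume "\<theta>1 \<in> \<Theta>" "\<theta>2 \<in> \<Theta>"
    then have "norm (K \<theta>1 h - K \<theta>2 h) \<le> D3 * \<bar>\<theta>1 - \<theta>2\<bar> * norm h"
      using b_lipschitz[rule_format, of \<theta>1 \<theta>2 h h] by simp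
    also have "\<dots> \<le> \<bar>D3\<bar> * \<bar>\<theta>1 - \<theta>2\<bar> * norm h" by (intro mult_right_mono) auto
    finally show "dist (K \<theta>1 h) (K \<theta>2 h) \<le> (\<bar>D3\<bar> * norm h) * dist \<theta>1 \<theta>2" by (simp add: dist_norm mult_ac)
  qed simp
  have conc: "concentration \<pi>f f0 (\<epsilon> n) \<le> ereal (real n * (\<epsilon> n)\<^sup>2)" if "1 \<le> n" for n using eps_concentration that by blast
  have sq4: "(\<lambda>n. sqrt (real n) * (\<epsilon> n)\<^sup>2) \<longlonglongrightarrow> 0" if "(\<lambda>n. real n * (\<epsilon> n) ^ 4) \<longlonglongrightarrow> 0"
  proof -
    have "(\<lambda>n. sqrt (real n * (\<epsilon> n) ^ 4)) \<longlonglongrightarrow> sqrt 0" by (intro tendsto_intros that)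
    moreover have "sqrt (real n * (\<epsilon> n) ^ 4) = sqrt (real n) * (\<epsilon> n)\<^sup>2" for n
      by (simp add: real_sqrt_mult real_sqrt_unique)
    ultimately show ?thesis by simp
  qed
  have const: "\<forall>\<theta>\<in>\<Theta>. \<forall>h. norm (K \<theta> h) = norm (K \<theta>0 h)" if "\<forall>f. (\<lambda>\<theta>. norm (K \<theta> f)) constant_on \<Theta>"
    using that th0 unfolding constant_on_def by metis
  \<comment> \<open>Both summands are nonnegative, so each is squeezed between 0 and their
    sum.\<close>
  have split: "(\<lambda>n. real n * (\<epsilon> n) ^ 4) \<longlonglongrightarrow> 0 \<and> (\<lambda>n. real n * (\<epsilon> n)\<^sup>2 * (\<rho> n)\<^sup>2) \<longlonglongrightarrow> 0"
    if "(\<lambda>n. real n * (\<epsilon> n) ^ 4 + real n * (\<epsilon> n)\<^sup>2 * (\<rho> n)\<^sup>2) \<longlonglongrightarrow> 0"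
    by (intro conjI tendsto_sandwich[OF _ _ tendsto_const that]) auto
  have bias: "(\<lambda>n. sqrt (real n) * (\<epsilon> n)\<^sup>2) \<longlonglongrightarrow> 0 \<or> (\<forall>\<theta>\<in>\<Theta>. \<forall>h. norm (K \<theta> h) = norm (K \<theta>0 h))"
    using cases split sq4 const by blast
  have shift_cases: "(\<lambda>n. real n * (\<epsilon> n)\<^sup>2 * (\<rho> n)\<^sup>2) \<longlonglongrightarrow> 0 \<or> \<gamma> \<in> rkhs \<pi>f"
    using cases split \<gamma>_def by blast
  obtain l r s where shift: "\<And>n. 0 < s n" "\<And>n. 1 \<le> n \<Longrightarrow> cov (l n) (l n) \<le> real n * (s n)\<^sup>2"
      "\<And>n. 1 \<le> n \<Longrightarrow> norm (covop (l n) - \<gamma>) \<le> r n"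
      "r \<longlonglongrightarrow> 0" "(\<lambda>n. sqrt (real n) * \<epsilon> n * r n) \<longlonglongrightarrow> 0" "s \<longlonglongrightarrow> 0" "(\<lambda>n. sqrt (real n) * \<epsilon> n * s n) \<longlonglongrightarrow> 0"
    using shift_cases
  proof
    assume "(\<lambda>n. real n * (\<epsilon> n)\<^sup>2 * (\<rho> n)\<^sup>2) \<longlonglongrightarrow> 0"
    from shift_sequence_decentering[OF rho_rate(1)[rule_format] rho_rate(3) _ eps_rate(1)[rule_format] this] show thesis
      using that rho_decentering \<gamma>_def by blast
  next
    assume "\<gamma> \<in> rkhs \<pi>f"
    from shift_sequence_rkhs[OF this eps_rate(3)] show thesis using that by blast
  qed
  interpret eta: prob_space "theta_prior \<Theta> p" by (rule p_prob)
  interpret model: bvm_density \<pi>f e \<Theta> K "Kd \<theta>0" \<theta>0 f0 S normS D \<epsilon> s l \<gamma> r info p p_lower p_upper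
  proof unfold_locales
    show "norm (K \<theta> h) \<le> D * norm h" if "\<theta> \<in> \<Theta>" for \<theta> h
    proof -
      have "norm (K \<theta>) \<le> D" using b_bounded[rule_format, OF that] D(3) by linarith
      then show ?thesis using order_trans[OF norm_blinfun mult_right_mono] norm_ge_zero by blast
    qed
    show "norm x \<le> D * normS x" if "x \<in> S" for x
      using order_trans[OF C[OF that] mult_right_mono[OF D(2) nS[OF that]]] .
    show "K \<theta> h - K \<theta>0 h \<in> S" if "\<theta> \<in> \<Theta>" for \<theta> h using first[OF that] by blast
    show "normS (K \<theta> h - K \<theta>0 h) \<le> D * \<bar>\<theta> - \<theta>0\<bar> * norm h" if "\<theta> \<in> \<Theta>" for \<theta> h
      by (rule order_trans[OF conjunct2[OF first[OF that]]]) (intro mult_right_mono D, auto)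
    show "K \<theta> h - K \<theta>0 h - (\<theta> - \<theta>0) *\<^sub>R Kd \<theta>0 h \<in> S" if "\<theta> \<in> \<Theta>" for \<theta> h using second[OF that] by blast
    show "normS (K \<theta> h - K \<theta>0 h - (\<theta> - \<theta>0) *\<^sub>R Kd \<theta>0 h) \<le> D * (\<theta> - \<theta>0)\<^sup>2 * norm h" if "\<theta> \<in> \<Theta>" for \<theta> h
      by (rule order_trans[OF conjunct2[OF second[OF that]]]) (intro mult_right_mono D, auto)
    show "exp (- (real n * (\<epsilon> n)\<^sup>2) - 1) \<le> measure \<pi>f {f. norm f \<le> \<epsilon> n}"
      "exp (- (real n * (\<epsilon> n)\<^sup>2) - 1) \<le> measure \<pi>f {f. norm (f - f0) \<le> 3 * \<epsilon> n}" if "1 \<le> n" for n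
      using concentration_ball[OF conc[OF that] eps_rate(1)[rule_format]] by auto
    show "\<gamma> \<bullet> v + K \<theta>0 \<gamma> \<bullet> K \<theta>0 v = Kd \<theta>0 f0 \<bullet> K \<theta>0 v" for v
      unfolding \<gamma>_def by (rule least_favorable_equation[OF basis])
    show "info = (norm (Kd \<theta>0 f0))\<^sup>2 - (norm \<gamma>)\<^sup>2 - (norm (K \<theta>0 \<gamma>))\<^sup>2"
      unfolding \<gamma>_def info_def by (rule efficient_information_eq[OF basis])
    show "0 < info" unfolding info_def using nondegenerate by (rule efficient_information_pos)
    show "\<exists>k. 0 < cov k k" by (rule exists_positive_variance[OF f0 eps_rate(1)[rule_format] eps_rate(3) conc])
    show "K \<theta> f0 \<noteq> K \<theta>0 f0" if "\<theta> \<in> \<Theta>" "\<theta> \<noteq> \<theta>0" for \<theta> using identifiable that by blast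
    show "p_lower \<le> p \<theta> \<and> p \<theta> \<le> p_upper" if "\<theta> \<in> \<Theta>" for \<theta> using p_bounds(2) that by blast
  qed (fact Theta theta0 D(1) continuous a_space(1) a_entropy eps_rate[rule_format] eps_rate(4) shift bias p_continuous p_bounds)+
  show ?thesis
    by (rule model.posterior_tv_tendsto) (simp_all add: \<gamma>_def info_def)
qed

end
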